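(* Let $(X,d,\mu)$ be a space of homogeneous type with $\mu(X)=\infty$ and $\mu(\{x\})=0$ for every $x\in X$. Let $p_1,p_2\in(1,\infty)$, $1/p=1/p_1+1/p_2$, let $\lambda_1,\lambda_2\in A_{p_1}$, $w\in A_{p_2}$, and put $\nu:=\lambda_1^{1/p_1}\lambda_2^{-1/p_1}$ and $\widehat w:=\lambda_2^{p/p_1}w^{p/p_2}$. If $b\in\mathrm{VMO}_\nu(X)$, then for every $0<\eta<1$ and for every $\eta$-sparse family $\mathcal S$ in $X$, the bilinear Bloom sparse operators $$\mathcal T^{B}_{\mathcal S,b}(f,g)(x)=\sum_{Q\in\mathcal S}|b(x)-b_Q|\,f_Q\,g_Q\,\chi_Q(x),$$ $$\mathcal T^{B,*}_{\mathcal S,b}(f,g)(x)=\sum_{Q\in\mathcal S}\Big(\frac1{\mu(Q)}\int_Q|(b(y)-b_Q)f(y)|\,d\mu(y)\Big)g_Q\,\chi_Q(x)$$ are compact from $L^{p_1}_{\lambda_1}(X)\times L^{p_2}_w(X)$ to $L^p_{\widehat w}(X)$.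
   Context: Space of homogeneous type: $X$ is a set with a quasi-metric $d:X\times X\to[0,\infty)$ (symmetric, $d(x,y)=0$ iff $x=y$, and $d(x,y)\le A_0[d(x,z)+d(z,y)]$ for a constant $A_0\ge1$) and a nonzero measure $\mu$ that is doubling: $\mu(B(x,2r))\le C_\mu\,\mu(B(x,r))<\infty$ for all $x\in X$, $r>0$, where $B(x,r)=\{y: d(x,y)<r\}$. Notation: $f_E=\frac1{\mu(E)}\int_E f\,d\mu$; for a weight $w$ (nonnegative locally integrable function), $w(E)=\int_E w\,d\mu$ and $L^p_w(X)$ is the $L^p$ space (quasi-normed if $p<1$) with respect to $w\,d\mu$; $r(B)$ is the radius of the ball $B$. An operator on a product of two normed spaces is compact if it maps products of bounded sets to relatively compact sets. $A_q$ ($1<q<\infty$): $w\in A_q$ iff $\sup_B\big(\frac1{\mu(B)}\int_B w\,d\mu\big)\big(\frac1{\mu(B)}\int_B w^{-1/(q-1)}d\mu\big)^{q-1}<\infty$, supremum over all balls. $\mathrm{BMO}_\nu(X)$: the functions $b\in L^1_{\rm loc}(X)$ with $\sup_B\frac1{\nu(B)}\int_B|b-b_B|\,d\mu<\infty$, supremum over all balls. $\mathrm{VMO}_\nu(X)$: the functions $b\in \mathrm{BMO}_\nu(X)$ such that (a) $\lim_{a\to0}\sup_{r(B)=a}\frac1{\nu(B)}\int_B|b-b_B|\,d\mu=0$; (b) $\lim_{a\to\infty}\sup_{r(B)=a}\frac1{\nu(B)}\int_B|b-b_B|\,d\mu=0$; (c) $\lim_{a\to\infty}\sup_{d(x_0,B)>a}\frac1{\nu(B)}\int_B|b-b_B|\,d\mu=0$,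 where the suprema are over balls $B\subset X$, $x_0\in X$ is a fixed point and $d(x_0,B)=\inf_{x\in B}d(x,x_0)$. System of dyadic cubes with parameters $\delta\in(0,1)$, $0<c_1\le C_1<\infty$: a countable family $\mathcal D=\bigcup_{k\in\mathbb Z}\mathcal D_k$, $\mathcal D_k=\{Q^k_\alpha\}_\alpha$, of Borel sets such that: for each $k$, $X$ is the disjoint union of the $Q^k_\alpha$; if $\ell\ge k$ then either $Q^\ell_\beta\subseteq Q^k_\alpha$ or $Q^\ell_\beta\cap Q^k_\alpha=\emptyset$; for each $(k,\alpha)$ and $\ell\le k$ there is a unique $\beta$ with $Q^k_\alpha\subseteq Q^\ell_\beta$; each $Q^k_\alpha$ is the union of at most $M$ (a fixed constant) cubes of $\mathcal D_{k+1}$; $B(x^k_\alpha,c_1\delta^k)\subseteq Q^k_\alpha\subseteq B(x^k_\alpha,C_1\delta^k)=:B(Q^k_\alpha)$ for some center $x^k_\alpha\in Q^k_\alpha$; and if $\ell\ge k$ and $Q^\ell_\beta\subseteq Q^k_\alpha$ then $B(Q^\ell_\beta)\subseteq B(Q^k_\alpha)$. $\eta$-sparse family in $X$ ($0<\eta<1$): a collection $\mathcal S\subset\mathcal D$, for an arbitrary system of dyadic cubes $\mathcal D$ on $X$, such that for each $Q\in\mathcal S$ there is a measurable $E_Q\subset Q$ with $\mu(E_Q)\ge\eta\,\mu(Q)$, and the sets $\{E_Q\}_{Q\in\mathcal S}$ have finite overlap (i.e. $\sum_{Q\in\mathcal S}\chi_{E_Q}$ is bounded by a constant). *)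

theory Defs
  imports "HOL-Analysis.Analysis"
begin

section \<open>Spaces of homogeneous type\<close>

definition qball :: "'a measure \<Rightarrow> ('a \<Rightarrow> 'a \<Rightarrow> real) \<Rightarrow> 'a \<Rightarrow> real \<Rightarrow> 'a set" where
  "qball M d x r = {y \<in> space M. d x y < r}"

definition quasi_metric_on :: "'a set \<Rightarrow> ('a \<Rightarrow> 'a \<Rightarrow> real) \<Rightarrow> bool" where
  "quasi_metric_on X d \<longleftrightarrow>
     (\<forall>x\<in>X. \<forall>y\<in>X. 0 \<le> d x y \<and> d x y = d y x \<and> (d x y = 0 \<longleftrightarrow> x = y)) \<and>
     (\<exists>A0\<ge>1. \<forall>x\<in>X. \<forall>y\<in>X. \<forall>z\<in>X. d x y \<le> A0 * (d x z + d z y))"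

text \<open>The open sets of the topology induced by a quasi-metric; balls need not be open.\<close>

definition qopen :: "'a measure \<Rightarrow> ('a \<Rightarrow> 'a \<Rightarrow> real) \<Rightarrow> 'a set \<Rightarrow> bool" where
  "qopen M d U \<longleftrightarrow> U \<subseteq> space M \<and> (\<forall>x\<in>U. \<exists>r>0. qball M d x r \<subseteq> U)"

definition qborel :: "'a measure \<Rightarrow> ('a \<Rightarrow> 'a \<Rightarrow> real) \<Rightarrow> 'a set set" where
  "qborel M d = sigma_sets (space M) {U. qopen M d U}"

text \<open>The underlying set is the space of the measure. Its \<open>\<sigma>\<close>-algebra contains the
  Borel sets and the balls, but may be larger (e.g. the completion).\<close>

definition homogeneous_type :: "'a measure \<Rightarrow> ('a \<Rightarrow> 'a \<Rightarrow> real) \<Rightarrow> bool" where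
  "homogeneous_type M d \<longleftrightarrow>
     quasi_metric_on (space M) d \<and>
     qborel M d \<subseteq> sets M \<and>
     (\<forall>x\<in>space M. \<forall>r>0. qball M d x r \<in> sets M) \<and>
     emeasure M (space M) \<noteq> 0 \<and>
     (\<exists>C::real. \<forall>x\<in>space M. \<forall>r>0.
        emeasure M (qball M d x (2 * r)) \<le> ennreal C * emeasure M (qball M d x r) \<and>
        emeasure M (qball M d x r) < \<infinity>)"

section \<open>Weights, BMO and VMO\<close>

definition avg :: "'a measure \<Rightarrow> 'a set \<Rightarrow> ('a \<Rightarrow> 'k::{banach, second_countable_topology}) \<Rightarrow> 'k" where
  "avg M E f = (1 / measure M E) *\<^sub>R (LINT x:E|M. f x)"

definition loc_integrable ::
  "'a measure \<Rightarrow> ('a \<Rightarrow> 'a \<Rightarrow> real) \<Rightarrow> ('a \<Rightarrow> 'k::{banach, second_countable_topology}) \<Rightarrow> bool" where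
  "loc_integrable M d f \<longleftrightarrow> (\<forall>x\<in>space M. \<forall>r>0. set_integrable M (qball M d x r) f)"

definition weight :: "'a measure \<Rightarrow> ('a \<Rightarrow> 'a \<Rightarrow> real) \<Rightarrow> ('a \<Rightarrow> real) \<Rightarrow> bool" where
  "weight M d w \<longleftrightarrow> (\<forall>x\<in>space M. 0 \<le> w x) \<and> loc_integrable M d w"

text \<open>The negative power of \<open>w\<close> is infinite where \<open>w\<close> vanishes, so finiteness of the
  supremum forces \<open>w > 0\<close> almost everywhere (for \<open>w = 0\<close> almost everywhere the product is
  \<open>0 \<sqdot> \<infinity>\<close>, which counts as infinite) and the negative power to be locally integrable. These
  consequences are listed explicitly because of the conventions that \<open>0 powr a = 0\<close> and that
  the integral of a non-integrable function is 0.\<close>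

definition muckenhoupt :: "'a measure \<Rightarrow> ('a \<Rightarrow> 'a \<Rightarrow> real) \<Rightarrow> real \<Rightarrow> ('a \<Rightarrow> real) \<Rightarrow> bool" where
  "muckenhoupt M d q w \<longleftrightarrow>
     weight M d w \<and>
     (AE x in M. 0 < w x) \<and>
     loc_integrable M d (\<lambda>x. w x powr (- 1 / (q - 1))) \<and>
     (\<exists>C. \<forall>x\<in>space M. \<forall>r>0.
        avg M (qball M d x r) w *
        avg M (qball M d x r) (\<lambda>y. w y powr (- 1 / (q - 1))) powr (q - 1) \<le> C)"

definition osc ::
  "'a measure \<Rightarrow> ('a \<Rightarrow> real) \<Rightarrow> ('a \<Rightarrow> 'k::{banach, second_countable_topology}) \<Rightarrow> 'a set \<Rightarrow> real" where
  "osc M \<nu> b B = (1 / (LINT x:B|M. \<nu> x)) * (LINT x:B|M. norm (b x - avg M B b))"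

definition BMO ::
  "'a measure \<Rightarrow> ('a \<Rightarrow> 'a \<Rightarrow> real) \<Rightarrow> ('a \<Rightarrow> real) \<Rightarrow> ('a \<Rightarrow> 'k::{banach, second_countable_topology}) set" where
  "BMO M d \<nu> = {b. loc_integrable M d b \<and>
     (\<exists>C. \<forall>x\<in>space M. \<forall>r>0. osc M \<nu> b (qball M d x r) \<le> C)}"

text \<open>A ball is given by its centre and its radius. The suprema are taken in
  \<open>[0, \<infinity>]\<close>, where they always exist (and are 0 over the empty set).\<close>

definition VMO ::
  "'a measure \<Rightarrow> ('a \<Rightarrow> 'a \<Rightarrow> real) \<Rightarrow> 'a \<Rightarrow> ('a \<Rightarrow> real) \<Rightarrow> ('a \<Rightarrow> 'k::{banach, second_countable_topology}) set" where
  "VMO M d x0 \<nu> = {b \<in> BMO M d \<nu>.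
     ((\<lambda>a. SUP x\<in>space M. ennreal (osc M \<nu> b (qball M d x a))) \<longlongrightarrow> 0) (at_right 0) \<and>
     ((\<lambda>a. SUP x\<in>space M. ennreal (osc M \<nu> b (qball M d x a))) \<longlongrightarrow> 0) at_top \<and>
     ((\<lambda>a. SUP (x, r)\<in>{(x, r). x \<in> space M \<and> 0 < r \<and> a < (INF y\<in>qball M d x r. d y x0)}.
         ennreal (osc M \<nu> b (qball M d x r))) \<longlongrightarrow> 0) at_top}"

section \<open>Dyadic cubes and sparse families\<close>

text \<open>\<open>D k\<close> is the set of cubes of generation \<open>k\<close>. A set may be a cube of several
  generations, so its centre \<open>c k Q\<close> depends on the generation as well.\<close>

definition dyadic_system ::
  "'a measure \<Rightarrow> ('a \<Rightarrow> 'a \<Rightarrow> real) \<Rightarrow> real \<Rightarrow> real \<Rightarrow> real \<Rightarrow> (int \<Rightarrow> 'a set set) \<Rightarrow> bool" where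
  "dyadic_system M d \<delta> c1 C1 D \<longleftrightarrow>
     0 < \<delta> \<and> \<delta> < 1 \<and> 0 < c1 \<and> c1 \<le> C1 \<and>
     countable (\<Union>k. D k) \<and>
     (\<Union>k. D k) \<subseteq> qborel M d \<and>
     (\<forall>k. partition_on (space M) (D k)) \<and>
     (\<forall>k l. k \<le> l \<longrightarrow> (\<forall>Q\<in>D k. \<forall>R\<in>D l. R \<subseteq> Q \<or> R \<inter> Q = {})) \<and>
     (\<forall>k l. l \<le> k \<longrightarrow> (\<forall>Q\<in>D k. \<exists>!R. R \<in> D l \<and> Q \<subseteq> R)) \<and>
     (\<exists>N::nat. \<forall>k. \<forall>Q\<in>D k. \<exists>\<C>\<subseteq>D (k + 1). finite \<C> \<and> card \<C> \<le> N \<and> Q = \<Union>\<C>) \<and>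
     (\<exists>c::int \<Rightarrow> 'a set \<Rightarrow> 'a.
        (\<forall>k. \<forall>Q\<in>D k. c k Q \<in> Q \<and>
           qball M d (c k Q) (c1 * \<delta> powi k) \<subseteq> Q \<and> Q \<subseteq> qball M d (c k Q) (C1 * \<delta> powi k)) \<and>
        (\<forall>k l. k \<le> l \<longrightarrow> (\<forall>Q\<in>D k. \<forall>R\<in>D l. R \<subseteq> Q \<longrightarrow>
           qball M d (c l R) (C1 * \<delta> powi l) \<subseteq> qball M d (c k Q) (C1 * \<delta> powi k))))"

definition sparse_family :: "'a measure \<Rightarrow> ('a \<Rightarrow> 'a \<Rightarrow> real) \<Rightarrow> real \<Rightarrow> 'a set set \<Rightarrow> bool" where
  "sparse_family M d \<eta> S \<longleftrightarrow>
     (\<exists>\<delta> c1 C1 D. dyadic_system M d \<delta> c1 C1 D \<and> S \<subseteq> (\<Union>k. D k)) \<and>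
     (\<exists>E. (\<forall>Q\<in>S. E Q \<in> sets M \<and> E Q \<subseteq> Q \<and> ennreal \<eta> * emeasure M Q \<le> emeasure M (E Q)) \<and>
          (\<exists>N::nat. \<forall>x\<in>space M. finite {Q \<in> S. x \<in> E Q} \<and> card {Q \<in> S. x \<in> E Q} \<le> N))"

section \<open>Lebesgue spaces and compact operators\<close>

text \<open>Elements of \<open>L\<^sup>p\<close> are represented by functions that are not identified when they agree
  almost everywhere. The topology \<open>Lp_topology\<close> is the pullback of the topology of the
  (quasi-)normed space of equivalence classes, so a set of functions has compact closure
  here iff the corresponding set of classes has. For \<open>p < 1\<close> the topology is that of the
  quasi-norm.\<close>

definition Lp_space :: "'a measure \<Rightarrow> real \<Rightarrow> ('a \<Rightarrow> 'k::euclidean_space) set" where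
  "Lp_space N p = {f \<in> borel_measurable N. integrable N (\<lambda>x. norm (f x) powr p)}"

definition Lp_norm :: "'a measure \<Rightarrow> real \<Rightarrow> ('a \<Rightarrow> 'k::euclidean_space) \<Rightarrow> real" where
  "Lp_norm N p f = (LINT x|N. norm (f x) powr p) powr (1 / p)"

definition Lp_topology :: "'a measure \<Rightarrow> real \<Rightarrow> ('a \<Rightarrow> 'k::euclidean_space) topology" where
  "Lp_topology N p = topology (\<lambda>U. U \<subseteq> Lp_space N p \<and>
     (\<forall>f\<in>U. \<exists>r>0. \<forall>g\<in>Lp_space N p. Lp_norm N p (\<lambda>x. g x - f x) < r \<longrightarrow> g \<in> U))"

lemma openin_Lp_topology:
  "openin (Lp_topology N p) U \<longleftrightarrow> U \<subseteq> Lp_space N p \<and>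
     (\<forall>f\<in>U. \<exists>r>0. \<forall>g\<in>Lp_space N p. Lp_norm N p (\<lambda>x. g x - f x) < r \<longrightarrow> g \<in> U)"
proof -
  let ?P = "\<lambda>U. U \<subseteq> Lp_space N p \<and>
     (\<forall>f\<in>U. \<exists>r>0. \<forall>g\<in>Lp_space N p. Lp_norm N p (\<lambda>x. g x - f x) < r \<longrightarrow> g \<in> U)"
  have "?P (U \<inter> V)" if U: "?P U" and V: "?P V" for U V
  proof (intro conjI ballI)
    show "U \<inter> V \<subseteq> Lp_space N p" using U by blast
    fix f assume f: "f \<in> U \<inter> V"
    obtain r where r: "r > 0" "\<forall>g\<in>Lp_space N p. Lp_norm N p (\<lambda>x. g x - f x) < r \<longrightarrow> g \<in> U"
      using U f by blast
    obtain s where s: "s > 0" "\<forall>g\<in>Lp_space N p. Lp_norm N p (\<lambda>x. g x - f x) < s \<longrightarrow> g \<in> V"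
      using V f by blast
    show "\<exists>r>0. \<forall>g\<in>Lp_space N p. Lp_norm N p (\<lambda>x. g x - f x) < r \<longrightarrow> g \<in> U \<inter> V"
      using r s by (intro exI[of _ "min r s"]) auto
  qed
  moreover have "?P (\<Union>K)" if K: "\<forall>U\<in>K. ?P U" for K
  proof (intro conjI ballI)
    show "\<Union>K \<subseteq> Lp_space N p" using K by blast
    fix f assume "f \<in> \<Union>K"
    then obtain U where U: "U \<in> K" "f \<in> U" by blast
    then obtain r where "r > 0" "\<forall>g\<in>Lp_space N p. Lp_norm N p (\<lambda>x. g x - f x) < r \<longrightarrow> g \<in> U"
      using K by blast
    then show "\<exists>r>0. \<forall>g\<in>Lp_space N p. Lp_norm N p (\<lambda>x. g x - f x) < r \<longrightarrow> g \<in> \<Union>K"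
      using U by blast
  qed
  ultimately have "istopology ?P"
    unfolding istopology_def by blast
  then show ?thesis
    unfolding Lp_topology_def by (subst topology_inverse') auto
qed

lemma topspace_Lp_topology [simp]: "topspace (Lp_topology N p) = Lp_space N p"
proof -
  have "openin (Lp_topology N p) (Lp_space N p)"
    unfolding openin_Lp_topology by (auto intro: exI[of _ 1])
  then show ?thesis
    by (meson openin_Lp_topology openin_subset openin_topspace subset_antisym)
qed

definition Lp_bounded :: "'a measure \<Rightarrow> real \<Rightarrow> ('a \<Rightarrow> 'k::euclidean_space) set \<Rightarrow> bool" where
  "Lp_bounded N p F \<longleftrightarrow> F \<subseteq> Lp_space N p \<and> (\<exists>C. \<forall>f\<in>F. Lp_norm N p f \<le> C)"

definition Lp_relatively_compact :: "'a measure \<Rightarrow> real \<Rightarrow> ('a \<Rightarrow> 'k::euclidean_space) set \<Rightarrow> bool" where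
  "Lp_relatively_compact N p H \<longleftrightarrow>
     H \<subseteq> Lp_space N p \<and> compactin (Lp_topology N p) (Lp_topology N p closure_of H)"

definition compact_Lp_operator ::
  "'a measure \<Rightarrow> real \<Rightarrow> 'a measure \<Rightarrow> real \<Rightarrow> 'a measure \<Rightarrow> real \<Rightarrow>
   (('a \<Rightarrow> 'k::euclidean_space) \<Rightarrow> ('a \<Rightarrow> 'k) \<Rightarrow> 'a \<Rightarrow> 'k) \<Rightarrow> bool" where
  "compact_Lp_operator N1 p1 N2 p2 N p T \<longleftrightarrow>
     (\<forall>F G. Lp_bounded N1 p1 F \<and> Lp_bounded N2 p2 G \<longrightarrow>
        Lp_relatively_compact N p {T f g | f g. f \<in> F \<and> g \<in> G})"

definition weighted :: "'a measure \<Rightarrow> ('a \<Rightarrow> real) \<Rightarrow> 'a measure" where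
  "weighted M w = density M (\<lambda>x. ennreal (w x))"

section \<open>Bilinear Bloom sparse operators\<close>

text \<open>The scalars \<open>'k\<close> are the real or the complex numbers.\<close>

definition bloom_term ::
  "'a measure \<Rightarrow> ('a \<Rightarrow> 'k::{real_normed_field, euclidean_space}) \<Rightarrow> ('a \<Rightarrow> 'k) \<Rightarrow> ('a \<Rightarrow> 'k) \<Rightarrow>
   'a set \<Rightarrow> 'a \<Rightarrow> 'k" where
  "bloom_term M b f g Q x =
     of_real (norm (b x - avg M Q b)) * avg M Q f * avg M Q g * indicator Q x"

definition bloom_adj_term ::
  "'a measure \<Rightarrow> ('a \<Rightarrow> 'k::{real_normed_field, euclidean_space}) \<Rightarrow> ('a \<Rightarrow> 'k) \<Rightarrow> ('a \<Rightarrow> 'k) \<Rightarrow>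
   'a set \<Rightarrow> 'a \<Rightarrow> 'k" where
  "bloom_adj_term M b f g Q x =
     of_real (avg M Q (\<lambda>y. norm ((b y - avg M Q b) * f y))) * avg M Q g * indicator Q x"

definition bloom_sparse ::
  "'a measure \<Rightarrow> 'a set set \<Rightarrow> ('a \<Rightarrow> 'k::{real_normed_field, euclidean_space}) \<Rightarrow>
   ('a \<Rightarrow> 'k) \<Rightarrow> ('a \<Rightarrow> 'k) \<Rightarrow> 'a \<Rightarrow> 'k" where
  "bloom_sparse M S b f g x = (\<Sum>\<^sub>\<infinity>Q\<in>S. bloom_term M b f g Q x)"

definition bloom_sparse_adj ::
  "'a measure \<Rightarrow> 'a set set \<Rightarrow> ('a \<Rightarrow> 'k::{real_normed_field, euclidean_space}) \<Rightarrow>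
   ('a \<Rightarrow> 'k) \<Rightarrow> ('a \<Rightarrow> 'k) \<Rightarrow> 'a \<Rightarrow> 'k" where
  "bloom_sparse_adj M S b f g x = (\<Sum>\<^sub>\<infinity>Q\<in>S. bloom_adj_term M b f g Q x)"

text \<open>Integrals of non-integrable functions and sums of non-summable families are 0 by
  convention. The following says that the defining formulas of both operators make sense
  at \<open>(f, g)\<close> without that convention: all averages exist and the sums over \<open>S\<close> converge
  (absolutely) almost everywhere.\<close>

definition bloom_well_defined ::
  "'a measure \<Rightarrow> 'a set set \<Rightarrow> ('a \<Rightarrow> 'k::{real_normed_field, euclidean_space}) \<Rightarrow>
   ('a \<Rightarrow> 'k) \<Rightarrow> ('a \<Rightarrow> 'k) \<Rightarrow> bool" where
  "bloom_well_defined M S b f g \<longleftrightarrow>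
     (\<forall>Q\<in>S. set_integrable M Q f \<and> set_integrable M Q g \<and>
            set_integrable M Q (\<lambda>y. norm ((b y - avg M Q b) * f y))) \<and>
     (AE x in M. (\<lambda>Q. bloom_term M b f g Q x) summable_on S) \<and>
     (AE x in M. (\<lambda>Q. bloom_adj_term M b f g Q x) summable_on S)"

end

theory Submission
  imports Defs
begin

text \<open>Both operators are dominated by positive ones, and all estimates are made for functions with
values in \<open>[0, \<infinity>]\<close>. Let \<open>M\<close> be the maximal function over the cubes of the dyadic system. Since
\<open>g\<^sub>Q \<le> M g\<close> on \<open>Q\<close>, a bilinear operator is at most \<open>M g\<close> times a linear one applied to \<open>f\<close>; as
\<open>M\<close> is bounded on \<open>L\<^sup>p\<^sup>2(w)\<close>, Hoelder's inequality leaves the linear operators from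
\<open>L\<^sup>p\<^sup>1(\<lambda>\<^sub>1)\<close> to \<open>L\<^sup>p\<^sup>1(\<lambda>\<^sub>2)\<close>. Write \<open>\<lambda>\<^sub>i\<close> as the power \<open>p\<^sub>1\<close> of \<open>\<omega>\<^sub>i\<close>, so that \<open>\<nu> = \<omega>\<^sub>1 / \<omega>\<^sub>2\<close>. By
duality both linear operators are controlled by the one form
\<open>B(f, h) = \<Sum>\<^sub>Q f\<^sub>Q \<integral>\<^sub>Q |b - b\<^sub>Q| h\<close>, for the second operator with \<open>(f, \<omega>\<^sub>1, p\<^sub>1)\<close> and
\<open>(h, 1 / \<omega>\<^sub>2, p\<^sub>1')\<close> exchanged, an exchange that preserves \<open>\<nu>\<close>.

The heart of the proof is \<open>oscillation_pairing\<close>: up to a constant, \<open>\<integral>\<^sub>Q |b - b\<^sub>Q| h\<close> is at most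
\<open>\<epsilon> \<integral>\<^sub>Q \<nu> M h\<close> plus the integrals of \<open>\<nu> M h\<close> over those cubes \<open>R \<subseteq> Q\<close> on which the oscillation of
\<open>b\<close> exceeds \<open>\<epsilon> \<nu>(R)\<close>. It is a stopping time argument; \<open>\<nu>\<close> is an \<open>A\<^sub>2\<close> weight, so each stopping step
loses a fixed part of the mass \<open>\<nu>\<close>. The three conditions of \<open>VMO\<close> leave only finitely many
exceptional cubes in the whole system (\<open>vmo_vanishing_oscillation\<close>).

In \<open>B\<close>, the first term is handled by sparseness, because
\<open>f\<^sub>Q h\<^sub>Q \<mu>(Q) \<le> \<eta>\<^sup>-\<^sup>1 \<integral> M f M h\<close> over \<open>E\<^sub>Q\<close>. An exceptional cube \<open>R\<close> contributes the functional
\<open>f \<mapsto> \<Sum>\<^sub>Q\<^sub>\<supseteq>\<^sub>R f\<^sub>Q\<close>, given by a function of the dual space whose tails tend to zero by dominated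
convergence. Hence the operators are bounded, and the part of the sum over \<open>S\<close> outside a suitable
finite set has arbitrarily small norm (\<open>bilinear_bounded\<close>, \<open>bilinear_tail\<close>).

For bounded sets of \<open>f\<close> and \<open>g\<close> the images are therefore series with fixed functions in \<open>L\<^sup>p\<close>,
bounded coefficients and uniformly small tails. The coefficient families that obey these bounds
form a compact subset of a countable product, on which the sum depends continuously
(\<open>countable_series_relatively_compact\<close>); so the images lie in a compact set, and its closure is
compact since the topology of \<open>L\<^sup>p\<close> is regular.\<close>

section \<open>Powers and \<open>L\<^sup>p\<close> functionals of extended nonnegative functions\<close>

text \<open>The power is taken to be infinite at \<open>\<infinity>\<close> for every exponent; it is meant for positive ones.\<close>
definition epow :: "ennreal \<Rightarrow> real \<Rightarrow> ennreal" where
  "epow x a = (if x = top then top else ennreal (enn2real x powr a))"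

lemma epow_ennreal [simp]: "0 \<le> r \<Longrightarrow> epow (ennreal r) a = ennreal (r powr a)"
  by (simp add: epow_def)

lemma epow_top [simp]: "epow top a = top"
  by (simp add: epow_def)

lemma epow_0 [simp]: "epow 0 a = 0"
  by (simp add: epow_def)

lemma epow_1 [simp]: "epow 1 a = 1"
  by (simp add: epow_def)

lemma epow_one_right [simp]: "epow x 1 = x"
  by (cases x) auto

lemma epow_eq_0_iff [simp]: "epow x a = 0 \<longleftrightarrow> x = 0"
  by (cases x) (auto simp: ennreal_eq_0_iff)

lemma epow_eq_top_iff [simp]: "epow x a = top \<longleftrightarrow> x = top"
  by (cases x) auto

lemma epow_less_top_iff [simp]: "epow x a < top \<longleftrightarrow> x < top"
  by (metis epow_eq_top_iff top.not_eq_extremum)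

lemma epow_mono: "x \<le> y \<Longrightarrow> 0 \<le> a \<Longrightarrow> epow x a \<le> epow y a"
  by (cases x; cases y) (auto intro!: ennreal_leI powr_mono2 simp: top_unique)

lemma epow_mult: "0 < a \<Longrightarrow> epow (x * y) a = epow x a * epow y a"
  by (cases x; cases y)
     (auto simp: ennreal_mult_eq_top_iff ennreal_mult_top ennreal_top_mult powr_mult ennreal_eq_0_iff
        simp flip: ennreal_mult)

lemma epow_epow: "epow (epow x a) b = epow x (a * b)"
  by (cases x) (auto simp: powr_powr)

lemma epow_add: "0 < a \<Longrightarrow> 0 < b \<Longrightarrow> epow x (a + b) = epow x a * epow x b"
  by (cases x) (auto simp: powr_add ennreal_mult)

lemma epow_2: "epow x 2 = x * x"
  using epow_add[of 1 1 x] by simp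

text \<open>A positive power is an order isomorphism of \<open>[0, \<infinity>]\<close>. This adjunction is the source of its continuity.\<close>
lemma epow_le_iff: "0 < a \<Longrightarrow> epow x a \<le> y \<longleftrightarrow> x \<le> epow y (1 / a)"
  using epow_mono[of "epow x a" y "1 / a"] epow_mono[of x "epow y (1 / a)" a]
  by (auto simp: epow_epow)

lemma le_epow_iff: "0 < a \<Longrightarrow> y \<le> epow x a \<longleftrightarrow> epow y (1 / a) \<le> x"
  using epow_le_iff[of "1 / a" y x] by simp

lemma epow_SUP:
  assumes "0 < a"
  shows "epow (SUP i\<in>I. f i) a = (SUP i\<in>I. epow (f i) a)"
proof (intro antisym SUP_least epow_mono SUP_upper)
  have "f i \<le> epow (SUP i\<in>I. epow (f i) a) (1 / a)" if "i \<in> I" for i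
    using assms that by (subst epow_le_iff[symmetric]) (auto intro: SUP_upper)
  then show "epow (SUP i\<in>I. f i) a \<le> (SUP i\<in>I. epow (f i) a)"
    using assms by (subst epow_le_iff) (auto intro: SUP_least)
qed (use assms in auto)

lemma epow_INF:
  assumes "0 < a"
  shows "epow (INF i\<in>I. f i) a = (INF i\<in>I. epow (f i) a)"
proof (intro antisym INF_greatest epow_mono INF_lower)
  have "epow (INF i\<in>I. epow (f i) a) (1 / a) \<le> f i" if "i \<in> I" for i
    using assms that by (subst le_epow_iff[symmetric]) (auto intro: INF_lower)
  then show "(INF i\<in>I. epow (f i) a) \<le> epow (INF i\<in>I. f i) a"
    using assms by (subst le_epow_iff) (auto intro: INF_greatest)
qed (use assms in auto)

lemma borel_measurable_epow [measurable (raw)]: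
  assumes [measurable]: "f \<in> borel_measurable M"
  shows "(\<lambda>x. epow (f x) a) \<in> borel_measurable M"
proof -
  have "{x \<in> space M. f x = top} \<in> sets M"
    by (rule borel_measurable_eq) auto
  moreover have "(\<lambda>x. ennreal (enn2real (f x) powr a)) \<in> borel_measurable M"
    by measurable
  ultimately show ?thesis
    unfolding epow_def by (intro measurable_If) (auto simp: pred_def)
qed

lemma epow_add_le:
  assumes "0 < a"
  shows "epow (x + y) a \<le> ennreal (2 powr a) * (epow x a + epow y a)"
proof -
  have "epow (x + y) a \<le> epow (2 * max x y) a"
    using assms by (intro epow_mono) (auto simp: mult_2 max_def intro: add_mono)
  also have "\<dots> = ennreal (2 powr a) * epow (max x y) a"
    using assms epow_ennreal[of 2 a] by (simp add: epow_mult)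
  also have "epow (max x y) a \<le> epow x a + epow y a"
    by (auto simp: max_def add_increasing add_increasing2)
  finally show ?thesis by (simp add: mult_left_mono)
qed

lemma conjugate_exponent:
  fixes p q :: real
  assumes "1 < p" "1 / p + 1 / q = 1"
  shows "1 < q" "(p - 1) * q = p" "(q - 1) * p = q" "1 / q + 1 / p = 1" "q / p = q - 1" "p / q = p - 1"
proof -
  have "1 / q = (p - 1) / p" using assms by (simp add: field_simps)
  then have q: "q = p / (p - 1)" using assms by (metis inverse_divide inverse_inverse_eq inverse_eq_divide)
  show "1 < q" "(p - 1) * q = p" "(q - 1) * p = q" "1 / q + 1 / p = 1" "q / p = q - 1" "p / q = p - 1"
    using assms unfolding q by (auto simp: field_simps)
qed

lemma Young_ennreal:
  fixes x y :: ennreal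
  assumes p: "1 < p" and pq: "1 / p + 1 / q = 1"
  shows "x * y \<le> ennreal (1 / p) * epow x p + ennreal (1 / q) * epow y q"
proof -
  note q = conjugate_exponent(1)[OF p pq]
  consider (fin) a c where "x = ennreal a" "y = ennreal c" "a \<ge> 0" "c \<ge> 0" | "x = 0" | "y = 0"
    | "x = top" | "y = top" by (cases x; cases y) auto
  then show ?thesis
  proof cases
    case fin
    then have "a * c \<le> a powr p / p + c powr q / q"
      using Youngs_inequality[of p q a c] p q pq by auto
    then show ?thesis using fin p q
      by (simp flip: ennreal_mult ennreal_plus)
  qed (use p q in \<open>auto simp: ennreal_mult_top\<close>)
qed

text \<open>The quasi-norm of \<open>L\<^sup>p\<close>, infinite outside that space.\<close>
definition enorm :: "'a measure \<Rightarrow> real \<Rightarrow> ('a \<Rightarrow> ennreal) \<Rightarrow> ennreal" where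
  "enorm M p f = epow (\<integral>\<^sup>+x. epow (f x) p \<partial>M) (1 / p)"

text \<open>With \<open>\<lambda> = \<omega>\<^sup>p\<close> and \<open>q\<close> conjugate to \<open>p\<close>, the next four are the norms of a function and of an indicator
function in \<open>L\<^sup>p(\<lambda>)\<close> and in its dual under the pairing \<open>\<integral> f h d\<mu>\<close>. The dual weight is again of this kind, with
\<open>1 / \<omega>\<close> and \<open>q\<close> in place of \<open>\<omega>\<close> and \<open>p\<close>.\<close>
abbreviation wnorm :: "'a measure \<Rightarrow> real \<Rightarrow> ('a \<Rightarrow> real) \<Rightarrow> ('a \<Rightarrow> ennreal) \<Rightarrow> ennreal" where
  "wnorm M p \<omega> f \<equiv> enorm M p (\<lambda>x. f x * ennreal (\<omega> x))"

abbreviation dnorm :: "'a measure \<Rightarrow> real \<Rightarrow> ('a \<Rightarrow> real) \<Rightarrow> ('a \<Rightarrow> ennreal) \<Rightarrow> ennreal" where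
  "dnorm M q \<omega> f \<equiv> enorm M q (\<lambda>x. f x * ennreal (1 / \<omega> x))"

abbreviation wcube :: "'a measure \<Rightarrow> real \<Rightarrow> ('a \<Rightarrow> real) \<Rightarrow> 'a set \<Rightarrow> ennreal" where
  "wcube M p \<omega> Q \<equiv> enorm M p (\<lambda>x. ennreal (\<omega> x) * indicator Q x)"

abbreviation dcube :: "'a measure \<Rightarrow> real \<Rightarrow> ('a \<Rightarrow> real) \<Rightarrow> 'a set \<Rightarrow> ennreal" where
  "dcube M q \<omega> Q \<equiv> enorm M q (\<lambda>x. ennreal (1 / \<omega> x) * indicator Q x)"

abbreviation mass :: "'a measure \<Rightarrow> ('a \<Rightarrow> real) \<Rightarrow> 'a set \<Rightarrow> ennreal" where
  "mass M v Q \<equiv> (\<integral>\<^sup>+x\<in>Q. ennreal (v x) \<partial>M)"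

lemma enorm_mono: "0 < p \<Longrightarrow> (\<And>x. x \<in> space M \<Longrightarrow> f x \<le> g x) \<Longrightarrow> enorm M p f \<le> enorm M p g"
  unfolding enorm_def by (intro epow_mono nn_integral_mono) auto

lemma enorm_mono_AE:
  assumes "0 < p" "AE x in M. f x \<le> g x"
  shows "enorm M p f \<le> enorm M p g"
proof -
  have "AE x in M. epow (f x) p \<le> epow (g x) p"
    using assms(2) by eventually_elim (use assms(1) in \<open>auto intro: epow_mono\<close>)
  then show ?thesis
    unfolding enorm_def using assms(1) by (intro epow_mono nn_integral_mono_AE) auto
qed

lemma enorm_cong: "(\<And>x. x \<in> space M \<Longrightarrow> f x = g x) \<Longrightarrow> enorm M p f = enorm M p g"
  unfolding enorm_def by (simp cong: nn_integral_cong)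

lemma epow_enorm: "0 < p \<Longrightarrow> epow (enorm M p f) p = (\<integral>\<^sup>+x. epow (f x) p \<partial>M)"
  unfolding enorm_def by (simp add: epow_epow)

lemma enorm_cmult:
  assumes "0 < p" "f \<in> borel_measurable M"
  shows "enorm M p (\<lambda>x. c * f x) = c * enorm M p f"
  using assms unfolding enorm_def
  by (simp add: epow_mult nn_integral_cmult epow_epow)

text \<open>Young's inequality, integrated after both factors have been normalised.\<close>
lemma Holder_nn_integral:
  assumes p: "1 < p" and pq: "1 / p + 1 / q = 1"
    and [measurable]: "f \<in> borel_measurable M" "g \<in> borel_measurable M"
  shows "(\<integral>\<^sup>+x. f x * g x \<partial>M) \<le> enorm M p f * enorm M q g"
proof -
  note q = conjugate_exponent[OF p pq]
  let ?A = "enorm M p f" and ?B = "enorm M q g"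
  have A0: "AE x in M. f x = 0" if "?A = 0"
    using that by (simp add: enorm_def nn_integral_0_iff_AE)
  have B0: "AE x in M. g x = 0" if "?B = 0"
    using that by (simp add: enorm_def nn_integral_0_iff_AE)
  consider "?A = 0" | "?B = 0" | "?A \<noteq> 0" "?B = top" | "?B \<noteq> 0" "?A = top"
    | (fin) a c where "?A = ennreal a" "?B = ennreal c" "a > 0" "c > 0"
    by (cases ?A; cases ?B) (auto simp: less_le)
  then show ?thesis
  proof cases
    case 1
    have "(\<integral>\<^sup>+x. f x * g x \<partial>M) = (\<integral>\<^sup>+x. 0 \<partial>M)"
      by (intro nn_integral_cong_AE) (use A0[OF 1] in auto)
    then show ?thesis by simp
  next
    case 2
    have "(\<integral>\<^sup>+x. f x * g x \<partial>M) = (\<integral>\<^sup>+x. 0 \<partial>M)"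
      by (intro nn_integral_cong_AE) (use B0[OF 2] in auto)
    then show ?thesis by simp
  next
    case fin
    define F where "F x = ennreal (1 / a) * f x" for x
    define G where "G x = ennreal (1 / c) * g x" for x
    have [measurable]: "F \<in> borel_measurable M" "G \<in> borel_measurable M"
      unfolding F_def G_def by measurable
    have "enorm M p F = 1" "enorm M q G = 1"
      using fin p q unfolding F_def G_def
      by (auto simp: enorm_cmult simp flip: ennreal_mult)
    then have 1: "(\<integral>\<^sup>+x. epow (F x) p \<partial>M) = 1" "(\<integral>\<^sup>+x. epow (G x) q \<partial>M) = 1"
      using epow_enorm[of p M F] epow_enorm[of q M G] p q by simp_all
    have "(\<integral>\<^sup>+x. F x * G x \<partial>M) \<le> (\<integral>\<^sup>+x. ennreal (1 / p) * epow (F x) p + ennreal (1 / q) * epow (G x) q \<partial>M)"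
      by (intro nn_integral_mono Young_ennreal p pq)
    also have "\<dots> = ennreal (1 / p) + ennreal (1 / q)"
      by (subst nn_integral_add) (auto simp: nn_integral_cmult 1)
    also have "\<dots> = 1" using p q pq by (simp flip: ennreal_plus)
    finally have le: "(\<integral>\<^sup>+x. F x * G x \<partial>M) \<le> 1" .
    have "f x * g x = ennreal (a * c) * (F x * G x)" for x
    proof -
      have "ennreal (a * c) * (F x * G x) = (ennreal a * ennreal (1/a)) * (ennreal c * ennreal (1/c)) * (f x * g x)"
        using fin by (simp add: F_def G_def ennreal_mult mult_ac)
      then show ?thesis using fin by (simp flip: ennreal_mult)
    qed
    then have "(\<integral>\<^sup>+x. f x * g x \<partial>M) = ennreal (a * c) * (\<integral>\<^sup>+x. F x * G x \<partial>M)"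
      by (simp add: nn_integral_cmult)
    also have "\<dots> \<le> ennreal (a * c) * 1" by (intro mult_left_mono le) auto
    finally show ?thesis using fin by (simp add: ennreal_mult)
  qed (auto simp: ennreal_mult_top ennreal_top_mult)
qed

lemma Holder_enorm:
  assumes "1 < p1" "1 < p2" "1 / p = 1 / p1 + 1 / p2"
    and [measurable]: "f \<in> borel_measurable M" "g \<in> borel_measurable M"
  shows "enorm M p (\<lambda>x. f x * g x) \<le> enorm M p1 f * enorm M p2 g"
proof -
  have "1 / p1 > 0" "1 / p2 > 0" using assms(1,2) by auto
  then have "1 / p > 1 / p1" "1 / p > 1 / p2" "1 / p > 0" using assms(3) by linarith+
  then have p: "0 < p" "p < p1" "p < p2" using assms(1,2)
    by (auto simp: zero_less_divide_iff field_simps)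
  have "p * (1 / p) = p * (1 / p1 + 1 / p2)" using assms(3) by simp
  then have pq: "1 / (p1 / p) + 1 / (p2 / p) = 1" using p by (simp add: algebra_simps)
  have "(\<integral>\<^sup>+x. epow (f x * g x) p \<partial>M) = (\<integral>\<^sup>+x. epow (f x) p * epow (g x) p \<partial>M)"
    using p by (simp add: epow_mult)
  also have "\<dots> \<le> enorm M (p1 / p) (\<lambda>x. epow (f x) p) * enorm M (p2 / p) (\<lambda>x. epow (g x) p)"
    by (rule Holder_nn_integral) (use p pq in auto)
  also have "\<dots> = epow (enorm M p1 f * enorm M p2 g) p"
    using p by (simp add: enorm_def epow_mult epow_epow)
  finally show ?thesis
    unfolding enorm_def[of M p] using p by (subst epow_le_iff) auto
qed

text \<open>Write \<open>(f + g)\<^sup>p\<close> as \<open>f (f + g)\<^sup>p\<^sup>-\<^sup>1 + g (f + g)\<^sup>p\<^sup>-\<^sup>1\<close>, apply Hoelder's inequality to both terms and cancel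
a power of the integral of \<open>(f + g)\<^sup>p\<close>.\<close>
lemma Minkowski_enorm:
  assumes p: "1 \<le> p" and [measurable]: "f \<in> borel_measurable M" "g \<in> borel_measurable M"
  shows "enorm M p (\<lambda>x. f x + g x) \<le> enorm M p f + enorm M p g"
proof (cases "p = 1")
  case True
  then show ?thesis by (simp add: enorm_def nn_integral_add)
next
  case False
  with p have p: "1 < p" by simp
  define q where "q = p / (p - 1)"
  have pq: "1 / p + 1 / q = 1" using p by (auto simp: q_def field_simps)
  note q = conjugate_exponent[OF p pq]
  define I where "I = (\<integral>\<^sup>+x. epow (f x + g x) p \<partial>M)"
  have If: "enorm M p f = top \<or> enorm M p g = top" if "I = top"
  proof (rule ccontr)
    assume "\<not> ?thesis"
    then have fin: "(\<integral>\<^sup>+x. epow (f x) p \<partial>M) < top" "(\<integral>\<^sup>+x. epow (g x) p \<partial>M) < top"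
      by (auto simp: enorm_def less_top)
    have "I \<le> (\<integral>\<^sup>+x. ennreal (2 powr p) * (epow (f x) p + epow (g x) p) \<partial>M)"
      unfolding I_def using p by (intro nn_integral_mono epow_add_le) auto
    also have "\<dots> < top"
      using fin by (simp add: nn_integral_cmult nn_integral_add ennreal_mult_less_top)
    finally show False using that by simp
  qed
  have "I = (\<integral>\<^sup>+x. f x * epow (f x + g x) (p - 1) + g x * epow (f x + g x) (p - 1) \<partial>M)"
    unfolding I_def using p epow_add[of 1 "p - 1"] by (simp add: distrib_right)
  also have "\<dots> = (\<integral>\<^sup>+x. f x * epow (f x + g x) (p - 1) \<partial>M) + (\<integral>\<^sup>+x. g x * epow (f x + g x) (p - 1) \<partial>M)"
    by (rule nn_integral_add) auto
  also have "\<dots> \<le> enorm M p f * enorm M q (\<lambda>x. epow (f x + g x) (p - 1)) +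
      enorm M p g * enorm M q (\<lambda>x. epow (f x + g x) (p - 1))"
    by (intro add_mono Holder_nn_integral p pq) auto
  also have "enorm M q (\<lambda>x. epow (f x + g x) (p - 1)) = epow I (1 / q)"
    by (simp add: enorm_def I_def epow_epow q)
  finally have le: "I \<le> (enorm M p f + enorm M p g) * epow I (1 / q)"
    by (simp add: distrib_right)
  show ?thesis
  proof (cases "I = 0 \<or> I = top")
    case True
    then show ?thesis using If p unfolding enorm_def[of M p "\<lambda>x. f x + g x"] I_def[symmetric] by auto
  next
    case False
    have "epow I (1 / p) * epow I (1 / q) \<le> (enorm M p f + enorm M p g) * epow I (1 / q)"
      using le epow_add[of "1 / p" "1 / q" I] p q pq by simp
    moreover have "epow I (1 / q) \<noteq> 0" "epow I (1 / q) < top"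
      using False by (auto simp: less_top)
    ultimately have "epow I (1 / p) \<le> enorm M p f + enorm M p g"
      by (simp add: mult.commute[of _ "epow I (1 / q)"] ennreal_mult_le_mult_iff)
    then show ?thesis by (simp add: enorm_def I_def)
  qed
qed

text \<open>The test function \<open>v\<^sup>p\<^sup>-\<^sup>1\<close> attains the norm. Truncation in height and to sets of finite measure makes the
quantity that is cancelled finite; monotone convergence removes it.\<close>
lemma enorm_le_dual:
  assumes p: "1 < p" and pq: "1 / p + 1 / q = 1" and sf: "sigma_finite_measure M"
    and [measurable]: "v \<in> borel_measurable M"
    and dual: "\<And>k. k \<in> borel_measurable M \<Longrightarrow> (\<integral>\<^sup>+x. v x * k x \<partial>M) \<le> K * enorm M q k"
  shows "enorm M p v \<le> K"
proof -
  note q = conjugate_exponent[OF p pq]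
  interpret sigma_finite_measure M by (rule sf)
  obtain A :: "nat \<Rightarrow> 'a set" where A: "range A \<subseteq> sets M" "(\<Union>i. A i) = space M"
    "\<And>i. emeasure M (A i) \<noteq> \<infinity>" "incseq A" using sigma_finite_incseq by blast
  then have [measurable]: "A n \<in> sets M" for n by auto
  \<comment> \<open>finite integral of the p-th power, so that the cancellation below is legitimate\<close>
  define u where "u n x = min (v x) (of_nat n) * indicator (A n) x" for n x
  have [measurable]: "u n \<in> borel_measurable M" for n unfolding u_def by measurable
  define X where "X n = (\<integral>\<^sup>+x. epow (u n x) p \<partial>M)" for n
  have Xfin: "X n < top" for n
  proof -
    have "X n \<le> (\<integral>\<^sup>+x. ennreal (real n powr p) * indicator (A n) x \<partial>M)"
      unfolding X_def
    proof (intro nn_integral_mono)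
      fix x
      have "epow (u n x) p \<le> epow (ennreal (real n)) p" if "x \<in> A n"
        using that p by (intro epow_mono) (auto simp: u_def ennreal_of_nat_eq_real_of_nat)
      then show "epow (u n x) p \<le> ennreal (real n powr p) * indicator (A n) x"
        by (cases "x \<in> A n") (auto simp: u_def)
    qed
    also have "\<dots> < top" using A(3)[of n]
      by (simp add: nn_integral_cmult_indicator ennreal_mult_less_top less_top)
    finally show ?thesis .
  qed
  have u_le: "u n x \<le> v x" for n x by (auto simp: u_def indicator_def)
  have bound: "epow (X n) (1 / p) \<le> K" for n
  proof (cases "X n = 0")
    case False
    have "X n = (\<integral>\<^sup>+x. u n x * epow (u n x) (p - 1) \<partial>M)"
      unfolding X_def using p epow_add[of 1 "p - 1"] by simp
    also have "\<dots> \<le> (\<integral>\<^sup>+x. v x * epow (u n x) (p - 1) \<partial>M)"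
      by (intro nn_integral_mono mult_right_mono u_le) auto
    also have "\<dots> \<le> K * enorm M q (\<lambda>x. epow (u n x) (p - 1))"
      by (rule dual) auto
    also have "enorm M q (\<lambda>x. epow (u n x) (p - 1)) = epow (X n) (1 / q)"
      by (simp add: enorm_def X_def epow_epow q)
    finally have "epow (X n) (1 / p) * epow (X n) (1 / q) \<le> K * epow (X n) (1 / q)"
      using epow_add[of "1 / p" "1 / q" "X n"] p q pq by simp
    moreover have "epow (X n) (1 / q) \<noteq> 0" "epow (X n) (1 / q) < top"
      using False Xfin[of n] by auto
    ultimately show ?thesis
      by (simp add: mult.commute[of _ "epow (X n) (1 / q)"] ennreal_mult_le_mult_iff)
  qed simp
  have inc: "incseq (\<lambda>n x. u n x)"
  proof (intro monoI le_funI)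
    fix m n :: nat and x assume "m \<le> n"
    then have "of_nat m \<le> (of_nat n :: ennreal)" "A m \<subseteq> A n" using A(4) by (auto simp: incseq_def)
    then show "u m x \<le> u n x"
      unfolding u_def by (intro mult_mono) (auto simp: indicator_def min_def intro: order_trans)
  qed
  have sup: "(SUP n. u n x) = v x" if "x \<in> space M" for x
  proof (rule antisym)
    show "(SUP n. u n x) \<le> v x" by (intro SUP_least u_le)
    from that A(2) obtain m where m: "x \<in> A m" by auto
    show "v x \<le> (SUP n. u n x)"
    proof (rule dense_le)
      fix y assume y: "y < v x"
      then have "y \<noteq> top" by (auto simp: top_unique)
      then obtain n where n: "y < of_nat n" using ennreal_Ex_less_of_nat[of y] by (auto simp: less_top)
      let ?k = "max n m"
      have "x \<in> A ?k" using m incseqD[OF A(4), of m ?k] by auto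
      moreover have "y \<le> of_nat ?k" using n by (meson less_imp_le less_le_trans max.cobounded1 of_nat_mono)
      ultimately have "y \<le> u ?k x" using y by (auto simp: u_def)
      then show "y \<le> (SUP n. u n x)" by (meson SUP_upper2 UNIV_I)
    qed
  qed
  have "(\<integral>\<^sup>+x. epow (v x) p \<partial>M) = (\<integral>\<^sup>+x. (SUP n. epow (u n x) p) \<partial>M)"
    using p sup by (intro nn_integral_cong) (simp flip: epow_SUP)
  also have "\<dots> = (SUP n. X n)"
    unfolding X_def using inc p
    by (intro nn_integral_monotone_convergence_SUP) (auto simp: incseq_def le_fun_def intro!: epow_mono)
  finally have "enorm M p v = (SUP n. epow (X n) (1 / p))"
    using p by (simp add: enorm_def epow_SUP)
  also have "\<dots> \<le> K" by (intro SUP_least bound)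
  finally show ?thesis .
qed

lemma wnorm_le_dual:
  assumes p: "1 < p" and pq: "1 / p + 1 / q = 1" and sf: "sigma_finite_measure M"
    and [measurable]: "\<omega> \<in> borel_measurable M" "L \<in> borel_measurable M"
    and pos: "\<And>x. x \<in> space M \<Longrightarrow> 0 < \<omega> x"
    and le: "\<And>h. h \<in> borel_measurable M \<Longrightarrow> (\<integral>\<^sup>+x. L x * h x \<partial>M) \<le> K * dnorm M q \<omega> h"
  shows "wnorm M p \<omega> L \<le> K"
proof (rule enorm_le_dual[OF p pq sf])
  fix k :: "'a \<Rightarrow> ennreal" assume [measurable]: "k \<in> borel_measurable M"
  have "(\<integral>\<^sup>+x. L x * ennreal (\<omega> x) * k x \<partial>M) \<le> K * dnorm M q \<omega> (\<lambda>x. ennreal (\<omega> x) * k x)"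
    using le[of "\<lambda>x. ennreal (\<omega> x) * k x"] by (simp add: mult.assoc)
  also have "dnorm M q \<omega> (\<lambda>x. ennreal (\<omega> x) * k x) = enorm M q k"
  proof (rule enorm_cong)
    fix x assume "x \<in> space M"
    then have "ennreal (1 / \<omega> x) * ennreal (\<omega> x) = 1" using pos[of x] by (simp flip: ennreal_mult)
    then show "ennreal (\<omega> x) * k x * ennreal (1 / \<omega> x) = k x" by (metis mult.assoc mult.commute mult_1)
  qed
  finally show "(\<integral>\<^sup>+x. L x * ennreal (\<omega> x) * k x \<partial>M) \<le> K * enorm M q k" .
qed measurable

section \<open>The maximal function of a nested family of sets\<close>

lemma indicator_Union_disjoint:
  assumes "disjoint \<P>"
  shows "(indicator (\<Union>\<P>) x :: ennreal) = (\<integral>\<^sup>+Q. indicator Q x \<partial>count_space \<P>)"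
proof -
  have "(\<integral>\<^sup>+Q. indicator Q x \<partial>count_space \<P>) = (\<integral>\<^sup>+Q. of_bool (x \<in> Q) \<partial>count_space \<P>)"
    by (intro nn_integral_cong) (simp add: indicator_def)
  also have "\<dots> = of_bool (\<exists>Q\<in>\<P>. x \<in> Q)"
    using assms by (intro of_bool_Bex_eq_nn_integral[symmetric]) (auto simp: pairwise_def disjnt_def)
  finally show ?thesis by (auto simp: indicator_def)
qed

text \<open>Sums over countable families are integrals for the counting measure, so that this is an exchange of integrals.\<close>
lemma nn_integral_Union_disjoint:
  assumes "disjoint \<P>" "countable \<P>" "\<P> \<subseteq> sets M" and [measurable]: "f \<in> borel_measurable M"
  shows "(\<integral>\<^sup>+x\<in>\<Union>\<P>. f x \<partial>M) = (\<integral>\<^sup>+Q. (\<integral>\<^sup>+x\<in>Q. f x \<partial>M) \<partial>count_space \<P>)"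
proof -
  have [measurable]: "Q \<in> sets M" if "Q \<in> \<P>" for Q using assms(3) that by auto
  have "(\<integral>\<^sup>+x\<in>\<Union>\<P>. f x \<partial>M) = (\<integral>\<^sup>+x. (\<integral>\<^sup>+Q. f x * indicator Q x \<partial>count_space \<P>) \<partial>M)"
    by (simp add: indicator_Union_disjoint[OF assms(1)] nn_integral_cmult)
  also have "\<dots> = (\<integral>\<^sup>+Q. (\<integral>\<^sup>+x\<in>Q. f x \<partial>M) \<partial>count_space \<P>)"
    by (intro nn_integral_count_space_nn_integral assms) measurable
  finally show ?thesis .
qed

lemma emeasure_Union_disjoint:
  assumes "disjoint \<P>" "countable \<P>" "\<P> \<subseteq> sets M"
  shows "emeasure M (\<Union>\<P>) = (\<integral>\<^sup>+Q. emeasure M Q \<partial>count_space \<P>)"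
proof -
  have "disjoint_family_on (\<lambda>Q. Q) \<P>"
    using assms(1) by (auto simp: disjoint_family_on_def pairwise_def disjnt_def)
  with emeasure_UN_countable[of \<P> "\<lambda>Q. Q" M] assms show ?thesis by auto
qed

lemma emeasure_countable_Union_le:
  assumes "countable \<Q>" "\<Q> \<subseteq> sets M" "\<And>\<F>. finite \<F> \<Longrightarrow> \<F> \<subseteq> \<Q> \<Longrightarrow> c * emeasure M (\<Union>\<F>) \<le> A"
  shows "c * emeasure M (\<Union>\<Q>) \<le> A"
proof (cases "\<Q> = {}")
  case False
  let ?U = "\<lambda>n::nat. \<Union>(from_nat_into \<Q> ` {..<n})"
  have r: "range (from_nat_into \<Q>) = \<Q>"
    using False assms(1) by (rule range_from_nat_into)
  then have "from_nat_into \<Q> i \<in> \<Q>" for i by auto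
  then have m: "from_nat_into \<Q> i \<in> sets M" for i using assms(2) by auto
  have "(\<Union>n. ?U n) = \<Union>(range (from_nat_into \<Q>))"
    by blast
  then have "(\<Union>n. ?U n) = \<Union>\<Q>" by (simp add: r)
  moreover have "(SUP n. emeasure M (?U n)) = emeasure M (\<Union>n. ?U n)"
    using m by (intro SUP_emeasure_incseq) (fastforce simp: incseq_def)+
  ultimately have "c * emeasure M (\<Union>\<Q>) = (SUP n. c * emeasure M (?U n))"
    by (simp only: SUP_mult_left_ennreal[symmetric])
  also have "\<dots> \<le> A"
    using \<open>\<And>i. from_nat_into \<Q> i \<in> \<Q>\<close> by (intro SUP_least assms(3)) auto
  finally show ?thesis .
qed (use assms(3)[of "{}"] in simp)

lemma sum_ennreal_less_top:
  fixes f :: "'i \<Rightarrow> ennreal"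
  assumes "finite I" "\<And>i. i \<in> I \<Longrightarrow> f i < top"
  shows "(\<Sum>i\<in>I. f i) < top"
  using assms by (induction I rule: finite_induct) auto

definition eavg :: "'a measure \<Rightarrow> ('a \<Rightarrow> ennreal) \<Rightarrow> 'a set \<Rightarrow> ennreal" where
  "eavg M f Q = (\<integral>\<^sup>+x\<in>Q. f x \<partial>M) / emeasure M Q"

lemma eavg_mult:
  assumes "Q \<in> sets M" "emeasure M Q < top"
  shows "eavg M f Q * emeasure M Q = (\<integral>\<^sup>+x\<in>Q. f x \<partial>M)"
proof (cases "emeasure M Q = 0")
  case True
  then have "(\<integral>\<^sup>+x\<in>Q. f x \<partial>M) = 0"
    using assms(1) by (intro nn_integral_null_set) auto
  with True show ?thesis by (simp add: eavg_def)
next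
  case False
  then show ?thesis
    using assms by (simp add: eavg_def ennreal_divide_times)
qed

lemma eavg_mono: "(\<And>x. x \<in> Q \<Longrightarrow> x \<in> space M \<Longrightarrow> f x \<le> g x) \<Longrightarrow> eavg M f Q \<le> eavg M g Q"
  unfolding eavg_def by (intro divide_right_mono_ennreal nn_integral_mono) (auto simp: indicator_def)

definition dmax :: "'a measure \<Rightarrow> 'a set set \<Rightarrow> ('a \<Rightarrow> ennreal) \<Rightarrow> 'a \<Rightarrow> ennreal" where
  "dmax M \<D> f x = (SUP Q\<in>\<D>. eavg M f Q * indicator Q x)"

lemma eavg_le_dmax: "Q \<in> \<D> \<Longrightarrow> x \<in> Q \<Longrightarrow> eavg M f Q \<le> dmax M \<D> f x"
  unfolding dmax_def by (rule SUP_upper2[of Q]) auto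

lemma dmax_mono: "(\<And>x. x \<in> space M \<Longrightarrow> f x \<le> g x) \<Longrightarrow> dmax M \<D> f x \<le> dmax M \<D> g x"
  unfolding dmax_def by (intro SUP_mono') (auto intro!: mult_right_mono eavg_mono)

locale nested_cubes =
  fixes M :: "'a measure" and \<D> :: "'a set set"
  assumes countable_cubes: "countable \<D>"
    and cubes_sets: "\<D> \<subseteq> sets M"
    and cube_finite: "Q \<in> \<D> \<Longrightarrow> emeasure M Q < top"
    and nested: "Q \<in> \<D> \<Longrightarrow> R \<in> \<D> \<Longrightarrow> Q \<subseteq> R \<or> R \<subseteq> Q \<or> Q \<inter> R = {}"
begin

lemma cube_sets [measurable]: "Q \<in> \<D> \<Longrightarrow> Q \<in> sets M"
  using cubes_sets by auto

lemma dmax_measurable [measurable]: "dmax M \<D> f \<in> borel_measurable M"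
  unfolding dmax_def[abs_def] using countable_cubes by measurable

lemma maximal_cubes:
  assumes "finite \<Q>" "\<Q> \<subseteq> \<D>"
  obtains \<P> where "\<P> \<subseteq> \<Q>" "disjoint \<P>" "\<Union>\<P> = \<Union>\<Q>"
proof
  let ?P = "{Q\<in>\<Q>. \<forall>R\<in>\<Q>. Q \<subseteq> R \<longrightarrow> Q = R}"
  show "?P \<subseteq> \<Q>" by auto
  show "disjoint ?P"
    unfolding pairwise_def disjnt_def
  proof (intro ballI impI)
    fix Q R assume QR: "Q \<in> ?P" "R \<in> ?P" "Q \<noteq> R"
    then have "Q \<in> \<D>" "R \<in> \<D>" using assms(2) by auto
    from nested[OF this] QR show "Q \<inter> R = {}" by blast
  qed
  show "\<Union>?P = \<Union>\<Q>"
  proof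
    show "\<Union>\<Q> \<subseteq> \<Union>?P"
    proof
      fix x assume "x \<in> \<Union>\<Q>"
      then obtain Q where Q: "Q \<in> \<Q>" "x \<in> Q" by auto
      from finite_has_maximal2[OF assms(1) Q(1)] Q(2) show "x \<in> \<Union>?P" by blast
    qed
  qed auto
qed

text \<open>Maximal members of the finite family are disjoint, so twice the left-hand side is at most the integral of \<open>f\<close> over the
union. The part of \<open>f\<close> below \<open>s\<close> contributes at most half of that and is absorbed on the left; what remains is the part
of \<open>f\<close> above \<open>s\<close>, as the strong type estimate needs it.\<close>
lemma weak_type_finite:
  assumes [measurable]: "f \<in> borel_measurable M" and s: "s < top"
    and \<Q>: "finite \<Q>" "\<Q> \<subseteq> \<D>" "\<And>Q. Q \<in> \<Q> \<Longrightarrow> 2 * s < eavg M f Q"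
  shows "s * emeasure M (\<Union>\<Q>) \<le> (\<integral>\<^sup>+x. f x * indicator {y. s < f y} x \<partial>M)"
proof -
  obtain \<P> where P: "\<P> \<subseteq> \<Q>" "disjoint \<P>" "\<Union>\<P> = \<Union>\<Q>" using maximal_cubes[OF \<Q>(1,2)] .
  have sets: "\<P> \<subseteq> sets M" "\<Q> \<subseteq> sets M" and c: "countable \<P>" "finite \<P>"
    using P \<Q> cubes_sets by (auto intro: finite_subset countable_finite)
  then have [measurable]: "\<Union>\<Q> \<in> sets M" using \<Q> by (intro sets.finite_Union) auto
  have "2 * s * emeasure M (\<Union>\<P>) = (\<integral>\<^sup>+Q. 2 * s * emeasure M Q \<partial>count_space \<P>)"
    using emeasure_Union_disjoint[OF P(2) c(1) sets(1)] by (simp add: nn_integral_cmult)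
  also have "\<dots> \<le> (\<integral>\<^sup>+Q. (\<integral>\<^sup>+x\<in>Q. f x \<partial>M) \<partial>count_space \<P>)"
  proof (intro nn_integral_mono)
    fix Q assume "Q \<in> space (count_space \<P>)"
    then have Q: "Q \<in> \<Q>" "Q \<in> \<D>" using P \<Q> by auto
    have "2 * s * emeasure M Q \<le> eavg M f Q * emeasure M Q"
      using \<Q>(3)[OF Q(1)] by (intro mult_right_mono) auto
    then show "2 * s * emeasure M Q \<le> (\<integral>\<^sup>+x\<in>Q. f x \<partial>M)"
      using Q cube_finite by (simp add: eavg_mult)
  qed
  also have "\<dots> = (\<integral>\<^sup>+x\<in>\<Union>\<P>. f x \<partial>M)"
    using nn_integral_Union_disjoint[OF P(2) c(1) sets(1)] by simp
  also have "\<dots> \<le> (\<integral>\<^sup>+x. s * indicator (\<Union>\<Q>) x + f x * indicator {y. s < f y} x \<partial>M)"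
    unfolding P(3) by (intro nn_integral_mono) (auto simp: indicator_def not_less intro: add_increasing)
  also have "\<dots> = s * emeasure M (\<Union>\<Q>) + (\<integral>\<^sup>+x. f x * indicator {y. s < f y} x \<partial>M)"
    by (subst nn_integral_add) (auto simp: nn_integral_cmult_indicator)
  finally have "s * emeasure M (\<Union>\<Q>) + s * emeasure M (\<Union>\<Q>) \<le>
      s * emeasure M (\<Union>\<Q>) + (\<integral>\<^sup>+x. f x * indicator {y. s < f y} x \<partial>M)"
    using P(3) by (simp add: mult_2 distrib_right)
  moreover have "emeasure M (\<Union>\<Q>) < top"
  proof (rule le_less_trans)
    show "emeasure M (\<Union>\<Q>) \<le> (\<Sum>Q\<in>\<Q>. emeasure M Q)"
      using emeasure_subadditive_finite[of \<Q> "\<lambda>Q. Q" M] \<Q>(1) sets by auto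
    show "(\<Sum>Q\<in>\<Q>. emeasure M Q) < top"
      using \<Q>(1,2) cube_finite by (intro sum_ennreal_less_top) auto
  qed
  ultimately show ?thesis
    using s by (auto simp: ennreal_add_left_cancel_le ennreal_mult_eq_top_iff)
qed

lemma weak_type:
  assumes [measurable]: "f \<in> borel_measurable M" and s: "s < top"
  shows "s * emeasure M {x\<in>space M. 2 * s < dmax M \<D> f x} \<le>
    (\<integral>\<^sup>+x. f x * indicator {y. s < f y} x \<partial>M)"
proof -
  have "{x\<in>space M. 2 * s < dmax M \<D> f x} = \<Union>{Q\<in>\<D>. 2 * s < eavg M f Q}"
    using cubes_sets sets.sets_into_space
    by (auto simp: dmax_def less_SUP_iff indicator_def split: if_splits)
  moreover have "s * emeasure M (\<Union>{Q\<in>\<D>. 2 * s < eavg M f Q}) \<le> (\<integral>\<^sup>+x. f x * indicator {y. s < f y} x \<partial>M)"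
  proof (rule emeasure_countable_Union_le)
    show "countable {Q\<in>\<D>. 2 * s < eavg M f Q}" using countable_cubes by simp
    show "{Q\<in>\<D>. 2 * s < eavg M f Q} \<subseteq> sets M" using cubes_sets by blast
    fix \<F> assume "finite \<F>" "\<F> \<subseteq> {Q\<in>\<D>. 2 * s < eavg M f Q}"
    then show "s * emeasure M (\<Union>\<F>) \<le> (\<integral>\<^sup>+x. f x * indicator {y. s < f y} x \<partial>M)"
      by (intro weak_type_finite assms) auto
  qed
  ultimately show ?thesis by simp
qed

text \<open>The term with \<open>2\<^sup>k < m \<le> 2\<^sup>k\<^sup>+\<^sup>1\<close> suffices; for \<open>m = \<infinity>\<close> all terms are present and unbounded.\<close>
lemma epow_le_dyadic_sum:
  assumes "0 < p"
  shows "epow m p \<le> (\<integral>\<^sup>+k. ennreal (2 powr ((real_of_int k + 1) * p)) * indicator {y. ennreal (2 powr real_of_int k) < y} m \<partial>count_space (UNIV::int set))"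
    (is "_ \<le> ?S")
proof -
  have ge: "ennreal (2 powr ((real_of_int k + 1) * p)) \<le> ?S" if "ennreal (2 powr real_of_int k) < m" for k :: int
    using that nn_integral_ge_point[of k UNIV "\<lambda>k. ennreal (2 powr ((real_of_int k + 1) * p)) * indicator {y. ennreal (2 powr real_of_int k) < y} m"]
    by simp
  consider "m = 0" | "m = top" | r where "m = ennreal r" "r > 0"
    by (cases m) (auto simp: less_le)
  then show ?thesis
  proof cases
    case 2
    have "of_nat n \<le> ?S" for n :: nat
    proof -
      obtain k :: nat where k: "real n < (2 powr p) ^ k"
        using real_arch_pow[of "2 powr p" "real n"] assms by auto
      have "of_nat n = ennreal (real n)" by (simp add: ennreal_of_nat_eq_real_of_nat)
      also have "\<dots> \<le> ennreal (2 powr ((int k + 1) * p))"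
      proof (rule ennreal_leI)
        have "real n \<le> 2 powr (k * p)" using k by (simp add: powr_powr mult.commute flip: powr_realpow)
        also have "\<dots> \<le> 2 powr ((int k + 1) * p)" using assms by (intro powr_mono) (auto simp: algebra_simps)
        finally show "real n \<le> 2 powr ((int k + 1) * p)" .
      qed
      also have "\<dots> \<le> ?S" using ge[of "int k"] 2 by simp
      finally show ?thesis .
    qed
    then have "(SUP n. of_nat n) \<le> ?S" by (intro SUP_least) auto
    then show ?thesis by (simp add: ennreal_SUP_of_nat_eq_top top_unique)
  next
    case 3
    define k where "k = \<lceil>log 2 r\<rceil> - 1"
    have k: "real_of_int k < log 2 r" "log 2 r \<le> real_of_int k + 1"
      unfolding k_def by linarith+
    have "2 powr k < 2 powr (log 2 r)" using k by (intro powr_less_mono) auto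
    then have "2 powr k < r" using 3 by simp
    then have "ennreal (2 powr ((real_of_int k + 1) * p)) \<le> ?S" using 3 by (intro ge) (auto intro: ennreal_lessI)
    moreover have "r powr p \<le> 2 powr ((real_of_int k + 1) * p)"
    proof -
      have "r powr p = 2 powr (log 2 r * p)" using 3 by (simp flip: powr_powr)
      also have "\<dots> \<le> 2 powr ((real_of_int k + 1) * p)" using k assms by (intro powr_mono mult_right_mono) auto
      finally show ?thesis by simp
    qed
    ultimately show ?thesis using 3 by (auto intro: order_trans[OF ennreal_leI])
  qed auto
qed

text \<open>The sum is a geometric series over the \<open>k\<close> with \<open>2\<^sup>k\<^sup>-\<^sup>1 < m\<close>, dominated by its largest term.\<close>
lemma dyadic_sum_le:
  fixes p :: real
  assumes p: "1 < p"
  defines "C \<equiv> 2 powr (2 * p) / (1 - 2 powr (1 - p))"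
  shows "m * (\<integral>\<^sup>+k. ennreal (2 powr ((p - 1) * real_of_int k + p + 1)) * indicator {y. ennreal (2 powr (real_of_int k - 1)) < y} m \<partial>count_space (UNIV::int set))
     \<le> ennreal C * epow m p" (is "m * ?S \<le> _")
proof -
  have lt: "2 powr (1 - p) < 1" using p by (simp add: powr_less_one)
  then have C: "C > 0" unfolding C_def by auto
  consider "m = 0" | "m = top" | r where "m = ennreal r" "r > 0"
    by (cases m) (auto simp: less_le)
  then show ?thesis
  proof cases
    case 2
    then show ?thesis using C by (simp add: ennreal_mult_top)
  next
    case 3
    define k0 where "k0 = \<lceil>log 2 r\<rceil>"
    have k0: "real_of_int k0 \<le> log 2 r + 1" unfolding k0_def by linarith
    have kle: "k \<le> k0" if "2 powr (real_of_int k - 1) < r" for k :: int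
    proof -
      have "real_of_int k - 1 < log 2 r" using that 3 by (simp add: less_log_iff)
      then show ?thesis unfolding k0_def by linarith
    qed
    have "?S \<le> (\<integral>\<^sup>+k. ennreal (2 powr ((p - 1) * real_of_int k + p + 1)) * indicator {..k0} k \<partial>count_space (UNIV::int set))"
      using 3 kle by (intro nn_integral_mono) (auto simp: indicator_def ennreal_less_iff)
    also have "\<dots> = (\<integral>\<^sup>+k. ennreal (2 powr ((p - 1) * real_of_int k + p + 1)) \<partial>count_space {..k0})"
      by (subst (2) nn_integral_count_space_indicator) auto
    also have "\<dots> = (\<integral>\<^sup>+j. ennreal (2 powr ((p - 1) * of_int (k0 - int (j::nat)) + p + 1)) \<partial>count_space (UNIV::nat set))"
    proof (rule nn_integral_bij_count_space[symmetric])
      show "bij_betw (\<lambda>j::nat. k0 - int j) UNIV {..k0}"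
        by (rule bij_betwI[where g = "\<lambda>k. nat (k0 - k)"]) auto
    qed
    also have "\<dots> = (\<Sum>j::nat. ennreal (2 powr ((p - 1) * k0 + p + 1) * (2 powr (1 - p)) ^ j))"
    proof -
      have "2 powr ((p - 1) * of_int (k0 - int (j::nat)) + p + 1) = 2 powr ((p - 1) * k0 + p + 1) * (2 powr (1 - p)) ^ j" for j
        by (simp add: powr_realpow[symmetric] powr_powr powr_add[symmetric] algebra_simps)
      then show ?thesis by (simp add: nn_integral_count_space_nat)
    qed
    also have "\<dots> = ennreal (2 powr ((p - 1) * k0 + p + 1) * (1 / (1 - 2 powr (1 - p))))"
      using lt by (intro suminf_ennreal_eq sums_mult geometric_sums) auto
    finally have "m * ?S \<le> ennreal r * ennreal (2 powr ((p - 1) * k0 + p + 1) * (1 / (1 - 2 powr (1 - p))))"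
      using 3 by (simp add: mult_left_mono)
    also have "\<dots> = ennreal (r * (2 powr ((p - 1) * k0 + p + 1) * (1 / (1 - 2 powr (1 - p)))))"
      using 3 by (intro ennreal_mult'[symmetric]) auto
    also have "\<dots> \<le> ennreal (C * r powr p)"
    proof (rule ennreal_leI)
      have "2 powr ((p - 1) * k0 + p + 1) \<le> 2 powr ((p - 1) * (log 2 r + 1) + p + 1)"
        using p k0 by (intro powr_mono add_right_mono mult_left_mono) auto
      also have "\<dots> = 2 powr (log 2 r * (p - 1)) * 2 powr (2 * p)"
        by (simp add: powr_add[symmetric] algebra_simps)
      also have "2 powr (log 2 r * (p - 1)) = r powr (p - 1)"
        using 3 by (simp flip: powr_powr)
      finally have "r * 2 powr ((p - 1) * k0 + p + 1) \<le> r * (r powr (p - 1) * 2 powr (2 * p))"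
        using 3 by (intro mult_left_mono) auto
      also have "\<dots> = r powr p * 2 powr (2 * p)"
        using 3 powr_add[of r 1 "p - 1"] by simp
      finally have "(r * 2 powr ((p - 1) * k0 + p + 1)) * (1 / (1 - 2 powr (1 - p))) \<le>
         (r powr p * 2 powr (2 * p)) * (1 / (1 - 2 powr (1 - p)))"
        using lt by (intro mult_right_mono) auto
      then show "r * (2 powr ((p - 1) * k0 + p + 1) * (1 / (1 - 2 powr (1 - p)))) \<le> C * r powr p"
        unfolding C_def by (simp add: mult_ac)
    qed
    finally show ?thesis using 3 C by (simp add: ennreal_mult)
  qed auto
qed

text \<open>Marcinkiewicz interpolation between the weak type bound and the trivial one at \<open>\<infinity>\<close>: split the range of the maximal
function at the powers of two, use \<open>weak_type\<close> on each level and sum the levels under the integral.\<close>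
lemma doob:
  assumes p: "1 < p"
  obtains C :: real where "0 \<le> C"
    "\<And>f. f \<in> borel_measurable M \<Longrightarrow> (\<integral>\<^sup>+x. epow (dmax M \<D> f x) p \<partial>M) \<le> ennreal C * (\<integral>\<^sup>+x. epow (f x) p \<partial>M)"
proof
  define C where "C = 2 powr (2 * p) / (1 - 2 powr (1 - p))"
  show "0 \<le> C" using p unfolding C_def by (simp add: powr_less_one less_imp_le)
  fix f :: "'a \<Rightarrow> ennreal" assume f[measurable]: "f \<in> borel_measurable M"
  let ?d = "dmax M \<D> f"
  have "(\<integral>\<^sup>+x. epow (?d x) p \<partial>M) \<le>
      (\<integral>\<^sup>+x. (\<integral>\<^sup>+k. ennreal (2 powr ((real_of_int k + 1) * p)) * indicator {y. ennreal (2 powr real_of_int k) < y} (?d x) \<partial>count_space (UNIV::int set)) \<partial>M)"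
    using p by (intro nn_integral_mono epow_le_dyadic_sum) auto
  also have "\<dots> = (\<integral>\<^sup>+k. (\<integral>\<^sup>+x. ennreal (2 powr ((real_of_int k + 1) * p)) * indicator {y. ennreal (2 powr real_of_int k) < y} (?d x) \<partial>M) \<partial>count_space (UNIV::int set))"
    by (rule nn_integral_count_space_nn_integral) auto
  also have "\<dots> \<le> (\<integral>\<^sup>+k. (\<integral>\<^sup>+x. ennreal (2 powr ((p - 1) * real_of_int k + p + 1)) * (f x * indicator {y. ennreal (2 powr (real_of_int k - 1)) < f y} x) \<partial>M) \<partial>count_space (UNIV::int set))"
  proof (rule nn_integral_mono)
    fix k :: int
    let ?s = "ennreal (2 powr (real_of_int k - 1))"
    have s2: "2 * ?s = ennreal (2 powr real_of_int k)"
    proof -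
      have "2 * ?s = ennreal (2 * 2 powr (real_of_int k - 1))" by (simp add: ennreal_mult)
      also have "2 * 2 powr (real_of_int k - 1) = 2 powr k" using powr_add[of 2 1 "k - 1"] by simp
      finally show ?thesis .
    qed
    have "(\<integral>\<^sup>+x. ennreal (2 powr ((real_of_int k + 1) * p)) * indicator {y. ennreal (2 powr real_of_int k) < y} (?d x) \<partial>M) =
       (\<integral>\<^sup>+x. ennreal (2 powr ((real_of_int k + 1) * p)) * indicator {x\<in>space M. ennreal (2 powr real_of_int k) < ?d x} x \<partial>M)"
      by (intro nn_integral_cong) (auto simp: indicator_def)
    also have "\<dots> = ennreal (2 powr ((real_of_int k + 1) * p)) * emeasure M {x\<in>space M. ennreal (2 powr real_of_int k) < ?d x}"
      by (rule nn_integral_cmult_indicator) auto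
    also have "\<dots> = ennreal (2 powr ((p - 1) * real_of_int k + p + 1)) * (?s * emeasure M {x\<in>space M. 2 * ?s < ?d x})"
    proof -
      have "2 powr ((real_of_int k + 1) * p) = 2 powr ((p - 1) * real_of_int k + p + 1) * 2 powr (real_of_int k - 1)"
        by (simp add: powr_add[symmetric] algebra_simps)
      then show ?thesis unfolding s2 by (simp add: ennreal_mult mult.assoc)
    qed
    also have "\<dots> \<le> ennreal (2 powr ((p - 1) * real_of_int k + p + 1)) * (\<integral>\<^sup>+x. f x * indicator {y. ?s < f y} x \<partial>M)"
      by (intro mult_left_mono weak_type) auto
    also have "\<dots> = (\<integral>\<^sup>+x. ennreal (2 powr ((p - 1) * real_of_int k + p + 1)) * (f x * indicator {y. ?s < f y} x) \<partial>M)"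
      by (subst nn_integral_cmult) auto
    finally show "(\<integral>\<^sup>+x. ennreal (2 powr ((real_of_int k + 1) * p)) * indicator {y. ennreal (2 powr real_of_int k) < y} (?d x) \<partial>M) \<le> \<dots>" .
  qed
  also have "\<dots> = (\<integral>\<^sup>+x. (\<integral>\<^sup>+k. ennreal (2 powr ((p - 1) * real_of_int k + p + 1)) * (f x * indicator {y. ennreal (2 powr (real_of_int k - 1)) < f y} x) \<partial>count_space (UNIV::int set)) \<partial>M)"
    by (rule nn_integral_count_space_nn_integral[symmetric]) auto
  also have "\<dots> = (\<integral>\<^sup>+x. f x * (\<integral>\<^sup>+k. ennreal (2 powr ((p - 1) * real_of_int k + p + 1)) * indicator {y. ennreal (2 powr (real_of_int k - 1)) < y} (f x) \<partial>count_space (UNIV::int set)) \<partial>M)"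
    by (subst nn_integral_cmult[symmetric]) (auto intro!: nn_integral_cong simp: indicator_def mult_ac)
  also have "\<dots> \<le> (\<integral>\<^sup>+x. ennreal C * epow (f x) p \<partial>M)"
    unfolding C_def using p by (intro nn_integral_mono dyadic_sum_le) auto
  also have "\<dots> = ennreal C * (\<integral>\<^sup>+x. epow (f x) p \<partial>M)"
    by (rule nn_integral_cmult) auto
  finally show "(\<integral>\<^sup>+x. epow (?d x) p \<partial>M) \<le> ennreal C * (\<integral>\<^sup>+x. epow (f x) p \<partial>M)" .
qed

end

section \<open>\<open>A\<^sub>p\<close> weights on cubes\<close>

lemma set_nn_integral_pos:
  assumes [measurable]: "v \<in> borel_measurable M" "Q \<in> sets M" and pos: "\<And>x. x \<in> space M \<Longrightarrow> 0 < v x" and "0 < emeasure M Q"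
  shows "mass M v Q \<noteq> 0"
proof
  assume "mass M v Q = 0"
  then have "AE x in M. ennreal (v x) * indicator Q x = 0"
    by (subst (asm) nn_integral_0_iff_AE) auto
  moreover have "AE x in M. 0 < v x" using pos by auto
  ultimately have "AE x in M. x \<notin> Q"
    by eventually_elim (auto simp: indicator_def ennreal_eq_0_iff split: if_splits)
  then have "emeasure M Q = 0"
    using AE_iff_measurable[OF assms(2), of "\<lambda>x. x \<notin> Q"] sets.sets_into_space[OF assms(2)] by auto
  with assms(4) show False by simp
qed

text \<open>The weight in question is \<open>\<omega>\<^sup>p\<close>, tested on cubes. In this form the condition is symmetric under
\<open>(p, \<omega>) \<mapsto> (q, 1 / \<omega>)\<close>, and the weights of the two-weight problem enter through the quotient \<open>\<omega>\<^sub>1 / \<omega>\<^sub>2\<close>.\<close>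
definition (in nested_cubes) Ap :: "real \<Rightarrow> real \<Rightarrow> ('a \<Rightarrow> real) \<Rightarrow> bool" where
  "Ap p q \<omega> \<longleftrightarrow> 1 < p \<and> 1 / p + 1 / q = 1 \<and> \<omega> \<in> borel_measurable M \<and> (\<forall>x\<in>space M. 0 < \<omega> x) \<and>
     (\<exists>C. 0 < C \<and> (\<forall>Q\<in>\<D>. wcube M p \<omega> Q *
        dcube M q \<omega> Q \<le> ennreal C * emeasure M Q))"

locale positive_cubes = nested_cubes +
  assumes cube_pos: "Q \<in> \<D> \<Longrightarrow> 0 < emeasure M Q"
begin

lemma Ap_dual:
  assumes "Ap p q \<omega>"
  shows "Ap q p (\<lambda>x. 1 / \<omega> x)"
proof -
  have p: "1 < p" "1 / p + 1 / q = 1" using assms by (auto simp: Ap_def)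
  note q = conjugate_exponent[OF p]
  obtain C where C: "0 < C" "\<And>Q. Q \<in> \<D> \<Longrightarrow> wcube M p \<omega> Q *
        dcube M q \<omega> Q \<le> ennreal C * emeasure M Q"
    using assms by (auto simp: Ap_def)
  have "\<omega> \<in> borel_measurable M" "\<And>x. x \<in> space M \<Longrightarrow> 0 < \<omega> x" using assms by (auto simp: Ap_def)
  then show ?thesis
    unfolding Ap_def using q C by (auto simp: mult.commute intro!: exI[of _ C])
qed

lemma wcube_nonzero:
  assumes [measurable]: "\<omega> \<in> borel_measurable M" and pos: "\<And>x. x \<in> space M \<Longrightarrow> 0 < \<omega> x"
    and Q: "Q \<in> \<D>"
  shows "wcube M p \<omega> Q \<noteq> 0"
proof -
  have "mass M (\<lambda>x. \<omega> x powr p) Q \<noteq> 0"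
    using pos cube_pos[OF Q] cube_sets[OF Q] by (intro set_nn_integral_pos) force+
  moreover have "mass M (\<lambda>x. \<omega> x powr p) Q = (\<integral>\<^sup>+x. epow (ennreal (\<omega> x) * indicator Q x) p \<partial>M)"
    by (intro nn_integral_cong) (use pos in \<open>auto simp: indicator_def less_imp_le\<close>)
  ultimately show ?thesis by (simp add: enorm_def)
qed

text \<open>A product of two nonzero factors that is finite has finite factors.\<close>
lemma Ap_weight_bounds:
  assumes "Ap p q \<omega>" "Q \<in> \<D>"
  shows "wcube M p \<omega> Q \<noteq> 0"
    "wcube M p \<omega> Q < top"
    "dcube M q \<omega> Q \<noteq> 0"
    "dcube M q \<omega> Q < top"
proof -
  have p: "1 < p" "1 / p + 1 / q = 1" using assms by (auto simp: Ap_def)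
  note q = conjugate_exponent[OF p]
  obtain C where C: "wcube M p \<omega> Q *
        dcube M q \<omega> Q \<le> ennreal C * emeasure M Q"
    using assms by (auto simp: Ap_def)
  have om: "\<omega> \<in> borel_measurable M" "\<And>x. x \<in> space M \<Longrightarrow> 0 < \<omega> x" using assms by (auto simp: Ap_def)
  show 1: "wcube M p \<omega> Q \<noteq> 0"
    using om assms(2) by (intro wcube_nonzero) auto
  show 2: "dcube M q \<omega> Q \<noteq> 0"
    using om assms(2) by (intro wcube_nonzero[where \<omega> = "\<lambda>x. 1 / \<omega> x"]) auto
  have "ennreal C * emeasure M Q < top"
    using cube_finite[OF assms(2)] by (simp add: ennreal_mult_less_top)
  with C have "wcube M p \<omega> Q *
        dcube M q \<omega> Q < top" by (rule le_less_trans)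
  with 1 2 show "wcube M p \<omega> Q < top"
     "dcube M q \<omega> Q < top"
    by (auto simp: ennreal_mult_less_top)
qed

lemma emeasure_density_powr:
  assumes [measurable]: "\<omega> \<in> borel_measurable M" and "\<And>x. x \<in> space M \<Longrightarrow> 0 < \<omega> x" "Q \<in> \<D>" "0 < p"
  shows "emeasure (density M (\<lambda>x. ennreal (\<omega> x powr p))) Q = epow (wcube M p \<omega> Q) p"
proof -
  note [measurable] = cube_sets[OF assms(3)]
  have "emeasure (density M (\<lambda>x. ennreal (\<omega> x powr p))) Q = (\<integral>\<^sup>+x. ennreal (\<omega> x powr p) * indicator Q x \<partial>M)"
    by (rule emeasure_density) auto
  also have "\<dots> = (\<integral>\<^sup>+x. epow (ennreal (\<omega> x) * indicator Q x) p \<partial>M)"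
  proof (rule nn_integral_cong)
    fix x assume "x \<in> space M"
    then have "0 \<le> \<omega> x" using assms(2) by (simp add: less_imp_le)
    then show "ennreal (\<omega> x powr p) * indicator Q x = epow (ennreal (\<omega> x) * indicator Q x) p"
      by (auto simp: indicator_def)
  qed
  finally show ?thesis using assms(4) by (simp add: epow_enorm)
qed

lemma nested_cubes_density:
  assumes "\<omega> \<in> borel_measurable M" "\<And>x. x \<in> space M \<Longrightarrow> 0 < \<omega> x" "0 < p"
    "\<And>Q. Q \<in> \<D> \<Longrightarrow> wcube M p \<omega> Q < top"
  shows "nested_cubes (density M (\<lambda>x. ennreal (\<omega> x powr p))) \<D>"
proof
  show "emeasure (density M (\<lambda>x. ennreal (\<omega> x powr p))) Q < top" if "Q \<in> \<D>" for Q
    using assms that by (simp add: emeasure_density_powr)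
qed (use countable_cubes cubes_sets nested in auto)

text \<open>Lerner's argument. Let \<open>W = \<omega>\<^sup>p\<close>, \<open>V = \<omega>\<^sup>-\<^sup>q\<close> and \<open>\<phi> = f \<omega>\<^sup>q\<close>. The average of \<open>f\<close> over \<open>Q\<close> is
\<open>V(Q) / \<mu>(Q)\<close> times the average \<open>t\<close> of \<open>\<phi>\<close> with respect to \<open>V\<close>, and \<open>t\<close> is at most the
maximal function of \<open>\<phi>\<close> at every point of \<open>Q\<close>. Averaging the power \<open>p - 1\<close> of that function in the measure \<open>W\<close>
returns \<open>t\<close> with a factor that the \<open>A\<^sub>p\<close> condition compares with \<open>V(Q) / \<mu>(Q)\<close>.\<close>
lemma Ap_pointwise:
  assumes ap: "Ap p q \<omega>"
  obtains K :: real where "0 \<le> K" "\<And>f x. f \<in> borel_measurable M \<Longrightarrow> dmax M \<D> f x \<le>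
    ennreal K * epow (dmax (density M (\<lambda>x. ennreal (\<omega> x powr p))) \<D>
      (\<lambda>x. epow (dmax (density M (\<lambda>x. ennreal ((1 / \<omega> x) powr q))) \<D> (\<lambda>x. f x * ennreal (\<omega> x powr q)) x) (p - 1)
         * ennreal ((1 / \<omega> x) powr p)) x) (q - 1)"
proof -
  have p: "1 < p" "1 / p + 1 / q = 1" using ap by (auto simp: Ap_def)
  note q = conjugate_exponent[OF p]
  have om[measurable]: "\<omega> \<in> borel_measurable M" and ompos: "\<And>x. x \<in> space M \<Longrightarrow> 0 < \<omega> x"
    using ap by (auto simp: Ap_def)
  obtain C where C: "0 < C" "\<And>Q. Q \<in> \<D> \<Longrightarrow> wcube M p \<omega> Q *
        dcube M q \<omega> Q \<le> ennreal C * emeasure M Q"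
    using ap by (auto simp: Ap_def)
  define W where "W = density M (\<lambda>x. ennreal (\<omega> x powr p))"
  define V where "V = density M (\<lambda>x. ennreal ((1 / \<omega> x) powr q))"
  note bd = Ap_weight_bounds[OF ap]
  interpret W: nested_cubes W \<D>
    unfolding W_def by (rule nested_cubes_density) (use p bd ompos in auto)
  interpret V: nested_cubes V \<D>
    unfolding V_def by (rule nested_cubes_density[of "\<lambda>x. 1 / \<omega> x"]) (use p q bd ompos in auto)
  have setsWV[measurable_cong]: "sets W = sets M" "sets V = sets M" by (auto simp: W_def V_def)
  show ?thesis
  proof (rule that[of "C powr q"])
    show "0 \<le> C powr q" by simp
    fix f :: "'a \<Rightarrow> ennreal" and x assume f[measurable]: "f \<in> borel_measurable M"
    define \<phi> where "\<phi> x = f x * ennreal (\<omega> x powr q)" for x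
    define G where "G x = epow (dmax V \<D> \<phi> x) (p - 1) * ennreal ((1 / \<omega> x) powr p)" for x
    have [measurable]: "\<phi> \<in> borel_measurable M" unfolding \<phi>_def by measurable
    have [measurable]: "dmax V \<D> \<phi> \<in> borel_measurable M"
      using V.dmax_measurable[of \<phi>] by (simp add: measurable_cong_sets[OF setsWV(2) refl])
    have [measurable]: "G \<in> borel_measurable M" unfolding G_def by measurable
    have "dmax M \<D> f x \<le> ennreal (C powr q) * epow (dmax W \<D> G x) (q - 1)"
      unfolding dmax_def[of M]
    proof (rule SUP_least)
      fix Q assume Q: "Q \<in> \<D>"
      note [measurable] = cube_sets[OF Q]
      show "eavg M f Q * indicator Q x \<le> ennreal (C powr q) * epow (dmax W \<D> G x) (q - 1)"
      proof (cases "x \<in> Q")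
        case True
        define t where "t = eavg V \<phi> Q"
        obtain m where m: "emeasure M Q = ennreal m" "m > 0"
          using cube_finite[OF Q] cube_pos[OF Q] by (cases "emeasure M Q") auto
        obtain a where a: "wcube M p \<omega> Q = ennreal a" "a > 0"
          using bd(1,2)[OF Q] by (cases "wcube M p \<omega> Q") (auto simp: less_le)
        obtain c where c: "dcube M q \<omega> Q = ennreal c" "c > 0"
          using bd(3,4)[OF Q] by (cases "dcube M q \<omega> Q") (auto simp: less_le)
        have ac: "a * c \<le> C * m"
          using C(2)[OF Q] C(1) a c m by (simp add: ennreal_le_iff flip: ennreal_mult)
        have WQ: "emeasure W Q = ennreal (a powr p)"
          unfolding W_def using emeasure_density_powr[OF om ompos Q, of p] p a by simp
        have VQ: "emeasure V Q = ennreal (c powr q)"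
          unfolding V_def using emeasure_density_powr[of "\<lambda>x. 1 / \<omega> x" Q q] ompos Q q c by simp
        have "(\<integral>\<^sup>+x\<in>Q. f x \<partial>M) = (\<integral>\<^sup>+x\<in>Q. \<phi> x \<partial>V)"
        proof -
          have "(\<integral>\<^sup>+x\<in>Q. \<phi> x \<partial>V) = (\<integral>\<^sup>+x. ennreal ((1 / \<omega> x) powr q) * (\<phi> x * indicator Q x) \<partial>M)"
            unfolding V_def by (rule nn_integral_density) auto
          also have "\<dots> = (\<integral>\<^sup>+x\<in>Q. f x \<partial>M)"
          proof (rule nn_integral_cong)
            fix x assume x: "x \<in> space M"
            have "ennreal ((1 / \<omega> x) powr q) * ennreal (\<omega> x powr q) = 1"
              using ompos[OF x] by (simp add: powr_divide flip: ennreal_mult)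
            then show "ennreal ((1 / \<omega> x) powr q) * (\<phi> x * indicator Q x) = f x * indicator Q x"
              unfolding \<phi>_def by (metis (no_types, opaque_lifting) mult.assoc mult.commute mult_1)
          qed
          finally show ?thesis ..
        qed
        also have "\<dots> = t * ennreal (c powr q)"
          unfolding t_def using eavg_mult[of Q V \<phi>] V.cube_sets[OF Q] V.cube_finite[OF Q] VQ by simp
        finally have "eavg M f Q = t * ennreal (c powr q / m)"
          using m by (simp add: eavg_def ennreal_times_divide divide_ennreal flip: ennreal_times_divide)
        also have "\<dots> \<le> t * ennreal (C powr q * (m / a powr p) powr (q - 1))"
        proof (intro mult_left_mono ennreal_leI)
          have "(a * c) powr q \<le> (C * m) powr q" using ac a c q by (intro powr_mono2) auto
          \<comment> \<open>with \<open>W(Q) = a\<^sup>p\<close> and \<open>V(Q) = c\<^sup>q\<close>, this is the comparison of \<open>V(Q) / \<mu>(Q)\<close> with \<open>(\<mu>(Q) / W(Q))\<^sup>q\<^sup>-\<^sup>1\<close>\<close>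
          then have "a powr q * c powr q \<le> C powr q * m powr q"
            using a c m C by (simp add: powr_mult)
          moreover have "m powr q = m * m powr (q - 1)" using m powr_add[of m 1 "q - 1"] by simp
          ultimately have "c powr q \<le> C powr q * (m * m powr (q - 1)) / a powr q"
            using a by (simp add: pos_le_divide_eq mult.commute)
          moreover have "(m / a powr p) powr (q - 1) = m powr (q - 1) / a powr q"
            using m a q by (simp add: powr_divide powr_powr mult.commute)
          ultimately show "c powr q / m \<le> C powr q * (m / a powr p) powr (q - 1)"
            using m by (simp add: pos_divide_le_eq mult_ac)
        qed simp
        also have "\<dots> = ennreal (C powr q) * (t * ennreal ((m / a powr p) powr (q - 1)))"
          by (simp add: ennreal_mult mult_ac)
        also have "t * ennreal ((m / a powr p) powr (q - 1)) = epow (epow t (p - 1) * ennreal (m / a powr p)) (q - 1)"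
        proof -
          have "(p - 1) * (q - 1) = 1" using q by (simp add: algebra_simps)
          then show ?thesis using p q m a by (simp add: epow_mult epow_epow)
        qed
        also have "\<dots> \<le> epow (eavg W G Q) (q - 1)"
        proof (intro epow_mono)
          have "epow t (p - 1) * emeasure M Q = (\<integral>\<^sup>+x. epow t (p - 1) * indicator Q x \<partial>M)"
            by (simp add: nn_integral_cmult_indicator)
          also have "\<dots> \<le> (\<integral>\<^sup>+x. ennreal (\<omega> x powr p) * (G x * indicator Q x) \<partial>M)"
          proof (rule nn_integral_mono)
            fix x assume x: "x \<in> space M"
            have 1: "ennreal (\<omega> x powr p) * ennreal ((1 / \<omega> x) powr p) = 1"
              using ompos[OF x] by (simp add: powr_divide flip: ennreal_mult)
            have "epow t (p - 1) \<le> epow (dmax V \<D> \<phi> x) (p - 1)" if "x \<in> Q"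
              unfolding t_def using Q that p by (intro epow_mono eavg_le_dmax) auto
            moreover have "ennreal (\<omega> x powr p) * (G x * indicator Q x) = epow (dmax V \<D> \<phi> x) (p - 1) * indicator Q x"
              unfolding G_def using 1 by (metis (no_types, opaque_lifting) mult.assoc mult.commute mult_1)
            ultimately show "epow t (p - 1) * indicator Q x \<le> ennreal (\<omega> x powr p) * (G x * indicator Q x)"
              by (auto simp: indicator_def)
          qed
          also have "\<dots> = (\<integral>\<^sup>+x\<in>Q. G x \<partial>W)"
            unfolding W_def by (rule nn_integral_density[symmetric]) auto
          finally have "epow t (p - 1) * ennreal m / ennreal (a powr p) \<le> eavg W G Q"
            unfolding eavg_def WQ m(1) by (rule divide_right_mono_ennreal)
          moreover have "epow t (p - 1) * ennreal (m / a powr p) = epow t (p - 1) * ennreal m / ennreal (a powr p)"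
            using m a by (simp add: divide_ennreal flip: ennreal_times_divide)
          ultimately show "epow t (p - 1) * ennreal (m / a powr p) \<le> eavg W G Q" by simp
        qed (use q in auto)
        also have "\<dots> \<le> epow (dmax W \<D> G x) (q - 1)"
          using Q True q by (intro epow_mono eavg_le_dmax) auto
        finally show ?thesis using True by (simp add: mult_left_mono)
      qed simp
    qed
    then show "dmax M \<D> f x \<le> ennreal (C powr q) * epow (dmax (density M (\<lambda>x. ennreal (\<omega> x powr p))) \<D>
      (\<lambda>x. epow (dmax (density M (\<lambda>x. ennreal ((1 / \<omega> x) powr q))) \<D> (\<lambda>x. f x * ennreal (\<omega> x powr q)) x) (p - 1)
         * ennreal ((1 / \<omega> x) powr p)) x) (q - 1)"
      unfolding W_def V_def G_def[abs_def] \<phi>_def[abs_def] .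
  qed
qed

text \<open>Each of the two maximal functions in \<open>Ap_pointwise\<close> is taken with respect to the measure in whose Lebesgue space it is
estimated, so \<open>doob\<close> applies twice; the powers of \<open>\<omega>\<close> match because \<open>p q = p + q\<close>.\<close>
lemma Ap_max_bounded:
  assumes ap: "Ap p q \<omega>"
  obtains C :: real where "0 \<le> C" "\<And>f. f \<in> borel_measurable M \<Longrightarrow>
    wnorm M p \<omega> (dmax M \<D> f) \<le> ennreal C * wnorm M p \<omega> f"
proof -
  have p: "1 < p" "1 / p + 1 / q = 1" using ap by (auto simp: Ap_def)
  note q = conjugate_exponent[OF p]
  have om[measurable]: "\<omega> \<in> borel_measurable M" and ompos: "\<And>x. x \<in> space M \<Longrightarrow> 0 < \<omega> x"
    using ap by (auto simp: Ap_def)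
  define W where "W = density M (\<lambda>x. ennreal (\<omega> x powr p))"
  define V where "V = density M (\<lambda>x. ennreal ((1 / \<omega> x) powr q))"
  note bd = Ap_weight_bounds[OF ap]
  interpret W: nested_cubes W \<D>
    unfolding W_def by (rule nested_cubes_density) (use p bd ompos in auto)
  interpret V: nested_cubes V \<D>
    unfolding V_def by (rule nested_cubes_density[of "\<lambda>x. 1 / \<omega> x"]) (use p q bd ompos in auto)
  have setsWV[measurable_cong]: "sets W = sets M" "sets V = sets M" by (auto simp: W_def V_def)
  have iW: "(\<integral>\<^sup>+x. g x \<partial>W) = (\<integral>\<^sup>+x. ennreal (\<omega> x powr p) * g x \<partial>M)" if "g \<in> borel_measurable M" for g
    unfolding W_def using that by (intro nn_integral_density) auto
  have iV: "(\<integral>\<^sup>+x. g x \<partial>V) = (\<integral>\<^sup>+x. ennreal ((1 / \<omega> x) powr q) * g x \<partial>M)" if "g \<in> borel_measurable M" for g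
    unfolding V_def using that by (intro nn_integral_density) auto
  obtain K where K: "0 \<le> K" "\<And>f x. f \<in> borel_measurable M \<Longrightarrow> dmax M \<D> f x \<le>
    ennreal K * epow (dmax W \<D> (\<lambda>x. epow (dmax V \<D> (\<lambda>x. f x * ennreal (\<omega> x powr q)) x) (p - 1)
         * ennreal ((1 / \<omega> x) powr p)) x) (q - 1)"
    using Ap_pointwise[OF ap] unfolding W_def V_def by blast
  obtain CW where CW: "0 \<le> CW" "\<And>f. f \<in> borel_measurable W \<Longrightarrow> (\<integral>\<^sup>+x. epow (dmax W \<D> f x) q \<partial>W) \<le> ennreal CW * (\<integral>\<^sup>+x. epow (f x) q \<partial>W)"
    using W.doob[OF q(1)] by blast
  obtain CV where CV: "0 \<le> CV" "\<And>f. f \<in> borel_measurable V \<Longrightarrow> (\<integral>\<^sup>+x. epow (dmax V \<D> f x) p \<partial>V) \<le> ennreal CV * (\<integral>\<^sup>+x. epow (f x) p \<partial>V)"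
    using V.doob[OF p(1)] by blast
  show ?thesis
  proof (rule that[of "(K powr p * CW * CV) powr (1 / p)"])
    fix f :: "'a \<Rightarrow> ennreal" assume f[measurable]: "f \<in> borel_measurable M"
    define \<phi> where "\<phi> x = f x * ennreal (\<omega> x powr q)" for x
    define G where "G x = epow (dmax V \<D> \<phi> x) (p - 1) * ennreal ((1 / \<omega> x) powr p)" for x
    have [measurable]: "\<phi> \<in> borel_measurable M" unfolding \<phi>_def by measurable
    have [measurable]: "dmax V \<D> \<phi> \<in> borel_measurable M"
      using V.dmax_measurable[of \<phi>] by (simp add: measurable_cong_sets[OF setsWV(2) refl])
    have [measurable]: "G \<in> borel_measurable M" unfolding G_def by measurable
    have [measurable]: "dmax W \<D> G \<in> borel_measurable M"
      using W.dmax_measurable[of G] by (simp add: measurable_cong_sets[OF setsWV(1) refl])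
    have le: "dmax M \<D> f x \<le> ennreal K * epow (dmax W \<D> G x) (q - 1)" for x
      using K(2)[OF f, of x] unfolding G_def[abs_def] \<phi>_def[abs_def] .
    have "(\<integral>\<^sup>+x. epow (dmax M \<D> f x * ennreal (\<omega> x)) p \<partial>M) \<le>
        (\<integral>\<^sup>+x. ennreal (K powr p) * (ennreal (\<omega> x powr p) * epow (dmax W \<D> G x) q) \<partial>M)"
    proof (rule nn_integral_mono)
      fix x assume x: "x \<in> space M"
      have "epow (dmax M \<D> f x * ennreal (\<omega> x)) p \<le> epow (ennreal K * epow (dmax W \<D> G x) (q - 1) * ennreal (\<omega> x)) p"
        using p by (intro epow_mono mult_right_mono le) auto
      also have "\<dots> = ennreal (K powr p) * (ennreal (\<omega> x powr p) * epow (dmax W \<D> G x) q)"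
        using p K(1) ompos[OF x] q by (simp add: epow_mult epow_epow mult_ac less_imp_le)
      finally show "epow (dmax M \<D> f x * ennreal (\<omega> x)) p \<le> \<dots>" .
    qed
    also have "\<dots> = ennreal (K powr p) * (\<integral>\<^sup>+x. epow (dmax W \<D> G x) q \<partial>W)"
      by (simp add: nn_integral_cmult iW)
    also have "\<dots> \<le> ennreal (K powr p) * (ennreal CW * (\<integral>\<^sup>+x. epow (G x) q \<partial>W))"
      by (intro mult_left_mono CW) auto
    also have "(\<integral>\<^sup>+x. epow (G x) q \<partial>W) = (\<integral>\<^sup>+x. epow (dmax V \<D> \<phi> x) p \<partial>V)"
    proof -
      have "ennreal (\<omega> x powr p) * epow (G x) q = ennreal ((1 / \<omega> x) powr q) * epow (dmax V \<D> \<phi> x) p" if "x \<in> space M" for x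
      proof -
        have "p * q = p + q" using p q by (simp add: field_simps)
        then have "\<omega> x powr p * (1 / \<omega> x) powr (p * q) = (1 / \<omega> x) powr q"
          using ompos[OF that] by (simp add: powr_divide powr_add)
        then have "ennreal (\<omega> x powr p) * ennreal ((1 / \<omega> x) powr (p * q)) = ennreal ((1 / \<omega> x) powr q)"
          by (simp flip: ennreal_mult)
        moreover have "epow (G x) q = ennreal ((1 / \<omega> x) powr (p * q)) * epow (dmax V \<D> \<phi> x) p"
          unfolding G_def using p q by (simp add: epow_mult epow_epow powr_powr mult_ac)
        ultimately show ?thesis by (simp only: mult.assoc[symmetric])
      qed
      then show ?thesis by (simp add: iW iV cong: nn_integral_cong)
    qed
    also have "\<dots> \<le> ennreal CV * (\<integral>\<^sup>+x. epow (\<phi> x) p \<partial>V)" by (intro CV) auto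
    also have "(\<integral>\<^sup>+x. epow (\<phi> x) p \<partial>V) = (\<integral>\<^sup>+x. epow (f x * ennreal (\<omega> x)) p \<partial>M)"
    proof -
      have "ennreal ((1 / \<omega> x) powr q) * epow (\<phi> x) p = epow (f x * ennreal (\<omega> x)) p" if "x \<in> space M" for x
      proof -
        have "q * p = q + p" using p q by (simp add: field_simps)
        then have "(1 / \<omega> x) powr q * \<omega> x powr (q * p) = \<omega> x powr p"
          using ompos[OF that] by (simp add: powr_divide powr_add)
        then have "ennreal ((1 / \<omega> x) powr q) * ennreal (\<omega> x powr (q * p)) = ennreal (\<omega> x powr p)"
          by (simp flip: ennreal_mult)
        moreover have "epow (\<phi> x) p = ennreal (\<omega> x powr (q * p)) * epow (f x) p"
          unfolding \<phi>_def using p q by (simp add: epow_mult powr_powr mult_ac)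
        moreover have "epow (f x * ennreal (\<omega> x)) p = ennreal (\<omega> x powr p) * epow (f x) p"
          using p ompos[OF that] by (simp add: epow_mult less_imp_le mult.commute)
        ultimately show ?thesis by (simp only: mult.assoc[symmetric])
      qed
      then show ?thesis by (simp add: iV cong: nn_integral_cong)
    qed
    finally have "(\<integral>\<^sup>+x. epow (dmax M \<D> f x * ennreal (\<omega> x)) p \<partial>M) \<le>
        ennreal (K powr p) * (ennreal CW * (ennreal CV * (\<integral>\<^sup>+x. epow (f x * ennreal (\<omega> x)) p \<partial>M)))"
      by (simp add: mult_left_mono)
    also have "\<dots> = ennreal (K powr p * CW * CV) * (\<integral>\<^sup>+x. epow (f x * ennreal (\<omega> x)) p \<partial>M)"
      using K CW CV by (simp add: ennreal_mult mult.assoc)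
    finally have "(\<integral>\<^sup>+x. epow (dmax M \<D> f x * ennreal (\<omega> x)) p \<partial>M) \<le> \<dots>" .
    then have "wnorm M p \<omega> (dmax M \<D> f) \<le>
        epow (ennreal (K powr p * CW * CV) * (\<integral>\<^sup>+x. epow (f x * ennreal (\<omega> x)) p \<partial>M)) (1 / p)"
      unfolding enorm_def using p by (intro epow_mono) auto
    also have "\<dots> = ennreal ((K powr p * CW * CV) powr (1 / p)) * wnorm M p \<omega> f"
      using p K CW CV by (simp add: enorm_def epow_mult)
    finally show "wnorm M p \<omega> (dmax M \<D> f) \<le> \<dots>" .
  qed simp
qed

text \<open>The form is symmetric: its terms are \<open>f\<^sub>Q h\<^sub>Q \<mu>(Q)\<close>, with \<open>\<mu>(Q) \<le> \<mu>(E\<^sub>Q) / \<eta>\<close>. On \<open>E\<^sub>Q\<close> both averages are below the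
maximal functions, so bounded overlap leaves the integral of \<open>M f M h\<close>, to which Hoelder's inequality and the bounds for
\<open>M\<close> on the space and on its dual apply.\<close>
lemma sparse_form_bounded:
  assumes ap: "Ap p q \<omega>" and S: "S \<subseteq> \<D>" and \<eta>: "0 < (\<eta>::real)"
    and E: "\<And>Q. Q \<in> S \<Longrightarrow> E Q \<in> sets M" "\<And>Q. Q \<in> S \<Longrightarrow> E Q \<subseteq> Q"
      "\<And>Q. Q \<in> S \<Longrightarrow> ennreal \<eta> * emeasure M Q \<le> emeasure M (E Q)"
    and overlap: "\<And>x. x \<in> space M \<Longrightarrow> finite {Q\<in>S. x \<in> E Q} \<and> card {Q\<in>S. x \<in> E Q} \<le> N"
  obtains C :: real where "0 \<le> C" "\<And>f h. f \<in> borel_measurable M \<Longrightarrow> h \<in> borel_measurable M \<Longrightarrow>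
    (\<integral>\<^sup>+Q. eavg M f Q * (\<integral>\<^sup>+x\<in>Q. h x \<partial>M) \<partial>count_space S) \<le>
      ennreal C * (wnorm M p \<omega> f * dnorm M q \<omega> h)"
proof -
  have p: "1 < p" "1 / p + 1 / q = 1" using ap by (auto simp: Ap_def)
  have om[measurable]: "\<omega> \<in> borel_measurable M" and ompos: "\<And>x. x \<in> space M \<Longrightarrow> 0 < \<omega> x"
    using ap by (auto simp: Ap_def)
  obtain C1 where C1: "0 \<le> C1" "\<And>f. f \<in> borel_measurable M \<Longrightarrow>
    wnorm M p \<omega> (dmax M \<D> f) \<le> ennreal C1 * wnorm M p \<omega> f"
    using Ap_max_bounded[OF ap] by blast
  obtain C2 where C2: "0 \<le> C2" "\<And>f. f \<in> borel_measurable M \<Longrightarrow>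
    dnorm M q \<omega> (dmax M \<D> f) \<le> ennreal C2 * dnorm M q \<omega> f"
    using Ap_max_bounded[OF Ap_dual[OF ap]] by blast
  have cS: "countable S" using S countable_cubes countable_subset by blast
  note [measurable] = E(1)
  show ?thesis
  proof (rule that[of "1 / \<eta> * real N * (C1 * C2)"])
    show "0 \<le> 1 / \<eta> * real N * (C1 * C2)" using \<eta> C1 C2 by auto
    fix f h :: "'a \<Rightarrow> ennreal" assume [measurable]: "f \<in> borel_measurable M" "h \<in> borel_measurable M"
    let ?Mf = "dmax M \<D> f" and ?Mh = "dmax M \<D> h"
    have "(\<integral>\<^sup>+Q. eavg M f Q * (\<integral>\<^sup>+x\<in>Q. h x \<partial>M) \<partial>count_space S) \<le>
       (\<integral>\<^sup>+Q. (\<integral>\<^sup>+x. ennreal (1 / \<eta>) * (?Mf x * ?Mh x) * indicator (E Q) x \<partial>M) \<partial>count_space S)"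
    proof (rule nn_integral_mono)
      fix Q assume "Q \<in> space (count_space S)"
      then have Q: "Q \<in> S" "Q \<in> \<D>" using S by auto
      note [measurable] = E(1)[OF Q(1)]
      have "emeasure M Q = ennreal (1 / \<eta>) * (ennreal \<eta> * emeasure M Q)"
        using \<eta> by (simp add: mult.assoc[symmetric] flip: ennreal_mult)
      also have "\<dots> \<le> ennreal (1 / \<eta>) * emeasure M (E Q)" by (intro mult_left_mono E Q) auto
      finally have le: "emeasure M Q \<le> ennreal (1 / \<eta>) * emeasure M (E Q)" .
      have "eavg M f Q * (\<integral>\<^sup>+x\<in>Q. h x \<partial>M) = eavg M f Q * (eavg M h Q * emeasure M Q)"
        using Q by (simp add: eavg_mult cube_finite)
      also have "\<dots> \<le> eavg M f Q * (eavg M h Q * (ennreal (1 / \<eta>) * emeasure M (E Q)))"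
        by (intro mult_left_mono le) auto
      also have "\<dots> = (\<integral>\<^sup>+x. ennreal (1 / \<eta>) * (eavg M f Q * eavg M h Q) * indicator (E Q) x \<partial>M)"
        by (subst nn_integral_cmult_indicator) (auto simp: mult_ac)
      also have "\<dots> \<le> (\<integral>\<^sup>+x. ennreal (1 / \<eta>) * (?Mf x * ?Mh x) * indicator (E Q) x \<partial>M)"
      proof (rule nn_integral_mono)
        fix x
        have "eavg M f Q * eavg M h Q \<le> ?Mf x * ?Mh x" if "x \<in> E Q"
          using that Q E(2)[OF Q(1)] by (intro mult_mono eavg_le_dmax) auto
        then show "ennreal (1 / \<eta>) * (eavg M f Q * eavg M h Q) * indicator (E Q) x \<le> ennreal (1 / \<eta>) * (?Mf x * ?Mh x) * indicator (E Q) x"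
          by (auto simp: indicator_def intro: mult_left_mono)
      qed
      finally show "eavg M f Q * (\<integral>\<^sup>+x\<in>Q. h x \<partial>M) \<le> \<dots>" .
    qed
    also have "\<dots> = (\<integral>\<^sup>+x. (\<integral>\<^sup>+Q. ennreal (1 / \<eta>) * (?Mf x * ?Mh x) * indicator (E Q) x \<partial>count_space S) \<partial>M)"
      by (rule nn_integral_count_space_nn_integral[symmetric, OF cS]) measurable
    also have "\<dots> \<le> (\<integral>\<^sup>+x. ennreal (1 / \<eta>) * ennreal (real N) * (?Mf x * ?Mh x) \<partial>M)"
    proof (rule nn_integral_mono)
      fix x assume x: "x \<in> space M"
      have "(\<integral>\<^sup>+Q. indicator (E Q) x \<partial>count_space S) = (\<integral>\<^sup>+Q. indicator {Q\<in>S. x \<in> E Q} Q \<partial>count_space S)"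
        by (rule nn_integral_cong) (auto simp: indicator_def)
      also have "\<dots> = ennreal (card {Q\<in>S. x \<in> E Q})"
        using overlap[OF x] by (simp add: emeasure_count_space ennreal_of_nat_eq_real_of_nat)
      also have "\<dots> \<le> ennreal (real N)" using overlap[OF x] by (intro ennreal_leI) auto
      finally have "(\<integral>\<^sup>+Q. indicator (E Q) x \<partial>count_space S) \<le> ennreal (real N)" .
      then have "ennreal (1 / \<eta>) * (?Mf x * ?Mh x) * (\<integral>\<^sup>+Q. indicator (E Q) x \<partial>count_space S) \<le>
          ennreal (1 / \<eta>) * (?Mf x * ?Mh x) * ennreal (real N)"
        by (rule mult_left_mono) simp
      then show "(\<integral>\<^sup>+Q. ennreal (1 / \<eta>) * (?Mf x * ?Mh x) * indicator (E Q) x \<partial>count_space S)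
          \<le> ennreal (1 / \<eta>) * ennreal (real N) * (?Mf x * ?Mh x)"
        by (subst nn_integral_cmult) (auto simp: mult_ac)
    qed
    also have "\<dots> = ennreal (1 / \<eta> * real N) * (\<integral>\<^sup>+x. ?Mf x * ?Mh x \<partial>M)"
      using \<eta> by (simp add: nn_integral_cmult flip: ennreal_mult)
    also have "(\<integral>\<^sup>+x. ?Mf x * ?Mh x \<partial>M) = (\<integral>\<^sup>+x. (?Mf x * ennreal (\<omega> x)) * (?Mh x * ennreal (1 / \<omega> x)) \<partial>M)"
    proof (rule nn_integral_cong)
      fix x assume x: "x \<in> space M"
      have 1: "ennreal (\<omega> x) * ennreal (1 / \<omega> x) = 1"
        using ompos[OF x] by (simp flip: ennreal_mult)
      have "(?Mf x * ennreal (\<omega> x)) * (?Mh x * ennreal (1 / \<omega> x)) = (?Mf x * ?Mh x) * (ennreal (\<omega> x) * ennreal (1 / \<omega> x))"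
        by (simp only: mult_ac)
      then show "?Mf x * ?Mh x = (?Mf x * ennreal (\<omega> x)) * (?Mh x * ennreal (1 / \<omega> x))" by (simp add: 1)
    qed
    also have "\<dots> \<le> wnorm M p \<omega> ?Mf * dnorm M q \<omega> ?Mh"
      by (rule Holder_nn_integral[OF p]) auto
    also have "\<dots> \<le> (ennreal C1 * wnorm M p \<omega> f) * (ennreal C2 * dnorm M q \<omega> h)"
      by (intro mult_mono C1 C2) auto
    also have "\<dots> = ennreal (C1 * C2) * (wnorm M p \<omega> f * dnorm M q \<omega> h)"
      using C1 C2 by (simp add: ennreal_mult mult_ac)
    finally show "(\<integral>\<^sup>+Q. eavg M f Q * (\<integral>\<^sup>+x\<in>Q. h x \<partial>M) \<partial>count_space S) \<le>
      ennreal (1 / \<eta> * real N * (C1 * C2)) * (wnorm M p \<omega> f * dnorm M q \<omega> h)"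
      using \<eta> C1 C2 by (simp only: ennreal_mult mult.assoc mult_left_mono zero_le of_nat_0_le_iff
        ennreal_mult'[of "1 / \<eta> * real N"] divide_nonneg_nonneg less_imp_le zero_le_one mult_nonneg_nonneg)
  qed
qed

end

section \<open>Oscillation over cubes\<close>

definition dev :: "'a measure \<Rightarrow> ('a \<Rightarrow> 'k::{banach, second_countable_topology}) \<Rightarrow> 'k \<Rightarrow> 'a set \<Rightarrow> ennreal" where
  "dev M b c Q = (\<integral>\<^sup>+x\<in>Q. ennreal (norm (b x - c)) \<partial>M)"

lemma avg_dist_le_dev:
  fixes b :: "'a \<Rightarrow> 'k::{banach, second_countable_topology}"
  assumes "P \<in> sets M" "set_integrable M P b" "0 < emeasure M P" "emeasure M P < top"
  shows "ennreal (norm (avg M P b - c)) * emeasure M P \<le> dev M b c P"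
proof -
  have mu: "emeasure M P = ennreal (measure M P)" "0 < measure M P"
    using assms(3,4) by (simp_all add: measure_def enn2real_positive_iff)
  have ic: "set_integrable M P (\<lambda>x. c)"
    unfolding set_integrable_def using assms by (intro integrable_scaleR_left) (auto intro: integrable_real_indicator)
  have i: "set_integrable M P (\<lambda>x. b x - c)" using assms(2) ic by (rule set_integral_diff)
  have "integrable M (indicator P :: 'a \<Rightarrow> real)"
    using assms by (intro integrable_real_indicator) auto
  then have "(LINT x:P|M. c) = measure M P *\<^sub>R c"
    using sets.sets_into_space[OF assms(1)]
    by (simp add: set_lebesgue_integral_def Int_absorb2)
  then have "(LINT x:P|M. b x - c) = (LINT x:P|M. b x) - measure M P *\<^sub>R c"
    using set_integral_diff(2)[OF assms(2) ic] by simp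
  then have "measure M P *\<^sub>R (avg M P b - c) = (LINT x:P|M. b x - c)"
    using mu by (simp add: avg_def scaleR_diff_right)
  then have "measure M P * norm (avg M P b - c) = norm (LINT x:P|M. b x - c)"
    using mu by (metis abs_of_pos norm_scaleR)
  also have "\<dots> \<le> (LINT x:P|M. norm (b x - c))"
    by (rule set_integral_norm_bound[OF i])
  finally have "ennreal (norm (avg M P b - c) * measure M P) \<le> ennreal (LINT x:P|M. norm (b x - c))"
    by (intro ennreal_leI) (simp add: mult.commute)
  also have "\<dots> = (\<integral>\<^sup>+x\<in>P. ennreal (norm (b x - c)) \<partial>M)"
  proof -
    have "ennreal (LINT x:P|M. norm (b x - c)) = (\<integral>\<^sup>+x. ennreal (indicator P x *\<^sub>R norm (b x - c)) \<partial>M)"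
      unfolding set_lebesgue_integral_def using set_integrable_norm[OF i]
      by (intro nn_integral_eq_integral[symmetric]) (auto simp: set_integrable_def)
    also have "\<dots> = (\<integral>\<^sup>+x\<in>P. ennreal (norm (b x - c)) \<partial>M)"
      by (intro nn_integral_cong) (auto simp: indicator_def)
    finally show ?thesis .
  qed
  finally show ?thesis using mu by (simp add: dev_def ennreal_mult)
qed

lemma dev_mono: "P \<subseteq> Q \<Longrightarrow> dev M b c P \<le> dev M b c Q"
  unfolding dev_def by (intro nn_integral_mono) (auto simp: indicator_def)

text \<open>By Cauchy-Schwarz, \<open>\<mu>(E)\<^sup>2\<close> is at most \<open>\<nu>(E)\<close> times the integral of \<open>1 / \<nu>\<close> over \<open>R\<close>, and the
\<open>A\<^sub>2\<close> condition bounds the latter by \<open>A \<mu>(R)\<^sup>2 / \<nu>(R)\<close>. Used for large parts of a cube and for a cube in its ball.\<close>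
lemma A2_subset:
  assumes [measurable]: "\<nu> \<in> borel_measurable M" and pos: "\<And>x. x \<in> space M \<Longrightarrow> 0 < \<nu> x"
    and [measurable]: "R \<in> sets M" "E \<in> sets M" and ER: "E \<subseteq> R"
    and mR: "0 < emeasure M R" "emeasure M R < top"
    and A2: "mass M \<nu> R * (\<integral>\<^sup>+x\<in>R. ennreal (1 / \<nu> x) \<partial>M) \<le> ennreal A * (emeasure M R * emeasure M R)"
    and le: "emeasure M R \<le> ennreal K * emeasure M E" and A: "0 \<le> A" and K: "0 \<le> K"
  shows "mass M \<nu> R \<le> ennreal (A * K\<^sup>2) * mass M \<nu> E"
proof -
  let ?m = "emeasure M R" and ?\<nu> = "\<lambda>E. \<integral>\<^sup>+x\<in>E. ennreal (\<nu> x) \<partial>M"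
  let ?n = "(\<integral>\<^sup>+x\<in>R. ennreal (1 / \<nu> x) \<partial>M)"
  have "emeasure M E = (\<integral>\<^sup>+x. indicator E x \<partial>M)" by simp
  also have "\<dots> = (\<integral>\<^sup>+x. epow (ennreal (\<nu> x) * indicator E x) (1/2) * epow (ennreal (1 / \<nu> x) * indicator E x) (1/2) \<partial>M)"
  proof (rule nn_integral_cong)
    fix x assume x: "x \<in> space M"
    then have "ennreal (\<nu> x) * ennreal (1 / \<nu> x) = 1"
      using pos[OF x] by (simp flip: ennreal_mult)
    then show "indicator E x = epow (ennreal (\<nu> x) * indicator E x) (1/2) * epow (ennreal (1 / \<nu> x) * indicator E x) (1/2)"
      by (auto simp: indicator_def simp flip: epow_mult)
  qed
  also have "\<dots> \<le> enorm M 2 (\<lambda>x. epow (ennreal (\<nu> x) * indicator E x) (1/2)) * enorm M 2 (\<lambda>x. epow (ennreal (1 / \<nu> x) * indicator E x) (1/2))"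
    by (rule Holder_nn_integral) auto
  also have "\<dots> = epow (?\<nu> E * (\<integral>\<^sup>+x\<in>E. ennreal (1 / \<nu> x) \<partial>M)) (1/2)"
    by (simp add: enorm_def epow_epow epow_mult)
  finally have "epow (emeasure M E) 2 \<le> ?\<nu> E * (\<integral>\<^sup>+x\<in>E. ennreal (1 / \<nu> x) \<partial>M)"
    by (simp add: epow_le_iff)
  also have "\<dots> \<le> ?\<nu> E * ?n"
    using ER by (intro mult_left_mono nn_integral_mono) (auto simp: indicator_def)
  finally have E2: "emeasure M E * emeasure M E \<le> ?\<nu> E * ?n" by (simp add: epow_2)
  have "?m * ?m * ?\<nu> R \<le> (ennreal K * emeasure M E) * (ennreal K * emeasure M E) * ?\<nu> R"
    by (intro mult_mono le) auto
  also have "\<dots> = ennreal (K\<^sup>2) * (emeasure M E * emeasure M E) * ?\<nu> R"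
    using K by (simp add: power2_eq_square ennreal_mult mult_ac)
  also have "\<dots> \<le> ennreal (K\<^sup>2) * (?\<nu> E * ?n) * ?\<nu> R" by (intro mult_mono E2) auto
  also have "\<dots> = ennreal (K\<^sup>2) * ?\<nu> E * (?\<nu> R * ?n)" by (simp add: mult_ac)
  also have "\<dots> \<le> ennreal (K\<^sup>2) * ?\<nu> E * (ennreal A * (?m * ?m))" by (intro mult_left_mono A2) auto
  also have "\<dots> = ?m * ?m * (ennreal (A * K\<^sup>2) * ?\<nu> E)"
    using A by (simp add: ennreal_mult mult_ac)
  finally show ?thesis using mR by (simp add: ennreal_mult_le_mult_iff ennreal_mult_eq_top_iff)
qed

text \<open>What is left of the generations of a dyadic system: a stopping condition has maximal cubes, and a proper subcube has a strictly
larger ancestor of comparable measure.\<close>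
locale dyadic_cubes = positive_cubes +
  fixes D :: real
  assumes between_finite: "P \<in> \<D> \<Longrightarrow> R \<in> \<D> \<Longrightarrow> finite {P'\<in>\<D>. P \<subseteq> P' \<and> P' \<subseteq> R}"
    and parent: "P \<in> \<D> \<Longrightarrow> R \<in> \<D> \<Longrightarrow> P \<subset> R \<Longrightarrow>
      \<exists>P'\<in>\<D>. P \<subset> P' \<and> P' \<subseteq> R \<and> emeasure M P' \<le> ennreal D * emeasure M P"
    and D_ge_1: "1 \<le> D"

text \<open>The oscillation of \<open>b\<close> is small compared with \<open>\<nu>\<close> on all but finitely many cubes, and every cube can be partitioned
into cubes on which it is small. The latter replaces the differentiation theorem, which may fail since the measure may live
on a larger \<open>\<sigma>\<close>-algebra than the one generated by the cubes.\<close>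
locale vanishing_oscillation = dyadic_cubes +
  fixes b :: "'a \<Rightarrow> 'k::{banach, second_countable_topology}" and \<nu> :: "'a \<Rightarrow> real" and A B :: real
  assumes b_measurable [measurable]: "b \<in> borel_measurable M"
    and b_integrable: "Q \<in> \<D> \<Longrightarrow> set_integrable M Q b"
    and \<nu>_measurable [measurable]: "\<nu> \<in> borel_measurable M"
    and \<nu>_pos: "x \<in> space M \<Longrightarrow> 0 < \<nu> x"
    and A_pos: "1 \<le> A"
    and \<nu>_A2: "Q \<in> \<D> \<Longrightarrow> mass M \<nu> Q * (\<integral>\<^sup>+x\<in>Q. ennreal (1 / \<nu> x) \<partial>M)
       \<le> ennreal A * (emeasure M Q * emeasure M Q)"
    and B_nonneg: "0 \<le> B"
    and bmo: "Q \<in> \<D> \<Longrightarrow> dev M b (avg M Q b) Q \<le> ennreal B * mass M \<nu> Q"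
    and vanish: "0 < \<epsilon> \<Longrightarrow> finite {Q\<in>\<D>. \<not> dev M b (avg M Q b) Q \<le> ennreal \<epsilon> * mass M \<nu> Q}"
    and fine: "0 < \<epsilon> \<Longrightarrow> R \<in> \<D> \<Longrightarrow> \<exists>\<P>\<subseteq>\<D>. disjoint \<P> \<and> \<Union>\<P> = R \<and>
      (\<forall>Q\<in>\<P>. dev M b (avg M Q b) Q \<le> ennreal \<epsilon> * mass M \<nu> Q)"
begin

abbreviation nu :: "'a set \<Rightarrow> ennreal" where "nu Q \<equiv> mass M \<nu> Q"
abbreviation bdev :: "'a set \<Rightarrow> ennreal" where "bdev Q \<equiv> dev M b (avg M Q b) Q"

lemma nu_inv_pos:
  assumes "Q \<in> \<D>"
  shows "mass M \<nu> Q \<noteq> 0" "(\<integral>\<^sup>+x\<in>Q. ennreal (1 / \<nu> x) \<partial>M) \<noteq> 0"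
  using \<nu>_pos cube_pos[OF assms] cube_sets[OF assms]
    set_nn_integral_pos[of \<nu> M Q] set_nn_integral_pos[of "\<lambda>x. 1 / \<nu> x" M Q]
  by auto

lemma nu_finite:
  assumes "Q \<in> \<D>"
  shows "mass M \<nu> Q < top" "(\<integral>\<^sup>+x\<in>Q. ennreal (1 / \<nu> x) \<partial>M) < top"
proof -
  have "mass M \<nu> Q * (\<integral>\<^sup>+x\<in>Q. ennreal (1 / \<nu> x) \<partial>M) < top"
    by (rule le_less_trans[OF \<nu>_A2[OF assms]]) (use cube_finite[OF assms] in \<open>auto simp: ennreal_mult_less_top\<close>)
  then show "mass M \<nu> Q < top" "(\<integral>\<^sup>+x\<in>Q. ennreal (1 / \<nu> x) \<partial>M) < top"
    using nu_inv_pos[OF assms] by (auto simp: ennreal_mult_less_top)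
qed

lemma bdev_finite: "Q \<in> \<D> \<Longrightarrow> bdev Q < top"
  using bmo[of Q] nu_finite(1)[of Q] B_nonneg by (auto simp: ennreal_mult_less_top intro: le_less_trans)

lemma nu_half:
  assumes "R \<in> \<D>" "E \<in> sets M" "E \<subseteq> R" "emeasure M R \<le> 2 * emeasure M E"
  shows "nu R \<le> ennreal (4 * A) * nu E"
  using A2_subset[of \<nu> M R E A 2] assms \<nu>_A2[OF assms(1)] \<nu>_pos cube_pos[OF assms(1)] cube_finite[OF assms(1)] A_pos
  by (simp add: mult.commute)

text \<open>Calderon-Zygmund decomposition of \<open>b\<close> on \<open>R\<close> at twice its mean oscillation. The jump of the averages is controlled by
the parent of a stopping cube, which is not a stopping cube. Off the stopping cubes, cut \<open>R\<close> into cubes on which \<open>b\<close> is nearly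
constant: those that meet the complement have averages below the threshold, so the part of \<open>|b - b\<^sub>R|\<close> above the threshold
has arbitrarily small integral.\<close>
lemma stopping_cubes:
  assumes R: "R \<in> \<D>"
  obtains \<C> where "\<C> \<subseteq> \<D>" "\<And>P. P \<in> \<C> \<Longrightarrow> P \<subset> R" "disjoint \<C>"
    "2 * emeasure M (\<Union>\<C>) \<le> emeasure M R"
    "\<And>P. P \<in> \<C> \<Longrightarrow> ennreal (norm (avg M P b - avg M R b)) \<le> 2 * ennreal D * (bdev R / emeasure M R)"
    "AE x in M. x \<in> R - \<Union>\<C> \<longrightarrow> ennreal (norm (b x - avg M R b)) \<le> 2 * (bdev R / emeasure M R)"
proof -
  note [measurable] = cube_sets[OF R]
  define \<Omega> where "\<Omega> = bdev R / emeasure M R"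
  let ?c = "avg M R b"
  have mR: "emeasure M R \<noteq> 0" "emeasure M R < top" using cube_pos[OF R] cube_finite[OF R] by auto
  have \<Omega>R: "\<Omega> * emeasure M R = bdev R"
    unfolding \<Omega>_def using mR by (simp add: ennreal_divide_times)
  have \<Omega>fin: "\<Omega> < top" using \<Omega>R bdev_finite[OF R] mR by (cases "\<Omega> = top") (auto simp: ennreal_top_mult less_top)
  \<comment> \<open>the factor 2 makes the stopping cubes fill at most half of \<open>R\<close>\<close>
  define stop where "stop P \<longleftrightarrow> P \<in> \<D> \<and> P \<subset> R \<and> 2 * \<Omega> * emeasure M P < dev M b ?c P" for P
  define \<C> where "\<C> = {P. stop P \<and> (\<forall>P'. stop P' \<longrightarrow> P \<subseteq> P' \<longrightarrow> P = P')}"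
  have nonstop: "dev M b ?c P \<le> 2 * \<Omega> * emeasure M P" if "P \<in> \<D>" "P \<subseteq> R" "\<not> stop P" for P
  proof (cases "P = R")
    case True
    have "dev M b ?c P = \<Omega> * emeasure M R" using \<Omega>R True by simp
    also have "\<dots> \<le> 2 * \<Omega> * emeasure M R"
      by (intro mult_right_mono) (auto simp: mult_2)
    finally show ?thesis using True by simp
  next
    case False
    then show ?thesis using that by (auto simp: stop_def)
  qed
  have maximal: "\<exists>P'\<in>\<C>. P \<subseteq> P'" if P: "stop P" for P
  proof -
    have PD: "P \<in> \<D>" "P \<subset> R" using P by (auto simp: stop_def)
    have "finite {P'. stop P' \<and> P \<subseteq> P'}"
      by (rule finite_subset[OF _ between_finite[OF PD(1) R]]) (auto simp: stop_def)
    from finite_has_maximal2[OF this, of P] P obtain P' where P': "stop P'" "P \<subseteq> P'"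
      "\<And>P''. stop P'' \<Longrightarrow> P \<subseteq> P'' \<Longrightarrow> P' \<subseteq> P'' \<Longrightarrow> P' = P''" by auto
    then have "P' \<in> \<C>" unfolding \<C>_def by blast
    with P' show ?thesis by blast
  qed
  have CD: "\<C> \<subseteq> \<D>" "\<And>P. P \<in> \<C> \<Longrightarrow> P \<subset> R" by (auto simp: \<C>_def stop_def)
  have disj: "disjoint \<C>"
    unfolding pairwise_def disjnt_def
  proof (intro ballI impI)
    fix P Q assume "P \<in> \<C>" "Q \<in> \<C>" "P \<noteq> Q"
    moreover from this have "P \<in> \<D>" "Q \<in> \<D>" using CD by auto
    ultimately show "P \<inter> Q = {}" using nested[of P Q] unfolding \<C>_def by blast
  qed
  have cC: "countable \<C>" using CD(1) countable_cubes by (rule countable_subset)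
  have sC: "\<C> \<subseteq> sets M" using CD(1) cubes_sets by auto
  have UC[measurable]: "\<Union>\<C> \<in> sets M" using cC sC by (rule sets.countable_Union) 
  have half: "2 * emeasure M (\<Union>\<C>) \<le> emeasure M R"
  proof (cases "\<Omega> = 0")
    case True
    have "dev M b ?c P = 0" if "P \<subset> R" for P
      using dev_mono[of P R M b ?c] that True \<Omega>R by auto
    then have "\<not> stop P" for P by (auto simp: stop_def)
    then have "\<C> = {}" by (auto simp: \<C>_def)
    then show ?thesis by simp
  next
    case False
    have "2 * \<Omega> * emeasure M (\<Union>\<C>) = (\<integral>\<^sup>+P. 2 * \<Omega> * emeasure M P \<partial>count_space \<C>)"
      using emeasure_Union_disjoint[OF disj cC sC] by (simp add: nn_integral_cmult)
    also have "\<dots> \<le> (\<integral>\<^sup>+P. dev M b ?c P \<partial>count_space \<C>)"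
      by (intro nn_integral_mono) (auto simp: \<C>_def stop_def less_imp_le)
    also have "\<dots> = dev M b ?c (\<Union>\<C>)"
      unfolding dev_def by (rule nn_integral_Union_disjoint[OF disj cC sC, symmetric]) measurable
    also have "\<dots> \<le> \<Omega> * emeasure M R" unfolding \<Omega>R using CD(2) by (intro dev_mono) auto
    finally have "\<Omega> * (2 * emeasure M (\<Union>\<C>)) \<le> \<Omega> * emeasure M R" by (simp add: mult_ac)
    then show ?thesis using False \<Omega>fin by (simp add: ennreal_mult_le_mult_iff)
  qed
  have child: "ennreal (norm (avg M P b - ?c)) \<le> 2 * ennreal D * \<Omega>" if P: "P \<in> \<C>" for P
  proof -
    have PD: "P \<in> \<D>" "P \<subset> R" using P CD by auto
    obtain P' where P': "P' \<in> \<D>" "P \<subset> P'" "P' \<subseteq> R" "emeasure M P' \<le> ennreal D * emeasure M P"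
      using parent[OF PD(1) R PD(2)] by blast
    have "\<not> stop P'" using P P'(2) unfolding \<C>_def by blast
    have mP: "emeasure M P \<noteq> 0" "emeasure M P < top" using cube_pos[OF PD(1)] cube_finite[OF PD(1)] by auto
    have "ennreal (norm (avg M P b - ?c)) * emeasure M P \<le> dev M b ?c P"
      using PD mP by (intro avg_dist_le_dev b_integrable cube_sets) (auto simp: zero_less_iff_neq_zero)
    also have "\<dots> \<le> dev M b ?c P'" using P' by (intro dev_mono) auto
    also have "\<dots> \<le> 2 * \<Omega> * emeasure M P'" using nonstop P' \<open>\<not> stop P'\<close> by auto
    also have "\<dots> \<le> 2 * \<Omega> * (ennreal D * emeasure M P)" by (intro mult_left_mono P') auto
    finally have "emeasure M P * ennreal (norm (avg M P b - ?c)) \<le> emeasure M P * (2 * ennreal D * \<Omega>)"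
      by (simp add: mult_ac)
    then show ?thesis using mP by (simp add: ennreal_mult_le_mult_iff)
  qed
  have ae: "AE x in M. x \<in> R - \<Union>\<C> \<longrightarrow> ennreal (norm (b x - ?c)) \<le> 2 * \<Omega>"
  proof -
    let ?E = "R - \<Union>\<C>"
    \<comment> \<open>truncated subtraction: the excess over the threshold\<close>
    let ?u = "\<lambda>x. ennreal (norm (b x - ?c)) - 2 * \<Omega>"
    have "(\<integral>\<^sup>+x\<in>?E. ?u x \<partial>M) \<le> ennreal \<epsilon> * nu R" if \<epsilon>: "0 < \<epsilon>" for \<epsilon>
    proof -
      obtain \<P> where P: "\<P> \<subseteq> \<D>" "disjoint \<P>" "\<Union>\<P> = R" "\<And>Q. Q \<in> \<P> \<Longrightarrow> bdev Q \<le> ennreal \<epsilon> * nu Q"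
        using fine[OF \<epsilon> R] by blast
      have cP: "countable \<P>" using P(1) countable_cubes by (rule countable_subset)
      have sP: "\<P> \<subseteq> sets M" using P(1) cubes_sets by auto
      have "(\<integral>\<^sup>+x\<in>?E. ?u x \<partial>M) = (\<integral>\<^sup>+x\<in>\<Union>\<P>. ?u x * indicator ?E x \<partial>M)"
        unfolding P(3) by (intro nn_integral_cong) (auto simp: indicator_def)
      also have "\<dots> = (\<integral>\<^sup>+Q. (\<integral>\<^sup>+x\<in>Q. ?u x * indicator ?E x \<partial>M) \<partial>count_space \<P>)"
        by (rule nn_integral_Union_disjoint[OF P(2) cP sP]) measurable
      also have "\<dots> \<le> (\<integral>\<^sup>+Q. ennreal \<epsilon> * nu Q \<partial>count_space \<P>)"
      proof (rule nn_integral_mono)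
        fix Q assume "Q \<in> space (count_space \<P>)"
        then have Q: "Q \<in> \<P>" "Q \<in> \<D>" "Q \<subseteq> R" using P by auto
        show "(\<integral>\<^sup>+x\<in>Q. ?u x * indicator ?E x \<partial>M) \<le> ennreal \<epsilon> * nu Q"
        proof (cases "stop Q")
          case True
          then obtain P' where "P' \<in> \<C>" "Q \<subseteq> P'" using maximal by blast
          then have "(\<integral>\<^sup>+x\<in>Q. ?u x * indicator ?E x \<partial>M) = (\<integral>\<^sup>+x. 0 \<partial>M)"
            by (intro nn_integral_cong) (auto simp: indicator_def)
          then show ?thesis by simp
        next
          case False
          have mQ: "emeasure M Q \<noteq> 0" "emeasure M Q < top" using cube_pos[OF Q(2)] cube_finite[OF Q(2)] by auto
          have "ennreal (norm (avg M Q b - ?c)) * emeasure M Q \<le> dev M b ?c Q"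
            using Q mQ by (intro avg_dist_le_dev b_integrable cube_sets) (auto simp: zero_less_iff_neq_zero)
          also have "\<dots> \<le> 2 * \<Omega> * emeasure M Q" using nonstop[OF Q(2,3) False] .
          finally have le: "ennreal (norm (avg M Q b - ?c)) \<le> 2 * \<Omega>"
            using mQ ennreal_mult_le_mult_iff[of "emeasure M Q"] by (simp add: mult.commute)
          have u: "?u x \<le> ennreal (norm (b x - avg M Q b))" for x
          proof -
            have "ennreal (norm (b x - ?c)) \<le> ennreal (norm (b x - avg M Q b)) + ennreal (norm (avg M Q b - ?c))"
              using norm_triangle_ineq[of "b x - avg M Q b" "avg M Q b - ?c"] by (simp flip: ennreal_plus)
            also have "\<dots> \<le> 2 * \<Omega> + ennreal (norm (b x - avg M Q b))" using le by (subst add.commute) (intro add_right_mono)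
            finally show ?thesis by (simp add: ennreal_minus_le_iff)
          qed
          have "(\<integral>\<^sup>+x\<in>Q. ?u x * indicator ?E x \<partial>M) \<le> bdev Q"
            unfolding dev_def using u by (intro nn_integral_mono) (auto simp: indicator_def)
          also have "\<dots> \<le> ennreal \<epsilon> * nu Q" by (rule P(4)[OF Q(1)])
          finally show ?thesis .
        qed
      qed
      also have "\<dots> = ennreal \<epsilon> * nu R"
        using nn_integral_Union_disjoint[OF P(2) cP sP, of "\<lambda>x. ennreal (\<nu> x)"] P(3) by (simp add: nn_integral_cmult)
      finally show ?thesis .
    qed
    note small = this
    have "(\<integral>\<^sup>+x\<in>?E. ?u x \<partial>M) \<le> 0 + ennreal e" if "0 < e" for e
    proof -
      obtain n where n: "nu R = ennreal n" "0 < n"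
        using nu_finite(1)[OF R] nu_inv_pos(1)[OF R] by (cases "nu R") (auto simp: less_le)
      have "(\<integral>\<^sup>+x\<in>?E. ?u x \<partial>M) \<le> ennreal (e / n) * nu R"
        by (rule small) (use that n in auto)
      also have "\<dots> = ennreal (e / n * n)"
        unfolding n(1) using that n by (intro ennreal_mult'[symmetric]) auto
      also have "e / n * n = e" using n by simp
      finally show ?thesis by simp
    qed
    note eps = this
    have "(\<integral>\<^sup>+x\<in>?E. ?u x \<partial>M) \<le> 0"
      by (rule ennreal_le_epsilon) (rule eps)
    then have "(\<integral>\<^sup>+x\<in>?E. ?u x \<partial>M) = 0" by (rule order_antisym) (rule zero_le)
    moreover have "(\<lambda>x. ?u x * indicator ?E x) \<in> borel_measurable M" by measurable
    ultimately have "AE x in M. ?u x * indicator ?E x = 0"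
      using nn_integral_0_iff_AE by blast
    then show ?thesis
      by eventually_elim (auto simp: indicator_def diff_eq_0_iff_ennreal split: if_splits)
  qed
  show ?thesis
    using that[OF CD disj half child[unfolded \<Omega>_def] ae[unfolded \<Omega>_def]] by blast
qed

text \<open>On \<open>R\<close>, replacing \<open>b\<^sub>R\<close> by \<open>b\<^sub>P\<close> on each stopping cube \<open>P\<close> costs the mean oscillation times \<open>\<integral>\<^sub>R h\<close>, that is the
oscillation times the average of \<open>h\<close>, which is bounded by an integral of \<open>\<nu> M h\<close> over the part \<open>E\<close> of \<open>R\<close> outside the
stopping cubes. These parts are disjoint, so the main terms of successive steps add up to one integral over \<open>R\<close>. The
remainder after \<open>n\<close> steps lives on cubes whose \<open>\<nu>\<close>-mass has shrunk by \<open>1 - 1 / (4 A)\<close> each time.\<close>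
lemma oscillation_pairing_step:
  assumes R: "R \<in> \<D>" and \<epsilon>: "0 < \<epsilon>" and h[measurable]: "h \<in> borel_measurable M" "\<And>x. h x \<le> ennreal m" "0 \<le> m"
  defines "\<F> \<equiv> {Q\<in>\<D>. \<not> bdev Q \<le> ennreal \<epsilon> * nu Q}"
  defines "wt \<equiv> \<lambda>R x. ennreal \<epsilon> + (\<Sum>R'\<in>{R'\<in>\<F>. R' \<subseteq> R}. ennreal B * indicator R' x)"
  defines "\<Psi> \<equiv> \<lambda>R. ennreal (8 * A * D) * (\<integral>\<^sup>+x\<in>R. wt R x * (ennreal (\<nu> x) * dmax M \<D> h x) \<partial>M)"
  shows "(\<integral>\<^sup>+x\<in>R. ennreal (norm (b x - avg M R b)) * h x \<partial>M) \<le> \<Psi> R + ennreal ((1 - 1 / (4 * A)) ^ n * (B * m)) * nu R"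
  using R
proof (induction n arbitrary: R)
  case 0
  note [measurable] = cube_sets[OF 0]
  have "(\<integral>\<^sup>+x\<in>R. ennreal (norm (b x - avg M R b)) * h x \<partial>M) \<le> (\<integral>\<^sup>+x. ennreal m * (ennreal (norm (b x - avg M R b)) * indicator R x) \<partial>M)"
    using h(2) by (intro nn_integral_mono) (auto simp: indicator_def mult.commute[of _ "h _"] intro: mult_right_mono)
  also have "\<dots> = ennreal m * bdev R" by (simp add: nn_integral_cmult dev_def)
  also have "\<dots> \<le> ennreal m * (ennreal B * nu R)" by (intro mult_left_mono bmo 0) auto
  also have "\<dots> = ennreal (B * m) * nu R" using B_nonneg h(3) by (simp add: ennreal_mult mult_ac)
  finally show ?case by (simp add: add_increasing)
next
  case (Suc n)
  note R = Suc.prems and [measurable] = cube_sets[OF Suc.prems]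
  let ?\<theta> = "1 - 1 / (4 * A)" and ?K = "ennreal (8 * A * D)"
  let ?g = "\<lambda>x. ennreal (norm (b x - avg M R b)) * h x"
  have \<theta>: "0 \<le> ?\<theta>" using A_pos by (simp add: field_simps)
  have fin\<F>: "finite \<F>" unfolding \<F>_def by (rule vanish[OF \<epsilon>])
  have \<F>D: "\<F> \<subseteq> \<D>" by (auto simp: \<F>_def)
  have [measurable]: "(\<lambda>x. wt R x) \<in> borel_measurable M" for R
    unfolding wt_def using \<F>D by (intro borel_measurable_add borel_measurable_sum) auto
  define \<Omega> where "\<Omega> = bdev R / emeasure M R"
  obtain \<C> where C: "\<C> \<subseteq> \<D>" "\<And>P. P \<in> \<C> \<Longrightarrow> P \<subset> R" "disjoint \<C>"
    "2 * emeasure M (\<Union>\<C>) \<le> emeasure M R"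
    "\<And>P. P \<in> \<C> \<Longrightarrow> ennreal (norm (avg M P b - avg M R b)) \<le> 2 * ennreal D * \<Omega>"
    "AE x in M. x \<in> R - \<Union>\<C> \<longrightarrow> ennreal (norm (b x - avg M R b)) \<le> 2 * \<Omega>"
    using stopping_cubes[OF R] unfolding \<Omega>_def by blast
  have cC: "countable \<C>" using C(1) countable_cubes by (rule countable_subset)
  have sC: "\<C> \<subseteq> sets M" using C(1) cubes_sets by auto
  have UC[measurable]: "\<Union>\<C> \<in> sets M" using cC sC by (rule sets.countable_Union)
  have UR: "\<Union>\<C> \<subseteq> R" using C(2) by auto
  define E where "E = R - \<Union>\<C>"
  have [measurable]: "E \<in> sets M" unfolding E_def by measurable
  have split: "(\<integral>\<^sup>+x\<in>R. f x \<partial>M) = (\<integral>\<^sup>+x\<in>E. f x \<partial>M) + (\<integral>\<^sup>+x\<in>\<Union>\<C>. f x \<partial>M)" if [measurable]: "f \<in> borel_measurable M" for f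
  proof -
    have "(\<integral>\<^sup>+x\<in>R. f x \<partial>M) = (\<integral>\<^sup>+x. f x * indicator E x + f x * indicator (\<Union>\<C>) x \<partial>M)"
      using UR by (intro nn_integral_cong) (auto simp: indicator_def E_def)
    then show ?thesis by (simp add: nn_integral_add)
  qed
  have half: "emeasure M R \<le> 2 * emeasure M E"
  proof -
    have "emeasure M R = emeasure M E + emeasure M (\<Union>\<C>)"
      using split[of "\<lambda>_. 1"] by simp
    then have "emeasure M R + emeasure M R = 2 * emeasure M E + 2 * emeasure M (\<Union>\<C>)"
      by (simp add: mult_2 add_ac)
    also have "\<dots> \<le> 2 * emeasure M E + emeasure M R" using C(4) by (intro add_left_mono)
    finally have "emeasure M R + emeasure M R \<le> emeasure M R + 2 * emeasure M E" by (simp add: add.commute)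
    then show ?thesis using cube_finite[OF R] by (auto simp: ennreal_add_left_cancel_le)
  qed
  \<comment> \<open>at least half of the measure of \<open>R\<close> is outside the stopping cubes, hence a fixed part of its \<open>\<nu>\<close>-mass\<close>
  have nuE: "nu R \<le> ennreal (4 * A) * nu E"
    by (rule nu_half[OF R _ _ half]) (auto simp: E_def)
  have nuC: "nu (\<Union>\<C>) \<le> ennreal ?\<theta> * nu R"
  proof -
    have sum: "nu R = nu E + nu (\<Union>\<C>)" by (rule split) auto
    have fin: "nu R < top" "nu E < top" "nu (\<Union>\<C>) < top" using nu_finite(1)[OF R] sum by auto
    obtain r where r: "nu R = ennreal r" "0 \<le> r" using fin(1) by (cases "nu R") auto
    obtain e where e: "nu E = ennreal e" "0 \<le> e" using fin(2) by (cases "nu E") auto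
    obtain c where c: "nu (\<Union>\<C>) = ennreal c" "0 \<le> c" using fin(3) by (cases "nu (\<Union>\<C>)") auto
    note rec = r e c
    have "r = e + c" using sum rec by (simp flip: ennreal_plus)
    moreover have "r \<le> 4 * A * e" using nuE rec A_pos by (simp flip: ennreal_mult)
    ultimately have "c \<le> ?\<theta> * r" using A_pos by (simp add: field_simps)
    then show ?thesis using rec \<theta> by (simp flip: ennreal_mult)
  qed
  have onE: "(\<integral>\<^sup>+x\<in>E. ?g x \<partial>M) \<le> 2 * ennreal D * \<Omega> * (\<integral>\<^sup>+x\<in>E. h x \<partial>M)"
  proof -
    have "AE x in M. ?g x * indicator E x \<le> 2 * ennreal D * \<Omega> * (h x * indicator E x)"
      using C(6)
    proof eventually_elim
      case (elim x)
      have "1 \<le> ennreal D" using D_ge_1 ennreal_leI[of 1 D] by simp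
      then have "1 * (2 * \<Omega>) \<le> ennreal D * (2 * \<Omega>)" by (rule mult_right_mono) simp
      then have "2 * \<Omega> \<le> 2 * ennreal D * \<Omega>" by (simp add: mult_ac)
      then have "ennreal (norm (b x - avg M R b)) \<le> 2 * ennreal D * \<Omega>" if "x \<in> E"
        using elim that by (auto simp: E_def)
      then show ?case by (auto simp: indicator_def intro: mult_right_mono)
    qed
    then have "(\<integral>\<^sup>+x\<in>E. ?g x \<partial>M) \<le> (\<integral>\<^sup>+x. 2 * ennreal D * \<Omega> * (h x * indicator E x) \<partial>M)"
      by (rule nn_integral_mono_AE)
    then show ?thesis by (simp add: nn_integral_cmult)
  qed
  have onP: "(\<integral>\<^sup>+x\<in>P. ?g x \<partial>M) \<le> \<Psi> P + ennreal (?\<theta> ^ n * (B * m)) * nu P + 2 * ennreal D * \<Omega> * (\<integral>\<^sup>+x\<in>P. h x \<partial>M)"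
    if P: "P \<in> \<C>" for P
  proof -
    have PD: "P \<in> \<D>" using P C by auto
    note [measurable] = cube_sets[OF PD]
    have "(\<integral>\<^sup>+x\<in>P. ?g x \<partial>M) \<le> (\<integral>\<^sup>+x. ennreal (norm (b x - avg M P b)) * h x * indicator P x + 2 * ennreal D * \<Omega> * (h x * indicator P x) \<partial>M)"
    proof (rule nn_integral_mono)
      fix x
      have "ennreal (norm (b x - avg M R b)) \<le> ennreal (norm (b x - avg M P b)) + ennreal (norm (avg M P b - avg M R b))"
        using norm_triangle_ineq[of "b x - avg M P b" "avg M P b - avg M R b"] by (simp flip: ennreal_plus)
      also have "\<dots> \<le> ennreal (norm (b x - avg M P b)) + 2 * ennreal D * \<Omega>" by (intro add_left_mono C P)
      finally have "ennreal (norm (b x - avg M R b)) * (h x * indicator P x) \<le>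
          (ennreal (norm (b x - avg M P b)) + 2 * ennreal D * \<Omega>) * (h x * indicator P x)"
        by (rule mult_right_mono) simp
      then show "?g x * indicator P x \<le> ennreal (norm (b x - avg M P b)) * h x * indicator P x + 2 * ennreal D * \<Omega> * (h x * indicator P x)"
        by (simp only: distrib_right mult.assoc)
    qed
    also have "\<dots> = (\<integral>\<^sup>+x\<in>P. ennreal (norm (b x - avg M P b)) * h x \<partial>M) + 2 * ennreal D * \<Omega> * (\<integral>\<^sup>+x\<in>P. h x \<partial>M)"
      by (subst nn_integral_add) (auto simp: nn_integral_cmult)
    also have "\<dots> \<le> (\<Psi> P + ennreal (?\<theta> ^ n * (B * m)) * nu P) + 2 * ennreal D * \<Omega> * (\<integral>\<^sup>+x\<in>P. h x \<partial>M)"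
      by (intro add_right_mono Suc.IH PD)
    finally show ?thesis .
  qed
  let ?w = "\<lambda>x. wt R x * (ennreal (\<nu> x) * dmax M \<D> h x)"
  have \<Psi>P: "\<Psi> P \<le> ?K * (\<integral>\<^sup>+x\<in>P. ?w x \<partial>M)" if P: "P \<in> \<C>" for P
  proof -
    have "wt P x \<le> wt R x" for x
      unfolding wt_def using fin\<F> C(2)[OF P]
      by (intro add_left_mono sum_mono2) auto
    then show ?thesis unfolding \<Psi>_def
      by (intro mult_left_mono nn_integral_mono mult_right_mono) auto
  qed
  have "(\<integral>\<^sup>+x\<in>\<Union>\<C>. ?g x \<partial>M) = (\<integral>\<^sup>+P. (\<integral>\<^sup>+x\<in>P. ?g x \<partial>M) \<partial>count_space \<C>)"
    by (rule nn_integral_Union_disjoint[OF C(3) cC sC]) measurable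
  also have "\<dots> \<le> (\<integral>\<^sup>+P. ?K * (\<integral>\<^sup>+x\<in>P. ?w x \<partial>M) + ennreal (?\<theta> ^ n * (B * m)) * nu P + 2 * ennreal D * \<Omega> * (\<integral>\<^sup>+x\<in>P. h x \<partial>M) \<partial>count_space \<C>)"
    by (intro nn_integral_mono order_trans[OF onP] add_right_mono \<Psi>P) auto
  also have "\<dots> = ?K * (\<integral>\<^sup>+x\<in>\<Union>\<C>. ?w x \<partial>M) + ennreal (?\<theta> ^ n * (B * m)) * nu (\<Union>\<C>) + 2 * ennreal D * \<Omega> * (\<integral>\<^sup>+x\<in>\<Union>\<C>. h x \<partial>M)"
    by (simp add: nn_integral_add nn_integral_cmult nn_integral_Union_disjoint[OF C(3) cC sC])
  also have "\<dots> \<le> ?K * (\<integral>\<^sup>+x\<in>\<Union>\<C>. ?w x \<partial>M) + ennreal (?\<theta> ^ n * (B * m)) * (ennreal ?\<theta> * nu R) + 2 * ennreal D * \<Omega> * (\<integral>\<^sup>+x\<in>\<Union>\<C>. h x \<partial>M)"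
    by (intro add_mono mult_left_mono nuC) auto
  also have "ennreal (?\<theta> ^ n * (B * m)) * (ennreal ?\<theta> * nu R) = ennreal (?\<theta> ^ Suc n * (B * m)) * nu R"
    using \<theta> B_nonneg h(3) by (simp add: ennreal_mult mult_ac del: right_diff_distrib left_diff_distrib)
  finally have onC: "(\<integral>\<^sup>+x\<in>\<Union>\<C>. ?g x \<partial>M) \<le> ?K * (\<integral>\<^sup>+x\<in>\<Union>\<C>. ?w x \<partial>M) + ennreal (?\<theta> ^ Suc n * (B * m)) * nu R + 2 * ennreal D * \<Omega> * (\<integral>\<^sup>+x\<in>\<Union>\<C>. h x \<partial>M)" .
  have main: "2 * ennreal D * \<Omega> * (\<integral>\<^sup>+x\<in>R. h x \<partial>M) \<le> ?K * (\<integral>\<^sup>+x\<in>E. ?w x \<partial>M)"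
  proof -
    \<comment> \<open>the oscillation on \<open>R\<close> is at most \<open>a\<close> times \<open>\<nu>(R)\<close>, and \<open>a\<close> is below the weight function on all of \<open>R\<close>\<close>
    define a where "a = (if R \<in> \<F> then ennreal B else ennreal \<epsilon>)"
    have a: "bdev R \<le> a * nu R" using bmo[OF R] R by (auto simp: a_def \<F>_def)
    have aw: "a \<le> wt R x" if "x \<in> R" for x
    proof (cases "R \<in> \<F>")
      case True
      have "ennreal B * indicator R x \<le> (\<Sum>R'\<in>{R'\<in>\<F>. R' \<subseteq> R}. ennreal B * indicator R' x)"
        using fin\<F> True by (intro member_le_sum) auto
      then show ?thesis using True that by (auto simp: wt_def a_def intro: add_increasing)
    qed (auto simp: wt_def a_def)
    have "2 * ennreal D * \<Omega> * (\<integral>\<^sup>+x\<in>R. h x \<partial>M) = 2 * ennreal D * (bdev R * eavg M h R)"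
      unfolding \<Omega>_def eavg_def by (simp add: ennreal_divide_times mult.assoc)
    also have "\<dots> \<le> 2 * ennreal D * ((a * (ennreal (4 * A) * nu E)) * eavg M h R)"
      by (intro mult_left_mono mult_right_mono order_trans[OF a] nuE) auto
    also have "\<dots> = ?K * (a * (nu E * eavg M h R))"
    proof -
      have "?K = 2 * ennreal D * ennreal (4 * A)" using A_pos D_ge_1 by (simp add: ennreal_mult mult_ac)
      then show ?thesis by (simp only: mult_ac)
    qed
    also have "a * (nu E * eavg M h R) = (\<integral>\<^sup>+x. a * (ennreal (\<nu> x) * eavg M h R) * indicator E x \<partial>M)"
    proof -
      have "(\<integral>\<^sup>+x. a * (ennreal (\<nu> x) * eavg M h R) * indicator E x \<partial>M) = (\<integral>\<^sup>+x. (a * eavg M h R) * (ennreal (\<nu> x) * indicator E x) \<partial>M)"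
        by (simp only: mult_ac)
      also have "\<dots> = (a * eavg M h R) * nu E" by (rule nn_integral_cmult) auto
      finally show ?thesis by (simp only: mult_ac)
    qed
    also have "\<dots> \<le> (\<integral>\<^sup>+x\<in>E. ?w x \<partial>M)"
    proof (rule nn_integral_mono)
      fix x
      have "a * (ennreal (\<nu> x) * eavg M h R) \<le> ?w x" if "x \<in> E"
        using that R by (intro mult_mono aw eavg_le_dmax) (auto simp: E_def)
      then show "a * (ennreal (\<nu> x) * eavg M h R) * indicator E x \<le> ?w x * indicator E x"
        by (auto simp: indicator_def)
    qed
    finally show ?thesis by (simp add: mult_left_mono)
  qed
  have "(\<integral>\<^sup>+x\<in>R. ?g x \<partial>M) = (\<integral>\<^sup>+x\<in>E. ?g x \<partial>M) + (\<integral>\<^sup>+x\<in>\<Union>\<C>. ?g x \<partial>M)" by (rule split) measurable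
  also have "\<dots> \<le> 2 * ennreal D * \<Omega> * (\<integral>\<^sup>+x\<in>E. h x \<partial>M) + (?K * (\<integral>\<^sup>+x\<in>\<Union>\<C>. ?w x \<partial>M) + ennreal (?\<theta> ^ Suc n * (B * m)) * nu R + 2 * ennreal D * \<Omega> * (\<integral>\<^sup>+x\<in>\<Union>\<C>. h x \<partial>M))"
    by (intro add_mono onE onC)
  also have "\<dots> = 2 * ennreal D * \<Omega> * (\<integral>\<^sup>+x\<in>R. h x \<partial>M) + ?K * (\<integral>\<^sup>+x\<in>\<Union>\<C>. ?w x \<partial>M) + ennreal (?\<theta> ^ Suc n * (B * m)) * nu R"
    by (simp add: split[OF h(1)] distrib_left add_ac)
  also have "\<dots> \<le> ?K * (\<integral>\<^sup>+x\<in>E. ?w x \<partial>M) + ?K * (\<integral>\<^sup>+x\<in>\<Union>\<C>. ?w x \<partial>M) + ennreal (?\<theta> ^ Suc n * (B * m)) * nu R"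
    by (intro add_right_mono main)
  also have "\<dots> = \<Psi> R + ennreal (?\<theta> ^ Suc n * (B * m)) * nu R"
    unfolding \<Psi>_def by (subst split) (auto simp: distrib_left)
  finally show ?case .
qed

text \<open>For bounded \<open>h\<close> the remainder in \<open>oscillation_pairing_step\<close> tends to zero; the general case follows by monotone
convergence.\<close>
lemma oscillation_pairing:
  assumes Q: "Q \<in> \<D>" and \<epsilon>: "0 < \<epsilon>" and h[measurable]: "h \<in> borel_measurable M"
  shows "(\<integral>\<^sup>+x\<in>Q. ennreal (norm (b x - avg M Q b)) * h x \<partial>M) \<le>
    ennreal (8 * A * D) * (ennreal \<epsilon> * (\<integral>\<^sup>+x\<in>Q. ennreal (\<nu> x) * dmax M \<D> h x \<partial>M) +
      ennreal B * (\<Sum>R\<in>{R\<in>\<D>. \<not> bdev R \<le> ennreal \<epsilon> * nu R \<and> R \<subseteq> Q}. \<integral>\<^sup>+x\<in>R. ennreal (\<nu> x) * dmax M \<D> h x \<partial>M))"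
proof -
  note [measurable] = cube_sets[OF Q]
  let ?\<theta> = "1 - 1 / (4 * A)" and ?K = "ennreal (8 * A * D)"
  define \<F> where "\<F> = {Q\<in>\<D>. \<not> bdev Q \<le> ennreal \<epsilon> * nu Q}"
  define wt where "wt x = ennreal \<epsilon> + (\<Sum>R'\<in>{R'\<in>\<F>. R' \<subseteq> Q}. ennreal B * indicator R' x)" for x
  have [measurable]: "wt \<in> borel_measurable M"
    unfolding wt_def[abs_def] \<F>_def by (intro borel_measurable_add borel_measurable_sum) auto
  have \<theta>: "0 \<le> ?\<theta>" "?\<theta> < 1" using A_pos by (auto simp: field_simps)
  define H where "H j x = min (h x) (ennreal (real j))" for j :: nat and x
  have [measurable]: "H j \<in> borel_measurable M" for j unfolding H_def[abs_def] by measurable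
  have Hle: "H j x \<le> h x" for j x by (simp add: H_def)
  let ?T = "?K * (\<integral>\<^sup>+x\<in>Q. wt x * (ennreal (\<nu> x) * dmax M \<D> h x) \<partial>M)"
  have bound: "(\<integral>\<^sup>+x\<in>Q. ennreal (norm (b x - avg M Q b)) * H j x \<partial>M) \<le> ?T" for j
  proof -
    obtain v where v: "nu Q = ennreal v" "0 \<le> v" using nu_finite(1)[OF Q] by (cases "nu Q") auto
    have step: "(\<integral>\<^sup>+x\<in>Q. ennreal (norm (b x - avg M Q b)) * H j x \<partial>M) \<le>
        ?T + ennreal (?\<theta> ^ n * (B * real j) * v)" for n
    proof -
      have "(\<integral>\<^sup>+x\<in>Q. ennreal (norm (b x - avg M Q b)) * H j x \<partial>M) \<le>
        ?K * (\<integral>\<^sup>+x\<in>Q. wt x * (ennreal (\<nu> x) * dmax M \<D> (H j) x) \<partial>M) + ennreal (?\<theta> ^ n * (B * real j)) * nu Q"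
        unfolding wt_def \<F>_def
        by (rule oscillation_pairing_step[OF Q \<epsilon>]) (auto simp: H_def)
      also have "\<dots> \<le> ?T + ennreal (?\<theta> ^ n * (B * real j)) * nu Q"
        by (intro add_right_mono mult_left_mono nn_integral_mono mult_right_mono dmax_mono) (auto simp: Hle)
      finally show ?thesis using v \<theta>(1) B_nonneg by (simp add: ennreal_mult'' del: right_diff_distrib left_diff_distrib)
    qed
    have "(\<lambda>n. ?\<theta> ^ n * (B * real j) * v) \<longlonglongrightarrow> 0 * (B * real j) * v"
      using \<theta> by (intro tendsto_mult tendsto_const LIMSEQ_realpow_zero)
    then have "(\<lambda>n. ?T + ennreal (?\<theta> ^ n * (B * real j) * v)) \<longlonglongrightarrow> ?T + ennreal 0"
      by (intro tendsto_add tendsto_const tendsto_ennrealI) simp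
    then show ?thesis using step by (intro LIMSEQ_le_const[where X = "\<lambda>n. ?T + ennreal (?\<theta> ^ n * (B * real j) * v)"]) auto
  qed
  have Hinc: "incseq H"
    by (auto simp: incseq_def le_fun_def H_def min_def intro: order_trans ennreal_leI)
  have Hsup: "(SUP j. H j x) = h x" for x
  proof (rule antisym)
    show "h x \<le> (SUP j. H j x)"
    proof (rule dense_le)
      fix y assume y: "y < h x"
      then have "y < top" by (meson less_le_trans top_greatest)
      then obtain n where "y < of_nat n" using ennreal_Ex_less_of_nat[of y] by (auto simp: less_top)
      then have "y \<le> H n x" using y by (auto simp: H_def ennreal_of_nat_eq_real_of_nat)
      then show "y \<le> (SUP j. H j x)" by (meson SUP_upper2 UNIV_I)
    qed
  qed (auto intro: SUP_least Hle)
  have "(\<integral>\<^sup>+x\<in>Q. ennreal (norm (b x - avg M Q b)) * h x \<partial>M) =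
      (\<integral>\<^sup>+x. (SUP j. ennreal (norm (b x - avg M Q b)) * H j x * indicator Q x) \<partial>M)"
    by (simp add: Hsup flip: SUP_mult_left_ennreal SUP_mult_right_ennreal)
  also have "\<dots> = (SUP j. \<integral>\<^sup>+x\<in>Q. ennreal (norm (b x - avg M Q b)) * H j x \<partial>M)"
    using Hinc by (intro nn_integral_monotone_convergence_SUP)
      (auto simp: incseq_def le_fun_def intro!: mult_right_mono mult_left_mono)
  also have "\<dots> \<le> ?T" by (intro SUP_least bound)
  also have "(\<integral>\<^sup>+x\<in>Q. wt x * (ennreal (\<nu> x) * dmax M \<D> h x) \<partial>M) =
     (\<integral>\<^sup>+x. ennreal \<epsilon> * (ennreal (\<nu> x) * dmax M \<D> h x * indicator Q x) +
       (\<Sum>R\<in>{R\<in>\<F>. R \<subseteq> Q}. ennreal B * (ennreal (\<nu> x) * dmax M \<D> h x * indicator R x)) \<partial>M)"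
  proof (rule nn_integral_cong)
    fix x
    let ?y = "ennreal (\<nu> x) * dmax M \<D> h x"
    have "indicator R x * indicator Q x = (indicator R x :: ennreal)" if "R \<subseteq> Q" for R
      using that by (auto simp: indicator_def)
    then have "(\<Sum>R\<in>{R\<in>\<F>. R \<subseteq> Q}. ennreal B * indicator R x) * ?y * indicator Q x =
        (\<Sum>R\<in>{R\<in>\<F>. R \<subseteq> Q}. ennreal B * (?y * indicator R x))"
      unfolding sum_distrib_right by (intro sum.cong) (auto simp: indicator_def mult_ac)
    then show "wt x * ?y * indicator Q x = ennreal \<epsilon> * (?y * indicator Q x) + (\<Sum>R\<in>{R\<in>\<F>. R \<subseteq> Q}. ennreal B * (?y * indicator R x))"
      unfolding wt_def by (simp add: distrib_right mult.assoc)
  qed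
  also have "\<dots> = ennreal \<epsilon> * (\<integral>\<^sup>+x\<in>Q. ennreal (\<nu> x) * dmax M \<D> h x \<partial>M) +
      (\<Sum>R\<in>{R\<in>\<F>. R \<subseteq> Q}. ennreal B * (\<integral>\<^sup>+x\<in>R. ennreal (\<nu> x) * dmax M \<D> h x \<partial>M))"
  proof -
    have [measurable]: "R \<in> sets M" if "R \<in> {R\<in>\<F>. R \<subseteq> Q}" for R using that by (auto simp: \<F>_def)
    show ?thesis
      by (subst nn_integral_add) (auto simp: nn_integral_cmult nn_integral_sum)
  qed
  finally show ?thesis
    by (simp add: sum_distrib_left \<F>_def conj_assoc)
qed

end

section \<open>The sparse form with oscillation\<close>

lemma ennreal_small_multiple:
  fixes c :: ennreal
  assumes "c < top" "0 < \<delta>"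
  obtains \<epsilon> :: real where "0 < \<epsilon>" "c * ennreal \<epsilon> \<le> ennreal \<delta>"
proof -
  obtain r where r: "c = ennreal r" "0 \<le> r" using assms(1) by (cases c) auto
  have "r * (\<delta> / (r + 1)) \<le> \<delta>" using r assms(2) by (simp add: field_simps)
  then show ?thesis using that[of "\<delta> / (r + 1)"] r assms(2) by (simp flip: ennreal_mult)
qed

lemma nn_integral_count_space_subset:
  assumes "T \<subseteq> S"
  shows "(\<integral>\<^sup>+Q. g Q \<partial>count_space T) = (\<integral>\<^sup>+Q. g Q * indicator T Q \<partial>count_space S)"
proof -
  have "(\<integral>\<^sup>+Q. g Q * indicator T Q \<partial>count_space S) = (\<integral>\<^sup>+Q. g Q * indicator T Q \<partial>count_space T)"
    using assms by (intro nn_integral_count_space_eq) auto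
  also have "\<dots> = (\<integral>\<^sup>+Q. g Q \<partial>count_space T)" by (intro nn_integral_cong) auto
  finally show ?thesis ..
qed

lemma nn_integral_count_space_mono_set:
  assumes "T \<subseteq> S"
  shows "(\<integral>\<^sup>+Q. g Q \<partial>count_space T) \<le> (\<integral>\<^sup>+Q. (g Q :: ennreal) \<partial>count_space S)"
  unfolding nn_integral_count_space_subset[OF assms] by (intro nn_integral_mono) (auto simp: indicator_def)

lemma borel_measurable_countable_sum [measurable (raw)]:
  assumes "countable S" "\<And>Q. Q \<in> S \<Longrightarrow> g Q \<in> borel_measurable M"
  shows "(\<lambda>x. \<integral>\<^sup>+Q. (g Q x :: ennreal) \<partial>count_space S) \<in> borel_measurable M"
proof -
  interpret sigma_finite_measure "count_space S"
    by (rule sigma_finite_measure_count_space_countable[OF assms(1)])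
  have "(\<lambda>(Q, x). g Q x) \<in> borel_measurable (count_space S \<Otimes>\<^sub>M M)"
    using assms by (intro measurable_pair_measure_countable1) auto
  then have "(\<lambda>(x, Q). g Q x) \<in> borel_measurable (M \<Otimes>\<^sub>M count_space S)"
    by (subst measurable_pair_swap_iff) (simp add: split_beta')
  then show ?thesis by (intro borel_measurable_nn_integral) auto
qed

text \<open>Dominated convergence for the counting measure.\<close>
lemma countable_sum_tail_tendsto:
  fixes a :: "'i \<Rightarrow> ennreal"
  assumes S: "countable S" "S \<noteq> {}" and fin: "(\<integral>\<^sup>+Q. a Q \<partial>count_space S) < top"
  shows "(\<lambda>n. \<integral>\<^sup>+Q. a Q \<partial>count_space (S - from_nat_into S ` {..<n})) \<longlonglongrightarrow> 0"
proof -
  let ?U = "\<lambda>n. S - from_nat_into S ` {..<n::nat}"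
  have "(\<lambda>n. \<integral>\<^sup>+Q. a Q * indicator (?U n) Q \<partial>count_space S) \<longlonglongrightarrow> (\<integral>\<^sup>+Q. 0 \<partial>count_space S)"
  proof (rule nn_integral_dominated_convergence[where w = a])
    show "AE Q in count_space S. (\<lambda>n. a Q * indicator (?U n) Q) \<longlonglongrightarrow> 0"
    proof (simp add: AE_count_space, intro ballI)
      fix Q assume "Q \<in> S"
      then obtain m where m: "Q = from_nat_into S m"
        using S by (metis from_nat_into_surj)
      have "eventually (\<lambda>n. a Q * indicator (?U n) Q = 0) sequentially"
        using eventually_gt_at_top[of m] by eventually_elim (auto simp: m)
      then show "(\<lambda>n. a Q * indicator (?U n) Q) \<longlonglongrightarrow> 0" by (rule tendsto_eventually)
    qed
  qed (use fin in \<open>auto simp: indicator_def\<close>)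
  then show ?thesis by (simp add: nn_integral_count_space_subset[of "?U _" S, OF Diff_subset])
qed

lemma enorm_countable_sum_tail:
  assumes S: "countable S" and g: "\<And>Q. Q \<in> S \<Longrightarrow> g Q \<in> borel_measurable M" and q: "0 < q"
    and fin: "enorm M q (\<lambda>x. \<integral>\<^sup>+Q. g Q x \<partial>count_space S) < top" and \<epsilon>: "0 < \<epsilon>"
  obtains S0 where "finite S0" "S0 \<subseteq> S" "enorm M q (\<lambda>x. \<integral>\<^sup>+Q. g Q x \<partial>count_space (S - S0)) \<le> ennreal \<epsilon>"
proof (cases "S = {}")
  case True
  then show ?thesis using that[of "{}"] q by (simp add: enorm_def nn_integral_empty)
next
  case False
  let ?U = "\<lambda>n. S - from_nat_into S ` {..<n::nat}"
  let ?F = "\<lambda>T x. \<integral>\<^sup>+Q. g Q x \<partial>count_space T"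
  have meas: "?F T \<in> borel_measurable M" if "T \<subseteq> S" for T
    using that S g by (intro borel_measurable_countable_sum) (auto intro: countable_subset)
  note [measurable] = meas[OF Diff_subset] meas[OF order_refl]
  have fin': "(\<integral>\<^sup>+x. epow (?F S x) q \<partial>M) < top" using fin by (simp add: enorm_def)
  have "(\<lambda>n. \<integral>\<^sup>+x. epow (?F (?U n) x) q \<partial>M) \<longlonglongrightarrow> (\<integral>\<^sup>+x. 0 \<partial>M)"
  proof (rule nn_integral_dominated_convergence[where w = "\<lambda>x. epow (?F S x) q"])
    have "AE x in M. epow (?F S x) q \<noteq> \<infinity>"
      using fin' by (intro nn_integral_PInf_AE) auto
    then show "AE x in M. (\<lambda>n. epow (?F (?U n) x) q) \<longlonglongrightarrow> 0"
    proof eventually_elim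
      case (elim x)
      then have lim: "(\<lambda>n. ?F (?U n) x) \<longlonglongrightarrow> 0"
        by (intro countable_sum_tail_tendsto S False) (auto simp: less_top)
      show ?case
      proof (rule order_tendstoI)
        fix y :: ennreal assume y: "0 < y"
        then have "0 < epow y (1 / q)" by (simp add: zero_less_iff_neq_zero)
        then have "eventually (\<lambda>n. ?F (?U n) x < epow y (1 / q)) sequentially" by (rule order_tendstoD[OF lim])
        then show "eventually (\<lambda>n. epow (?F (?U n) x) q < y) sequentially"
          by eventually_elim (use q in \<open>simp add: le_epow_iff not_le[symmetric]\<close>)
      qed simp
    qed
    show "AE x in M. epow (?F (?U n) x) q \<le> epow (?F S x) q" for n
      using q by (intro AE_I2 epow_mono nn_integral_count_space_mono_set) auto
  qed (use fin' in auto)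
  then have lim: "(\<lambda>n. \<integral>\<^sup>+x. epow (?F (?U n) x) q \<partial>M) \<longlonglongrightarrow> 0" by simp
  have "0 < ennreal (\<epsilon> powr q)" using \<epsilon> by simp
  from order_tendstoD(2)[OF lim this] obtain n where "(\<integral>\<^sup>+x. epow (?F (?U n) x) q \<partial>M) < ennreal (\<epsilon> powr q)"
    by (auto simp: eventually_sequentially)
  then have "enorm M q (?F (?U n)) \<le> ennreal \<epsilon>"
    unfolding enorm_def using q \<epsilon> by (subst epow_le_iff) (auto simp: less_imp_le)
  moreover have "from_nat_into S ` {..<n} \<subseteq> S" using from_nat_into[OF False] by auto
  ultimately show ?thesis using that[of "from_nat_into S ` {..<n}"] by auto
qed

definition (in nested_cubes) sparse :: "'a set set \<Rightarrow> bool" where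
  "sparse S \<longleftrightarrow> S \<subseteq> \<D> \<and> (\<exists>(\<eta>::real) E N. 0 < \<eta> \<and>
     (\<forall>Q\<in>S. E Q \<in> sets M \<and> E Q \<subseteq> Q \<and> ennreal \<eta> * emeasure M Q \<le> emeasure M (E Q)) \<and>
     (\<forall>x\<in>space M. finite {Q\<in>S. x \<in> E Q} \<and> card {Q\<in>S. x \<in> E Q} \<le> N))"

context positive_cubes
begin

lemma sparse_bounded:
  assumes "Ap p q \<omega>" "sparse S"
  obtains C :: real where "0 \<le> C" "\<And>f h. f \<in> borel_measurable M \<Longrightarrow> h \<in> borel_measurable M \<Longrightarrow>
    (\<integral>\<^sup>+Q. eavg M f Q * (\<integral>\<^sup>+x\<in>Q. h x \<partial>M) \<partial>count_space S) \<le>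
      ennreal C * (wnorm M p \<omega> f * dnorm M q \<omega> h)"
proof -
  from assms(2) obtain \<eta> :: real and E N where *: "S \<subseteq> \<D>" "0 < \<eta>"
     "\<And>Q. Q \<in> S \<Longrightarrow> E Q \<in> sets M" "\<And>Q. Q \<in> S \<Longrightarrow> E Q \<subseteq> Q" "\<And>Q. Q \<in> S \<Longrightarrow> ennreal \<eta> * emeasure M Q \<le> emeasure M (E Q)"
     "\<And>x. x\<in>space M \<Longrightarrow> finite {Q\<in>S. x \<in> E Q} \<and> card {Q\<in>S. x \<in> E Q} \<le> N"
    unfolding sparse_def by blast
  show ?thesis using sparse_form_bounded[OF assms(1) *] that by blast
qed

text \<open>The function that represents \<open>f \<mapsto> \<Sum>\<^sub>Q\<^sub>\<supseteq>\<^sub>R f\<^sub>Q\<close>, the sum being over the cubes \<open>Q\<close> of \<open>S\<close>.\<close>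
definition above :: "'a set \<Rightarrow> 'a set set \<Rightarrow> 'a \<Rightarrow> ennreal" where
  "above R S x = (\<integral>\<^sup>+Q. indicator Q x * (if R \<subseteq> Q then 1 / emeasure M Q else 0) \<partial>count_space S)"

lemma above_measurable [measurable]:
  assumes "S \<subseteq> \<D>"
  shows "above R S \<in> borel_measurable M"
  unfolding above_def[abs_def] using assms countable_cubes
  by (intro borel_measurable_countable_sum) (auto intro: countable_subset)

lemma above_pairing:
  assumes S: "S \<subseteq> \<D>" and [measurable]: "f \<in> borel_measurable M"
  shows "(\<integral>\<^sup>+x. above R S x * f x \<partial>M) = (\<integral>\<^sup>+Q. (if R \<subseteq> Q then eavg M f Q else 0) \<partial>count_space S)"
proof -
  have cS: "countable S" using S countable_cubes by (rule countable_subset)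
  have [measurable]: "Q \<in> sets M" if "Q \<in> S" for Q using S that by auto
  let ?c = "\<lambda>Q. if R \<subseteq> Q then 1 / emeasure M Q else 0"
  have "(\<integral>\<^sup>+x. above R S x * f x \<partial>M) = (\<integral>\<^sup>+x. (\<integral>\<^sup>+Q. ?c Q * (f x * indicator Q x) \<partial>count_space S) \<partial>M)"
    unfolding above_def by (subst nn_integral_multc[symmetric]) (auto intro!: nn_integral_cong simp: mult_ac)
  also have "\<dots> = (\<integral>\<^sup>+Q. (\<integral>\<^sup>+x. ?c Q * (f x * indicator Q x) \<partial>M) \<partial>count_space S)"
    by (rule nn_integral_count_space_nn_integral[OF cS]) measurable
  also have "\<dots> = (\<integral>\<^sup>+Q. (if R \<subseteq> Q then eavg M f Q else 0) \<partial>count_space S)"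
  proof (rule nn_integral_cong)
    fix Q assume "Q \<in> space (count_space S)"
    then have [measurable]: "Q \<in> sets M" by simp
    have "(\<integral>\<^sup>+x. ?c Q * (f x * indicator Q x) \<partial>M) = ?c Q * (\<integral>\<^sup>+x\<in>Q. f x \<partial>M)"
      by (rule nn_integral_cmult) measurable
    then show "(\<integral>\<^sup>+x. ?c Q * (f x * indicator Q x) \<partial>M) = (if R \<subseteq> Q then eavg M f Q else 0)"
      by (simp add: eavg_def ennreal_divide_times)
  qed
  finally show ?thesis .
qed

text \<open>The functional is at most the sparse form at \<open>f\<close> and the normalised indicator of \<open>R\<close>, since \<open>R\<close> has measure
\<open>\<mu>(R)\<close> inside every cube above it.\<close>
lemma enorm_above_finite:
  assumes ap: "Ap p q \<omega>" and sp: "sparse S" and sf: "sigma_finite_measure M" and R: "R \<in> \<D>"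
  shows "dnorm M q \<omega> (above R S) < top"
proof -
  have p: "1 < p" "1 / p + 1 / q = 1" using ap by (auto simp: Ap_def)
  note q = conjugate_exponent[OF p]
  have om[measurable]: "\<omega> \<in> borel_measurable M" and ompos: "\<And>x. x \<in> space M \<Longrightarrow> 0 < \<omega> x"
    using ap by (auto simp: Ap_def)
  have S: "S \<subseteq> \<D>" using sp by (auto simp: sparse_def)
  note [measurable] = cube_sets[OF R] above_measurable[OF S]
  obtain C where C: "0 \<le> C" "\<And>f h. f \<in> borel_measurable M \<Longrightarrow> h \<in> borel_measurable M \<Longrightarrow>
    (\<integral>\<^sup>+Q. eavg M f Q * (\<integral>\<^sup>+x\<in>Q. h x \<partial>M) \<partial>count_space S) \<le>
      ennreal C * (wnorm M p \<omega> f * dnorm M q \<omega> h)"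
    using sparse_bounded[OF ap sp] by blast
  let ?c = "ennreal C * enorm M q (\<lambda>x. indicator R x * ennreal (1 / \<omega> x)) / emeasure M R"
  have mR: "emeasure M R \<noteq> 0" "emeasure M R < top" using cube_pos[OF R] cube_finite[OF R] by auto
  have "dnorm M q \<omega> (above R S) \<le> ?c"
  proof (rule enorm_le_dual[OF q(1,4) sf])
    fix k :: "'a \<Rightarrow> ennreal" assume [measurable]: "k \<in> borel_measurable M"
    let ?f = "\<lambda>x. ennreal (1 / \<omega> x) * k x"
    have "(\<integral>\<^sup>+x. above R S x * ennreal (1 / \<omega> x) * k x \<partial>M) = (\<integral>\<^sup>+Q. (if R \<subseteq> Q then eavg M ?f Q else 0) \<partial>count_space S)"
      by (simp add: above_pairing[OF S] mult.assoc)
    also have "\<dots> \<le> (\<integral>\<^sup>+Q. eavg M ?f Q * (\<integral>\<^sup>+x\<in>Q. indicator R x \<partial>M) / emeasure M R \<partial>count_space S)"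
    proof (intro nn_integral_mono)
      fix Q
      have "(\<integral>\<^sup>+x\<in>Q. indicator R x \<partial>M) = emeasure M R" if "R \<subseteq> Q"
      proof -
        have "(\<integral>\<^sup>+x\<in>Q. indicator R x \<partial>M) = (\<integral>\<^sup>+x. indicator R x \<partial>M)"
          using that by (intro nn_integral_cong) (auto simp: indicator_def)
        then show ?thesis by simp
      qed
      then show "(if R \<subseteq> Q then eavg M ?f Q else 0) \<le> eavg M ?f Q * (\<integral>\<^sup>+x\<in>Q. indicator R x \<partial>M) / emeasure M R"
        using mR by (simp flip: ennreal_times_divide)
    qed
    also have "\<dots> = (\<integral>\<^sup>+Q. eavg M ?f Q * (\<integral>\<^sup>+x\<in>Q. indicator R x \<partial>M) \<partial>count_space S) / emeasure M R"
      by (rule nn_integral_divide) simp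
    also have "\<dots> \<le> (ennreal C * (wnorm M p \<omega> ?f * enorm M q (\<lambda>x. indicator R x * ennreal (1 / \<omega> x)))) / emeasure M R"
      by (intro divide_right_mono_ennreal C) auto
    also have "wnorm M p \<omega> ?f = enorm M p k"
    proof (rule enorm_cong)
      fix x assume "x \<in> space M"
      then have "ennreal (1 / \<omega> x) * ennreal (\<omega> x) = 1" using ompos[of x] by (simp flip: ennreal_mult)
      then show "?f x * ennreal (\<omega> x) = k x" by (metis mult.assoc mult.commute mult_1)
    qed
    finally show "(\<integral>\<^sup>+x. above R S x * ennreal (1 / \<omega> x) * k x \<partial>M) \<le> ?c * enorm M p k"
      by (simp add: ennreal_times_divide mult_ac)
  qed (use S in measurable)
  also have "?c < top"
  proof -
    have "enorm M q (\<lambda>x. indicator R x * ennreal (1 / \<omega> x)) < top"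
      using Ap_weight_bounds(4)[OF ap R] by (simp add: mult.commute)
    then have "ennreal C * enorm M q (\<lambda>x. indicator R x * ennreal (1 / \<omega> x)) < top"
      by (simp add: ennreal_mult_less_top)
    then show ?thesis using mR by (simp add: divide_less_ennreal ennreal_top_mult)
  qed
  finally show ?thesis .
qed

lemma enorm_above_tail:
  assumes ap: "Ap p q \<omega>" and sp: "sparse S" and sf: "sigma_finite_measure M" and R: "R \<in> \<D>" and \<epsilon>: "0 < \<epsilon>"
  obtains S0 where "finite S0" "S0 \<subseteq> S" "dnorm M q \<omega> (above R (S - S0)) \<le> ennreal \<epsilon>"
proof -
  have p: "1 < p" "1 / p + 1 / q = 1" using ap by (auto simp: Ap_def)
  note q = conjugate_exponent[OF p]
  have om[measurable]: "\<omega> \<in> borel_measurable M" using ap by (auto simp: Ap_def)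
  have S: "S \<subseteq> \<D>" using sp by (auto simp: sparse_def)
  have cS: "countable S" using S countable_cubes by (rule countable_subset)
  let ?g = "\<lambda>Q x. indicator Q x * (if R \<subseteq> Q then 1 / emeasure M Q else 0) * ennreal (1 / \<omega> x)"
  have eq: "(\<integral>\<^sup>+Q. ?g Q x \<partial>count_space T) = above R T x * ennreal (1 / \<omega> x)" for T x
    unfolding above_def by (rule nn_integral_multc) simp
  have [measurable]: "Q \<in> sets M" if "Q \<in> S" for Q using S that by auto
  show ?thesis
    using enorm_countable_sum_tail[OF cS, of ?g M q \<epsilon>] that q \<epsilon> enorm_above_finite[OF ap sp sf R]
    unfolding eq by auto
qed

end

context vanishing_oscillation
begin

definition form :: "'a set set \<Rightarrow> ('a \<Rightarrow> ennreal) \<Rightarrow> ('a \<Rightarrow> ennreal) \<Rightarrow> ennreal" where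
  "form S f h = (\<integral>\<^sup>+Q. eavg M f Q * (\<integral>\<^sup>+x\<in>Q. ennreal (norm (b x - avg M Q b)) * h x \<partial>M) \<partial>count_space S)"

text \<open>Insert \<open>oscillation_pairing\<close>. The first term is a sparse form at \<open>f\<close> and \<open>\<nu> M h\<close>; the weight of the dual norm turns
\<open>\<nu> / \<omega>\<^sub>1\<close> into \<open>1 / \<omega>\<^sub>2\<close>. In the second, sum over \<open>Q\<close> first, which gives the functional \<open>above\<close> for each exceptional cube.\<close>
lemma form_le:
  assumes ap1: "Ap p q \<omega>1" and ap2: "Ap p q \<omega>2" and \<nu>: "\<And>x. x \<in> space M \<Longrightarrow> \<nu> x = \<omega>1 x / \<omega>2 x"
    and sp: "sparse S"
  obtains C :: real where "0 \<le> C" "\<And>\<epsilon> T f h. 0 < \<epsilon> \<Longrightarrow> T \<subseteq> S \<Longrightarrow> f \<in> borel_measurable M \<Longrightarrow> h \<in> borel_measurable M \<Longrightarrow>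
    form T f h \<le> ennreal C * (ennreal \<epsilon> + (\<Sum>R\<in>{R\<in>\<D>. \<not> bdev R \<le> ennreal \<epsilon> * nu R}.
        wcube M p \<omega>1 R * dnorm M q \<omega>1 (above R T))) *
      (wnorm M p \<omega>1 f * dnorm M q \<omega>2 h)"
proof -
  have p: "1 < p" "1 / p + 1 / q = 1" using ap1 by (auto simp: Ap_def)
  note q = conjugate_exponent[OF p]
  have [measurable]: "\<omega>1 \<in> borel_measurable M" "\<omega>2 \<in> borel_measurable M"
    and pos: "\<And>x. x \<in> space M \<Longrightarrow> 0 < \<omega>1 x" "\<And>x. x \<in> space M \<Longrightarrow> 0 < \<omega>2 x"
    using ap1 ap2 by (auto simp: Ap_def)
  obtain C1 where C1: "0 \<le> C1" "\<And>f h. f \<in> borel_measurable M \<Longrightarrow> h \<in> borel_measurable M \<Longrightarrow>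
    (\<integral>\<^sup>+Q. eavg M f Q * (\<integral>\<^sup>+x\<in>Q. h x \<partial>M) \<partial>count_space S) \<le>
      ennreal C1 * (wnorm M p \<omega>1 f * dnorm M q \<omega>1 h)"
    using sparse_bounded[OF ap1 sp] by blast
  obtain C2 where C2: "0 \<le> C2" "\<And>h. h \<in> borel_measurable M \<Longrightarrow>
    dnorm M q \<omega>2 (dmax M \<D> h) \<le> ennreal C2 * dnorm M q \<omega>2 h"
    using Ap_max_bounded[OF Ap_dual[OF ap2]] by blast
  define c where "c = max C1 B"
  have c: "0 \<le> c" "C1 \<le> c" "B \<le> c" using C1 by (auto simp: c_def)
  show ?thesis
  proof (rule that[of "8 * A * D * c * C2"])
    show "0 \<le> 8 * A * D * c * C2" using A_pos D_ge_1 c C2 by auto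
    fix \<epsilon> :: real and T and f h :: "'a \<Rightarrow> ennreal"
    assume \<epsilon>: "0 < \<epsilon>" and T: "T \<subseteq> S" and [measurable]: "f \<in> borel_measurable M" "h \<in> borel_measurable M"
    have SD: "S \<subseteq> \<D>" using sp by (auto simp: sparse_def)
    then have TD: "T \<subseteq> \<D>" using T by auto
    define \<F> where "\<F> = {R\<in>\<D>. \<not> bdev R \<le> ennreal \<epsilon> * nu R}"
    have \<F>: "finite \<F>" "\<F> \<subseteq> \<D>" unfolding \<F>_def using vanish[OF \<epsilon>] by auto
    let ?g = "\<lambda>x. ennreal (\<nu> x) * dmax M \<D> h x"
    let ?K = "ennreal (8 * A * D)"
    let ?nf = "wnorm M p \<omega>1 f" and ?nh = "dnorm M q \<omega>2 h"
    let ?s = "\<lambda>R. wcube M p \<omega>1 R * dnorm M q \<omega>1 (above R T)"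
    have g1: "?g x * ennreal (1 / \<omega>1 x) = dmax M \<D> h x * ennreal (1 / \<omega>2 x)"
      and g2: "ennreal (\<omega>1 x) * (dmax M \<D> h x * ennreal (1 / \<omega>2 x)) = ?g x"
      and f1: "(f x * ennreal (\<omega>1 x)) * (above R T x * ennreal (1 / \<omega>1 x)) = above R T x * f x"
      if "x \<in> space M" for x R
    proof -
      have 1: "ennreal (\<nu> x) * ennreal (1 / \<omega>1 x) = ennreal (1 / \<omega>2 x)"
        "ennreal (\<omega>1 x) * ennreal (1 / \<omega>2 x) = ennreal (\<nu> x)"
        "ennreal (\<omega>1 x) * ennreal (1 / \<omega>1 x) = 1"
        using pos[OF that] \<nu>[OF that] by (simp_all flip: ennreal_mult)
      show "?g x * ennreal (1 / \<omega>1 x) = dmax M \<D> h x * ennreal (1 / \<omega>2 x)"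
        using 1(1) by (metis mult.assoc mult.commute)
      show "ennreal (\<omega>1 x) * (dmax M \<D> h x * ennreal (1 / \<omega>2 x)) = ?g x"
        using 1(2) by (metis mult.assoc mult.commute)
      have "(f x * ennreal (\<omega>1 x)) * (above R T x * ennreal (1 / \<omega>1 x)) = (above R T x * f x) * (ennreal (\<omega>1 x) * ennreal (1 / \<omega>1 x))"
        by (simp only: mult_ac)
      then show "(f x * ennreal (\<omega>1 x)) * (above R T x * ennreal (1 / \<omega>1 x)) = above R T x * f x" by (simp add: 1(3))
    qed
    have main: "(\<integral>\<^sup>+Q. eavg M f Q * (\<integral>\<^sup>+x\<in>Q. ?g x \<partial>M) \<partial>count_space T) \<le> ennreal (C1 * C2) * (?nf * ?nh)"
    proof -
      have "(\<integral>\<^sup>+Q. eavg M f Q * (\<integral>\<^sup>+x\<in>Q. ?g x \<partial>M) \<partial>count_space T) \<le> (\<integral>\<^sup>+Q. eavg M f Q * (\<integral>\<^sup>+x\<in>Q. ?g x \<partial>M) \<partial>count_space S)"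
        by (rule nn_integral_count_space_mono_set[OF T])
      also have "\<dots> \<le> ennreal C1 * (?nf * dnorm M q \<omega>1 ?g)" by (rule C1) measurable
      also have "dnorm M q \<omega>1 ?g = dnorm M q \<omega>2 (dmax M \<D> h)"
        by (rule enorm_cong) (rule g1)
      also have "ennreal C1 * (?nf * \<dots>) \<le> ennreal C1 * (?nf * (ennreal C2 * ?nh))"
        by (intro mult_left_mono C2) auto
      finally show ?thesis using C1(1) C2(1) by (simp add: ennreal_mult mult_ac)
    qed
    have X: "(\<integral>\<^sup>+x\<in>R. ?g x \<partial>M) \<le> wcube M p \<omega>1 R * (ennreal C2 * ?nh)" if "R \<in> \<F>" for R
    proof -
      have [measurable]: "R \<in> sets M" using that \<F> by auto
      have "(\<integral>\<^sup>+x\<in>R. ?g x \<partial>M) = (\<integral>\<^sup>+x. (ennreal (\<omega>1 x) * indicator R x) * (dmax M \<D> h x * ennreal (1 / \<omega>2 x)) \<partial>M)"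
        by (intro nn_integral_cong) (simp add: g2[symmetric] mult_ac)
      also have "\<dots> \<le> wcube M p \<omega>1 R * dnorm M q \<omega>2 (dmax M \<D> h)"
        by (rule Holder_nn_integral[OF p]) auto
      also have "\<dots> \<le> wcube M p \<omega>1 R * (ennreal C2 * ?nh)"
        by (intro mult_left_mono C2) auto
      finally show ?thesis .
    qed
    have Y: "(\<integral>\<^sup>+Q. (if R \<subseteq> Q then eavg M f Q else 0) \<partial>count_space T) \<le> ?nf * dnorm M q \<omega>1 (above R T)" for R
    proof -
      note [measurable] = above_measurable[OF TD]
      have "(\<integral>\<^sup>+Q. (if R \<subseteq> Q then eavg M f Q else 0) \<partial>count_space T) = (\<integral>\<^sup>+x. above R T x * f x \<partial>M)"
        by (simp add: above_pairing[OF TD])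
      also have "\<dots> = (\<integral>\<^sup>+x. (f x * ennreal (\<omega>1 x)) * (above R T x * ennreal (1 / \<omega>1 x)) \<partial>M)"
        by (intro nn_integral_cong) (simp only: f1)
      also have "\<dots> \<le> ?nf * dnorm M q \<omega>1 (above R T)"
        by (rule Holder_nn_integral[OF p]) auto
      finally show ?thesis .
    qed
    have "form T f h \<le> (\<integral>\<^sup>+Q. eavg M f Q * (?K * (ennreal \<epsilon> * (\<integral>\<^sup>+x\<in>Q. ?g x \<partial>M) +
      ennreal B * (\<Sum>R\<in>{R\<in>\<D>. \<not> bdev R \<le> ennreal \<epsilon> * nu R \<and> R \<subseteq> Q}. \<integral>\<^sup>+x\<in>R. ?g x \<partial>M))) \<partial>count_space T)"
      unfolding form_def using TD by (intro nn_integral_mono mult_left_mono oscillation_pairing \<epsilon>) auto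
    also have "\<dots> = (\<integral>\<^sup>+Q. ?K * (ennreal \<epsilon> * (eavg M f Q * (\<integral>\<^sup>+x\<in>Q. ?g x \<partial>M)) +
        ennreal B * (\<Sum>R\<in>\<F>. (\<integral>\<^sup>+x\<in>R. ?g x \<partial>M) * (if R \<subseteq> Q then eavg M f Q else 0))) \<partial>count_space T)"
    proof (rule nn_integral_cong)
      fix Q
      have "(\<Sum>R\<in>{R\<in>\<D>. \<not> bdev R \<le> ennreal \<epsilon> * nu R \<and> R \<subseteq> Q}. \<integral>\<^sup>+x\<in>R. ?g x \<partial>M) =
         (\<Sum>R\<in>\<F>. (\<integral>\<^sup>+x\<in>R. ?g x \<partial>M) * (if R \<subseteq> Q then 1 else 0))"
        using \<F>(1) by (intro sum.mono_neutral_cong_left) (auto simp: \<F>_def)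
      moreover have "eavg M f Q * (\<Sum>R\<in>\<F>. (\<integral>\<^sup>+x\<in>R. ?g x \<partial>M) * (if R \<subseteq> Q then 1 else 0)) =
         (\<Sum>R\<in>\<F>. (\<integral>\<^sup>+x\<in>R. ?g x \<partial>M) * (if R \<subseteq> Q then eavg M f Q else 0))"
        unfolding sum_distrib_left by (intro sum.cong) (auto simp: mult.commute)
      ultimately show "eavg M f Q * (?K * (ennreal \<epsilon> * (\<integral>\<^sup>+x\<in>Q. ?g x \<partial>M) +
          ennreal B * (\<Sum>R\<in>{R\<in>\<D>. \<not> bdev R \<le> ennreal \<epsilon> * nu R \<and> R \<subseteq> Q}. \<integral>\<^sup>+x\<in>R. ?g x \<partial>M))) =
        ?K * (ennreal \<epsilon> * (eavg M f Q * (\<integral>\<^sup>+x\<in>Q. ?g x \<partial>M)) +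
        ennreal B * (\<Sum>R\<in>\<F>. (\<integral>\<^sup>+x\<in>R. ?g x \<partial>M) * (if R \<subseteq> Q then eavg M f Q else 0)))"
        by (simp only: distrib_left mult.left_commute[of "eavg M f Q"])
    qed
    also have "\<dots> = ?K * (ennreal \<epsilon> * (\<integral>\<^sup>+Q. eavg M f Q * (\<integral>\<^sup>+x\<in>Q. ?g x \<partial>M) \<partial>count_space T) +
        ennreal B * (\<Sum>R\<in>\<F>. (\<integral>\<^sup>+x\<in>R. ?g x \<partial>M) * (\<integral>\<^sup>+Q. (if R \<subseteq> Q then eavg M f Q else 0) \<partial>count_space T)))"
      by (simp add: nn_integral_add nn_integral_cmult nn_integral_sum)
    also have "\<dots> \<le> ?K * (ennreal \<epsilon> * (ennreal (C1 * C2) * (?nf * ?nh)) +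
        ennreal B * (\<Sum>R\<in>\<F>. (wcube M p \<omega>1 R * (ennreal C2 * ?nh)) *
          (?nf * dnorm M q \<omega>1 (above R T))))"
      by (intro mult_left_mono add_mono main sum_mono mult_mono X Y) auto
    also have "\<dots> = ?K * (ennreal (C1 * C2) * ennreal \<epsilon> * (?nf * ?nh) + ennreal (B * C2) * (\<Sum>R\<in>\<F>. ?s R) * (?nf * ?nh))"
    proof -
      have "(\<Sum>R\<in>\<F>. (wcube M p \<omega>1 R * (ennreal C2 * ?nh)) *
          (?nf * dnorm M q \<omega>1 (above R T))) = ennreal C2 * (\<Sum>R\<in>\<F>. ?s R) * (?nf * ?nh)"
        unfolding sum_distrib_left sum_distrib_right by (intro sum.cong) (auto simp: mult_ac)
      then show ?thesis using B_nonneg C2(1) by (simp add: ennreal_mult mult_ac)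
    qed
    also have "\<dots> \<le> ?K * (ennreal (c * C2) * ennreal \<epsilon> * (?nf * ?nh) + ennreal (c * C2) * (\<Sum>R\<in>\<F>. ?s R) * (?nf * ?nh))"
      using c C2(1) by (intro mult_left_mono add_mono mult_right_mono ennreal_leI) auto
    also have "\<dots> = ennreal (8 * A * D * c * C2) * (ennreal \<epsilon> + (\<Sum>R\<in>\<F>. ?s R)) * (?nf * ?nh)"
    proof -
      have "ennreal (8 * A * D * c * C2) = ?K * ennreal (c * C2)"
        using A_pos D_ge_1 c C2(1) by (simp add: ennreal_mult mult_ac)
      then show ?thesis by (simp only: distrib_left distrib_right mult_ac)
    qed
    finally show "form T f h \<le> ennreal (8 * A * D * c * C2) * (ennreal \<epsilon> + (\<Sum>R\<in>{R\<in>\<D>. \<not> bdev R \<le> ennreal \<epsilon> * nu R}. ?s R)) * (?nf * ?nh)"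
      unfolding \<F>_def .
  qed
qed

lemma enorm_above_mono:
  assumes "0 < q" "T \<subseteq> T'"
  shows "enorm M q (\<lambda>x. above R T x * ennreal (w x)) \<le> enorm M q (\<lambda>x. above R T' x * ennreal (w x))"
  unfolding above_def using assms by (intro enorm_mono mult_right_mono nn_integral_count_space_mono_set) auto

lemma form_bounded:
  assumes ap1: "Ap p q \<omega>1" and ap2: "Ap p q \<omega>2" and \<nu>: "\<And>x. x \<in> space M \<Longrightarrow> \<nu> x = \<omega>1 x / \<omega>2 x"
    and sp: "sparse S" and sf: "sigma_finite_measure M"
  obtains C :: real where "0 \<le> C" "\<And>f h. f \<in> borel_measurable M \<Longrightarrow> h \<in> borel_measurable M \<Longrightarrow>
    form S f h \<le> ennreal C * (wnorm M p \<omega>1 f * dnorm M q \<omega>2 h)"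
proof -
  obtain C where C: "0 \<le> C" "\<And>\<epsilon> T f h. 0 < \<epsilon> \<Longrightarrow> T \<subseteq> S \<Longrightarrow> f \<in> borel_measurable M \<Longrightarrow> h \<in> borel_measurable M \<Longrightarrow>
    form T f h \<le> ennreal C * (ennreal \<epsilon> + (\<Sum>R\<in>{R\<in>\<D>. \<not> bdev R \<le> ennreal \<epsilon> * nu R}.
        wcube M p \<omega>1 R * dnorm M q \<omega>1 (above R T))) *
      (wnorm M p \<omega>1 f * dnorm M q \<omega>2 h)"
    using form_le[OF ap1 ap2 \<nu> sp] by blast
  define c where "c = ennreal C * (ennreal 1 + (\<Sum>R\<in>{R\<in>\<D>. \<not> bdev R \<le> ennreal 1 * nu R}.
        wcube M p \<omega>1 R * dnorm M q \<omega>1 (above R S)))"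
  have "(\<Sum>R\<in>{R\<in>\<D>. \<not> bdev R \<le> ennreal 1 * nu R}.
        wcube M p \<omega>1 R * dnorm M q \<omega>1 (above R S)) < top"
  proof (rule sum_ennreal_less_top)
    show "finite {R\<in>\<D>. \<not> bdev R \<le> ennreal 1 * nu R}" by (rule vanish) simp
    fix R assume "R \<in> {R\<in>\<D>. \<not> bdev R \<le> ennreal 1 * nu R}"
    then have "R \<in> \<D>" by simp
    then show "wcube M p \<omega>1 R * dnorm M q \<omega>1 (above R S) < top"
      using Ap_weight_bounds(2)[OF ap1] enorm_above_finite[OF ap1 sp sf] by (simp add: ennreal_mult_less_top)
  qed
  then have "c < top" unfolding c_def by (simp add: ennreal_mult_less_top)
  then obtain c' where c': "c = ennreal c'" "0 \<le> c'" by (cases c) auto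
  show ?thesis
  proof (rule that[OF c'(2)])
    fix f h :: "'a \<Rightarrow> ennreal" assume m: "f \<in> borel_measurable M" "h \<in> borel_measurable M"
    show "form S f h \<le> ennreal c' * (wnorm M p \<omega>1 f * dnorm M q \<omega>2 h)"
      using C(2)[OF zero_less_one order_refl m] unfolding c'(1)[symmetric] c_def .
  qed
qed

text \<open>Choose \<open>\<epsilon>\<close> so that the first term is at most half of \<open>\<delta>\<close>, which fixes the finitely many exceptional cubes, and then
remove enough of \<open>S\<close> to make the tail of \<open>above\<close> small for each of them.\<close>
lemma form_tail:
  assumes ap1: "Ap p q \<omega>1" and ap2: "Ap p q \<omega>2" and \<nu>: "\<And>x. x \<in> space M \<Longrightarrow> \<nu> x = \<omega>1 x / \<omega>2 x"
    and sp: "sparse S" and sf: "sigma_finite_measure M" and \<delta>: "0 < \<delta>"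
  obtains S0 where "finite S0" "S0 \<subseteq> S" "\<And>f h. f \<in> borel_measurable M \<Longrightarrow> h \<in> borel_measurable M \<Longrightarrow>
    form (S - S0) f h \<le> ennreal \<delta> * (wnorm M p \<omega>1 f * dnorm M q \<omega>2 h)"
proof -
  have p: "1 < p" "1 / p + 1 / q = 1" using ap1 by (auto simp: Ap_def)
  note q = conjugate_exponent[OF p]
  obtain C where C: "0 \<le> C" "\<And>\<epsilon> T f h. 0 < \<epsilon> \<Longrightarrow> T \<subseteq> S \<Longrightarrow> f \<in> borel_measurable M \<Longrightarrow> h \<in> borel_measurable M \<Longrightarrow>
    form T f h \<le> ennreal C * (ennreal \<epsilon> + (\<Sum>R\<in>{R\<in>\<D>. \<not> bdev R \<le> ennreal \<epsilon> * nu R}.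
        wcube M p \<omega>1 R * dnorm M q \<omega>1 (above R T))) *
      (wnorm M p \<omega>1 f * dnorm M q \<omega>2 h)"
    using form_le[OF ap1 ap2 \<nu> sp] by blast
  obtain \<epsilon> where \<epsilon>: "0 < \<epsilon>" "ennreal C * ennreal \<epsilon> \<le> ennreal (\<delta> / 2)"
    using ennreal_small_multiple[of "ennreal C" "\<delta> / 2"] \<delta> by auto
  define \<F> where "\<F> = {R\<in>\<D>. \<not> bdev R \<le> ennreal \<epsilon> * nu R}"
  have \<F>: "finite \<F>" "\<F> \<subseteq> \<D>" unfolding \<F>_def using vanish[OF \<epsilon>(1)] by auto
  let ?d = "\<delta> / (2 * (card \<F> + 1))"
  let ?a = "\<lambda>R. wcube M p \<omega>1 R"
  let ?t = "\<lambda>R T. dnorm M q \<omega>1 (above R T)"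
  have "\<exists>S0. finite S0 \<and> S0 \<subseteq> S \<and> ennreal C * (?a R * ?t R (S - S0)) \<le> ennreal ?d" if R: "R \<in> \<F>" for R
  proof -
    have RD: "R \<in> \<D>" using R \<F> by auto
    have "ennreal C * ?a R < top" using Ap_weight_bounds(2)[OF ap1 RD] by (simp add: ennreal_mult_less_top)
    then obtain \<tau> where \<tau>: "0 < \<tau>" "ennreal C * ?a R * ennreal \<tau> \<le> ennreal ?d"
      using ennreal_small_multiple[of "ennreal C * ?a R" ?d] \<delta> by auto
    obtain S0 where S0: "finite S0" "S0 \<subseteq> S" "?t R (S - S0) \<le> ennreal \<tau>"
      using enorm_above_tail[OF ap1 sp sf RD \<tau>(1)] by blast
    have "ennreal C * (?a R * ?t R (S - S0)) \<le> ennreal C * (?a R * ennreal \<tau>)"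
      by (intro mult_left_mono S0) auto
    also have "\<dots> \<le> ennreal ?d" using \<tau>(2) by (simp add: mult.assoc)
    finally show ?thesis using S0 by blast
  qed
  then have "\<forall>R\<in>\<F>. \<exists>S0. finite S0 \<and> S0 \<subseteq> S \<and> ennreal C * (?a R * ?t R (S - S0)) \<le> ennreal ?d" ..
  from bchoice[OF this] obtain \<sigma> where
    \<sigma>: "\<forall>R\<in>\<F>. finite (\<sigma> R) \<and> \<sigma> R \<subseteq> S \<and> ennreal C * (?a R * ?t R (S - \<sigma> R)) \<le> ennreal ?d" ..
  define S0 where "S0 = (\<Union>R\<in>\<F>. \<sigma> R)"
  have S0: "finite S0" "S0 \<subseteq> S" using \<sigma> \<F> by (auto simp: S0_def)
  have "ennreal C * (ennreal \<epsilon> + (\<Sum>R\<in>\<F>. ?a R * ?t R (S - S0))) \<le> ennreal \<delta>"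
  proof -
    have "ennreal C * (\<Sum>R\<in>\<F>. ?a R * ?t R (S - S0)) \<le> (\<Sum>R\<in>\<F>. ennreal ?d)"
      unfolding sum_distrib_left
    proof (rule sum_mono)
      fix R assume R: "R \<in> \<F>"
      have "ennreal C * (?a R * ?t R (S - S0)) \<le> ennreal C * (?a R * ?t R (S - \<sigma> R))"
        using q R by (intro mult_left_mono enorm_above_mono) (auto simp: S0_def)
      also have "\<dots> \<le> ennreal ?d" using bspec[OF \<sigma> R] by blast
      finally show "ennreal C * (?a R * ?t R (S - S0)) \<le> ennreal ?d" .
    qed
    also have "\<dots> = ennreal (card \<F> * ?d)" using \<delta> by (simp add: ennreal_of_nat_eq_real_of_nat flip: ennreal_mult')
    also have "\<dots> \<le> ennreal (\<delta> / 2)"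
      using \<delta> by (intro ennreal_leI) (simp add: field_simps)
    finally have "ennreal C * ennreal \<epsilon> + ennreal C * (\<Sum>R\<in>\<F>. ?a R * ?t R (S - S0)) \<le> ennreal (\<delta> / 2) + ennreal (\<delta> / 2)"
      using \<epsilon>(2) by (intro add_mono)
    then show ?thesis using \<delta> by (simp add: distrib_left flip: ennreal_plus)
  qed
  note small = this
  show ?thesis
  proof (rule that[OF S0])
    fix f h :: "'a \<Rightarrow> ennreal" assume m: "f \<in> borel_measurable M" "h \<in> borel_measurable M"
    show "form (S - S0) f h \<le> ennreal \<delta> * (wnorm M p \<omega>1 f * dnorm M q \<omega>2 h)"
      using C(2)[OF \<epsilon>(1) _ m, of "S - S0"] small unfolding \<F>_def
      by (meson Diff_subset mult_right_mono order_trans zero_le)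
  qed
qed

end

section \<open>Positive majorants of the operators\<close>

context vanishing_oscillation
begin

definition lin :: "'a set set \<Rightarrow> ('a \<Rightarrow> ennreal) \<Rightarrow> 'a \<Rightarrow> ennreal" where
  "lin T f x = (\<integral>\<^sup>+Q. eavg M f Q * (ennreal (norm (b x - avg M Q b)) * indicator Q x) \<partial>count_space T)"

definition lin_adj :: "'a set set \<Rightarrow> ('a \<Rightarrow> ennreal) \<Rightarrow> 'a \<Rightarrow> ennreal" where
  "lin_adj T f x = (\<integral>\<^sup>+Q. eavg M (\<lambda>y. ennreal (norm (b y - avg M Q b)) * f y) Q * indicator Q x \<partial>count_space T)"

lemma lin_measurable:
  assumes "T \<subseteq> \<D>" shows "lin T f \<in> borel_measurable M" "lin_adj T f \<in> borel_measurable M"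
proof -
  have c: "countable T" using assms countable_cubes by (rule countable_subset)
  have [measurable]: "Q \<in> sets M" if "Q \<in> T" for Q using assms that by auto
  show "lin T f \<in> borel_measurable M" "lin_adj T f \<in> borel_measurable M"
    unfolding lin_def[abs_def] lin_adj_def[abs_def]
    by (intro borel_measurable_countable_sum c; measurable)+
qed

lemma lin_pairing:
  assumes T: "T \<subseteq> \<D>" and [measurable]: "f \<in> borel_measurable M" "h \<in> borel_measurable M"
  shows "(\<integral>\<^sup>+x. lin T f x * h x \<partial>M) = form T f h"
proof -
  have c: "countable T" using T countable_cubes by (rule countable_subset)
  have [measurable]: "Q \<in> sets M" if "Q \<in> T" for Q using T that by auto
  have "(\<integral>\<^sup>+x. lin T f x * h x \<partial>M) = (\<integral>\<^sup>+x. (\<integral>\<^sup>+Q. eavg M f Q * (ennreal (norm (b x - avg M Q b)) * h x * indicator Q x) \<partial>count_space T) \<partial>M)"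
    unfolding lin_def by (subst nn_integral_multc[symmetric]) (auto intro!: nn_integral_cong simp: mult_ac)
  also have "\<dots> = (\<integral>\<^sup>+Q. (\<integral>\<^sup>+x. eavg M f Q * (ennreal (norm (b x - avg M Q b)) * h x * indicator Q x) \<partial>M) \<partial>count_space T)"
    by (rule nn_integral_count_space_nn_integral[OF c]) measurable
  also have "\<dots> = form T f h"
    unfolding form_def by (intro nn_integral_cong nn_integral_cmult) auto
  finally show ?thesis .
qed

lemma lin_adj_pairing:
  assumes T: "T \<subseteq> \<D>" and [measurable]: "f \<in> borel_measurable M" "h \<in> borel_measurable M"
  shows "(\<integral>\<^sup>+x. lin_adj T f x * h x \<partial>M) = form T h f"
proof -
  have c: "countable T" using T countable_cubes by (rule countable_subset)
  have [measurable]: "Q \<in> sets M" if "Q \<in> T" for Q using T that by auto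
  let ?e = "\<lambda>Q. eavg M (\<lambda>y. ennreal (norm (b y - avg M Q b)) * f y) Q"
  have "(\<integral>\<^sup>+x. lin_adj T f x * h x \<partial>M) = (\<integral>\<^sup>+x. (\<integral>\<^sup>+Q. ?e Q * (h x * indicator Q x) \<partial>count_space T) \<partial>M)"
    unfolding lin_adj_def by (subst nn_integral_multc[symmetric]) (auto intro!: nn_integral_cong simp: mult_ac)
  also have "\<dots> = (\<integral>\<^sup>+Q. (\<integral>\<^sup>+x. ?e Q * (h x * indicator Q x) \<partial>M) \<partial>count_space T)"
    by (rule nn_integral_count_space_nn_integral[OF c]) measurable
  also have "\<dots> = (\<integral>\<^sup>+Q. ?e Q * (\<integral>\<^sup>+x\<in>Q. h x \<partial>M) \<partial>count_space T)"
    by (intro nn_integral_cong nn_integral_cmult) auto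
  also have "\<dots> = form T h f"
    unfolding form_def eavg_def by (intro nn_integral_cong) (simp add: ennreal_divide_times mult.commute)
  finally show ?thesis .
qed

lemma lin_norm_le:
  assumes ap2: "Ap p q \<omega>2" and sf: "sigma_finite_measure M" and T: "T \<subseteq> \<D>"
    and le: "\<And>h. h \<in> borel_measurable M \<Longrightarrow> form T f h \<le> K * (wnorm M p \<omega>1 f * dnorm M q \<omega>2 h)"
    and f: "f \<in> borel_measurable M"
  shows "wnorm M p \<omega>2 (lin T f) \<le> K * wnorm M p \<omega>1 f"
proof (rule wnorm_le_dual[OF _ _ sf])
  fix h :: "'a \<Rightarrow> ennreal" assume h: "h \<in> borel_measurable M"
  show "(\<integral>\<^sup>+x. lin T f x * h x \<partial>M) \<le> K * wnorm M p \<omega>1 f * dnorm M q \<omega>2 h"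
    using le[OF h] by (simp add: lin_pairing[OF T f h] mult.assoc)
qed (use ap2 lin_measurable[OF T] in \<open>auto simp: Ap_def\<close>)

lemma lin_adj_norm_le:
  assumes ap2: "Ap p q \<omega>2" and sf: "sigma_finite_measure M" and T: "T \<subseteq> \<D>"
    and le: "\<And>h. h \<in> borel_measurable M \<Longrightarrow>
      form T h f \<le> K * (dnorm M q \<omega>2 h * enorm M p (\<lambda>x. f x * ennreal (1 / (1 / \<omega>1 x))))"
    and f: "f \<in> borel_measurable M"
  shows "wnorm M p \<omega>2 (lin_adj T f) \<le> K * wnorm M p \<omega>1 f"
proof (rule wnorm_le_dual[OF _ _ sf])
  fix h :: "'a \<Rightarrow> ennreal" assume h: "h \<in> borel_measurable M"
  show "(\<integral>\<^sup>+x. lin_adj T f x * h x \<partial>M) \<le> K * wnorm M p \<omega>1 f * dnorm M q \<omega>2 h"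
    unfolding lin_adj_pairing[OF T f h] using le[OF h] by (simp add: mult_ac)
qed (use ap2 lin_measurable[OF T] in \<open>auto simp: Ap_def\<close>)

definition bilin :: "'a set set \<Rightarrow> ('a \<Rightarrow> ennreal) \<Rightarrow> ('a \<Rightarrow> ennreal) \<Rightarrow> 'a \<Rightarrow> ennreal" where
  "bilin T f g x = (\<integral>\<^sup>+Q. eavg M f Q * eavg M g Q * (ennreal (norm (b x - avg M Q b)) * indicator Q x) \<partial>count_space T)"

definition bilin_adj :: "'a set set \<Rightarrow> ('a \<Rightarrow> ennreal) \<Rightarrow> ('a \<Rightarrow> ennreal) \<Rightarrow> 'a \<Rightarrow> ennreal" where
  "bilin_adj T f g x = (\<integral>\<^sup>+Q. eavg M (\<lambda>y. ennreal (norm (b y - avg M Q b)) * f y) Q * eavg M g Q * indicator Q x \<partial>count_space T)"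

lemma bilin_le:
  assumes T: "T \<subseteq> \<D>"
  shows "bilin T f g x \<le> lin T f x * dmax M \<D> g x" "bilin_adj T f g x \<le> lin_adj T f x * dmax M \<D> g x"
proof -
  have *: "(u * eavg M g Q) * (v * indicator Q x) \<le> (u * (v * indicator Q x)) * dmax M \<D> g x" if "Q \<in> T" for u v Q
    using eavg_le_dmax[of Q \<D> x M g] that T
    by (auto simp: indicator_def mult_ac intro!: mult_left_mono)
  show "bilin T f g x \<le> lin T f x * dmax M \<D> g x"
    unfolding bilin_def lin_def by (subst nn_integral_multc[symmetric]) (auto intro!: nn_integral_mono *)
  show "bilin_adj T f g x \<le> lin_adj T f x * dmax M \<D> g x"
    unfolding bilin_adj_def lin_adj_def
    using *[where v = 1] by (subst nn_integral_multc[symmetric]) (auto intro!: nn_integral_mono)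
qed

text \<open>Hoelder's inequality with the weights distributed over the two factors.\<close>
lemma bilinear_from_linear:
  assumes p: "1 < p" and ap3: "Ap p2 q2 \<omega>3" and exps: "1 / p0 = 1 / p + 1 / p2"
    and C3: "\<And>g. g \<in> borel_measurable M \<Longrightarrow> wnorm M p2 \<omega>3 (dmax M \<D> g) \<le> C3 * wnorm M p2 \<omega>3 g"
    and w[measurable]: "\<omega>2 \<in> borel_measurable M" and w0: "\<And>x. x \<in> space M \<Longrightarrow> 0 < \<omega>2 x"
    and L[measurable]: "L \<in> borel_measurable M" and g: "g \<in> borel_measurable M"
    and le: "wnorm M p \<omega>2 L \<le> K" and F: "\<And>x. F x \<le> L x * dmax M \<D> g x"
  shows "enorm M p0 (\<lambda>x. F x * ennreal (\<omega>2 x * \<omega>3 x)) \<le> K * (C3 * wnorm M p2 \<omega>3 g)"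
proof -
  have p2: "1 < p2" and [measurable]: "\<omega>3 \<in> borel_measurable M" and pos: "\<And>x. x \<in> space M \<Longrightarrow> 0 < \<omega>3 x"
    using ap3 by (auto simp: Ap_def)
  have "1 / p > 0" "1 / p2 > 0" using p p2 by auto
  then have "1 / p0 > 0" using exps by linarith
  then have p0: "0 < p0" by (simp add: zero_less_divide_iff)
  have "enorm M p0 (\<lambda>x. F x * ennreal (\<omega>2 x * \<omega>3 x)) \<le> enorm M p0 (\<lambda>x. (L x * ennreal (\<omega>2 x)) * (dmax M \<D> g x * ennreal (\<omega>3 x)))"
  proof (rule enorm_mono[OF p0])
    fix x assume x: "x \<in> space M"
    have "F x * ennreal (\<omega>2 x * \<omega>3 x) \<le> L x * dmax M \<D> g x * ennreal (\<omega>2 x * \<omega>3 x)"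
      by (intro mult_right_mono F) auto
    also have "\<dots> = (L x * ennreal (\<omega>2 x)) * (dmax M \<D> g x * ennreal (\<omega>3 x))"
      using pos[OF x] w0[OF x] by (simp add: ennreal_mult mult_ac)
    finally show "F x * ennreal (\<omega>2 x * \<omega>3 x) \<le> \<dots>" .
  qed
  also have "\<dots> \<le> wnorm M p \<omega>2 L * wnorm M p2 \<omega>3 (dmax M \<D> g)"
    by (rule Holder_enorm[OF p p2 exps]) auto
  also have "\<dots> \<le> K * (C3 * wnorm M p2 \<omega>3 g)"
    by (intro mult_mono le C3 g) auto
  finally show ?thesis .
qed

end

locale bloom_setting = vanishing_oscillation M \<D> D b \<nu> A B
  for M :: "'a measure" and \<D> D and b :: "'a \<Rightarrow> 'k::{real_normed_field, euclidean_space}" and \<nu> A B +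
  fixes p q p2 q2 p0 :: real and \<omega>1 \<omega>2 \<omega>3 :: "'a \<Rightarrow> real" and S
  assumes ap1: "Ap p q \<omega>1" and ap2: "Ap p q \<omega>2" and ap3: "Ap p2 q2 \<omega>3"
    and exps: "1 / p0 = 1 / p + 1 / p2" and \<nu>: "\<And>x. x \<in> space M \<Longrightarrow> \<nu> x = \<omega>1 x / \<omega>2 x"
    and sp: "sparse S" and sf: "sigma_finite_measure M"
begin

lemma bilinear_estimate:
  assumes T: "T \<subseteq> S"
    and K: "0 \<le> K"
    and f1: "\<And>f h. f \<in> borel_measurable M \<Longrightarrow> h \<in> borel_measurable M \<Longrightarrow>
      form T f h \<le> ennreal K * (wnorm M p \<omega>1 f * dnorm M q \<omega>2 h)"
    and f2: "\<And>f h. f \<in> borel_measurable M \<Longrightarrow> h \<in> borel_measurable M \<Longrightarrow>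
      form T h f \<le> ennreal K * (dnorm M q \<omega>2 h * enorm M p (\<lambda>x. f x * ennreal (1 / (1 / \<omega>1 x))))"
    and C3: "0 \<le> C3" "\<And>g. g \<in> borel_measurable M \<Longrightarrow> wnorm M p2 \<omega>3 (dmax M \<D> g) \<le> ennreal C3 * wnorm M p2 \<omega>3 g"
    and fg: "f \<in> borel_measurable M" "g \<in> borel_measurable M"
  shows "enorm M p0 (\<lambda>x. bilin T f g x * ennreal (\<omega>2 x * \<omega>3 x)) \<le>
      ennreal (K * C3) * (wnorm M p \<omega>1 f * wnorm M p2 \<omega>3 g)" (is "?A \<le> ?R")
    and "enorm M p0 (\<lambda>x. bilin_adj T f g x * ennreal (\<omega>2 x * \<omega>3 x)) \<le>
      ennreal (K * C3) * (wnorm M p \<omega>1 f * wnorm M p2 \<omega>3 g)" (is "?B \<le> ?R")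
proof -
  have p: "1 < p" using ap1 by (auto simp: Ap_def)
  have w: "\<omega>2 \<in> borel_measurable M" "\<And>x. x \<in> space M \<Longrightarrow> 0 < \<omega>2 x" using ap2 by (auto simp: Ap_def)
  have TD: "T \<subseteq> \<D>" using T sp by (auto simp: sparse_def)
  have eq: "ennreal K * wnorm M p \<omega>1 f * (ennreal C3 * wnorm M p2 \<omega>3 g) = ?R"
    using K C3(1) by (simp add: ennreal_mult mult_ac)
  show "?A \<le> ?R"
    unfolding eq[symmetric]
    by (rule bilinear_from_linear[OF p ap3 exps C3(2) w lin_measurable(1)[OF TD] fg(2)
        lin_norm_le[OF ap2 sf TD f1[OF fg(1)] fg(1)] bilin_le(1)[OF TD]])
  show "?B \<le> ?R"
    unfolding eq[symmetric]
    by (rule bilinear_from_linear[OF p ap3 exps C3(2) w lin_measurable(2)[OF TD] fg(2)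
        lin_adj_norm_le[OF ap2 sf TD f2[OF fg(1)] fg(1)] bilin_le(2)[OF TD]])
qed

text \<open>The exchange of the two sides of the form keeps \<open>\<nu>\<close>, so \<open>form_bounded\<close> and \<open>form_tail\<close> also apply after it.\<close>
lemma \<nu>_dual: "x \<in> space M \<Longrightarrow> \<nu> x = (1 / \<omega>2 x) / (1 / \<omega>1 x)"
  using \<nu> by simp

theorem bilinear_bounded:
  obtains C :: real where "0 \<le> C"
    "\<And>f g. f \<in> borel_measurable M \<Longrightarrow> g \<in> borel_measurable M \<Longrightarrow>
      enorm M p0 (\<lambda>x. bilin S f g x * ennreal (\<omega>2 x * \<omega>3 x)) \<le>
      ennreal C * (wnorm M p \<omega>1 f * wnorm M p2 \<omega>3 g)"
    "\<And>f g. f \<in> borel_measurable M \<Longrightarrow> g \<in> borel_measurable M \<Longrightarrow>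
      enorm M p0 (\<lambda>x. bilin_adj S f g x * ennreal (\<omega>2 x * \<omega>3 x)) \<le>
      ennreal C * (wnorm M p \<omega>1 f * wnorm M p2 \<omega>3 g)"
    "\<And>f. f \<in> borel_measurable M \<Longrightarrow> wnorm M p \<omega>2 (lin_adj S f) \<le> ennreal C * wnorm M p \<omega>1 f"
proof -
  obtain K1 where K1: "0 \<le> K1" "\<And>f h. f \<in> borel_measurable M \<Longrightarrow> h \<in> borel_measurable M \<Longrightarrow>
      form S f h \<le> ennreal K1 * (wnorm M p \<omega>1 f * dnorm M q \<omega>2 h)"
    using form_bounded[OF ap1 ap2 \<nu> sp sf] by blast
  obtain K2 where K2: "0 \<le> K2" "\<And>h f. h \<in> borel_measurable M \<Longrightarrow> f \<in> borel_measurable M \<Longrightarrow>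
      form S h f \<le> ennreal K2 * (dnorm M q \<omega>2 h * enorm M p (\<lambda>x. f x * ennreal (1 / (1 / \<omega>1 x))))"
    using form_bounded[OF Ap_dual[OF ap2] Ap_dual[OF ap1] \<nu>_dual sp sf] by blast
  obtain C3 where C3: "0 \<le> C3" "\<And>g. g \<in> borel_measurable M \<Longrightarrow> wnorm M p2 \<omega>3 (dmax M \<D> g) \<le> ennreal C3 * wnorm M p2 \<omega>3 g"
    using Ap_max_bounded[OF ap3] by blast
  define K where "K = max K1 K2"
  have K: "0 \<le> K" "ennreal K1 \<le> ennreal K" "ennreal K2 \<le> ennreal K" using K1 by (auto simp: K_def intro: ennreal_leI)
  have f1: "form S f h \<le> ennreal K * (wnorm M p \<omega>1 f * dnorm M q \<omega>2 h)"
    if "f \<in> borel_measurable M" "h \<in> borel_measurable M" for f h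
    using K1(2)[OF that] K(2) by (meson mult_right_mono order_trans zero_le)
  have f2: "form S h f \<le> ennreal K * (dnorm M q \<omega>2 h * enorm M p (\<lambda>x. f x * ennreal (1 / (1 / \<omega>1 x))))"
    if "f \<in> borel_measurable M" "h \<in> borel_measurable M" for f h
    using K2(2)[OF that(2,1)] K(3) by (meson mult_right_mono order_trans zero_le)
  note est = bilinear_estimate[OF order_refl K(1) f1 f2 C3]
  have SD: "S \<subseteq> \<D>" using sp by (auto simp: sparse_def)
  show ?thesis
  proof (rule that[of "max (K * C3) K"])
    show "0 \<le> max (K * C3) K" using K by auto
    have le: "ennreal (K * C3) \<le> ennreal (max (K * C3) K)" "ennreal K \<le> ennreal (max (K * C3) K)"
      by (auto intro: ennreal_leI)
    fix f g :: "'a \<Rightarrow> ennreal" assume m: "f \<in> borel_measurable M" "g \<in> borel_measurable M"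
    show "enorm M p0 (\<lambda>x. bilin S f g x * ennreal (\<omega>2 x * \<omega>3 x)) \<le>
      ennreal (max (K * C3) K) * (wnorm M p \<omega>1 f * wnorm M p2 \<omega>3 g)"
      by (rule order_trans[OF est(1)[OF _ _ _ _ _ m]]) (use f1 f2 C3 le in \<open>auto intro: mult_right_mono\<close>)
    show "enorm M p0 (\<lambda>x. bilin_adj S f g x * ennreal (\<omega>2 x * \<omega>3 x)) \<le>
      ennreal (max (K * C3) K) * (wnorm M p \<omega>1 f * wnorm M p2 \<omega>3 g)"
      by (rule order_trans[OF est(2)[OF _ _ _ _ _ m]]) (use f1 f2 C3 le in \<open>auto intro: mult_right_mono\<close>)
    show "wnorm M p \<omega>2 (lin_adj S f) \<le> ennreal (max (K * C3) K) * wnorm M p \<omega>1 f"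
      by (rule order_trans[OF lin_adj_norm_le[OF ap2 sf SD f2[OF m(1)] m(1)]]) (use le in \<open>auto intro: mult_right_mono\<close>)
  qed
qed

theorem bilinear_tail:
  assumes \<delta>: "0 < \<delta>"
  obtains S0 where "finite S0" "S0 \<subseteq> S"
    "\<And>f g. f \<in> borel_measurable M \<Longrightarrow> g \<in> borel_measurable M \<Longrightarrow>
      enorm M p0 (\<lambda>x. bilin (S - S0) f g x * ennreal (\<omega>2 x * \<omega>3 x)) \<le>
      ennreal \<delta> * (wnorm M p \<omega>1 f * wnorm M p2 \<omega>3 g)"
    "\<And>f g. f \<in> borel_measurable M \<Longrightarrow> g \<in> borel_measurable M \<Longrightarrow>
      enorm M p0 (\<lambda>x. bilin_adj (S - S0) f g x * ennreal (\<omega>2 x * \<omega>3 x)) \<le>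
      ennreal \<delta> * (wnorm M p \<omega>1 f * wnorm M p2 \<omega>3 g)"
proof -
  obtain C3 where C3: "0 \<le> C3" "\<And>g. g \<in> borel_measurable M \<Longrightarrow> wnorm M p2 \<omega>3 (dmax M \<D> g) \<le> ennreal C3 * wnorm M p2 \<omega>3 g"
    using Ap_max_bounded[OF ap3] by blast
  define K where "K = \<delta> / (C3 + 1)"
  have K: "0 < K" "K * C3 \<le> \<delta>" using \<delta> C3(1) by (auto simp: K_def field_simps)
  obtain S1 where S1: "finite S1" "S1 \<subseteq> S" "\<And>f h. f \<in> borel_measurable M \<Longrightarrow> h \<in> borel_measurable M \<Longrightarrow>
      form (S - S1) f h \<le> ennreal K * (wnorm M p \<omega>1 f * dnorm M q \<omega>2 h)"
    using form_tail[OF ap1 ap2 \<nu> sp sf K(1)] by blast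
  obtain S2 where S2: "finite S2" "S2 \<subseteq> S" "\<And>h f. h \<in> borel_measurable M \<Longrightarrow> f \<in> borel_measurable M \<Longrightarrow>
      form (S - S2) h f \<le> ennreal K * (dnorm M q \<omega>2 h * enorm M p (\<lambda>x. f x * ennreal (1 / (1 / \<omega>1 x))))"
    using form_tail[OF Ap_dual[OF ap2] Ap_dual[OF ap1] \<nu>_dual sp sf K(1)] by blast
  let ?S0 = "S1 \<union> S2"
  have mono: "form (S - ?S0) f h \<le> form (S - S1) f h" "form (S - ?S0) f h \<le> form (S - S2) f h" for f h
    unfolding form_def by (intro nn_integral_count_space_mono_set; auto)+
  have f1: "form (S - ?S0) f h \<le> ennreal K * (wnorm M p \<omega>1 f * dnorm M q \<omega>2 h)"
    if "f \<in> borel_measurable M" "h \<in> borel_measurable M" for f h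
    using order_trans[OF mono(1) S1(3)[OF that]] .
  have f2: "form (S - ?S0) h f \<le> ennreal K * (dnorm M q \<omega>2 h * enorm M p (\<lambda>x. f x * ennreal (1 / (1 / \<omega>1 x))))"
    if "f \<in> borel_measurable M" "h \<in> borel_measurable M" for f h
    using order_trans[OF mono(2) S2(3)[OF that(2,1)]] .
  note est = bilinear_estimate[OF Diff_subset less_imp_le[OF K(1)] f1 f2 C3]
  have le: "ennreal (K * C3) \<le> ennreal \<delta>" using K by (intro ennreal_leI)
  show ?thesis
  proof (rule that[of ?S0])
    show "finite ?S0" "?S0 \<subseteq> S" using S1 S2 by auto
    fix f g :: "'a \<Rightarrow> ennreal" assume m: "f \<in> borel_measurable M" "g \<in> borel_measurable M"
    show "enorm M p0 (\<lambda>x. bilin (S - ?S0) f g x * ennreal (\<omega>2 x * \<omega>3 x)) \<le>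
      ennreal \<delta> * (wnorm M p \<omega>1 f * wnorm M p2 \<omega>3 g)"
      by (rule order_trans[OF est(1)[OF _ _ _ _ _ m]]) (use f1 f2 C3 le in \<open>auto intro: mult_right_mono\<close>)
    show "enorm M p0 (\<lambda>x. bilin_adj (S - ?S0) f g x * ennreal (\<omega>2 x * \<omega>3 x)) \<le>
      ennreal \<delta> * (wnorm M p \<omega>1 f * wnorm M p2 \<omega>3 g)"
      by (rule order_trans[OF est(2)[OF _ _ _ _ _ m]]) (use f1 f2 C3 le in \<open>auto intro: mult_right_mono\<close>)
  qed
qed

end

section \<open>Spaces of homogeneous type\<close>

locale homogeneous =
  fixes M :: "'a measure" and d :: "'a \<Rightarrow> 'a \<Rightarrow> real"
  assumes ht: "homogeneous_type M d"
begin

lemma d_sym: "x \<in> space M \<Longrightarrow> y \<in> space M \<Longrightarrow> d x y = d y x"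
  and d_self: "x \<in> space M \<Longrightarrow> d x x = 0"
  using ht by (auto simp: homogeneous_type_def quasi_metric_on_def)

lemma quasi_triangle:
  obtains A0 where "1 \<le> A0" "\<And>x y z. x \<in> space M \<Longrightarrow> y \<in> space M \<Longrightarrow> z \<in> space M \<Longrightarrow> d x y \<le> A0 * (d x z + d z y)"
proof -
  have "\<exists>A0\<ge>1. \<forall>x\<in>space M. \<forall>y\<in>space M. \<forall>z\<in>space M. d x y \<le> A0 * (d x z + d z y)"
    using ht unfolding homogeneous_type_def quasi_metric_on_def by (elim conjE)
  then obtain A0 where "1 \<le> A0" "\<forall>x\<in>space M. \<forall>y\<in>space M. \<forall>z\<in>space M. d x y \<le> A0 * (d x z + d z y)"
    by (elim exE conjE)
  then show ?thesis using that[of A0] by simp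
qed

lemma ball_sets [measurable]: "x \<in> space M \<Longrightarrow> 0 < r \<Longrightarrow> qball M d x r \<in> sets M"
  using ht by (auto simp: homogeneous_type_def)

lemma ball_finite: "x \<in> space M \<Longrightarrow> 0 < r \<Longrightarrow> emeasure M (qball M d x r) < top"
  using ht by (auto simp: homogeneous_type_def)

lemma ball_mono: "r \<le> s \<Longrightarrow> qball M d x r \<subseteq> qball M d x s"
  by (auto simp: qball_def)

lemma center_in_ball: "x \<in> space M \<Longrightarrow> 0 < r \<Longrightarrow> x \<in> qball M d x r"
  by (simp add: qball_def d_self)

lemma doubling_pow:
  obtains C :: real where "0 \<le> C" "\<And>x r n. x \<in> space M \<Longrightarrow> 0 < r \<Longrightarrow>
    emeasure M (qball M d x (2 ^ n * r)) \<le> ennreal (C ^ n) * emeasure M (qball M d x r)"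
proof -
  obtain C :: real where C: "\<And>x r. x \<in> space M \<Longrightarrow> 0 < r \<Longrightarrow>
     emeasure M (qball M d x (2 * r)) \<le> ennreal C * emeasure M (qball M d x r)"
    using ht unfolding homogeneous_type_def by blast
  let ?C = "max C 0"
  have C': "emeasure M (qball M d x (2 * r)) \<le> ennreal ?C * emeasure M (qball M d x r)" if "x \<in> space M" "0 < r" for x r
    using C[OF that] by (cases "0 \<le> C") (auto simp: max_def ennreal_neg)
  have "emeasure M (qball M d x (2 ^ n * r)) \<le> ennreal (?C ^ n) * emeasure M (qball M d x r)"
    if x: "x \<in> space M" "0 < r" for x r n
  proof (induction n)
    case (Suc n)
    have "emeasure M (qball M d x (2 ^ Suc n * r)) \<le> ennreal ?C * emeasure M (qball M d x (2 ^ n * r))"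
      using C'[of x "2 ^ n * r"] x by (simp add: mult.assoc)
    also have "\<dots> \<le> ennreal ?C * (ennreal (?C ^ n) * emeasure M (qball M d x r))"
      by (intro mult_left_mono Suc) auto
    finally show ?case by (simp add: ennreal_mult mult.assoc)
  qed simp
  then show ?thesis using that[of ?C] by simp
qed

lemma doubling:
  fixes t :: real
  obtains K :: real where "1 \<le> K" "\<And>x r. x \<in> space M \<Longrightarrow> 0 < r \<Longrightarrow>
    emeasure M (qball M d x (t * r)) \<le> ennreal K * emeasure M (qball M d x r)"
proof -
  obtain C :: real where C: "0 \<le> C" "\<And>x r n. x \<in> space M \<Longrightarrow> 0 < r \<Longrightarrow>
    emeasure M (qball M d x (2 ^ n * r)) \<le> ennreal (C ^ n) * emeasure M (qball M d x r)"
    by (rule doubling_pow) blast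
  obtain n where n: "t < 2 ^ n" using real_arch_pow[of 2 t] by auto
  show ?thesis
  proof (rule that[of "max 1 (C ^ n)"])
    fix x r assume x: "x \<in> space M" "0 < (r::real)"
    have "emeasure M (qball M d x (t * r)) \<le> emeasure M (qball M d x (2 ^ n * r))"
      using n x by (intro emeasure_mono ball_mono ball_sets) auto
    also have "\<dots> \<le> ennreal (C ^ n) * emeasure M (qball M d x r)" by (rule C(2)[OF x])
    also have "\<dots> \<le> ennreal (max 1 (C ^ n)) * emeasure M (qball M d x r)"
      by (intro mult_right_mono ennreal_leI) auto
    finally show "emeasure M (qball M d x (t * r)) \<le> ennreal (max 1 (C ^ n)) * emeasure M (qball M d x r)" .
  qed simp
qed

lemma Union_balls:
  assumes "x \<in> space M" "0 < r"
  shows "(\<Union>n::nat. qball M d x (2 ^ n * r)) = space M"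
proof
  show "space M \<subseteq> (\<Union>n::nat. qball M d x (2 ^ n * r))"
  proof
    fix y assume y: "y \<in> space M"
    obtain n where "d x y / r < 2 ^ n" using real_arch_pow[of 2 "d x y / r"] by auto
    then have "d x y < 2 ^ n * r" using assms by (simp add: pos_divide_less_eq)
    then show "y \<in> (\<Union>n::nat. qball M d x (2 ^ n * r))" using y by (auto simp: qball_def)
  qed
qed (auto simp: qball_def)

lemma ball_pos:
  assumes x: "x \<in> space M" "0 < r"
  shows "0 < emeasure M (qball M d x r)"
proof (rule ccontr)
  assume "\<not> ?thesis"
  then have 0: "emeasure M (qball M d x r) = 0" by (simp add: zero_less_iff_neq_zero)
  obtain C :: real where C: "0 \<le> C" "\<And>x r n. x \<in> space M \<Longrightarrow> 0 < r \<Longrightarrow>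
    emeasure M (qball M d x (2 ^ n * r)) \<le> ennreal (C ^ n) * emeasure M (qball M d x r)"
    by (rule doubling_pow) blast
  have "emeasure M (qball M d x (2 ^ n * r)) = 0" for n
    using C(2)[OF x, of n] 0 by simp
  then have "(\<Union>n::nat. qball M d x (2 ^ n * r)) \<in> null_sets M"
    using x by (intro null_sets_UN) (auto simp: null_sets_def)
  then have "emeasure M (space M) = 0" using Union_balls[OF x] by auto
  then show False using ht by (simp add: homogeneous_type_def)
qed

lemma space_nonempty: "space M \<noteq> {}"
  using ht by (auto simp: homogeneous_type_def emeasure_empty)

lemma sigma_finite: "sigma_finite_measure M"
proof -
  obtain x where x: "x \<in> space M" using space_nonempty by auto
  show ?thesis
  proof
    show "\<exists>A. countable A \<and> A \<subseteq> sets M \<and> \<Union>A = space M \<and> (\<forall>a\<in>A. emeasure M a \<noteq> \<infinity>)"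
      using Union_balls[OF x, of 1] x ball_finite[of x]
      by (intro exI[of _ "range (\<lambda>n::nat. qball M d x (2 ^ n * 1))"]) (auto simp: less_top[symmetric] intro!: ball_sets)
  qed
qed

text \<open>The space is the union of an increasing sequence of balls.\<close>
lemma loc_integrable_measurable:
  fixes f :: "'a \<Rightarrow> 'k::{banach, second_countable_topology}"
  assumes "loc_integrable M d f"
  shows "f \<in> borel_measurable M"
proof -
  obtain x0 where x0: "x0 \<in> space M" using space_nonempty by auto
  let ?B = "\<lambda>n::nat. qball M d x0 (2 ^ n * 1)"
  show ?thesis
  proof (rule borel_measurable_LIMSEQ_metric)
    show "(\<lambda>x. indicator (?B n) x *\<^sub>R f x) \<in> borel_measurable M" for n
      using assms x0 unfolding loc_integrable_def set_integrable_def by (auto intro!: borel_measurable_integrable)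
    fix x assume "x \<in> space M"
    then obtain m where m: "x \<in> ?B m" using Union_balls[OF x0, of 1] by auto
    have "eventually (\<lambda>n. indicator (?B n) x *\<^sub>R f x = f x) sequentially"
      using eventually_ge_at_top[of m]
    proof eventually_elim
      case (elim n)
      have "(2::real) ^ m * 1 \<le> 2 ^ n * 1" using elim by simp
      then have "x \<in> ?B n" using m ball_mono by blast
      then show ?case by simp
    qed
    then show "(\<lambda>n. indicator (?B n) x *\<^sub>R f x) \<longlonglongrightarrow> f x" by (rule tendsto_eventually)
  qed
qed

text \<open>An everywhere positive \<open>p\<close>-th root. Changing the weight on a null set keeps all integrals, and the condition on
averages, raised to the power \<open>1 / p\<close>, becomes the symmetric condition on norms.\<close>
lemma muckenhoupt_root:
  assumes mw: "muckenhoupt M d p lam" and p: "1 < p" and pq: "1 / p + 1 / q = 1"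
  obtains \<omega> :: "'a \<Rightarrow> real" and C :: real where "\<omega> \<in> borel_measurable M" "\<And>x. x \<in> space M \<Longrightarrow> 0 < \<omega> x"
    "AE x in M. 0 < lam x \<and> \<omega> x = lam x powr (1 / p)" "1 \<le> C"
    "\<And>x r. x \<in> space M \<Longrightarrow> 0 < r \<Longrightarrow>
       wcube M p \<omega> (qball M d x r) *
       dcube M q \<omega> (qball M d x r) \<le> ennreal C * emeasure M (qball M d x r)"
proof -
  note q = conjugate_exponent[OF p pq]
  have lp: "AE x in M. 0 < lam x" and li: "loc_integrable M d lam"
    and ls: "loc_integrable M d (\<lambda>x. lam x powr (- 1 / (p - 1)))"
    using mw by (auto simp: muckenhoupt_def weight_def)
  obtain C0 where C0: "\<And>x r. x \<in> space M \<Longrightarrow> 0 < r \<Longrightarrow> avg M (qball M d x r) lam *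
        avg M (qball M d x r) (\<lambda>y. lam y powr (- 1 / (p - 1))) powr (p - 1) \<le> C0"
    using mw unfolding muckenhoupt_def by blast
  have [measurable]: "lam \<in> borel_measurable M" by (rule loc_integrable_measurable[OF li])
  \<comment> \<open>the value 1 is arbitrary; it is taken on a null set\<close>
  define \<omega> where "\<omega> x = (if 0 < lam x then lam x powr (1 / p) else 1)" for x
  have [measurable]: "\<omega> \<in> borel_measurable M" unfolding \<omega>_def by measurable
  define C where "C = max C0 1 powr (1 / p)"
  have "(q - 1) * (p - 1) = 1" using q by (simp add: algebra_simps)
  then have "q - 1 = 1 / (p - 1)" using p by (simp add: eq_divide_eq)
  then have qp: "- q * (1 / p) = - 1 / (p - 1)" using q(5) by simp
  show ?thesis
  proof (rule that[of \<omega> C])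
    show "\<omega> \<in> borel_measurable M" by measurable
    show "0 < \<omega> x" for x by (simp add: \<omega>_def)
    show "AE x in M. 0 < lam x \<and> \<omega> x = lam x powr (1 / p)"
      using lp by eventually_elim (simp add: \<omega>_def)
    show "1 \<le> C" unfolding C_def using p by (intro ge_one_powr_ge_zero) auto
    fix x r assume x: "x \<in> space M" "0 < (r::real)"
    let ?B = "qball M d x r"
    have [measurable]: "?B \<in> sets M" using x by auto
    define m where "m = measure M ?B"
    have m: "emeasure M ?B = ennreal m" "0 < m"
      using ball_pos[OF x] ball_finite[OF x] by (simp_all add: m_def measure_def enn2real_positive_iff)
    define a where "a = (LINT y:?B|M. lam y)"
    define s where "s = (LINT y:?B|M. lam y powr (- 1 / (p - 1)))"
    have "AE y in M. indicator ?B y *\<^sub>R lam y \<ge> 0" using lp by eventually_elim (auto simp: indicator_def)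
    then have a: "(\<integral>\<^sup>+y. ennreal (indicator ?B y *\<^sub>R lam y) \<partial>M) = ennreal a" "0 \<le> a"
      unfolding a_def set_lebesgue_integral_def using li x
      by (auto intro!: nn_integral_eq_integral integral_nonneg_AE simp: loc_integrable_def set_integrable_def)
    have s: "(\<integral>\<^sup>+y. ennreal (indicator ?B y *\<^sub>R lam y powr (- 1 / (p - 1))) \<partial>M) = ennreal s" "0 \<le> s"
      unfolding s_def set_lebesgue_integral_def using ls x
      by (auto intro!: nn_integral_eq_integral integral_nonneg_AE simp: loc_integrable_def set_integrable_def)
    have 1: "wcube M p \<omega> ?B = ennreal (a powr (1 / p))"
    proof -
      have "(\<integral>\<^sup>+y. epow (ennreal (\<omega> y) * indicator ?B y) p \<partial>M) = (\<integral>\<^sup>+y. ennreal (indicator ?B y *\<^sub>R lam y) \<partial>M)"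
      proof (rule nn_integral_cong_AE)
        show "AE y in M. epow (ennreal (\<omega> y) * indicator ?B y) p = ennreal (indicator ?B y *\<^sub>R lam y)"
          using lp by eventually_elim (use p in \<open>auto simp: indicator_def \<omega>_def powr_powr\<close>)
      qed
      then show ?thesis using a by (simp add: enorm_def)
    qed
    have 2: "dcube M q \<omega> ?B = ennreal (s powr (1 / q))"
    proof -
      have "(\<integral>\<^sup>+y. epow (ennreal (1 / \<omega> y) * indicator ?B y) q \<partial>M) = (\<integral>\<^sup>+y. ennreal (indicator ?B y *\<^sub>R lam y powr (- 1 / (p - 1))) \<partial>M)"
      proof (rule nn_integral_cong_AE)
        show "AE y in M. epow (ennreal (1 / \<omega> y) * indicator ?B y) q = ennreal (indicator ?B y *\<^sub>R lam y powr (- 1 / (p - 1)))"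
          using lp
        proof eventually_elim
          case (elim y)
          have "1 / \<omega> y = lam y powr (- (1 / p))" using elim by (simp add: \<omega>_def powr_minus_divide)
          then have "(1 / \<omega> y) powr q = lam y powr (- 1 / (p - 1))"
            using qp by (simp add: powr_powr mult.commute)
          then show ?case by (auto simp: indicator_def \<omega>_def)
        qed
      qed
      then show ?thesis using s by (simp add: enorm_def)
    qed
    have "a powr (1 / p) * s powr (1 / q) \<le> C * m"
    proof -
      have "(a / m) * (s / m) powr (p - 1) \<le> max C0 1"
        using C0[OF x] by (simp add: avg_def a_def s_def m_def)
      then have "((a / m) * (s / m) powr (p - 1)) powr (1 / p) \<le> C"
        unfolding C_def using p a s m by (intro powr_mono2) auto
      also have "((a / m) * (s / m) powr (p - 1)) powr (1 / p) = (a / m) powr (1 / p) * (s / m) powr (1 / q)"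
      proof -
        have "(p - 1) * (1 / p) = 1 / q" using p pq by (simp add: field_simps)
        then show ?thesis using powr_mult[of "a / m" "(s / m) powr (p - 1)" "1 / p"] a s m
          by (simp only: powr_powr)
      qed
      also have "\<dots> = a powr (1 / p) * s powr (1 / q) / (m powr (1 / p) * m powr (1 / q))"
        using a s m by (simp add: powr_divide)
      also have "m powr (1 / p) * m powr (1 / q) = m" using m pq by (simp flip: powr_add)
      finally show ?thesis using m by (simp add: pos_divide_le_eq)
    qed
    then have "ennreal (a powr (1 / p) * s powr (1 / q)) \<le> ennreal (C * m)" by (rule ennreal_leI)
    moreover have "0 \<le> C" by (simp add: C_def)
    ultimately show "wcube M p \<omega> ?B *
       dcube M q \<omega> ?B \<le> ennreal C * emeasure M ?B"
      unfolding 1 2 m(1) using m(2) by (simp add: ennreal_mult)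
  qed
qed

end

text \<open>Hoelder's inequality for \<open>\<omega>\<^sub>1 / \<omega>\<^sub>2\<close> and for \<open>\<omega>\<^sub>2 / \<omega>\<^sub>1\<close>.\<close>
lemma A2_from_Ap:
  assumes p: "1 < p" "1 / p + 1 / q = 1"
    and [measurable]: "\<omega>1 \<in> borel_measurable M" "\<omega>2 \<in> borel_measurable M" "R \<in> sets M"
    and pos: "\<And>x. x \<in> space M \<Longrightarrow> 0 < \<omega>1 x" "\<And>x. x \<in> space M \<Longrightarrow> 0 < \<omega>2 x"
    and C: "wcube M p \<omega>1 R * dcube M q \<omega>1 R \<le> ennreal C1 * emeasure M R"
      "wcube M p \<omega>2 R * dcube M q \<omega>2 R \<le> ennreal C2 * emeasure M R"
      "0 \<le> C1" "0 \<le> C2"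
  shows "(\<integral>\<^sup>+x\<in>R. ennreal (\<omega>1 x / \<omega>2 x) \<partial>M) * (\<integral>\<^sup>+x\<in>R. ennreal (1 / (\<omega>1 x / \<omega>2 x)) \<partial>M) \<le> ennreal (C1 * C2) * (emeasure M R * emeasure M R)"
proof -
  have H: "(\<integral>\<^sup>+x\<in>R. ennreal (u x / v x) \<partial>M) \<le> enorm M p (\<lambda>y. ennreal (u y) * indicator R y) * enorm M q (\<lambda>y. ennreal (1 / v y) * indicator R y)"
    if [measurable]: "u \<in> borel_measurable M" "v \<in> borel_measurable M" and pos: "\<And>x. x \<in> space M \<Longrightarrow> 0 < u x" "\<And>x. x \<in> space M \<Longrightarrow> 0 < v x"
    for u v :: "'a \<Rightarrow> real"
  proof -
    have "(\<integral>\<^sup>+x\<in>R. ennreal (u x / v x) \<partial>M) = (\<integral>\<^sup>+x. (ennreal (u x) * indicator R x) * (ennreal (1 / v x) * indicator R x) \<partial>M)"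
    proof (rule nn_integral_cong)
      fix x assume "x \<in> space M"
      then have "ennreal (u x / v x) = ennreal (u x) * ennreal (1 / v x)" using pos[of x] by (simp flip: ennreal_mult)
      then show "ennreal (u x / v x) * indicator R x = (ennreal (u x) * indicator R x) * (ennreal (1 / v x) * indicator R x)"
        by (auto simp: indicator_def)
    qed
    also have "\<dots> \<le> enorm M p (\<lambda>y. ennreal (u y) * indicator R y) * enorm M q (\<lambda>y. ennreal (1 / v y) * indicator R y)"
      by (rule Holder_nn_integral[OF p]) auto
    finally show ?thesis .
  qed
  have "(\<integral>\<^sup>+x\<in>R. ennreal (\<omega>1 x / \<omega>2 x) \<partial>M) * (\<integral>\<^sup>+x\<in>R. ennreal (1 / (\<omega>1 x / \<omega>2 x)) \<partial>M) =
     (\<integral>\<^sup>+x\<in>R. ennreal (\<omega>1 x / \<omega>2 x) \<partial>M) * (\<integral>\<^sup>+x\<in>R. ennreal (\<omega>2 x / \<omega>1 x) \<partial>M)" by simp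
  also have "\<dots> \<le> (wcube M p \<omega>1 R * dcube M q \<omega>2 R) *
     (wcube M p \<omega>2 R * dcube M q \<omega>1 R)"
    by (intro mult_mono H pos) auto
  also have "\<dots> = (wcube M p \<omega>1 R * dcube M q \<omega>1 R) *
     (wcube M p \<omega>2 R * dcube M q \<omega>2 R)"
    by (simp only: mult_ac)
  also have "\<dots> \<le> (ennreal C1 * emeasure M R) * (ennreal C2 * emeasure M R)" by (intro mult_mono C) auto
  also have "\<dots> = ennreal (C1 * C2) * (emeasure M R * emeasure M R)" using C(3,4) by (simp add: ennreal_mult mult_ac)
  finally show ?thesis .
qed

locale homogeneous_dyadic = homogeneous +
  fixes \<delta> c1 C1 :: real and Dk :: "int \<Rightarrow> 'a set set" and cen :: "int \<Rightarrow> 'a set \<Rightarrow> 'a"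
  assumes params: "0 < \<delta>" "\<delta> < 1" "0 < c1" "c1 \<le> C1"
    and countable_all: "countable (\<Union>k. Dk k)"
    and borel: "(\<Union>k. Dk k) \<subseteq> qborel M d"
    and part: "partition_on (space M) (Dk k)"
    and gen_nested: "k \<le> l \<Longrightarrow> Q \<in> Dk k \<Longrightarrow> R \<in> Dk l \<Longrightarrow> R \<subseteq> Q \<or> R \<inter> Q = {}"
    and ancestor: "l \<le> k \<Longrightarrow> Q \<in> Dk k \<Longrightarrow> \<exists>!R. R \<in> Dk l \<and> Q \<subseteq> R"
    and center: "Q \<in> Dk k \<Longrightarrow> cen k Q \<in> Q"
    and inner: "Q \<in> Dk k \<Longrightarrow> qball M d (cen k Q) (c1 * \<delta> powi k) \<subseteq> Q"
    and outer: "Q \<in> Dk k \<Longrightarrow> Q \<subseteq> qball M d (cen k Q) (C1 * \<delta> powi k)"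
begin

abbreviation "DD \<equiv> \<Union>k. Dk k"

lemma rad_pos: "0 < C1 * \<delta> powi k" "0 < c1 * \<delta> powi k"
  using params by (auto intro!: mult_pos_pos zero_less_power_int)

lemma cube_subset_space: "Q \<in> Dk k \<Longrightarrow> Q \<subseteq> space M"
  using partition_onD1[OF part] by auto

lemma cen_space: "Q \<in> Dk k \<Longrightarrow> cen k Q \<in> space M"
  using center cube_subset_space by blast

lemma cube_sets: "Q \<in> DD \<Longrightarrow> Q \<in> sets M"
  using borel ht by (auto simp: homogeneous_type_def)

lemma outer_ball_le:
  fixes t :: real
  obtains K :: real where "1 \<le> K" "\<And>k Q. Q \<in> Dk k \<Longrightarrow> emeasure M (qball M d (cen k Q) (t * \<delta> powi k)) \<le> ennreal K * emeasure M Q"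
proof -
  obtain K where K: "1 \<le> K" "\<And>x r. x \<in> space M \<Longrightarrow> 0 < r \<Longrightarrow>
    emeasure M (qball M d x ((t / c1) * r)) \<le> ennreal K * emeasure M (qball M d x r)"
    by (rule doubling) blast
  show ?thesis
  proof (rule that[OF K(1)])
    fix k Q assume Q: "Q \<in> Dk k"
    have "emeasure M (qball M d (cen k Q) ((t / c1) * (c1 * \<delta> powi k))) \<le> ennreal K * emeasure M (qball M d (cen k Q) (c1 * \<delta> powi k))"
      using cen_space[OF Q] rad_pos by (intro K) auto
    also have "\<dots> \<le> ennreal K * emeasure M Q"
      using inner[OF Q] cube_sets Q by (intro mult_left_mono emeasure_mono) auto
    finally show "emeasure M (qball M d (cen k Q) (t * \<delta> powi k)) \<le> ennreal K * emeasure M Q"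
      using params by simp
  qed
qed

lemma cubes_nested:
  assumes "Q \<in> DD" "R \<in> DD"
  shows "Q \<subseteq> R \<or> R \<subseteq> Q \<or> Q \<inter> R = {}"
proof -
  obtain k l where "Q \<in> Dk k" "R \<in> Dk l" using assms by auto
  then show ?thesis using gen_nested[of k l Q R] gen_nested[of l k R Q] by (cases "k \<le> l") auto
qed

lemma cube_nonempty: "Q \<in> Dk k \<Longrightarrow> Q \<noteq> {}"
  using center by auto

sublocale positive_cubes M DD
proof
  show "countable DD" by (rule countable_all)
  show "DD \<subseteq> sets M" using cube_sets by auto
  fix Q assume "Q \<in> DD"
  then obtain k where k: "Q \<in> Dk k" by auto
  have "emeasure M Q \<le> emeasure M (qball M d (cen k Q) (C1 * \<delta> powi k))"
    using outer[OF k] cen_space[OF k] rad_pos by (intro emeasure_mono ball_sets) auto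
  also have "\<dots> < top" using cen_space[OF k] rad_pos by (intro ball_finite) auto
  finally show "emeasure M Q < top" .
  have "0 < emeasure M (qball M d (cen k Q) (c1 * \<delta> powi k))"
    using cen_space[OF k] rad_pos by (intro ball_pos) auto
  also have "\<dots> \<le> emeasure M Q" using inner[OF k] cube_sets k by (intro emeasure_mono) auto
  finally show "0 < emeasure M Q" .
qed (rule cubes_nested)

lemma Dk_unique:
  assumes "P \<in> Dk l" "R \<in> Dk m" "R' \<in> Dk m" "P \<subseteq> R" "P \<subseteq> R'"
  shows "R = R'"
proof -
  have "R \<inter> R' \<noteq> {}" using assms cube_nonempty by blast
  then show ?thesis using partition_onD2[OF part[of m]] assms(2,3) by (auto simp: pairwise_def disjnt_def)
qed

text \<open>A cube may be a cube of several generations, so the parent is found at the first generation (going up) that does not contain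
the cube any more. The parent lies in a ball about the centre of the cube whose radius is a fixed multiple of the inner radius.\<close>
lemma dyadic:
  obtains D where "dyadic_cubes M DD D"
proof -
  obtain A0 where A0: "1 \<le> A0" "\<And>x y z. x \<in> space M \<Longrightarrow> y \<in> space M \<Longrightarrow> z \<in> space M \<Longrightarrow> d x y \<le> A0 * (d x z + d z y)"
    by (rule quasi_triangle) blast
  obtain K where K: "1 \<le> K" "\<And>k Q. Q \<in> Dk k \<Longrightarrow> emeasure M (qball M d (cen k Q) ((2 * A0 * C1 / \<delta>) * \<delta> powi k)) \<le> ennreal K * emeasure M Q"
    by (rule outer_ball_le) blast
  show ?thesis
  proof (rule that[of K], unfold_locales)
    fix P R assume "P \<in> DD" "R \<in> DD"
    then obtain l k where P: "P \<in> Dk l" and R: "R \<in> Dk k" by auto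
    show "finite {P'\<in>DD. P \<subseteq> P' \<and> P' \<subseteq> R}"
    proof (rule finite_subset)
      show "{P'\<in>DD. P \<subseteq> P' \<and> P' \<subseteq> R} \<subseteq> {P, R} \<union> (\<Union>m\<in>{k..l}. {P'\<in>Dk m. P \<subseteq> P'})"
      proof
        fix P' assume "P' \<in> {P'\<in>DD. P \<subseteq> P' \<and> P' \<subseteq> R}"
        then obtain m where m: "P' \<in> Dk m" "P \<subseteq> P'" "P' \<subseteq> R" by auto
        have "P' = P" if "l < m" using gen_nested[of l m P P'] that P m cube_nonempty[OF P] by auto
        moreover have "P' = R" if "m < k" using gen_nested[of m k P' R] that R m cube_nonempty[OF m(1)] by auto
        ultimately show "P' \<in> {P, R} \<union> (\<Union>m\<in>{k..l}. {P'\<in>Dk m. P \<subseteq> P'})"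
          using m by (cases "l < m"; cases "m < k") auto
      qed
      have "finite {P'\<in>Dk m. P \<subseteq> P'}" for m
      proof (rule finite_subset)
        show "{P'\<in>Dk m. P \<subseteq> P'} \<subseteq> {SOME P'. P' \<in> Dk m \<and> P \<subseteq> P'}"
          using Dk_unique[OF P] by (auto intro!: some_equality[symmetric])
      qed simp
      then show "finite ({P, R} \<union> (\<Union>m\<in>{k..l}. {P'\<in>Dk m. P \<subseteq> P'}))" by simp
    qed
    assume PR: "P \<subset> R"
    have kl: "k < l"
      using gen_nested[of l k P R] P R PR cube_nonempty[OF P] by (cases "k < l") auto
    have Pk: "P \<notin> Dk k" using Dk_unique[OF P, of P k R] R PR by auto
    \<comment> \<open>the generations, from that of \<open>R\<close> on, at which \<open>P\<close> is a cube\<close>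
    define J where "J = {j\<in>{k..l}. P \<in> Dk j}"
    have J: "finite J" "l \<in> J"
  proof -
    have "J \<subseteq> {k..l}" by (auto simp: J_def)
    then show "finite J" by (rule finite_subset) simp
  qed (use P kl in \<open>auto simp: J_def\<close>)
    define j where "j = Min J"
    have j: "j \<in> J" using J unfolding j_def by (intro Min_in) auto
    have jmin: "j \<le> i" if "i \<in> J" for i using J that unfolding j_def by (intro Min_le) auto
    have Pj: "P \<in> Dk j" and kj: "k < j" using j Pk by (auto simp: J_def less_le)
    have Pm: "P \<notin> Dk (j - 1)" using jmin[of "j - 1"] kj j by (auto simp: J_def)
    obtain P' where P': "P' \<in> Dk (j - 1)" "P \<subseteq> P'" using ancestor[OF _ Pj, of "j - 1"] by auto
    have "P \<subset> P'" using P' Pm by auto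
    moreover have "P' \<subseteq> R" using gen_nested[of k "j - 1" R P'] kj R P' PR cube_nonempty[OF P] by auto
    moreover have "emeasure M P' \<le> ennreal K * emeasure M P"
    proof -
      let ?y = "cen j P" and ?c = "cen (j - 1) P'"
      have y: "?y \<in> P'" "?y \<in> space M" using center[OF Pj] P' cen_space[OF Pj] by auto
      have c: "?c \<in> space M" using cen_space[OF P'(1)] .
      have dj: "\<delta> powi (j - 1) = \<delta> powi j / \<delta>" using params by (simp add: power_int_diff)
      have "P' \<subseteq> qball M d ?y ((2 * A0 * C1 / \<delta>) * \<delta> powi j)"
      proof
        fix z assume z: "z \<in> P'"
        then have zs: "z \<in> space M" using cube_subset_space[OF P'(1)] by auto
        have 1: "d ?c z < C1 * \<delta> powi (j - 1)" "d ?c ?y < C1 * \<delta> powi (j - 1)"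
          using outer[OF P'(1)] z y by (auto simp: qball_def)
        have "d ?y z \<le> A0 * (d ?y ?c + d ?c z)" by (rule A0(2)) (use y zs c in auto)
        also have "\<dots> < A0 * (C1 * \<delta> powi (j - 1) + C1 * \<delta> powi (j - 1))"
          using 1 A0(1) d_sym[OF y(2) c] by (intro mult_strict_left_mono add_strict_mono) auto
        also have "\<dots> = (2 * A0 * C1 / \<delta>) * \<delta> powi j" unfolding dj by simp
        finally show "z \<in> qball M d ?y ((2 * A0 * C1 / \<delta>) * \<delta> powi j)" using zs by (simp add: qball_def)
      qed
      then have "emeasure M P' \<le> emeasure M (qball M d ?y ((2 * A0 * C1 / \<delta>) * \<delta> powi j))"
        using y params A0 by (intro emeasure_mono ball_sets) (auto intro!: mult_pos_pos divide_pos_pos zero_less_power_int)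
      also have "\<dots> \<le> ennreal K * emeasure M P" by (rule K(2)[OF Pj])
      finally show ?thesis .
    qed
    ultimately show "\<exists>P'\<in>DD. P \<subset> P' \<and> P' \<subseteq> R \<and> emeasure M P' \<le> ennreal K * emeasure M P"
      using P'(1) by blast
  next
    show "1 \<le> K" by (rule K(1))
  qed
qed

lemma fine_partition:
  assumes "R \<in> Dk k" "k \<le> l"
  shows "disjoint {Q\<in>Dk l. Q \<subseteq> R}" "\<Union>{Q\<in>Dk l. Q \<subseteq> R} = R"
proof -
  show "disjoint {Q\<in>Dk l. Q \<subseteq> R}"
    using partition_onD2[OF part[of l]] by (auto intro: pairwise_subset)
  show "\<Union>{Q\<in>Dk l. Q \<subseteq> R} = R"
  proof
    show "R \<subseteq> \<Union>{Q\<in>Dk l. Q \<subseteq> R}"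
    proof
      fix x assume x: "x \<in> R"
      then obtain Q where "Q \<in> Dk l" "x \<in> Q"
        using cube_subset_space[OF assms(1)] partition_onD1[OF part[of l]] by auto
      then show "x \<in> \<Union>{Q\<in>Dk l. Q \<subseteq> R}" using gen_nested[OF assms(2,1), of Q] x by auto
    qed
  qed auto
qed

lemma radius_tendsto:
  assumes "0 < a"
  obtains L where "\<And>k. L \<le> k \<Longrightarrow> C1 * \<delta> powi k < a"
proof -
  obtain n where n: "\<delta> ^ n < a / C1"
    using real_arch_pow_inv[of "a / C1" \<delta>] params assms by auto
  show ?thesis
  proof (rule that[of "int n"])
    fix k assume k: "int n \<le> k"
    then have "\<delta> powi k = \<delta> ^ nat k" by (simp add: power_int_def)
    also have "\<dots> \<le> \<delta> ^ n" using k params by (intro power_decreasing) auto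
    finally have "C1 * \<delta> powi k \<le> C1 * \<delta> ^ n" using params by (intro mult_left_mono) auto
    also have "\<dots> < a" using n params by (simp add: pos_less_divide_eq mult.commute)
    finally show "C1 * \<delta> powi k < a" .
  qed
qed

lemma radius_lower:
  obtains L where "\<And>k. k \<le> L \<Longrightarrow> a \<le> C1 * \<delta> powi k"
proof -
  obtain n where n: "\<delta> ^ n < C1 / (\<bar>a\<bar> + 1)"
    using real_arch_pow_inv[of "C1 / (\<bar>a\<bar> + 1)" \<delta>] params by auto
  show ?thesis
  proof (rule that[of "- int n"])
    fix k assume k: "k \<le> - int n"
    have "\<delta> powi k = inverse (\<delta> ^ nat (- k))" using k by (cases "k = 0") (auto simp: power_int_def field_simps)
    moreover have "\<delta> ^ nat (- k) \<le> \<delta> ^ n" using k params by (intro power_decreasing) auto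
    then have "\<delta> ^ nat (- k) < C1 / (\<bar>a\<bar> + 1)" using n by simp
    then have "(\<bar>a\<bar> + 1) * \<delta> ^ nat (- k) < C1" by (simp add: pos_less_divide_eq mult.commute)
    then have "\<bar>a\<bar> + 1 < C1 / \<delta> ^ nat (- k)" using params by (simp add: pos_less_divide_eq)
    ultimately show "a \<le> C1 * \<delta> powi k" by (simp add: divide_inverse)
  qed
qed

text \<open>All these cubes lie in one ball, and each has at least a fixed fraction of its measure; they are disjoint.\<close>
lemma finite_near:
  assumes x0: "x0 \<in> space M"
  shows "finite {Q\<in>Dk k. d (cen k Q) x0 \<le> \<rho>}"
proof (rule ccontr)
  assume inf: "infinite {Q\<in>Dk k. d (cen k Q) x0 \<le> \<rho>}"
  obtain A0 where A0: "1 \<le> A0" "\<And>x y z. x \<in> space M \<Longrightarrow> y \<in> space M \<Longrightarrow> z \<in> space M \<Longrightarrow> d x y \<le> A0 * (d x z + d z y)"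
    by (rule quasi_triangle) blast
  define R where "R = A0 * (\<bar>\<rho>\<bar> + C1 * \<delta> powi k)"
  have R: "0 < R" unfolding R_def using A0 rad_pos[of k] by (intro mult_pos_pos) auto
  define t where "t = A0 * (\<bar>\<rho>\<bar> + R) / \<delta> powi k"
  obtain K where K: "1 \<le> K" "\<And>k Q. Q \<in> Dk k \<Longrightarrow> emeasure M (qball M d (cen k Q) (t * \<delta> powi k)) \<le> ennreal K * emeasure M Q"
    by (rule outer_ball_le) blast
  have t: "t * \<delta> powi k = A0 * (\<bar>\<rho>\<bar> + R)" using params by (simp add: t_def)
  let ?B = "qball M d x0 R"
  have B: "0 < emeasure M ?B" "emeasure M ?B < top" "?B \<in> sets M"
    using ball_pos[OF x0 R] ball_finite[OF x0 R] ball_sets[OF x0 R] by auto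
  obtain n :: nat where n: "K < n" using reals_Archimedean2 by blast
  obtain \<F> where F: "\<F> \<subseteq> {Q\<in>Dk k. d (cen k Q) x0 \<le> \<rho>}" "finite \<F>" "card \<F> = n"
    using infinite_arbitrarily_large[OF inf, of n] by blast
  have le: "emeasure M ?B \<le> ennreal K * emeasure M Q" "Q \<subseteq> ?B" if "Q \<in> \<F>" for Q
  proof -
    have Q: "Q \<in> Dk k" "d (cen k Q) x0 \<le> \<rho>" using that F by auto
    note c = cen_space[OF Q(1)]
    have "?B \<subseteq> qball M d (cen k Q) (A0 * (\<bar>\<rho>\<bar> + R))"
    proof
      fix z assume "z \<in> ?B"
      then have z: "z \<in> space M" "d x0 z < R" by (auto simp: qball_def)
      have "d (cen k Q) z \<le> A0 * (d (cen k Q) x0 + d x0 z)" by (rule A0(2)) (use c z x0 in auto)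
      also have "\<dots> < A0 * (\<bar>\<rho>\<bar> + R)" using A0(1) Q(2) z by (intro mult_strict_left_mono add_le_less_mono) auto
      finally show "z \<in> qball M d (cen k Q) (A0 * (\<bar>\<rho>\<bar> + R))" using z by (simp add: qball_def)
    qed
    then have "emeasure M ?B \<le> emeasure M (qball M d (cen k Q) (t * \<delta> powi k))"
      unfolding t using c A0(1) R by (intro emeasure_mono ball_sets) auto
    also have "\<dots> \<le> ennreal K * emeasure M Q" by (rule K(2)[OF Q(1)])
    finally show "emeasure M ?B \<le> ennreal K * emeasure M Q" .
    show "Q \<subseteq> ?B"
    proof
      fix z assume "z \<in> Q"
      then have z: "z \<in> space M" "d (cen k Q) z < C1 * \<delta> powi k" using outer[OF Q(1)] by (auto simp: qball_def)
      have "d x0 z \<le> A0 * (d x0 (cen k Q) + d (cen k Q) z)" by (rule A0(2)) (use c z x0 in auto)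
      also have "\<dots> < R" unfolding R_def using A0(1) Q(2) z d_sym[OF x0 c] by (intro mult_strict_left_mono add_le_less_mono) auto
      finally show "z \<in> ?B" using z by (simp add: qball_def)
    qed
  qed
  have FD: "\<F> \<subseteq> Dk k" using F by auto
  have "disjoint \<F>" using partition_onD2[OF part[of k]] FD by (rule pairwise_subset)
  moreover have "\<F> \<subseteq> DD" using FD by auto
  then have "\<F> \<subseteq> sets M" using cubes_sets by (rule order_trans)
  ultimately have "(\<Sum>Q\<in>\<F>. emeasure M Q) = emeasure M (\<Union>\<F>)"
    using emeasure_Union_disjoint[of \<F> M] F(2) by (simp add: countable_finite nn_integral_count_space_finite)
  also have "\<dots> \<le> emeasure M ?B" using le B by (intro emeasure_mono) auto
  finally have sum: "(\<Sum>Q\<in>\<F>. emeasure M Q) \<le> emeasure M ?B" .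
  have "of_nat n * emeasure M ?B = (\<Sum>Q\<in>\<F>. emeasure M ?B)" using F by simp
  also have "\<dots> \<le> (\<Sum>Q\<in>\<F>. ennreal K * emeasure M Q)" by (intro sum_mono le)
  also have "\<dots> \<le> ennreal K * emeasure M ?B" unfolding sum_distrib_left[symmetric] by (intro mult_left_mono sum) auto
  finally have "emeasure M ?B * ennreal n \<le> emeasure M ?B * ennreal K"
    by (simp add: ennreal_of_nat_eq_real_of_nat mult.commute)
  then have "ennreal n \<le> ennreal K" using B by (simp add: ennreal_mult_le_mult_iff)
  then show False using n K(1) by (simp add: ennreal_le_iff2)
qed

end

section \<open>Vanishing oscillation on cubes from \<open>VMO\<close>\<close>

text \<open>Replacing a constant by the average at most doubles the mean deviation.\<close>
lemma dev_avg_le: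
  fixes b :: "'a \<Rightarrow> 'k::{banach, second_countable_topology}"
  assumes Q: "Q \<in> sets M" "set_integrable M Q b" "0 < emeasure M Q" "emeasure M Q < top" and [measurable]: "b \<in> borel_measurable M"
  shows "dev M b (avg M Q b) Q \<le> 2 * dev M b c Q"
proof -
  note [measurable] = Q(1)
  have "dev M b (avg M Q b) Q \<le> (\<integral>\<^sup>+x. ennreal (norm (b x - c)) * indicator Q x + ennreal (norm (avg M Q b - c)) * indicator Q x \<partial>M)"
    unfolding dev_def
  proof (rule nn_integral_mono)
    fix x
    have "norm (b x - avg M Q b) \<le> norm (b x - c) + norm (avg M Q b - c)"
      using norm_triangle_ineq4[of "b x - c" "avg M Q b - c"] by simp
    then have "ennreal (norm (b x - avg M Q b)) \<le> ennreal (norm (b x - c)) + ennreal (norm (avg M Q b - c))"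
      by (simp flip: ennreal_plus)
    then show "ennreal (norm (b x - avg M Q b)) * indicator Q x \<le> ennreal (norm (b x - c)) * indicator Q x + ennreal (norm (avg M Q b - c)) * indicator Q x"
      by (auto simp: indicator_def)
  qed
  also have "\<dots> = dev M b c Q + ennreal (norm (avg M Q b - c)) * emeasure M Q"
    by (subst nn_integral_add) (auto simp: dev_def nn_integral_cmult_indicator)
  also have "\<dots> \<le> dev M b c Q + dev M b c Q"
    by (intro add_left_mono avg_dist_le_dev Q)
  finally show ?thesis by (simp add: mult_2)
qed

lemma dev_eq_osc:
  fixes b :: "'a \<Rightarrow> 'k::{banach, second_countable_topology}"
  assumes [measurable]: "B \<in> sets M" "b \<in> borel_measurable M" "\<nu> \<in> borel_measurable M" "v \<in> borel_measurable M"
    and b: "set_integrable M B b" and fin: "emeasure M B < top"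
    and v: "AE x in M. \<nu> x = v x" "\<And>x. x \<in> space M \<Longrightarrow> 0 < v x"
    and I: "mass M v B \<noteq> 0" "mass M v B < top"
  shows "dev M b (avg M B b) B = ennreal (osc M \<nu> b B) * mass M v B"
proof -
  obtain i where i: "mass M v B = ennreal i" "0 < i"
    using I by (cases "\<integral>\<^sup>+x\<in>B. ennreal (v x) \<partial>M") (auto simp: less_le)
  have "(LINT x:B|M. \<nu> x) = enn2real (\<integral>\<^sup>+x. ennreal (indicator B x *\<^sub>R \<nu> x) \<partial>M)"
    unfolding set_lebesgue_integral_def
  proof (rule integral_eq_nn_integral)
    show "AE x in M. 0 \<le> indicator B x *\<^sub>R \<nu> x"
      using v(1) AE_space by eventually_elim (use v(2) in \<open>auto simp: indicator_def less_imp_le\<close>)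
  qed measurable
  also have "(\<integral>\<^sup>+x. ennreal (indicator B x *\<^sub>R \<nu> x) \<partial>M) = mass M v B"
    using v(1) by (intro nn_integral_cong_AE; eventually_elim) (auto simp: indicator_def)
  finally have nu: "(LINT x:B|M. \<nu> x) = i" using i by simp
  define D where "D = (LINT x:B|M. norm (b x - avg M B b))"
  have "set_integrable M B (\<lambda>x. avg M B b)"
    unfolding set_integrable_def using fin by (intro integrable_scaleR_left) (auto intro: integrable_real_indicator)
  then have "set_integrable M B (\<lambda>x. norm (b x - avg M B b))"
    by (intro set_integrable_norm set_integral_diff b)
  then have "(\<integral>\<^sup>+x. ennreal (indicator B x *\<^sub>R norm (b x - avg M B b)) \<partial>M) = ennreal D"
    unfolding D_def set_lebesgue_integral_def by (intro nn_integral_eq_integral) (auto simp: set_integrable_def)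
  moreover have "dev M b (avg M B b) B = (\<integral>\<^sup>+x. ennreal (indicator B x *\<^sub>R norm (b x - avg M B b)) \<partial>M)"
    unfolding dev_def by (intro nn_integral_cong) (auto simp: indicator_def)
  ultimately have dev: "dev M b (avg M B b) B = ennreal D" by simp
  have o: "osc M \<nu> b B = D / i" unfolding osc_def nu D_def by simp
  then have "ennreal (osc M \<nu> b B) * ennreal i = ennreal (D / i * i)"
    unfolding o using i by (intro ennreal_mult''[symmetric]) auto
  then show ?thesis using i dev by simp
qed

context homogeneous_dyadic
begin

lemma Ap_from_balls:
  assumes p: "1 < p" "1 / p + 1 / q = 1" and om: "\<omega> \<in> borel_measurable M" "\<And>x. x \<in> space M \<Longrightarrow> 0 < \<omega> x"
    and C: "0 < C" "\<And>x r. x \<in> space M \<Longrightarrow> 0 < r \<Longrightarrow>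
       wcube M p \<omega> (qball M d x r) *
       dcube M q \<omega> (qball M d x r) \<le> ennreal C * emeasure M (qball M d x r)"
  shows "Ap p q \<omega>"
proof -
  note q = conjugate_exponent[OF p]
  obtain K where K: "1 \<le> K" "\<And>k Q. Q \<in> Dk k \<Longrightarrow> emeasure M (qball M d (cen k Q) (C1 * \<delta> powi k)) \<le> ennreal K * emeasure M Q"
    by (rule outer_ball_le) blast
  have "wcube M p \<omega> Q * dcube M q \<omega> Q \<le> ennreal (C * K) * emeasure M Q"
    if Q: "Q \<in> DD" for Q
  proof -
    obtain k where k: "Q \<in> Dk k" using Q by auto
    let ?B = "qball M d (cen k Q) (C1 * \<delta> powi k)"
    have "wcube M p \<omega> Q * dcube M q \<omega> Q
        \<le> wcube M p \<omega> ?B * dcube M q \<omega> ?B"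
      using outer[OF k] p q by (intro mult_mono enorm_mono mult_left_mono) (auto simp: indicator_def)
    also have "\<dots> \<le> ennreal C * emeasure M ?B" using cen_space[OF k] rad_pos by (intro C) auto
    also have "\<dots> \<le> ennreal C * (ennreal K * emeasure M Q)" by (intro mult_left_mono K k) auto
    finally show ?thesis using C(1) K(1) by (simp add: ennreal_mult mult.assoc)
  qed
  then show ?thesis
    unfolding Ap_def using p om C(1) K(1) by (auto intro!: exI[of _ "C * K"])
qed

text \<open>A cube \<open>Q\<close> is compared with its ball \<open>B\<close>: the deviation on \<open>Q\<close> is at most twice that on \<open>B\<close>, and \<open>\<nu>(B)\<close> is at most a
multiple of \<open>\<nu>(Q)\<close> because \<open>\<nu>\<close> is an \<open>A\<^sub>2\<close> weight. By the three conditions of \<open>VMO\<close> the oscillation is small on the cubes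
of all fine and of all coarse generations and, for each of the finitely many generations in between, on the cubes far from
\<open>x\<^sub>0\<close>; only finitely many cubes of a given generation are near \<open>x\<^sub>0\<close>.\<close>
theorem vmo_vanishing_oscillation:
  fixes b :: "'a \<Rightarrow> 'k::{banach, second_countable_topology}"
  assumes p: "1 < p" "1 / p + 1 / q = 1"
    and om[measurable]: "\<omega>1 \<in> borel_measurable M" "\<omega>2 \<in> borel_measurable M"
    and pos: "\<And>x. x \<in> space M \<Longrightarrow> 0 < \<omega>1 x" "\<And>x. x \<in> space M \<Longrightarrow> 0 < \<omega>2 x"
    and K1: "1 \<le> K1" "\<And>x r. x \<in> space M \<Longrightarrow> 0 < r \<Longrightarrow>
       wcube M p \<omega>1 (qball M d x r) *
       dcube M q \<omega>1 (qball M d x r) \<le> ennreal K1 * emeasure M (qball M d x r)"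
    and K2: "1 \<le> K2" "\<And>x r. x \<in> space M \<Longrightarrow> 0 < r \<Longrightarrow>
       wcube M p \<omega>2 (qball M d x r) *
       dcube M q \<omega>2 (qball M d x r) \<le> ennreal K2 * emeasure M (qball M d x r)"
    and \<nu>[measurable]: "\<nu> \<in> borel_measurable M" and \<nu>_eq: "AE x in M. \<nu> x = \<omega>1 x / \<omega>2 x"
    and x0: "x0 \<in> space M" and b: "b \<in> VMO M d x0 \<nu>"
  obtains D A B where "vanishing_oscillation M DD D b (\<lambda>x. \<omega>1 x / \<omega>2 x) A B"
proof -
  define v where "v x = \<omega>1 x / \<omega>2 x" for x
  have [measurable]: "v \<in> borel_measurable M" unfolding v_def by measurable
  have vpos: "0 < v x" if "x \<in> space M" for x using pos[OF that] by (simp add: v_def)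
  have bl: "loc_integrable M d b" using b by (auto simp: VMO_def BMO_def)
  note [measurable] = loc_integrable_measurable[OF bl]
  have ap1: "Ap p q \<omega>1" using K1 by (intro Ap_from_balls[OF p om(1) pos(1), of K1]) auto
  have ap2: "Ap p q \<omega>2" using K2 by (intro Ap_from_balls[OF p om(2) pos(2), of K2]) auto
  obtain D where "dyadic_cubes M DD D" by (rule dyadic)
  then interpret dc: dyadic_cubes M DD D .
  obtain Kd where Kd: "1 \<le> Kd" "\<And>k Q. Q \<in> Dk k \<Longrightarrow> emeasure M (qball M d (cen k Q) (C1 * \<delta> powi k)) \<le> ennreal Kd * emeasure M Q"
    by (rule outer_ball_le) blast
  have ballA2: "mass M v (qball M d x r) * (\<integral>\<^sup>+x\<in>qball M d x r. ennreal (1 / v x) \<partial>M)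
      \<le> ennreal (K1 * K2) * (emeasure M (qball M d x r) * emeasure M (qball M d x r))" if "x \<in> space M" "0 < r" for x r
    unfolding v_def using that K1 K2 by (intro A2_from_Ap[OF p om _ pos]) auto
  have cubeA2: "\<exists>A\<ge>1. \<forall>Q\<in>DD. mass M v Q * (\<integral>\<^sup>+x\<in>Q. ennreal (1 / v x) \<partial>M)
      \<le> ennreal A * (emeasure M Q * emeasure M Q)"
  proof -
    obtain A1 where A1: "0 < A1" "\<And>Q. Q \<in> DD \<Longrightarrow> wcube M p \<omega>1 Q *
        dcube M q \<omega>1 Q \<le> ennreal A1 * emeasure M Q"
      using ap1 unfolding Ap_def by blast
    obtain A2 where A2: "0 < A2" "\<And>Q. Q \<in> DD \<Longrightarrow> wcube M p \<omega>2 Q *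
        dcube M q \<omega>2 Q \<le> ennreal A2 * emeasure M Q"
      using ap2 unfolding Ap_def by blast
    have "mass M v Q * (\<integral>\<^sup>+x\<in>Q. ennreal (1 / v x) \<partial>M) \<le> ennreal (max 1 (A1 * A2)) * (emeasure M Q * emeasure M Q)"
      if Q: "Q \<in> DD" for Q
    proof -
      have "mass M v Q * (\<integral>\<^sup>+x\<in>Q. ennreal (1 / v x) \<partial>M) \<le> ennreal (A1 * A2) * (emeasure M Q * emeasure M Q)"
        unfolding v_def using A1 A2 Q cube_sets[OF Q] by (intro A2_from_Ap[OF p om _ pos]) auto
      also have "\<dots> \<le> ennreal (max 1 (A1 * A2)) * (emeasure M Q * emeasure M Q)"
        by (intro mult_right_mono ennreal_leI) auto
      finally show ?thesis .
    qed
    then show ?thesis by (intro exI[of _ "max 1 (A1 * A2)"]) auto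
  qed
  then obtain A where A: "1 \<le> A" "\<And>Q. Q \<in> DD \<Longrightarrow> mass M v Q * (\<integral>\<^sup>+x\<in>Q. ennreal (1 / v x) \<partial>M)
      \<le> ennreal A * (emeasure M Q * emeasure M Q)" by blast
  \<comment> \<open>2 from the change of the average, the rest from comparing \<open>\<nu>\<close> on \<open>Q\<close> and on its ball\<close>
  define \<Lambda> where "\<Lambda> = 2 * (K1 * K2 * Kd\<^sup>2)"
  have \<Lambda>: "0 \<le> \<Lambda>" using K1 K2 by (simp add: \<Lambda>_def)
  let ?ball = "\<lambda>k Q. qball M d (cen k Q) (C1 * \<delta> powi k)"
  have bQ: "set_integrable M Q b" if Q: "Q \<in> DD" for Q
  proof -
    obtain k where k: "Q \<in> Dk k" using Q by auto
    have "set_integrable M (?ball k Q) b" using bl cen_space[OF k] rad_pos by (auto simp: loc_integrable_def)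
    then show ?thesis using cube_sets[OF Q] outer[OF k] by (rule set_integrable_subset)
  qed
  have devQ: "dev M b (avg M Q b) Q \<le> ennreal (\<Lambda> * osc M \<nu> b (?ball k Q)) * mass M v Q"
    if k: "Q \<in> Dk k" for Q k
  proof -
    let ?B = "?ball k Q"
    have Q: "Q \<in> DD" using k by auto
    have r: "cen k Q \<in> space M" "0 < C1 * \<delta> powi k" using cen_space[OF k] rad_pos by auto
    have B: "?B \<in> sets M" "0 < emeasure M ?B" "emeasure M ?B < top"
      using ball_sets[OF r] ball_pos[OF r] ball_finite[OF r] by auto
    have I0: "mass M v ?B \<noteq> 0" using vpos B by (intro set_nn_integral_pos) auto
    have J0: "(\<integral>\<^sup>+x\<in>?B. ennreal (1 / v x) \<partial>M) \<noteq> 0" using vpos B by (intro set_nn_integral_pos[of "\<lambda>x. 1 / v x"]) auto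
    have "mass M v ?B * (\<integral>\<^sup>+x\<in>?B. ennreal (1 / v x) \<partial>M) < top"
      by (rule le_less_trans[OF ballA2[OF r]]) (use B in \<open>auto simp: ennreal_mult_less_top\<close>)
    then have Ifin: "mass M v ?B < top" using I0 J0 by (auto simp: ennreal_mult_less_top)
    have bB: "set_integrable M ?B b" using bl r by (auto simp: loc_integrable_def)
    have eq: "dev M b (avg M ?B b) ?B = ennreal (osc M \<nu> b ?B) * mass M v ?B"
      by (rule dev_eq_osc) (use B bB I0 Ifin vpos \<nu>_eq in \<open>auto simp: v_def\<close>)
    have "dev M b (avg M Q b) Q \<le> 2 * dev M b (avg M ?B b) Q"
      using cube_sets[OF Q] bQ[OF Q] cube_pos[OF Q] cube_finite[OF Q] by (intro dev_avg_le) auto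
    also have "\<dots> \<le> 2 * dev M b (avg M ?B b) ?B"
      by (intro mult_left_mono dev_mono outer k) auto
    also have "\<dots> = 2 * (ennreal (osc M \<nu> b ?B) * mass M v ?B)" by (simp only: eq)
    also have "\<dots> \<le> 2 * (ennreal (osc M \<nu> b ?B) * (ennreal (K1 * K2 * Kd\<^sup>2) * mass M v Q))"
    proof (intro mult_left_mono)
      show "mass M v ?B \<le> ennreal (K1 * K2 * Kd\<^sup>2) * mass M v Q"
        by (rule A2_subset[where K = Kd and A = "K1 * K2"])
           (use B cube_sets[OF Q] outer[OF k] ballA2[OF r] Kd(2)[OF k] Kd(1) K1 K2 vpos in auto)
    qed auto
    also have "\<dots> = ennreal (\<Lambda> * osc M \<nu> b ?B) * mass M v Q"
    proof -
      have "ennreal (\<Lambda> * osc M \<nu> b ?B) = 2 * ennreal (K1 * K2 * Kd\<^sup>2) * ennreal (osc M \<nu> b ?B)"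
        using K1 K2 unfolding \<Lambda>_def by (simp add: ennreal_mult')
      then show ?thesis by (simp only: mult_ac)
    qed
    finally show ?thesis .
  qed
  obtain Cb where Cb: "\<And>x r. x \<in> space M \<Longrightarrow> 0 < r \<Longrightarrow> osc M \<nu> b (qball M d x r) \<le> Cb"
    using b by (auto simp: VMO_def BMO_def)
  define B where "B = \<Lambda> * max Cb 0"
  have B: "0 \<le> B" using \<Lambda> by (simp add: B_def)
  have bmoQ: "dev M b (avg M Q b) Q \<le> ennreal B * mass M v Q" if Q: "Q \<in> DD" for Q
  proof -
    obtain k where k: "Q \<in> Dk k" using Q by auto
    have "osc M \<nu> b (?ball k Q) \<le> max Cb 0" using Cb[OF cen_space[OF k] rad_pos(1)[of k]] by simp
    then have "\<Lambda> * osc M \<nu> b (?ball k Q) \<le> B" unfolding B_def using \<Lambda> by (rule mult_left_mono)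
    then show ?thesis by (intro order_trans[OF devQ[OF k]] mult_right_mono ennreal_leI) auto
  qed
  have le_eps: "dev M b (avg M Q b) Q \<le> ennreal \<epsilon> * mass M v Q"
    if "Q \<in> Dk k" "0 < \<epsilon>" "ennreal (osc M \<nu> b (?ball k Q)) < ennreal (\<epsilon> / (\<Lambda> + 1))" for Q k \<epsilon>
  proof -
    have "osc M \<nu> b (?ball k Q) < \<epsilon> / (\<Lambda> + 1)"
      using that(3) ennreal_leI by (meson not_le)
    then have "\<Lambda> * osc M \<nu> b (?ball k Q) \<le> \<Lambda> * (\<epsilon> / (\<Lambda> + 1))" using \<Lambda> by (intro mult_left_mono) auto
    also have "\<dots> \<le> \<epsilon>" using \<Lambda> that(2) by (simp add: field_simps)
    finally show ?thesis by (intro order_trans[OF devQ[OF that(1)]] mult_right_mono ennreal_leI) auto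
  qed
  have small: "\<exists>L. \<forall>k\<ge>L. \<forall>Q\<in>Dk k. dev M b (avg M Q b) Q \<le> ennreal \<epsilon> * mass M v Q" if \<epsilon>: "0 < \<epsilon>" for \<epsilon>
  proof -
    have "((\<lambda>a. SUP x\<in>space M. ennreal (osc M \<nu> b (qball M d x a))) \<longlongrightarrow> 0) (at_right 0)"
      using b by (simp add: VMO_def)
    moreover have "0 < ennreal (\<epsilon> / (\<Lambda> + 1))" using \<epsilon> \<Lambda> by simp
    ultimately have "\<forall>\<^sub>F a in at_right 0. (SUP x\<in>space M. ennreal (osc M \<nu> b (qball M d x a))) < ennreal (\<epsilon> / (\<Lambda> + 1))"
      by (rule order_tendstoD(2))
    then obtain a0 where a0: "0 < a0" "\<And>a. 0 < a \<Longrightarrow> a < a0 \<Longrightarrow> (SUP x\<in>space M. ennreal (osc M \<nu> b (qball M d x a))) < ennreal (\<epsilon> / (\<Lambda> + 1))"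
      by (auto simp: eventually_at_right_field)
    obtain L where L: "\<And>k. L \<le> k \<Longrightarrow> C1 * \<delta> powi k < a0" using radius_tendsto[OF a0(1)] by blast
    show ?thesis
    proof (intro exI[of _ L] allI impI ballI)
      fix k Q assume k: "L \<le> k" "Q \<in> Dk k"
      have "ennreal (osc M \<nu> b (?ball k Q)) \<le> (SUP x\<in>space M. ennreal (osc M \<nu> b (qball M d x (C1 * \<delta> powi k))))"
        using cen_space[OF k(2)] by (rule SUP_upper)
      also have "\<dots> < ennreal (\<epsilon> / (\<Lambda> + 1))" using L[OF k(1)] rad_pos by (intro a0) auto
      finally show "dev M b (avg M Q b) Q \<le> ennreal \<epsilon> * mass M v Q" by (rule le_eps[OF k(2) \<epsilon>])
    qed
  qed
  have large: "\<exists>L. \<forall>k\<le>L. \<forall>Q\<in>Dk k. dev M b (avg M Q b) Q \<le> ennreal \<epsilon> * mass M v Q" if \<epsilon>: "0 < \<epsilon>" for \<epsilon>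
  proof -
    have "((\<lambda>a. SUP x\<in>space M. ennreal (osc M \<nu> b (qball M d x a))) \<longlongrightarrow> 0) at_top"
      using b by (simp add: VMO_def)
    moreover have "0 < ennreal (\<epsilon> / (\<Lambda> + 1))" using \<epsilon> \<Lambda> by simp
    ultimately have "\<forall>\<^sub>F a in at_top. (SUP x\<in>space M. ennreal (osc M \<nu> b (qball M d x a))) < ennreal (\<epsilon> / (\<Lambda> + 1))"
      by (rule order_tendstoD(2))
    then obtain a1 where a1: "\<And>a. a1 \<le> a \<Longrightarrow> (SUP x\<in>space M. ennreal (osc M \<nu> b (qball M d x a))) < ennreal (\<epsilon> / (\<Lambda> + 1))"
      by (auto simp: eventually_at_top_linorder)
    obtain L where L: "\<And>k. k \<le> L \<Longrightarrow> a1 \<le> C1 * \<delta> powi k" by (rule radius_lower) blast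
    show ?thesis
    proof (intro exI[of _ L] allI impI ballI)
      fix k Q assume k: "k \<le> L" "Q \<in> Dk k"
      have "ennreal (osc M \<nu> b (?ball k Q)) \<le> (SUP x\<in>space M. ennreal (osc M \<nu> b (qball M d x (C1 * \<delta> powi k))))"
        using cen_space[OF k(2)] by (rule SUP_upper)
      also have "\<dots> < ennreal (\<epsilon> / (\<Lambda> + 1))" using L[OF k(1)] by (intro a1) auto
      finally show "dev M b (avg M Q b) Q \<le> ennreal \<epsilon> * mass M v Q" by (rule le_eps[OF k(2) \<epsilon>])
    qed
  qed
  have far: "\<exists>\<rho>. \<forall>Q\<in>Dk k. \<rho> < d (cen k Q) x0 \<longrightarrow> dev M b (avg M Q b) Q \<le> ennreal \<epsilon> * mass M v Q" if \<epsilon>: "0 < \<epsilon>" for \<epsilon> k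
  proof -
    let ?F = "\<lambda>a. SUP (x, r)\<in>{(x, r). x \<in> space M \<and> 0 < r \<and> a < (INF y\<in>qball M d x r. d y x0)}. ennreal (osc M \<nu> b (qball M d x r))"
    have "(?F \<longlongrightarrow> 0) at_top" using b by (simp add: VMO_def)
    moreover have "0 < ennreal (\<epsilon> / (\<Lambda> + 1))" using \<epsilon> \<Lambda> by simp
    ultimately have "\<forall>\<^sub>F a in at_top. ?F a < ennreal (\<epsilon> / (\<Lambda> + 1))"
      by (rule order_tendstoD(2))
    then obtain a where a: "?F a < ennreal (\<epsilon> / (\<Lambda> + 1))"
      by (auto simp: eventually_at_top_linorder)
    obtain A0 where A0: "1 \<le> A0" "\<And>x y z. x \<in> space M \<Longrightarrow> y \<in> space M \<Longrightarrow> z \<in> space M \<Longrightarrow> d x y \<le> A0 * (d x z + d z y)"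
      by (rule quasi_triangle) blast
    show ?thesis
    proof (intro exI[of _ "A0 * (C1 * \<delta> powi k + (a + 1))"] ballI impI)
      fix Q assume Q: "Q \<in> Dk k" and far: "A0 * (C1 * \<delta> powi k + (a + 1)) < d (cen k Q) x0"
      note c = cen_space[OF Q]
      have "a + 1 \<le> d y x0" if y: "y \<in> ?ball k Q" for y
      proof (rule ccontr)
        assume "\<not> ?thesis"
        then have "d y x0 < a + 1" by simp
        moreover have ys: "y \<in> space M" "d (cen k Q) y < C1 * \<delta> powi k" using y by (auto simp: qball_def)
        moreover have "d (cen k Q) x0 \<le> A0 * (d (cen k Q) y + d y x0)" by (rule A0(2)) (use c ys x0 in auto)
        moreover have "A0 * (d (cen k Q) y + d y x0) \<le> A0 * (C1 * \<delta> powi k + (a + 1))"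
          using calculation A0(1) by (intro mult_left_mono) auto
        ultimately show False using far by simp
      qed
      then have "a + 1 \<le> (INF y\<in>?ball k Q. d y x0)"
        using center_in_ball[OF c rad_pos(1)[of k]] by (intro cINF_greatest) auto
      then have "(cen k Q, C1 * \<delta> powi k) \<in> {(x, r). x \<in> space M \<and> 0 < r \<and> a < (INF y\<in>qball M d x r. d y x0)}"
        using c rad_pos(1)[of k] by auto
      then have "(case (cen k Q, C1 * \<delta> powi k) of (x, r) \<Rightarrow> ennreal (osc M \<nu> b (qball M d x r))) \<le> ?F a"
        by (rule SUP_upper)
      then have "ennreal (osc M \<nu> b (?ball k Q)) < ennreal (\<epsilon> / (\<Lambda> + 1))" using a by simp
      then show "dev M b (avg M Q b) Q \<le> ennreal \<epsilon> * mass M v Q" by (rule le_eps[OF Q \<epsilon>])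
    qed
  qed
  have vanish: "finite {Q\<in>DD. \<not> dev M b (avg M Q b) Q \<le> ennreal \<epsilon> * mass M v Q}" if \<epsilon>: "0 < \<epsilon>" for \<epsilon>
  proof -
    obtain L where L: "\<forall>k\<ge>L. \<forall>Q\<in>Dk k. dev M b (avg M Q b) Q \<le> ennreal \<epsilon> * mass M v Q" using small[OF \<epsilon>] ..
    obtain L' where L': "\<forall>k\<le>L'. \<forall>Q\<in>Dk k. dev M b (avg M Q b) Q \<le> ennreal \<epsilon> * mass M v Q" using large[OF \<epsilon>] ..
    have "\<forall>k. \<exists>\<rho>. \<forall>Q\<in>Dk k. \<rho> < d (cen k Q) x0 \<longrightarrow> dev M b (avg M Q b) Q \<le> ennreal \<epsilon> * mass M v Q"
      by (intro allI far \<epsilon>)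
    from choice[OF this] obtain \<rho> where \<rho>: "\<forall>k. \<forall>Q\<in>Dk k. \<rho> k < d (cen k Q) x0 \<longrightarrow> dev M b (avg M Q b) Q \<le> ennreal \<epsilon> * mass M v Q" ..
    show ?thesis
    proof (rule finite_subset)
      show "{Q\<in>DD. \<not> dev M b (avg M Q b) Q \<le> ennreal \<epsilon> * mass M v Q} \<subseteq>
          (\<Union>k\<in>{L'..L}. {Q\<in>Dk k. d (cen k Q) x0 \<le> \<rho> k})"
      proof
        fix Q assume Q: "Q \<in> {Q\<in>DD. \<not> dev M b (avg M Q b) Q \<le> ennreal \<epsilon> * mass M v Q}"
        then obtain k where k: "Q \<in> Dk k" by auto
        have "\<not> L \<le> k" "\<not> k \<le> L'" "\<not> \<rho> k < d (cen k Q) x0" using Q L L' \<rho> k by blast+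
        then show "Q \<in> (\<Union>k\<in>{L'..L}. {Q\<in>Dk k. d (cen k Q) x0 \<le> \<rho> k})" using k by auto
      qed
    qed (use finite_near[OF x0] in auto)
  qed
  have fine: "\<exists>\<P>\<subseteq>DD. disjoint \<P> \<and> \<Union>\<P> = R \<and> (\<forall>Q\<in>\<P>. dev M b (avg M Q b) Q \<le> ennreal \<epsilon> * mass M v Q)"
    if \<epsilon>: "0 < \<epsilon>" and R: "R \<in> DD" for \<epsilon> R
  proof -
    obtain L where L: "\<forall>k\<ge>L. \<forall>Q\<in>Dk k. dev M b (avg M Q b) Q \<le> ennreal \<epsilon> * mass M v Q" using small[OF \<epsilon>] ..
    obtain k where k: "R \<in> Dk k" using R by auto
    let ?P = "{Q\<in>Dk (max k L). Q \<subseteq> R}"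
    have "?P \<subseteq> DD" by auto
    moreover have "disjoint ?P" "\<Union>?P = R" using fine_partition[OF k, of "max k L"] by auto
    moreover have "\<forall>Q\<in>?P. dev M b (avg M Q b) Q \<le> ennreal \<epsilon> * mass M v Q"
      using L[rule_format, of "max k L"] by auto
    ultimately show ?thesis by blast
  qed
  show ?thesis
  proof (rule that)
    have "vanishing_oscillation M DD D b v A B"
    proof unfold_locales
      show "b \<in> borel_measurable M" "v \<in> borel_measurable M" by measurable
    qed (rule A(1) B | erule vpos bQ A(2) bmoQ vanish fine | (rule fine; assumption))+
    then show "vanishing_oscillation M DD D b (\<lambda>x. \<omega>1 x / \<omega>2 x) A B"
      unfolding v_def[abs_def] .
  qed
qed

end

section \<open>Relative compactness in \<open>L\<^sup>p\<close>\<close>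

text \<open>A compact set and the complement of a finite union of open sets covering it have disjoint neighbourhoods, so the union also
covers the closure.\<close>
lemma compactin_closure_of_regular:
  assumes X: "regular_space X" and K: "compactin X K" and HK: "H \<subseteq> K"
  shows "compactin X (X closure_of H)"
proof -
  have "compactin X (X closure_of K)"
    unfolding compactin_def
  proof (intro conjI allI impI)
    show "X closure_of K \<subseteq> topspace X" by (rule closure_of_subset_topspace)
    fix \<U> assume U: "(\<forall>U\<in>\<U>. openin X U) \<and> X closure_of K \<subseteq> \<Union>\<U>"
    have "K \<subseteq> X closure_of K" using K by (simp add: closure_of_subset compactin_subset_topspace)
    with U have "\<forall>U\<in>\<U>. openin X U" "K \<subseteq> \<Union>\<U>" by auto
    then obtain \<F> where F: "finite \<F>" "\<F> \<subseteq> \<U>" "K \<subseteq> \<Union>\<F>"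
      using K unfolding compactin_def by meson
    have W: "openin X (\<Union>\<F>)" using U F by (intro openin_Union) auto
    have "disjnt K (topspace X - \<Union>\<F>)" using F by (auto simp: disjnt_def)
    then obtain A B where AB: "openin X A" "openin X B" "K \<subseteq> A" "topspace X - \<Union>\<F> \<subseteq> B" "disjnt A B"
      using regular_space_compact_closed_separation[OF X K, of "topspace X - \<Union>\<F>"] W
      by (meson closedin_diff closedin_topspace)
    have "closedin X (topspace X - B)" using AB(2) by (intro closedin_diff) auto
    moreover have "K \<subseteq> topspace X - B"
      using AB compactin_subset_topspace[OF K] by (auto simp: disjnt_def)
    ultimately have "X closure_of K \<subseteq> topspace X - B" by (rule closure_of_minimal[rotated])
    also have "\<dots> \<subseteq> \<Union>\<F>" using AB(4) by auto
    finally show "\<exists>\<F>. finite \<F> \<and> \<F> \<subseteq> \<U> \<and> X closure_of K \<subseteq> \<Union>\<F>" using F by blast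
  qed
  from closed_compactin[OF this closure_of_mono[OF HK] closedin_closure_of] show ?thesis .
qed

lemma epow_subadditive:
  assumes "0 < p" "p \<le> 1"
  shows "epow (x + y) p \<le> epow x p + epow y p"
proof -
  consider "x = top \<or> y = top" | "x + y = 0" | a c where "x = ennreal a" "y = ennreal c" "0 \<le> a" "0 \<le> c" "0 < a + c"
    by (cases x; cases y) (auto simp: less_le add_nonneg_eq_0_iff)
  then show ?thesis
  proof cases
    case 3
    have *: "u / (a + c) \<le> (u / (a + c)) powr p" if "0 \<le> u" "u \<le> a + c" for u
      using powr_mono'[of p 1 "u / (a + c)"] assms that 3 by (cases "u = 0") auto
    have "1 = a / (a + c) + c / (a + c)" using 3 by (simp flip: add_divide_distrib)
    also have "\<dots> \<le> (a / (a + c)) powr p + (c / (a + c)) powr p"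
      using 3 by (intro add_mono *) auto
    also have "\<dots> = (a powr p + c powr p) / (a + c) powr p"
      using 3 by (simp add: powr_divide add_divide_distrib)
    finally have "(a + c) powr p \<le> a powr p + c powr p" using 3 by (simp add: pos_le_divide_eq)
    then show ?thesis using 3 by (simp flip: ennreal_plus)
  qed auto
qed

text \<open>The quasi-norm fails the triangle inequality for \<open>p < 1\<close>, but its power \<open>p\<close> satisfies it; for \<open>p \<ge> 1\<close> this is the norm itself.\<close>
definition gauge_pow :: "'a measure \<Rightarrow> real \<Rightarrow> ('a \<Rightarrow> ennreal) \<Rightarrow> ennreal" where
  "gauge_pow N p u = epow (enorm N p u) (min p 1)"

lemma gauge_pow_add:
  assumes p: "0 < p" and [measurable]: "u \<in> borel_measurable N" "v \<in> borel_measurable N"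
  shows "gauge_pow N p (\<lambda>x. u x + v x) \<le> gauge_pow N p u + gauge_pow N p v"
proof (cases "1 \<le> p")
  case True
  then show ?thesis using Minkowski_enorm[OF True assms(2,3)] by (simp add: gauge_pow_def min_absorb2)
next
  case False
  then have eq: "gauge_pow N p u = (\<integral>\<^sup>+x. epow (u x) p \<partial>N)" for u :: "'a \<Rightarrow> ennreal"
    using p by (simp add: gauge_pow_def min_absorb1 epow_enorm)
  have "(\<integral>\<^sup>+x. epow (u x + v x) p \<partial>N) \<le> (\<integral>\<^sup>+x. epow (u x) p + epow (v x) p \<partial>N)"
    using p False by (intro nn_integral_mono epow_subadditive) auto
  also have "\<dots> = (\<integral>\<^sup>+x. epow (u x) p \<partial>N) + (\<integral>\<^sup>+x. epow (v x) p \<partial>N)" by (rule nn_integral_add) auto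
  finally show ?thesis by (simp add: eq)
qed

lemma gauge_pow_mono_AE: "0 < p \<Longrightarrow> (AE x in N. u x \<le> v x) \<Longrightarrow> gauge_pow N p u \<le> gauge_pow N p v"
  unfolding gauge_pow_def by (intro epow_mono enorm_mono_AE) auto

lemma gauge_pow_mono: "0 < p \<Longrightarrow> (\<And>x. x \<in> space N \<Longrightarrow> u x \<le> v x) \<Longrightarrow> gauge_pow N p u \<le> gauge_pow N p v"
  unfolding gauge_pow_def by (intro epow_mono enorm_mono) auto

lemma gauge_pow_finite_iff: "gauge_pow N p u < top \<longleftrightarrow> enorm N p u < top"
  by (simp add: gauge_pow_def)

lemma gauge_pow_zero: "0 < p \<Longrightarrow> gauge_pow N p (\<lambda>x. 0) = 0"
  by (simp add: gauge_pow_def enorm_def)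

lemma gauge_pow_sum:
  assumes p: "0 < p" and "finite F" "\<And>n. n \<in> F \<Longrightarrow> u n \<in> borel_measurable N"
  shows "gauge_pow N p (\<lambda>x. \<Sum>n\<in>F. u n x) \<le> (\<Sum>n\<in>F. gauge_pow N p (u n))"
  using assms(2,3)
proof (induction F rule: finite_induct)
  case (insert n F)
  have "gauge_pow N p (\<lambda>x. \<Sum>n\<in>insert n F. u n x) = gauge_pow N p (\<lambda>x. u n x + (\<Sum>n\<in>F. u n x))"
    using insert by simp
  also have "\<dots> \<le> gauge_pow N p (u n) + gauge_pow N p (\<lambda>x. \<Sum>n\<in>F. u n x)"
    using insert.prems by (intro gauge_pow_add p borel_measurable_sum) auto
  also have "\<dots> \<le> gauge_pow N p (u n) + (\<Sum>n\<in>F. gauge_pow N p (u n))"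
    using insert by (intro add_left_mono) auto
  finally show ?case using insert by simp
qed (simp add: gauge_pow_zero p)

lemma gauge_pow_cmult:
  assumes "0 < p" "u \<in> borel_measurable N"
  shows "gauge_pow N p (\<lambda>x. c * u x) = epow c (min p 1) * gauge_pow N p u"
  using assms by (simp add: gauge_pow_def enorm_cmult epow_mult)

lemma Lp_space_iff:
  fixes f :: "'a \<Rightarrow> 'k::euclidean_space"
  assumes "0 < p"
  shows "f \<in> Lp_space N p \<longleftrightarrow> f \<in> borel_measurable N \<and> enorm N p (\<lambda>x. ennreal (norm (f x))) < top"
proof (cases "f \<in> borel_measurable N")
  case True
  note [measurable] = True
  have "integrable N (\<lambda>x. norm (f x) powr p) \<longleftrightarrow> (\<integral>\<^sup>+x. ennreal (norm (f x) powr p) \<partial>N) < top"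
    by (subst integrable_iff_bounded) simp
  then show ?thesis by (simp add: Lp_space_def enorm_def True)
qed (simp add: Lp_space_def)

lemma Lp_norm_eq:
  fixes f :: "'a \<Rightarrow> 'k::euclidean_space"
  assumes "0 < p" "f \<in> Lp_space N p"
  shows "ennreal (Lp_norm N p f) = enorm N p (\<lambda>x. ennreal (norm (f x)))"
proof -
  have "integrable N (\<lambda>x. norm (f x) powr p)" using assms(2) by (simp add: Lp_space_def)
  then have "(\<integral>\<^sup>+x. ennreal (norm (f x) powr p) \<partial>N) = ennreal (LINT x|N. norm (f x) powr p)"
    by (intro nn_integral_eq_integral) auto
  then show ?thesis by (simp add: enorm_def Lp_norm_def)
qed

lemma Lp_space_diff:
  fixes f g :: "'a \<Rightarrow> 'k::euclidean_space"
  assumes p: "0 < p" and f: "f \<in> Lp_space N p" and g: "g \<in> Lp_space N p"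
  shows "(\<lambda>x. f x - g x) \<in> Lp_space N p"
proof -
  have [measurable]: "f \<in> borel_measurable N" "g \<in> borel_measurable N" using f g by (auto simp: Lp_space_def)
  have "gauge_pow N p (\<lambda>x. ennreal (norm (f x - g x))) \<le> gauge_pow N p (\<lambda>x. ennreal (norm (f x)) + ennreal (norm (g x)))"
    using p by (intro gauge_pow_mono) (auto simp: norm_triangle_ineq4 simp flip: ennreal_plus)
  also have "\<dots> \<le> gauge_pow N p (\<lambda>x. ennreal (norm (f x))) + gauge_pow N p (\<lambda>x. ennreal (norm (g x)))"
    by (intro gauge_pow_add p) auto
  also have "\<dots> < top"
    using f g p by (simp add: gauge_pow_finite_iff Lp_space_iff)
  finally show ?thesis using p by (simp add: Lp_space_iff gauge_pow_finite_iff)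
qed

definition Lp_dist :: "'a measure \<Rightarrow> real \<Rightarrow> ('a \<Rightarrow> 'k::euclidean_space) \<Rightarrow> ('a \<Rightarrow> 'k) \<Rightarrow> real" where
  "Lp_dist N p f g = Lp_norm N p (\<lambda>x. f x - g x) powr (min p 1)"

lemma ennreal_Lp_dist:
  fixes f g :: "'a \<Rightarrow> 'k::euclidean_space"
  assumes "0 < p" "f \<in> Lp_space N p" "g \<in> Lp_space N p"
  shows "ennreal (Lp_dist N p f g) = gauge_pow N p (\<lambda>x. ennreal (norm (f x - g x)))"
proof -
  have "ennreal (Lp_dist N p f g) = epow (ennreal (Lp_norm N p (\<lambda>x. f x - g x))) (min p 1)"
    by (simp add: Lp_dist_def Lp_norm_def)
  then show ?thesis using Lp_norm_eq[OF assms(1) Lp_space_diff[OF assms]] by (simp add: gauge_pow_def)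
qed

lemma Lp_dist_triangle:
  fixes f g h :: "'a \<Rightarrow> 'k::euclidean_space"
  assumes p: "0 < p" and f: "f \<in> Lp_space N p" and g: "g \<in> Lp_space N p" and h: "h \<in> Lp_space N p"
  shows "Lp_dist N p f h \<le> Lp_dist N p f g + Lp_dist N p g h"
proof -
  have [measurable]: "f \<in> borel_measurable N" "g \<in> borel_measurable N" "h \<in> borel_measurable N"
    using f g h by (auto simp: Lp_space_def)
  have "gauge_pow N p (\<lambda>x. ennreal (norm (f x - h x))) \<le> gauge_pow N p (\<lambda>x. ennreal (norm (f x - g x)) + ennreal (norm (g x - h x)))"
  proof (rule gauge_pow_mono[OF p])
    fix x
    show "ennreal (norm (f x - h x)) \<le> ennreal (norm (f x - g x)) + ennreal (norm (g x - h x))"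
      using norm_triangle_ineq[of "f x - g x" "g x - h x"] by (simp flip: ennreal_plus)
  qed
  also have "\<dots> \<le> gauge_pow N p (\<lambda>x. ennreal (norm (f x - g x))) + gauge_pow N p (\<lambda>x. ennreal (norm (g x - h x)))"
    by (intro gauge_pow_add p) auto
  finally have "ennreal (Lp_dist N p f h) \<le> ennreal (Lp_dist N p f g + Lp_dist N p g h)"
    using ennreal_Lp_dist[OF p f h] ennreal_Lp_dist[OF p f g] ennreal_Lp_dist[OF p g h]
    by (simp add: Lp_dist_def)
  moreover have "0 \<le> Lp_dist N p f g + Lp_dist N p g h" by (simp add: Lp_dist_def)
  ultimately show ?thesis by (simp only: ennreal_le_iff)
qed

lemma Lp_dist_commute: "Lp_dist N p f g = Lp_dist N p g f"
  by (simp add: Lp_dist_def Lp_norm_def norm_minus_commute)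

lemma Lp_dist_self: "Lp_dist N p f f = 0"
  by (simp add: Lp_dist_def Lp_norm_def)

lemma Lp_norm_less_iff:
  assumes "0 < p" "0 < r"
  shows "Lp_norm N p (\<lambda>x. f x - g x) < r \<longleftrightarrow> Lp_dist N p f g < r powr (min p 1)"
proof -
  have "0 \<le> Lp_norm N p (\<lambda>x. f x - g x)" by (simp add: Lp_norm_def)
  then show ?thesis
    unfolding Lp_dist_def using assms
    by (meson less_imp_le min_less_iff_conj not_le powr_less_mono2 powr_mono2 zero_less_one)
qed

lemma openin_Lp_dist:
  "0 < p \<Longrightarrow> openin (Lp_topology N p) U \<longleftrightarrow> U \<subseteq> Lp_space N p \<and>
     (\<forall>f\<in>U. \<exists>r>0. \<forall>g\<in>Lp_space N p. Lp_dist N p g f < r \<longrightarrow> g \<in> U)"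
  unfolding openin_Lp_topology
proof (intro conj_cong refl ball_cong iffI)
  fix f assume p: "0 < p" and "\<exists>r>0. \<forall>g\<in>Lp_space N p. Lp_norm N p (\<lambda>x. g x - f x) < r \<longrightarrow> g \<in> U"
  then obtain r where "0 < r" "\<forall>g\<in>Lp_space N p. Lp_norm N p (\<lambda>x. g x - f x) < r \<longrightarrow> g \<in> U" by blast
  then show "\<exists>r>0. \<forall>g\<in>Lp_space N p. Lp_dist N p g f < r \<longrightarrow> g \<in> U"
    by (intro exI[of _ "r powr min p 1"]) (auto simp: Lp_norm_less_iff[OF p, symmetric])
next
  fix f assume p: "0 < p" and "\<exists>r>0. \<forall>g\<in>Lp_space N p. Lp_dist N p g f < r \<longrightarrow> g \<in> U"
  then obtain r where r: "0 < r" "\<forall>g\<in>Lp_space N p. Lp_dist N p g f < r \<longrightarrow> g \<in> U" by blast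
  have "(r powr (1 / min p 1)) powr (min p 1) = r" using p r by (simp add: powr_powr)
  then show "\<exists>r>0. \<forall>g\<in>Lp_space N p. Lp_norm N p (\<lambda>x. g x - f x) < r \<longrightarrow> g \<in> U"
    using Lp_norm_less_iff[OF p, of "r powr (1 / min p 1)"] r by (intro exI[of _ "r powr (1 / min p 1)"]) auto
qed

text \<open>\<open>Lp_dist\<close> is a pseudometric that induces the topology; balls about a point and complements of closed balls separate.\<close>
lemma regular_Lp_topology:
  assumes p: "0 < p"
  shows "regular_space (Lp_topology N p :: ('a \<Rightarrow> 'k::euclidean_space) topology)"
  unfolding regular_space_def
proof (intro allI impI)
  let ?X = "Lp_topology N p :: ('a \<Rightarrow> 'k) topology"
  fix C a assume Ca: "closedin ?X C \<and> a \<in> topspace ?X - C"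
  then have a: "a \<in> Lp_space N p" by simp
  have "openin ?X (topspace ?X - C)" using Ca by (intro openin_diff openin_topspace) auto
  then have "\<exists>r>0. \<forall>g\<in>Lp_space N p. Lp_dist N p g a < r \<longrightarrow> g \<in> topspace ?X - C"
    using Ca unfolding openin_Lp_dist[OF p] by blast
  then obtain r where r: "0 < r" "\<And>g. g \<in> Lp_space N p \<Longrightarrow> Lp_dist N p g a < r \<Longrightarrow> g \<notin> C"
    by blast
  let ?U = "{h\<in>Lp_space N p. Lp_dist N p h a < r / 2}" and ?V = "{h\<in>Lp_space N p. r / 2 < Lp_dist N p h a}"
  have "openin ?X ?U"
    unfolding openin_Lp_dist[OF p]
  proof (intro conjI ballI)
    fix f assume f: "f \<in> ?U"
    show "\<exists>r'>0. \<forall>g\<in>Lp_space N p. Lp_dist N p g f < r' \<longrightarrow> g \<in> ?U"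
    proof (intro exI[of _ "r / 2 - Lp_dist N p f a"] conjI ballI impI)
      fix g assume g: "g \<in> Lp_space N p" "Lp_dist N p g f < r / 2 - Lp_dist N p f a"
      then show "g \<in> ?U" using Lp_dist_triangle[OF p g(1) _ a, of f] f by auto
    qed (use f in auto)
  qed auto
  moreover have "openin ?X ?V"
    unfolding openin_Lp_dist[OF p]
  proof (intro conjI ballI)
    fix f assume f: "f \<in> ?V"
    show "\<exists>r'>0. \<forall>g\<in>Lp_space N p. Lp_dist N p g f < r' \<longrightarrow> g \<in> ?V"
    proof (intro exI[of _ "Lp_dist N p f a - r / 2"] conjI ballI impI)
      fix g assume g: "g \<in> Lp_space N p" "Lp_dist N p g f < Lp_dist N p f a - r / 2"
      then show "g \<in> ?V" using Lp_dist_triangle[OF p _ g(1) a, of f] f Lp_dist_commute[of N p f g] by auto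
    qed (use f in auto)
  qed auto
  moreover have "a \<in> ?U" using a r by (simp add: Lp_dist_self)
  moreover have "C \<subseteq> ?V"
  proof
    fix g assume g: "g \<in> C"
    then have "g \<in> Lp_space N p" using Ca closedin_subset by fastforce
    moreover have "r \<le> Lp_dist N p g a" using r(2)[OF calculation] g by (meson not_le)
    ultimately show "g \<in> ?V" using r(1) by auto
  qed
  moreover have "disjnt ?U ?V" by (auto simp: disjnt_def)
  ultimately show "\<exists>U V. openin ?X U \<and> openin ?X V \<and> a \<in> U \<and> C \<subseteq> V \<and> disjnt U V" by blast
qed

lemma Lp_relatively_compactI:
  fixes H K :: "('a \<Rightarrow> 'k::euclidean_space) set"
  assumes "0 < p" "compactin (Lp_topology N p) K" "H \<subseteq> K"
  shows "Lp_relatively_compact N p H"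
  using assms compactin_closure_of_regular[OF regular_Lp_topology[OF assms(1)] assms(2,3)]
    compactin_subset_topspace[OF assms(2)]
  by (auto simp: Lp_relatively_compact_def)

text \<open>Unconditional and absolute summability agree in each coordinate.\<close>
lemma summable_on_euclidean_iff:
  fixes f :: "'i \<Rightarrow> 'k::euclidean_space"
  shows "f summable_on A \<longleftrightarrow> integrable (count_space A) f"
proof
  assume f: "f summable_on A"
  have s: "(\<lambda>x. f x \<bullet> e) summable_on A" for e
    by (rule summable_on_bounded_linear[OF bounded_linear_inner_left f])
  have "integrable (count_space A) (\<lambda>x. f x \<bullet> e)" for e
    using iffD1[OF summable_on_iff_abs_summable_on_real s[of e]]
    by (simp only: abs_summable_equivalent abs_summable_on_def)
  then have "integrable (count_space A) (\<lambda>x. \<Sum>e\<in>Basis. (f x \<bullet> e) *\<^sub>R e)"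
    by (intro Bochner_Integration.integrable_sum integrable_scaleR_left) auto
  then show "integrable (count_space A) f" by (simp add: euclidean_representation)
next
  assume "integrable (count_space A) f"
  then have "Infinite_Sum.abs_summable_on f A" by (simp only: abs_summable_equivalent abs_summable_on_def)
  then show "f summable_on A" by (rule abs_summable_summable)
qed

text \<open>Both sides are zero when the family is not summable. Measurability in a parameter can be read off from the right-hand side.\<close>
lemma infsum_eq_integral_count_space:
  fixes f :: "'i \<Rightarrow> 'k::euclidean_space"
  shows "infsum f A = (LINT n|count_space A. f n)"
proof (cases "f summable_on A")
  case True
  then have "Infinite_Set_Sum.abs_summable_on f A" by (simp add: summable_on_euclidean_iff abs_summable_on_def)
  then show ?thesis using infsetsum_infsum[of f A] by (simp add: infsetsum_def)
next
  case False
  then show ?thesis by (simp add: infsum_not_exists not_integrable_integral_eq summable_on_euclidean_iff)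
qed

lemma summable_on_if_nn_integral_finite:
  fixes f :: "'i \<Rightarrow> 'k::euclidean_space"
  assumes "(\<integral>\<^sup>+n. ennreal (norm (f n)) \<partial>count_space A) < top"
  shows "f summable_on A"
  using assms by (simp add: summable_on_euclidean_iff integrable_iff_bounded)

lemma norm_infsum_le_nn_integral:
  fixes f :: "'i \<Rightarrow> 'k::euclidean_space"
  shows "ennreal (norm (infsum f A)) \<le> (\<integral>\<^sup>+n. ennreal (norm (f n)) \<partial>count_space A)"
proof (cases "integrable (count_space A) f")
  case True
  then show ?thesis unfolding infsum_eq_integral_count_space by (rule integral_norm_bound_ennreal)
next
  case False
  then show ?thesis by (simp add: infsum_eq_integral_count_space not_integrable_integral_eq)
qed

lemma borel_measurable_infsum:
  fixes f :: "'i \<Rightarrow> 'a \<Rightarrow> 'k::euclidean_space"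
  assumes "countable A" "\<And>n. n \<in> A \<Longrightarrow> f n \<in> borel_measurable N"
  shows "(\<lambda>x. infsum (\<lambda>n. f n x) A) \<in> borel_measurable N"
proof -
  interpret sigma_finite_measure "count_space A"
    by (rule sigma_finite_measure_count_space_countable[OF assms(1)])
  have "(\<lambda>(Q, x). f Q x) \<in> borel_measurable (count_space A \<Otimes>\<^sub>M N)"
    using assms by (intro measurable_pair_measure_countable1) auto
  then have "(\<lambda>(x, Q). f Q x) \<in> borel_measurable (N \<Otimes>\<^sub>M count_space A)"
    by (subst measurable_pair_swap_iff) (simp add: split_beta')
  then show ?thesis unfolding infsum_eq_integral_count_space by (intro borel_measurable_lebesgue_integral) auto
qed

text \<open>Fatou's lemma, applied after moving the power inside the lower limit.\<close>
lemma enorm_le_of_tendsto: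
  fixes u :: "nat \<Rightarrow> 'a \<Rightarrow> ennreal"
  assumes p: "0 < p" and [measurable]: "\<And>j. u j \<in> borel_measurable N"
    and le: "\<And>j. enorm N p (u j) \<le> C" and v: "\<And>x. x \<in> space N \<Longrightarrow> v x \<le> liminf (\<lambda>j. u j x)"
  shows "enorm N p v \<le> C"
proof -
  have "(\<integral>\<^sup>+x. epow (v x) p \<partial>N) \<le> (\<integral>\<^sup>+x. liminf (\<lambda>j. epow (u j x) p) \<partial>N)"
  proof (rule nn_integral_mono)
    fix x assume "x \<in> space N"
    then have "epow (v x) p \<le> epow (liminf (\<lambda>j. u j x)) p" using p v by (intro epow_mono) auto
    also have "\<dots> = liminf (\<lambda>j. epow (u j x) p)"
      by (simp add: liminf_SUP_INF epow_SUP epow_INF p)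
    finally show "epow (v x) p \<le> \<dots>" .
  qed
  also have "\<dots> \<le> liminf (\<lambda>j. \<integral>\<^sup>+x. epow (u j x) p \<partial>N)"
    by (rule nn_integral_liminf) measurable
  also have "\<dots> \<le> epow C p"
  proof -
    have "(\<integral>\<^sup>+x. epow (u j x) p \<partial>N) \<le> epow C p" for j
      using epow_mono[OF le[of j], of p] p by (simp add: epow_enorm)
    then have "limsup (\<lambda>j. \<integral>\<^sup>+x. epow (u j x) p \<partial>N) \<le> epow C p"
      by (intro Limsup_bounded) auto
    then show ?thesis by (meson Liminf_le_Limsup order_trans sequentially_bot)
  qed
  finally show ?thesis unfolding enorm_def using p by (subst epow_le_iff) (auto simp: epow_epow)
qed

lemma compact_coefficients:
  fixes R :: "nat \<Rightarrow> real"
  shows "compact {c :: nat \<Rightarrow> 'k::euclidean_space. \<forall>n. norm (c n) \<le> R n}"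
proof -
  have "{c :: nat \<Rightarrow> 'k. \<forall>n. norm (c n) \<le> R n} = PiE UNIV (\<lambda>n. cball 0 (R n))" by auto
  moreover have "compactin (product_topology (\<lambda>i. euclidean) UNIV) (PiE UNIV (\<lambda>n. cball (0::'k) (R n)))"
    by (simp add: compactin_PiE)
  ultimately show ?thesis by (simp add: euclidean_product_topology)
qed

text \<open>The coefficient sequences that satisfy the same bounds and the same tail estimates form a closed set, by Fatou's lemma, inside
a product of closed balls; it is compact and metrizable. For a convergent sequence of coefficients, the difference of the
sums consists of finitely many terms that converge and two uniformly small tails, so the sum is sequentially continuous
into \<open>L\<^sup>p\<close>. Its image of the compact set is compact and contains the given sums.\<close>
theorem series_relatively_compact:
  fixes \<phi> :: "nat \<Rightarrow> 'a \<Rightarrow> 'k::{real_normed_field, euclidean_space}" and \<C> :: "(nat \<Rightarrow> 'k) set"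
  assumes p: "0 < p" and \<phi>: "\<And>n. \<phi> n \<in> Lp_space N p"
    and bd: "\<And>n. \<exists>R. \<forall>c\<in>\<C>. norm (c n) \<le> R"
    and tail: "\<And>\<epsilon>. 0 < \<epsilon> \<Longrightarrow> \<exists>F. finite F \<and> (\<forall>c\<in>\<C>. enorm N p (\<lambda>x. \<integral>\<^sup>+n. ennreal (norm (c n * \<phi> n x)) \<partial>count_space (- F)) \<le> ennreal \<epsilon>)"
  shows "Lp_relatively_compact N p ((\<lambda>c x. \<Sum>\<^sub>\<infinity>n. c n * \<phi> n x) ` \<C>)"
proof -
  have [measurable]: "\<phi> n \<in> borel_measurable N" for n using \<phi> by (auto simp: Lp_space_def)
  have \<phi>fin: "gauge_pow N p (\<lambda>x. ennreal (norm (\<phi> n x))) < top" for n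
    using \<phi>[of n] p by (simp add: Lp_space_iff gauge_pow_finite_iff)
  let ?t = "\<lambda>F c x. \<integral>\<^sup>+n. ennreal (norm (c n * \<phi> n x)) \<partial>count_space F"
  have tm[measurable]: "?t F c \<in> borel_measurable N" for F c
    by (intro borel_measurable_countable_sum) auto
  obtain R where R: "\<And>n c. c \<in> \<C> \<Longrightarrow> norm (c n) \<le> R n" using bd by metis
  have "\<forall>k::nat. \<exists>F. finite F \<and> (\<forall>c\<in>\<C>. enorm N p (?t (- F) c) \<le> ennreal (1 / (real k + 1)))"
    by (intro allI tail) auto
  from choice[OF this] obtain F where
    F: "\<And>k. finite (F k)" "\<And>k c. c \<in> \<C> \<Longrightarrow> enorm N p (?t (- F k) c) \<le> ennreal (1 / (real k + 1))" by blast
  define K where "K = {c. (\<forall>n. norm (c n) \<le> R n) \<and> (\<forall>k. enorm N p (?t (- F k) c) \<le> ennreal (1 / (real k + 1)))}"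
  have CK: "\<C> \<subseteq> K" using R F by (auto simp: K_def)
  have coord: "(\<lambda>j. c j n) \<longlonglongrightarrow> l n" if "c \<longlonglongrightarrow> l" for c :: "nat \<Rightarrow> nat \<Rightarrow> 'k" and l n
    using continuous_on_tendsto_compose[OF continuous_on_product_coordinates that] by auto
  have "closed K"
    unfolding closed_sequential_limits
  proof (intro allI impI)
    fix c l assume cl: "(\<forall>j. c j \<in> K) \<and> c \<longlonglongrightarrow> l"
    have "norm (l n) \<le> R n" for n
      using cl by (intro LIMSEQ_le_const2[OF tendsto_norm[OF coord]]) (auto simp: K_def)
    moreover have "enorm N p (?t (- F k) l) \<le> ennreal (1 / (real k + 1))" for k
    proof (rule enorm_le_of_tendsto[OF p])
      fix x
      have "?t (- F k) l x = (\<integral>\<^sup>+n. liminf (\<lambda>j. ennreal (norm (c j n * \<phi> n x))) \<partial>count_space (- F k))"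
      proof (rule nn_integral_cong)
        fix n
        have "(\<lambda>j. ennreal (norm (c j n * \<phi> n x))) \<longlonglongrightarrow> ennreal (norm (l n * \<phi> n x))"
          using cl by (intro tendsto_intros coord) auto
        from lim_imp_Liminf[OF _ this]
        show "ennreal (norm (l n * \<phi> n x)) = liminf (\<lambda>j. ennreal (norm (c j n * \<phi> n x)))"
          by simp
      qed
      also have "\<dots> \<le> liminf (\<lambda>j. ?t (- F k) (c j) x)" by (rule nn_integral_liminf) auto
      finally show "?t (- F k) l x \<le> liminf (\<lambda>j. ?t (- F k) (c j) x)" .
    qed (use cl in \<open>auto simp: K_def\<close>)
    ultimately show "l \<in> K" by (simp add: K_def)
  qed
  then have "compact (K \<inter> {c. \<forall>n. norm (c n) \<le> R n})"
    using compact_coefficients by (rule closed_Int_compact)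
  moreover have "K \<inter> {c. \<forall>n. norm (c n) \<le> R n} = K" by (auto simp: K_def)
  ultimately have compK: "compact K" by simp
  let ?\<Phi> = "\<lambda>c x. \<Sum>\<^sub>\<infinity>n. c n * \<phi> n x"
  have \<Phi>m[measurable]: "?\<Phi> c \<in> borel_measurable N" for c
    by (intro borel_measurable_infsum) auto
  have split: "?t UNIV c x = ?t G c x + ?t (- G) c x" for c x and G
  proof -
    have "?t UNIV c x = (\<integral>\<^sup>+n. ennreal (norm (c n * \<phi> n x)) * indicator G n + ennreal (norm (c n * \<phi> n x)) * indicator (- G) n \<partial>count_space UNIV)"
      by (intro nn_integral_cong) (auto simp: indicator_def)
    also have "\<dots> = ?t G c x + ?t (- G) c x"
      by (subst nn_integral_add) (auto simp: nn_integral_count_space_subset[of _ UNIV, symmetric])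
    finally show ?thesis .
  qed
  have fin_part: "gauge_pow N p (?t G c) \<le> (\<Sum>n\<in>G. epow (ennreal (norm (c n))) (min p 1) * gauge_pow N p (\<lambda>x. ennreal (norm (\<phi> n x))))"
    if G: "finite G" for G c
  proof -
    have "gauge_pow N p (?t G c) = gauge_pow N p (\<lambda>x. \<Sum>n\<in>G. ennreal (norm (c n)) * ennreal (norm (\<phi> n x)))"
      using G by (simp add: nn_integral_count_space_finite norm_mult ennreal_mult)
    also have "\<dots> \<le> (\<Sum>n\<in>G. gauge_pow N p (\<lambda>x. ennreal (norm (c n)) * ennreal (norm (\<phi> n x))))"
      by (intro gauge_pow_sum p G) measurable
    also have "\<dots> = (\<Sum>n\<in>G. epow (ennreal (norm (c n))) (min p 1) * gauge_pow N p (\<lambda>x. ennreal (norm (\<phi> n x))))"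
      by (intro sum.cong gauge_pow_cmult p) auto
    finally show ?thesis .
  qed
  have tailK: "gauge_pow N p (?t (- F k) c) \<le> ennreal ((1 / (real k + 1)) powr (min p 1))" if "c \<in> K" for c k
  proof -
    have "gauge_pow N p (?t (- F k) c) \<le> epow (ennreal (1 / (real k + 1))) (min p 1)"
      unfolding gauge_pow_def using that p by (intro epow_mono) (auto simp: K_def)
    then show ?thesis by simp
  qed
  have totK: "gauge_pow N p (?t UNIV c) < top" if c: "c \<in> K" for c
  proof -
    have "gauge_pow N p (?t UNIV c) \<le> gauge_pow N p (?t (F 0) c) + gauge_pow N p (?t (- F 0) c)"
      unfolding split[of c _ "F 0"] by (intro gauge_pow_add p) auto
    also have "\<dots> \<le> (\<Sum>n\<in>F 0. epow (ennreal (norm (c n))) (min p 1) * gauge_pow N p (\<lambda>x. ennreal (norm (\<phi> n x))))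
        + ennreal ((1 / (real 0 + 1)) powr (min p 1))"
      by (intro add_mono fin_part F tailK c)
    also have "\<dots> < top"
      using \<phi>fin by (auto simp: ennreal_mult_less_top intro!: sum_ennreal_less_top F)
    finally show ?thesis .
  qed
  have \<Phi>L: "?\<Phi> c \<in> Lp_space N p" if c: "c \<in> K" for c
  proof -
    have "gauge_pow N p (\<lambda>x. ennreal (norm (?\<Phi> c x))) \<le> gauge_pow N p (?t UNIV c)"
      by (intro gauge_pow_mono p norm_infsum_le_nn_integral)
    also have "\<dots> < top" by (rule totK[OF c])
    finally show ?thesis using p by (simp add: Lp_space_iff gauge_pow_finite_iff)
  qed
  have aefin: "AE x in N. ?t UNIV c x < top" if c: "c \<in> K" for c
  proof -
    have "(\<integral>\<^sup>+x. epow (?t UNIV c x) p \<partial>N) \<noteq> \<infinity>"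
      using totK[OF c] by (auto simp: gauge_pow_finite_iff enorm_def less_top)
    then have "AE x in N. epow (?t UNIV c x) p \<noteq> \<infinity>" by (intro nn_integral_PInf_AE) auto
    then show ?thesis by eventually_elim (auto simp: less_top)
  qed
  have diff: "gauge_pow N p (\<lambda>x. ennreal (norm (?\<Phi> c x - ?\<Phi> l x))) \<le>
      (\<Sum>n\<in>F k. epow (ennreal (norm (c n - l n))) (min p 1) * gauge_pow N p (\<lambda>x. ennreal (norm (\<phi> n x)))) +
      (ennreal ((1 / (real k + 1)) powr (min p 1)) + ennreal ((1 / (real k + 1)) powr (min p 1)))"
    if c: "c \<in> K" and l: "l \<in> K" for c l k
  proof -
    let ?e = "\<lambda>n. c n - l n"
    have "gauge_pow N p (\<lambda>x. ennreal (norm (?\<Phi> c x - ?\<Phi> l x))) \<le>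
        gauge_pow N p (\<lambda>x. ?t (F k) ?e x + (?t (- F k) c x + ?t (- F k) l x))"
    proof (rule gauge_pow_mono_AE[OF p])
      show "AE x in N. ennreal (norm (?\<Phi> c x - ?\<Phi> l x)) \<le> ?t (F k) ?e x + (?t (- F k) c x + ?t (- F k) l x)"
        using aefin[OF c] aefin[OF l]
      proof eventually_elim
        case (elim x)
        have s: "integrable (count_space UNIV) (\<lambda>n. c n * \<phi> n x)" "integrable (count_space UNIV) (\<lambda>n. l n * \<phi> n x)"
          using elim by (auto simp: integrable_iff_bounded)
        have "?\<Phi> c x - ?\<Phi> l x = (\<Sum>\<^sub>\<infinity>n. c n * \<phi> n x - l n * \<phi> n x)"
          unfolding infsum_eq_integral_count_space by (rule Bochner_Integration.integral_diff[OF s, symmetric])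
        also have "\<dots> = ?\<Phi> ?e x" by (simp add: left_diff_distrib)
        finally have "ennreal (norm (?\<Phi> c x - ?\<Phi> l x)) \<le> ?t UNIV ?e x"
          using norm_infsum_le_nn_integral[of "\<lambda>n. ?e n * \<phi> n x" UNIV] by simp
        also have "\<dots> = ?t (F k) ?e x + ?t (- F k) ?e x" by (rule split)
        also have "?t (- F k) ?e x \<le> (\<integral>\<^sup>+n. ennreal (norm (c n * \<phi> n x)) + ennreal (norm (l n * \<phi> n x)) \<partial>count_space (- F k))"
        proof (rule nn_integral_mono)
          fix n
          have "norm (?e n * \<phi> n x) \<le> norm (c n * \<phi> n x) + norm (l n * \<phi> n x)"
            by (simp add: left_diff_distrib norm_triangle_ineq4)
          then show "ennreal (norm (?e n * \<phi> n x)) \<le> ennreal (norm (c n * \<phi> n x)) + ennreal (norm (l n * \<phi> n x))"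
            by (simp flip: ennreal_plus)
        qed
        also have "\<dots> = ?t (- F k) c x + ?t (- F k) l x" by (rule nn_integral_add) auto
        finally show ?case by (simp add: add_left_mono)
      qed
    qed
    also have "\<dots> \<le> gauge_pow N p (?t (F k) ?e) + gauge_pow N p (\<lambda>x. ?t (- F k) c x + ?t (- F k) l x)"
      by (intro gauge_pow_add p) measurable
    also have "\<dots> \<le> gauge_pow N p (?t (F k) ?e) + (gauge_pow N p (?t (- F k) c) + gauge_pow N p (?t (- F k) l))"
      by (intro add_left_mono gauge_pow_add p) measurable
    also have "\<dots> \<le> (\<Sum>n\<in>F k. epow (ennreal (norm (?e n))) (min p 1) * gauge_pow N p (\<lambda>x. ennreal (norm (\<phi> n x)))) +
      (ennreal ((1 / (real k + 1)) powr (min p 1)) + ennreal ((1 / (real k + 1)) powr (min p 1)))"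
      by (intro add_mono fin_part F tailK c l)
    finally show ?thesis .
  qed
  have conv: "(\<lambda>j. Lp_dist N p (?\<Phi> (c j)) (?\<Phi> l)) \<longlonglongrightarrow> 0" if cl: "\<And>j. c j \<in> K" "l \<in> K" "c \<longlonglongrightarrow> l" for c l
  proof (rule LIMSEQ_I)
    fix r :: real assume r: "0 < r"
    have "(\<lambda>k. (1 / (real k + 1)) powr (min p 1)) \<longlonglongrightarrow> 0 powr (min p 1)"
    proof (intro tendsto_powr2 tendsto_const)
      show "(\<lambda>k. 1 / (real k + 1)) \<longlonglongrightarrow> 0"
        using LIMSEQ_inverse_real_of_nat by (simp add: inverse_eq_divide add.commute)
    qed (use p in auto)
    then have "eventually (\<lambda>k. (1 / (real k + 1)) powr (min p 1) < r / 4) sequentially"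
      using r by (intro order_tendstoD(2)[where y = 0]) auto
    then obtain k where k: "(1 / (real k + 1)) powr (min p 1) < r / 4" by (auto simp: eventually_sequentially)
    let ?g = "\<lambda>n. enn2real (gauge_pow N p (\<lambda>x. ennreal (norm (\<phi> n x))))"
    let ?s = "\<lambda>j. \<Sum>n\<in>F k. norm (c j n - l n) powr (min p 1) * ?g n"
    have "(\<lambda>j. norm (c j n - l n) powr (min p 1)) \<longlonglongrightarrow> 0 powr (min p 1)" for n
    proof (intro tendsto_powr2 tendsto_const)
      have "(\<lambda>j. norm (c j n - l n)) \<longlonglongrightarrow> norm (l n - l n)"
        by (intro tendsto_intros coord cl)
      then show "(\<lambda>j. norm (c j n - l n)) \<longlonglongrightarrow> 0" by simp
    qed (use p in auto)
    then have "?s \<longlonglongrightarrow> (\<Sum>n\<in>F k. 0 powr (min p 1) * ?g n)"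
      by (intro tendsto_sum tendsto_mult tendsto_const) auto
    then have "?s \<longlonglongrightarrow> 0" by simp
    then have "eventually (\<lambda>j. ?s j < r / 2) sequentially"
      using r by (intro order_tendstoD(2)[where y = 0]) auto
    then obtain J where J: "\<And>j. J \<le> j \<Longrightarrow> ?s j < r / 2" by (auto simp: eventually_sequentially)
    show "\<exists>no. \<forall>j\<ge>no. norm (Lp_dist N p (?\<Phi> (c j)) (?\<Phi> l) - 0) < r"
    proof (intro exI[of _ J] allI impI)
      fix j assume j: "J \<le> j"
      have s0: "0 \<le> ?s j" by (intro sum_nonneg mult_nonneg_nonneg) auto
      have "ennreal (Lp_dist N p (?\<Phi> (c j)) (?\<Phi> l)) \<le>
        (\<Sum>n\<in>F k. epow (ennreal (norm (c j n - l n))) (min p 1) * gauge_pow N p (\<lambda>x. ennreal (norm (\<phi> n x)))) +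
         (ennreal ((1 / (real k + 1)) powr (min p 1)) + ennreal ((1 / (real k + 1)) powr (min p 1)))"
        using diff[OF cl(1)[of j] cl(2), of k] ennreal_Lp_dist[OF p \<Phi>L[OF cl(1)] \<Phi>L[OF cl(2)]] by simp
      also have "(\<Sum>n\<in>F k. epow (ennreal (norm (c j n - l n))) (min p 1) * gauge_pow N p (\<lambda>x. ennreal (norm (\<phi> n x)))) = ennreal (?s j)"
        using \<phi>fin by (subst sum_ennreal[symmetric]) (auto simp: ennreal_mult intro!: sum.cong)
      also have "ennreal (?s j) + (ennreal ((1 / (real k + 1)) powr (min p 1)) + ennreal ((1 / (real k + 1)) powr (min p 1))) =
          ennreal (?s j + ((1 / (real k + 1)) powr (min p 1) + (1 / (real k + 1)) powr (min p 1)))"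
        using s0 by (simp only: ennreal_plus[symmetric] powr_ge_zero add_nonneg_nonneg)
      finally have "Lp_dist N p (?\<Phi> (c j)) (?\<Phi> l) \<le> ?s j + ((1 / (real k + 1)) powr (min p 1) + (1 / (real k + 1)) powr (min p 1))"
        using s0 by (subst (asm) ennreal_le_iff) auto
      also have "\<dots> < r" using J[OF j] k by simp
      finally show "norm (Lp_dist N p (?\<Phi> (c j)) (?\<Phi> l) - 0) < r" by (simp add: Lp_dist_def)
    qed
  qed
  have cont: "continuous_map (top_of_set K) (Lp_topology N p) ?\<Phi>"
    unfolding continuous_map_def
  proof (intro conjI allI impI)
    show "?\<Phi> \<in> topspace (top_of_set K) \<rightarrow> topspace (Lp_topology N p)" using \<Phi>L by auto
    fix U :: "('a \<Rightarrow> 'k) set" assume U: "openin (Lp_topology N p) U"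
    show "openin (top_of_set K) {x \<in> topspace (top_of_set K). ?\<Phi> x \<in> U}"
      unfolding openin_euclidean_subtopology_iff
    proof (intro conjI ballI)
      fix l assume l: "l \<in> {x \<in> topspace (top_of_set K). ?\<Phi> x \<in> U}"
      then have lK: "l \<in> K" and lU: "?\<Phi> l \<in> U" by auto
      obtain r where r: "0 < r" "\<And>g. g \<in> Lp_space N p \<Longrightarrow> Lp_dist N p g (?\<Phi> l) < r \<Longrightarrow> g \<in> U"
        using U lU unfolding openin_Lp_dist[OF p] by blast
      show "\<exists>e>0. \<forall>x'\<in>K. dist x' l < e \<longrightarrow> x' \<in> {x \<in> topspace (top_of_set K). ?\<Phi> x \<in> U}"
      proof (rule ccontr)
        assume neg: "\<not> ?thesis"
        have "\<exists>x'\<in>K. dist x' l < 1 / (real j + 1) \<and> ?\<Phi> x' \<notin> U" for j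
        proof -
          have "0 < 1 / (real j + 1)" by simp
          then show ?thesis using neg by auto
        qed
        then obtain c where c: "\<And>j. c j \<in> K" "\<And>j. dist (c j) l < 1 / (real j + 1)" "\<And>j. ?\<Phi> (c j) \<notin> U" by metis
        have "(\<lambda>j. dist (c j) l) \<longlonglongrightarrow> 0"
        proof (rule tendsto_sandwich[of "\<lambda>_. 0" _ _ "\<lambda>j. 1 / (real j + 1)"])
          show "(\<lambda>j. 1 / (real j + 1)) \<longlonglongrightarrow> 0"
            using LIMSEQ_inverse_real_of_nat by (simp add: inverse_eq_divide add.commute)
        qed (use c(2) in \<open>auto simp: less_imp_le\<close>)
        then have "c \<longlonglongrightarrow> l" by (rule iffD2[OF tendsto_dist_iff])
        then have "(\<lambda>j. Lp_dist N p (?\<Phi> (c j)) (?\<Phi> l)) \<longlonglongrightarrow> 0" by (intro conv c(1) lK)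
        then have "eventually (\<lambda>j. Lp_dist N p (?\<Phi> (c j)) (?\<Phi> l) < r) sequentially"
          using r(1) by (rule order_tendstoD(2))
        then obtain j where "Lp_dist N p (?\<Phi> (c j)) (?\<Phi> l) < r" by (auto simp: eventually_sequentially)
        then show False using r(2)[OF \<Phi>L[OF c(1)]] c(3) by blast
      qed
    qed auto
  qed
  have "compactin (top_of_set K) K" using compK by (simp add: compactin_subtopology)
  then have "compactin (Lp_topology N p) (?\<Phi> ` K)" using cont by (rule image_compactin)
  then show ?thesis using p CK by (intro Lp_relatively_compactI) auto
qed

text \<open>The index set is moved to the natural numbers; unused indices carry the zero function and the coefficient 0.\<close>
theorem countable_series_relatively_compact:
  fixes \<phi> :: "'i \<Rightarrow> 'a \<Rightarrow> 'k::{real_normed_field, euclidean_space}" and \<C> :: "('i \<Rightarrow> 'k) set"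
  assumes p: "0 < p" and S: "countable S" and \<phi>: "\<And>Q. Q \<in> S \<Longrightarrow> \<phi> Q \<in> Lp_space N p"
    and bd: "\<And>Q. Q \<in> S \<Longrightarrow> \<exists>R. \<forall>c\<in>\<C>. norm (c Q) \<le> R"
    and tail: "\<And>\<epsilon>. 0 < \<epsilon> \<Longrightarrow> \<exists>S0. finite S0 \<and> S0 \<subseteq> S \<and>
      (\<forall>c\<in>\<C>. enorm N p (\<lambda>x. \<integral>\<^sup>+Q. ennreal (norm (c Q * \<phi> Q x)) \<partial>count_space (S - S0)) \<le> ennreal \<epsilon>)"
  shows "Lp_relatively_compact N p ((\<lambda>c x. \<Sum>\<^sub>\<infinity>Q\<in>S. c Q * \<phi> Q x) ` \<C>)"
proof -
  define e where "e = to_nat_on S"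
  have inj: "inj_on e S" unfolding e_def using S by (rule inj_on_to_nat_on)
  define d where "d n = from_nat_into S n" for n
  have de: "d (e Q) = Q" if "Q \<in> S" for Q unfolding d_def e_def using S that by simp
  define \<psi> where "\<psi> n = (if n \<in> e ` S then \<phi> (d n) else (\<lambda>x. 0))" for n
  define r where "r c n = (if n \<in> e ` S then c (d n) else 0)" for c :: "'i \<Rightarrow> 'k" and n
  have term_in: "r c (e Q) * \<psi> (e Q) x = c Q * \<phi> Q x" if "Q \<in> S" for c Q x
    using that de by (simp add: r_def \<psi>_def)
  have term_out: "r c n * \<psi> n x = 0" if "n \<notin> e ` S" for c n x using that by (simp add: r_def)
  have sum_eq: "(\<Sum>\<^sub>\<infinity>n. r c n * \<psi> n x) = (\<Sum>\<^sub>\<infinity>Q\<in>S. c Q * \<phi> Q x)" for c x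
  proof -
    have "(\<Sum>\<^sub>\<infinity>n. r c n * \<psi> n x) = (\<Sum>\<^sub>\<infinity>n\<in>e ` S. r c n * \<psi> n x)"
    proof (rule infsum_cong_neutral)
      fix n assume "n \<in> UNIV - e ` S"
      then show "r c n * \<psi> n x = 0" by (intro term_out) blast
    qed blast+
    also have "\<dots> = (\<Sum>\<^sub>\<infinity>Q\<in>S. r c (e Q) * \<psi> (e Q) x)"
      using infsum_reindex[OF inj] by (simp add: o_def)
    also have "\<dots> = (\<Sum>\<^sub>\<infinity>Q\<in>S. c Q * \<phi> Q x)" by (intro infsum_cong term_in)
    finally show ?thesis .
  qed
  have "Lp_relatively_compact N p ((\<lambda>c x. \<Sum>\<^sub>\<infinity>n. c n * \<psi> n x) ` (r ` \<C>))"
  proof (rule series_relatively_compact[OF p])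
    show "\<psi> n \<in> Lp_space N p" for n
      using \<phi> de by (auto simp: \<psi>_def Lp_space_def)
    show "\<exists>R. \<forall>c\<in>r ` \<C>. norm (c n) \<le> R" for n
    proof (cases "n \<in> e ` S")
      case True
      then have "d n \<in> S" using de by auto
      then show ?thesis using bd[of "d n"] True by (auto simp: r_def)
    qed (auto simp: r_def)
    fix \<epsilon> :: real assume "0 < \<epsilon>"
    from tail[OF this] obtain S0 where S0: "finite S0" "S0 \<subseteq> S"
      "\<forall>c\<in>\<C>. enorm N p (\<lambda>x. \<integral>\<^sup>+Q. ennreal (norm (c Q * \<phi> Q x)) \<partial>count_space (S - S0)) \<le> ennreal \<epsilon>"
      by (elim exE conjE)
    have eq: "(\<integral>\<^sup>+n. ennreal (norm (r c n * \<psi> n x)) \<partial>count_space (- e ` S0)) = (\<integral>\<^sup>+Q. ennreal (norm (c Q * \<phi> Q x)) \<partial>count_space (S - S0))" for c x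
    proof -
      have "(\<integral>\<^sup>+n. ennreal (norm (r c n * \<psi> n x)) \<partial>count_space (- e ` S0)) = (\<integral>\<^sup>+n. ennreal (norm (r c n * \<psi> n x)) \<partial>count_space (e ` (S - S0)))"
      proof (rule nn_integral_count_space_eq)
        fix n assume "n \<in> - e ` S0 - e ` (S - S0)"
        then have "n \<notin> e ` S" by blast
        then show "ennreal (norm (r c n * \<psi> n x)) = 0" by (simp add: term_out)
      next
        fix n assume "n \<in> e ` (S - S0) - - e ` S0"
        then have False using inj S0(2) by (auto dest: inj_onD)
        then show "ennreal (norm (r c n * \<psi> n x)) = 0" ..
      qed
      also have "\<dots> = (\<integral>\<^sup>+Q. ennreal (norm (r c (e Q) * \<psi> (e Q) x)) \<partial>count_space (S - S0))"
        by (rule nn_integral_bij_count_space[symmetric]) (use inj in \<open>auto intro: inj_on_imp_bij_betw inj_on_subset\<close>)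
      also have "\<dots> = (\<integral>\<^sup>+Q. ennreal (norm (c Q * \<phi> Q x)) \<partial>count_space (S - S0))"
        by (rule nn_integral_cong) (simp add: term_in)
      finally show ?thesis .
    qed
    show "\<exists>F. finite F \<and> (\<forall>c\<in>r ` \<C>. enorm N p (\<lambda>x. \<integral>\<^sup>+n. ennreal (norm (c n * \<psi> n x)) \<partial>count_space (- F)) \<le> ennreal \<epsilon>)"
      using S0 by (intro exI[of _ "e ` S0"]) (auto simp: eq)
  qed
  then show ?thesis by (simp add: image_image sum_eq)
qed

section \<open>The Bloom sparse operators\<close>

lemma enorm_weighted:
  assumes [measurable]: "lam \<in> borel_measurable M" "\<omega> \<in> borel_measurable M" "u \<in> borel_measurable M"
    and eq: "AE x in M. lam x = \<omega> x powr p" and pos: "\<And>x. x \<in> space M \<Longrightarrow> 0 < \<omega> x" and p: "0 < p"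
  shows "enorm (weighted M lam) p u = wnorm M p \<omega> u"
proof -
  have "(\<integral>\<^sup>+x. epow (u x) p \<partial>weighted M lam) = (\<integral>\<^sup>+x. ennreal (lam x) * epow (u x) p \<partial>M)"
    unfolding weighted_def by (rule nn_integral_density) auto
  also have "\<dots> = (\<integral>\<^sup>+x. epow (u x * ennreal (\<omega> x)) p \<partial>M)"
  proof (rule nn_integral_cong_AE)
    show "AE x in M. ennreal (lam x) * epow (u x) p = epow (u x * ennreal (\<omega> x)) p"
      using eq AE_space by eventually_elim (use pos p in \<open>auto simp: epow_mult less_imp_le mult.commute\<close>)
  qed
  finally show ?thesis by (simp add: enorm_def)
qed

lemma set_integrable_if_finite:
  fixes f :: "'a \<Rightarrow> 'k::{banach, second_countable_topology}"
  assumes [measurable]: "Q \<in> sets M" "f \<in> borel_measurable M" and "(\<integral>\<^sup>+x\<in>Q. ennreal (norm (f x)) \<partial>M) < top"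
  shows "set_integrable M Q f"
  unfolding set_integrable_def integrable_iff_bounded
proof
  have "(\<integral>\<^sup>+x. ennreal (norm (indicator Q x *\<^sub>R f x)) \<partial>M) = (\<integral>\<^sup>+x\<in>Q. ennreal (norm (f x)) \<partial>M)"
    by (intro nn_integral_cong) (auto simp: indicator_def)
  with assms(3) show "(\<integral>\<^sup>+x. ennreal (norm (indicator Q x *\<^sub>R f x)) \<partial>M) < \<infinity>" by simp
qed measurable

lemma norm_avg_le_eavg:
  fixes f :: "'a \<Rightarrow> 'k::{banach, second_countable_topology}"
  assumes Q: "Q \<in> sets M" "0 < emeasure M Q" "emeasure M Q < top"
  shows "ennreal (norm (avg M Q f)) \<le> eavg M (\<lambda>x. ennreal (norm (f x))) Q"
proof -
  have m: "emeasure M Q = ennreal (measure M Q)" "0 < measure M Q"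
    using Q by (simp_all add: measure_def enn2real_positive_iff)
  have "ennreal (norm (LINT x:Q|M. f x)) \<le> (\<integral>\<^sup>+x\<in>Q. ennreal (norm (f x)) \<partial>M)"
  proof (cases "set_integrable M Q f")
    case True
    then have "ennreal (norm (LINT x:Q|M. f x)) \<le> (\<integral>\<^sup>+x. ennreal (norm (indicator Q x *\<^sub>R f x)) \<partial>M)"
      unfolding set_lebesgue_integral_def set_integrable_def by (rule integral_norm_bound_ennreal)
    also have "\<dots> = (\<integral>\<^sup>+x\<in>Q. ennreal (norm (f x)) \<partial>M)"
      by (intro nn_integral_cong) (auto simp: indicator_def)
    finally show ?thesis .
  next
    case False
    then show ?thesis by (simp add: set_lebesgue_integral_def set_integrable_def not_integrable_integral_eq)
  qed
  then have "ennreal (norm (LINT x:Q|M. f x)) / ennreal (measure M Q) \<le> eavg M (\<lambda>x. ennreal (norm (f x))) Q"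
    unfolding eavg_def m(1) by (rule divide_right_mono_ennreal)
  moreover have "ennreal (norm (avg M Q f)) = ennreal (norm (LINT x:Q|M. f x)) / ennreal (measure M Q)"
    using m(2) by (simp add: avg_def divide_ennreal)
  ultimately show ?thesis by simp
qed

context positive_cubes
begin

lemma cube_integral_le:
  assumes ap: "Ap p q \<omega>" and Q: "Q \<in> \<D>" and [measurable]: "f \<in> borel_measurable M"
  shows "(\<integral>\<^sup>+x\<in>Q. f x \<partial>M) \<le> wnorm M p \<omega> f * dcube M q \<omega> Q"
proof -
  have p: "1 < p" "1 / p + 1 / q = 1" and [measurable]: "\<omega> \<in> borel_measurable M" and pos: "\<And>x. x \<in> space M \<Longrightarrow> 0 < \<omega> x"
    using ap by (auto simp: Ap_def)
  note [measurable] = cube_sets[OF Q]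
  have "(\<integral>\<^sup>+x\<in>Q. f x \<partial>M) = (\<integral>\<^sup>+x. (f x * ennreal (\<omega> x)) * (ennreal (1 / \<omega> x) * indicator Q x) \<partial>M)"
  proof (rule nn_integral_cong)
    fix x assume "x \<in> space M"
    then have "ennreal (\<omega> x) * ennreal (1 / \<omega> x) = 1" using pos[of x] by (simp flip: ennreal_mult)
    moreover have "(f x * ennreal (\<omega> x)) * (ennreal (1 / \<omega> x) * indicator Q x) = f x * indicator Q x * (ennreal (\<omega> x) * ennreal (1 / \<omega> x))"
      by (simp only: mult_ac)
    ultimately show "f x * indicator Q x = (f x * ennreal (\<omega> x)) * (ennreal (1 / \<omega> x) * indicator Q x)" by simp
  qed
  also have "\<dots> \<le> wnorm M p \<omega> f * dcube M q \<omega> Q"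
    by (rule Holder_nn_integral[OF p]) auto
  finally show ?thesis .
qed

lemma eavg_bound:
  assumes ap: "Ap p q \<omega>" and Q: "Q \<in> \<D>"
  obtains K :: real where "0 \<le> K" "\<And>f. f \<in> borel_measurable M \<Longrightarrow> eavg M f Q \<le> ennreal K * wnorm M p \<omega> f"
proof -
  let ?c = "dcube M q \<omega> Q / emeasure M Q"
  have "?c < top"
    using Ap_weight_bounds(4)[OF ap Q] cube_pos[OF Q] cube_finite[OF Q] by (simp add: divide_less_ennreal ennreal_top_mult)
  then obtain K where K: "?c = ennreal K" "0 \<le> K" by (cases ?c) auto
  show ?thesis
  proof (rule that[OF K(2)])
    fix f :: "'a \<Rightarrow> ennreal" assume f: "f \<in> borel_measurable M"
    have "eavg M f Q \<le> (wnorm M p \<omega> f * dcube M q \<omega> Q) / emeasure M Q"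
      unfolding eavg_def by (intro divide_right_mono_ennreal cube_integral_le ap Q f)
    also have "\<dots> = ennreal K * wnorm M p \<omega> f"
      unfolding K(1)[symmetric] by (simp add: ennreal_times_divide mult.commute)
    finally show "eavg M f Q \<le> \<dots>" .
  qed
qed

end

context bloom_setting
begin

lemma params: "1 < p" "1 < p2" "0 < p0"
  and weights_measurable [measurable]: "\<omega>1 \<in> borel_measurable M" "\<omega>2 \<in> borel_measurable M" "\<omega>3 \<in> borel_measurable M"
  and weights_pos: "x \<in> space M \<Longrightarrow> 0 < \<omega>1 x" "x \<in> space M \<Longrightarrow> 0 < \<omega>2 x" "x \<in> space M \<Longrightarrow> 0 < \<omega>3 x"
proof -
  show p: "1 < p" "1 < p2" using ap1 ap3 by (auto simp: Ap_def)
  have "1 / p > 0" "1 / p2 > 0" using p by auto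
  then have "1 / p0 > 0" using exps by linarith
  then show "0 < p0" by (simp add: zero_less_divide_iff)
qed (use ap1 ap2 ap3 in \<open>auto simp: Ap_def\<close>)

lemma S_cubes: "S \<subseteq> \<D>" and S_countable: "countable S"
  using sp countable_cubes by (auto simp: sparse_def intro: countable_subset)

abbreviation nrm :: "('a \<Rightarrow> 'k) \<Rightarrow> 'a \<Rightarrow> ennreal" where "nrm f \<equiv> \<lambda>x. ennreal (norm (f x))"
abbreviation norm1 :: "('a \<Rightarrow> ennreal) \<Rightarrow> ennreal" where "norm1 f \<equiv> wnorm M p \<omega>1 f"
abbreviation norm3 :: "('a \<Rightarrow> ennreal) \<Rightarrow> ennreal" where "norm3 g \<equiv> wnorm M p2 \<omega>3 g"
abbreviation norm0 :: "('a \<Rightarrow> ennreal) \<Rightarrow> ennreal" where "norm0 u \<equiv> enorm M p0 (\<lambda>x. u x * ennreal (\<omega>2 x * \<omega>3 x))"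

text \<open>A single term is bounded by the whole sum, whose norm is controlled; the norm of the indicator of \<open>Q\<close> is positive.\<close>
lemma adj_eavg_bound:
  assumes Q: "Q \<in> S"
  obtains K :: real where "0 \<le> K" "\<And>f. f \<in> borel_measurable M \<Longrightarrow>
    eavg M (\<lambda>y. ennreal (norm (b y - avg M Q b)) * f y) Q \<le> ennreal K * norm1 f"
proof -
  have QD: "Q \<in> \<D>" using Q S_cubes by auto
  note [measurable] = cube_sets[OF QD]
  obtain C where C: "0 \<le> C" "\<And>f. f \<in> borel_measurable M \<Longrightarrow> wnorm M p \<omega>2 (lin_adj S f) \<le> ennreal C * norm1 f"
    by (rule bilinear_bounded) (rule that; assumption)
  let ?w = "wcube M p \<omega>2 Q"
  obtain w where w: "?w = ennreal w" "0 < w"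
    using Ap_weight_bounds(1,2)[OF ap2 QD] by (cases ?w) (auto simp: less_le)
  show ?thesis
  proof (rule that[of "C / w"])
    show "0 \<le> C / w" using C w by simp
    fix f :: "'a \<Rightarrow> ennreal" assume f: "f \<in> borel_measurable M"
    let ?e = "eavg M (\<lambda>y. ennreal (norm (b y - avg M Q b)) * f y) Q"
    have "?e * ennreal w = enorm M p (\<lambda>x. ?e * (ennreal (\<omega>2 x) * indicator Q x))"
      unfolding w(1)[symmetric] using params by (subst enorm_cmult) auto
    also have "\<dots> \<le> wnorm M p \<omega>2 (lin_adj S f)"
    proof (rule enorm_mono)
      fix x
      have "?e * indicator Q x \<le> lin_adj S f x"
        unfolding lin_adj_def by (rule nn_integral_ge_point[OF Q])
      then have "?e * indicator Q x * ennreal (\<omega>2 x) \<le> lin_adj S f x * ennreal (\<omega>2 x)" by (rule mult_right_mono) simp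
      then show "?e * (ennreal (\<omega>2 x) * indicator Q x) \<le> lin_adj S f x * ennreal (\<omega>2 x)" by (simp add: mult_ac)
    qed (use params in auto)
    also have "\<dots> \<le> ennreal C * norm1 f" by (rule C(2)[OF f])
    finally have "ennreal (1 / w) * (?e * ennreal w) \<le> ennreal (1 / w) * (ennreal C * norm1 f)" by (rule mult_left_mono) simp
    moreover have "ennreal (1 / w) * (?e * ennreal w) = ?e"
    proof -
      have "ennreal (1 / w) * ennreal w = 1" using w by (simp flip: ennreal_mult)
      moreover have "ennreal (1 / w) * (?e * ennreal w) = ?e * (ennreal (1 / w) * ennreal w)" by (rule mult.left_commute)
      ultimately show ?thesis by simp
    qed
    moreover have "ennreal (1 / w) * (ennreal C * norm1 f) = ennreal (C / w) * norm1 f"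
    proof -
      have "ennreal (C / w) = ennreal (1 / w) * ennreal C" using w C by (simp flip: ennreal_mult)
      then show ?thesis by (simp only: mult.assoc)
    qed
    ultimately show "?e \<le> ennreal (C / w) * norm1 f" by simp
  qed
qed

lemma bloom_term_norm_le:
  assumes Q: "Q \<in> S"
  shows "ennreal (norm (bloom_term M b f g Q x)) \<le>
    eavg M (nrm f) Q * eavg M (nrm g) Q * (ennreal (norm (b x - avg M Q b)) * indicator Q x)"
proof -
  have QD: "Q \<in> \<D>" using Q S_cubes by auto
  note m = cube_sets[OF QD] cube_pos[OF QD] cube_finite[OF QD]
  have "ennreal (norm (bloom_term M b f g Q x)) =
      ennreal (norm (avg M Q f)) * ennreal (norm (avg M Q g)) * (ennreal (norm (b x - avg M Q b)) * indicator Q x)"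
    by (auto simp: bloom_term_def norm_mult ennreal_mult indicator_def mult_ac)
  also have "\<dots> \<le> eavg M (nrm f) Q * eavg M (nrm g) Q * (ennreal (norm (b x - avg M Q b)) * indicator Q x)"
    by (intro mult_mono norm_avg_le_eavg m) auto
  finally show ?thesis .
qed

lemma bloom_adj_term_norm_le:
  assumes Q: "Q \<in> S"
  shows "ennreal (norm (bloom_adj_term M b f g Q x)) \<le>
    eavg M (\<lambda>y. ennreal (norm (b y - avg M Q b)) * nrm f y) Q * eavg M (nrm g) Q * indicator Q x"
proof -
  have QD: "Q \<in> \<D>" using Q S_cubes by auto
  note m = cube_sets[OF QD] cube_pos[OF QD] cube_finite[OF QD]
  have "ennreal (norm (avg M Q (\<lambda>y. norm ((b y - avg M Q b) * f y)))) \<le> eavg M (\<lambda>y. ennreal (norm (norm ((b y - avg M Q b) * f y)))) Q"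
    by (rule norm_avg_le_eavg[OF m])
  also have "\<dots> = eavg M (\<lambda>y. ennreal (norm (b y - avg M Q b)) * nrm f y) Q"
    by (simp add: norm_mult ennreal_mult)
  finally have le: "ennreal (norm (avg M Q (\<lambda>y. norm ((b y - avg M Q b) * f y)))) \<le> \<dots>" .
  have "ennreal (norm (bloom_adj_term M b f g Q x)) =
      ennreal (norm (avg M Q (\<lambda>y. norm ((b y - avg M Q b) * f y)))) * ennreal (norm (avg M Q g)) * indicator Q x"
    by (auto simp: bloom_adj_term_def norm_mult[of "of_real _ * _"] norm_mult[of "of_real _"] ennreal_mult indicator_def)
  also have "\<dots> \<le> eavg M (\<lambda>y. ennreal (norm (b y - avg M Q b)) * nrm f y) Q * eavg M (nrm g) Q * indicator Q x"
    by (intro mult_mono norm_avg_le_eavg m le) auto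
  finally show ?thesis .
qed

lemma bilin_measurable [measurable]:
  assumes T: "T \<subseteq> \<D>"
  shows "bilin T f g \<in> borel_measurable M" "bilin_adj T f g \<in> borel_measurable M"
proof -
  have c: "countable T" using T countable_cubes by (rule countable_subset)
  have [measurable]: "Q \<in> sets M" if "Q \<in> T" for Q using T that by auto
  show "bilin T f g \<in> borel_measurable M" "bilin_adj T f g \<in> borel_measurable M"
    unfolding bilin_def[abs_def] bilin_adj_def[abs_def]
    by (intro borel_measurable_countable_sum c; measurable)+
qed

lemma AE_finite_if_norm0:
  assumes [measurable]: "u \<in> borel_measurable M" and "norm0 u < top"
  shows "AE x in M. u x < top"
proof -
  have "(\<integral>\<^sup>+x. epow (u x * ennreal (\<omega>2 x * \<omega>3 x)) p0 \<partial>M) \<noteq> \<infinity>"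
    using assms(2) by (auto simp: enorm_def less_top)
  then have "AE x in M. epow (u x * ennreal (\<omega>2 x * \<omega>3 x)) p0 \<noteq> \<infinity>" by (intro nn_integral_PInf_AE) auto
  then show ?thesis
    using AE_space
  proof eventually_elim
    case (elim x)
    have "ennreal (\<omega>2 x * \<omega>3 x) \<noteq> 0" using weights_pos(2,3)[OF elim(2)] by (simp add: ennreal_eq_0_iff not_le)
    then have "u x \<noteq> top" using elim(1) by (cases "u x = top") (simp_all add: ennreal_top_mult)
    then show ?case by (simp add: less_top)
  qed
qed

theorem bloom_operators_well_defined:
  assumes [measurable]: "f \<in> borel_measurable M" "g \<in> borel_measurable M" and fin: "norm1 (nrm f) < top" "norm3 (nrm g) < top"
  shows "bloom_well_defined M S b f g"
proof -
  obtain C where C: "0 \<le> C"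
    "\<And>f g. f \<in> borel_measurable M \<Longrightarrow> g \<in> borel_measurable M \<Longrightarrow> norm0 (bilin S f g) \<le> ennreal C * (norm1 f * norm3 g)"
    "\<And>f g. f \<in> borel_measurable M \<Longrightarrow> g \<in> borel_measurable M \<Longrightarrow> norm0 (bilin_adj S f g) \<le> ennreal C * (norm1 f * norm3 g)"
    by (rule bilinear_bounded) (rule that; assumption)
  have top: "ennreal C * (norm1 (nrm f) * norm3 (nrm g)) < top" using fin by (simp add: ennreal_mult_less_top)
  have ae1: "AE x in M. bilin S (nrm f) (nrm g) x < top"
    using S_cubes by (intro AE_finite_if_norm0 le_less_trans[OF C(2) top]) auto
  have ae2: "AE x in M. bilin_adj S (nrm f) (nrm g) x < top"
    using S_cubes by (intro AE_finite_if_norm0 le_less_trans[OF C(3) top]) auto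
  have int: "set_integrable M Q f \<and> set_integrable M Q g \<and> set_integrable M Q (\<lambda>y. norm ((b y - avg M Q b) * f y))" if Q: "Q \<in> S" for Q
  proof -
    have QD: "Q \<in> \<D>" using Q S_cubes by auto
    note [measurable] = cube_sets[OF QD]
    have "(\<integral>\<^sup>+x\<in>Q. ennreal (norm (f x)) \<partial>M) < top"
      by (rule le_less_trans[OF cube_integral_le[OF ap1 QD]])
         (use fin Ap_weight_bounds(4)[OF ap1 QD] in \<open>auto simp: ennreal_mult_less_top\<close>)
    moreover have "(\<integral>\<^sup>+x\<in>Q. ennreal (norm (g x)) \<partial>M) < top"
      by (rule le_less_trans[OF cube_integral_le[OF ap3 QD]])
         (use fin Ap_weight_bounds(4)[OF ap3 QD] in \<open>auto simp: ennreal_mult_less_top\<close>)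
    moreover have "(\<integral>\<^sup>+x\<in>Q. ennreal (norm (norm ((b x - avg M Q b) * f x))) \<partial>M) < top"
    proof -
      obtain K where K: "0 \<le> K" "\<And>f. f \<in> borel_measurable M \<Longrightarrow>
          eavg M (\<lambda>y. ennreal (norm (b y - avg M Q b)) * f y) Q \<le> ennreal K * norm1 f"
        using adj_eavg_bound[OF Q] by blast
      have "(\<integral>\<^sup>+x\<in>Q. ennreal (norm (norm ((b x - avg M Q b) * f x))) \<partial>M) =
          eavg M (\<lambda>y. ennreal (norm (b y - avg M Q b)) * nrm f y) Q * emeasure M Q"
        using cube_finite[OF QD] by (simp add: eavg_mult norm_mult ennreal_mult)
      also have "\<dots> \<le> ennreal K * norm1 (nrm f) * emeasure M Q" by (intro mult_right_mono K) auto
      also have "\<dots> < top" using fin cube_finite[OF QD] by (simp add: ennreal_mult_less_top)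
      finally show ?thesis .
    qed
    ultimately show ?thesis by (intro conjI set_integrable_if_finite) auto
  qed
  have "AE x in M. (\<lambda>Q. bloom_term M b f g Q x) summable_on S"
    using ae1
  proof eventually_elim
    case (elim x)
    have "(\<integral>\<^sup>+Q. ennreal (norm (bloom_term M b f g Q x)) \<partial>count_space S) \<le> bilin S (nrm f) (nrm g) x"
      unfolding bilin_def by (intro nn_integral_mono bloom_term_norm_le) auto
    then show ?case using elim by (intro summable_on_if_nn_integral_finite) (rule le_less_trans)
  qed
  moreover have "AE x in M. (\<lambda>Q. bloom_adj_term M b f g Q x) summable_on S"
    using ae2
  proof eventually_elim
    case (elim x)
    have "(\<integral>\<^sup>+Q. ennreal (norm (bloom_adj_term M b f g Q x)) \<partial>count_space S) \<le> bilin_adj S (nrm f) (nrm g) x"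
      unfolding bilin_adj_def by (intro nn_integral_mono bloom_adj_term_norm_le) auto
    then show ?case using elim by (intro summable_on_if_nn_integral_finite) (rule le_less_trans)
  qed
  ultimately show ?thesis using int by (auto simp: bloom_well_defined_def)
qed

text \<open>Apply the boundedness of the sum to functions \<open>f\<close> and \<open>g\<close> of finite norm whose averages over \<open>Q\<close> do not vanish, and keep only
the term of \<open>Q\<close>.\<close>
lemma norm0_oscillation_finite:
  assumes Q: "Q \<in> S"
  shows "norm0 (\<lambda>x. ennreal (norm (b x - avg M Q b)) * indicator Q x) < top"
proof -
  have QD: "Q \<in> \<D>" using Q S_cubes by auto
  note [measurable] = cube_sets[OF QD]
  have mQ: "0 < emeasure M Q" "emeasure M Q < top" using cube_pos[OF QD] cube_finite[OF QD] by auto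
  obtain C where C: "0 \<le> C"
    "\<And>f g. f \<in> borel_measurable M \<Longrightarrow> g \<in> borel_measurable M \<Longrightarrow> norm0 (bilin S f g) \<le> ennreal C * (norm1 f * norm3 g)"
    by (rule bilinear_bounded) (rule that; assumption)
  have aux: "enorm M r (\<lambda>x. (ennreal (1 / \<omega> x) * indicator Q x) * ennreal (\<omega> x)) < top" "eavg M (\<lambda>x. ennreal (1 / \<omega> x) * indicator Q x) Q \<noteq> 0"
    if [measurable]: "\<omega> \<in> borel_measurable M" and pos: "\<And>x. x \<in> space M \<Longrightarrow> 0 < \<omega> x" and r: "0 < r" for \<omega> and r :: real
  proof -
    have "enorm M r (\<lambda>x. (ennreal (1 / \<omega> x) * indicator Q x) * ennreal (\<omega> x)) = enorm M r (indicator Q)"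
    proof (rule enorm_cong)
      fix x assume "x \<in> space M"
      then have "ennreal (1 / \<omega> x) * ennreal (\<omega> x) = 1" using pos[of x] by (simp flip: ennreal_mult)
      then show "(ennreal (1 / \<omega> x) * indicator Q x) * ennreal (\<omega> x) = indicator Q x" by (auto simp: indicator_def)
    qed
    also have "\<dots> = epow (emeasure M Q) (1 / r)"
    proof -
      have "(\<integral>\<^sup>+x. epow (indicator Q x) r \<partial>M) = (\<integral>\<^sup>+x. indicator Q x \<partial>M)"
        by (intro nn_integral_cong) (auto simp: indicator_def)
      then show ?thesis by (simp add: enorm_def)
    qed
    also have "\<dots> < top" using mQ by simp
    finally show "enorm M r (\<lambda>x. (ennreal (1 / \<omega> x) * indicator Q x) * ennreal (\<omega> x)) < top" .
    have "(\<integral>\<^sup>+x\<in>Q. ennreal (1 / \<omega> x) \<partial>M) \<noteq> 0"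
      using pos mQ by (intro set_nn_integral_pos) auto
    moreover have "(\<integral>\<^sup>+x\<in>Q. ennreal (1 / \<omega> x) * indicator Q x \<partial>M) = (\<integral>\<^sup>+x\<in>Q. ennreal (1 / \<omega> x) \<partial>M)"
      by (intro nn_integral_cong) (auto simp: indicator_def)
    ultimately show "eavg M (\<lambda>x. ennreal (1 / \<omega> x) * indicator Q x) Q \<noteq> 0"
      using mQ by (simp add: eavg_def)
  qed
  let ?f = "\<lambda>x. ennreal (1 / \<omega>1 x) * indicator Q x" and ?g = "\<lambda>x. ennreal (1 / \<omega>3 x) * indicator Q x"
  let ?u = "\<lambda>x. ennreal (norm (b x - avg M Q b)) * indicator Q x"
  let ?c = "eavg M ?f Q * eavg M ?g Q"
  have f: "norm1 ?f < top" "eavg M ?f Q \<noteq> 0" using aux[of \<omega>1 p] weights_pos params by auto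
  have g: "norm3 ?g < top" "eavg M ?g Q \<noteq> 0" using aux[of \<omega>3 p2] weights_pos params by auto
  have "?c * norm0 ?u = enorm M p0 (\<lambda>x. ?c * (?u x * ennreal (\<omega>2 x * \<omega>3 x)))"
    using params by (subst enorm_cmult) auto
  also have "\<dots> \<le> norm0 (bilin S ?f ?g)"
  proof (rule enorm_mono)
    fix x
    have "?c * ?u x \<le> bilin S ?f ?g x"
      unfolding bilin_def by (rule nn_integral_ge_point[OF Q])
    then have "?c * ?u x * ennreal (\<omega>2 x * \<omega>3 x) \<le> bilin S ?f ?g x * ennreal (\<omega>2 x * \<omega>3 x)" by (rule mult_right_mono) simp
    then show "?c * (?u x * ennreal (\<omega>2 x * \<omega>3 x)) \<le> bilin S ?f ?g x * ennreal (\<omega>2 x * \<omega>3 x)" by (simp only: mult.assoc)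
  qed (use params in auto)
  also have "\<dots> \<le> ennreal C * (norm1 ?f * norm3 ?g)" by (rule C(2)) measurable
  also have "\<dots> < top" using f g by (simp add: ennreal_mult_less_top)
  finally show ?thesis using f g by (auto simp: ennreal_mult_less_top)
qed

lemma norm0_indicator_finite:
  assumes Q: "Q \<in> \<D>"
  shows "norm0 (indicator Q) < top"
proof -
  note [measurable] = cube_sets[OF Q]
  have "norm0 (indicator Q) = enorm M p0 (\<lambda>x. (ennreal (\<omega>2 x) * indicator Q x) * (ennreal (\<omega>3 x) * indicator Q x))"
    by (rule enorm_cong) (use weights_pos in \<open>auto simp: indicator_def ennreal_mult less_imp_le\<close>)
  also have "\<dots> \<le> wcube M p \<omega>2 Q * wcube M p2 \<omega>3 Q"
    using params by (intro Holder_enorm exps) auto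
  also have "\<dots> < top"
    using Ap_weight_bounds(2)[OF ap2 Q] Ap_weight_bounds(2)[OF ap3 Q] by (simp add: ennreal_mult_less_top)
  finally show ?thesis .
qed

text \<open>Both operators are series over \<open>S\<close> with fixed functions, \<open>|b - b\<^sub>Q|\<close> on \<open>Q\<close> for the first and the indicator of \<open>Q\<close> for the second,
and with coefficients that depend on \<open>f\<close> and \<open>g\<close>.\<close>
theorem bloom_compact:
  assumes N: "sets N = sets M" "\<And>u. u \<in> borel_measurable M \<Longrightarrow> enorm N p0 u = norm0 u"
    and F: "\<And>f. f \<in> F \<Longrightarrow> f \<in> borel_measurable M" "\<And>f. f \<in> F \<Longrightarrow> norm1 (nrm f) \<le> ennreal CF" "0 \<le> CF"
    and G: "\<And>g. g \<in> G \<Longrightarrow> g \<in> borel_measurable M" "\<And>g. g \<in> G \<Longrightarrow> norm3 (nrm g) \<le> ennreal CG" "0 \<le> CG"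
  shows "Lp_relatively_compact N p0 {bloom_sparse M S b f g | f g. f \<in> F \<and> g \<in> G}"
    and "Lp_relatively_compact N p0 {bloom_sparse_adj M S b f g | f g. f \<in> F \<and> g \<in> G}"
proof -
  have meas: "u \<in> borel_measurable N \<longleftrightarrow> u \<in> borel_measurable M" for u :: "'a \<Rightarrow> 'z::topological_space"
    using measurable_cong_sets[OF N(1) refl] by blast
  have nrm_m: "nrm f \<in> borel_measurable M" if "f \<in> borel_measurable M" for f using that by measurable
  have tailbound: "norm1 (nrm f) * norm3 (nrm g) \<le> ennreal (CF * CG)" if "f \<in> F" "g \<in> G" for f g
    using mult_mono[OF F(2)[OF that(1)] G(2)[OF that(2)]] F(3) G(3) by (simp add: ennreal_mult)
  have tail: "\<exists>S0. finite S0 \<and> S0 \<subseteq> S \<and> (\<forall>f\<in>F. \<forall>g\<in>G. norm0 (bilin (S - S0) (nrm f) (nrm g)) \<le> ennreal \<epsilon> \<and>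
      norm0 (bilin_adj (S - S0) (nrm f) (nrm g)) \<le> ennreal \<epsilon>)" if \<epsilon>: "0 < \<epsilon>" for \<epsilon>
  proof -
    \<comment> \<open>the summand 1 avoids a division by zero\<close>
    define \<delta> where "\<delta> = \<epsilon> / (CF * CG + 1)"
    have c: "0 \<le> CF * CG" using F(3) G(3) by simp
    have \<delta>: "0 < \<delta>" "\<delta> * (CF * CG) \<le> \<epsilon>" using \<epsilon> c by (auto simp: \<delta>_def field_simps)
    obtain S0 where S0: "finite S0" "S0 \<subseteq> S"
      "\<And>f g. f \<in> borel_measurable M \<Longrightarrow> g \<in> borel_measurable M \<Longrightarrow> norm0 (bilin (S - S0) f g) \<le> ennreal \<delta> * (norm1 f * norm3 g)"
      "\<And>f g. f \<in> borel_measurable M \<Longrightarrow> g \<in> borel_measurable M \<Longrightarrow> norm0 (bilin_adj (S - S0) f g) \<le> ennreal \<delta> * (norm1 f * norm3 g)"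
      using bilinear_tail[OF \<delta>(1)] by blast
    have le: "ennreal \<delta> * (norm1 (nrm f) * norm3 (nrm g)) \<le> ennreal \<epsilon>" if "f \<in> F" "g \<in> G" for f g
    proof -
      have "ennreal \<delta> * (norm1 (nrm f) * norm3 (nrm g)) \<le> ennreal \<delta> * ennreal (CF * CG)"
        by (intro mult_left_mono tailbound that) simp
      also have "\<dots> = ennreal (\<delta> * (CF * CG))" using \<delta>(1) c by (intro ennreal_mult[symmetric]) auto
      also have "\<dots> \<le> ennreal \<epsilon>" by (intro ennreal_leI \<delta>)
      finally show ?thesis .
    qed
    have "norm0 (bilin (S - S0) (nrm f) (nrm g)) \<le> ennreal \<epsilon> \<and> norm0 (bilin_adj (S - S0) (nrm f) (nrm g)) \<le> ennreal \<epsilon>"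
      if fg: "f \<in> F" "g \<in> G" for f g
      using order_trans[OF S0(3) le[OF fg]] order_trans[OF S0(4) le[OF fg]] nrm_m F(1) G(1) fg by auto
    with S0(1,2) show ?thesis by blast
  qed
  have Lp: "(\<lambda>x. of_real (r x) * indicator Q x :: 'k) \<in> Lp_space N p0"
    if [measurable]: "r \<in> borel_measurable M" and Q: "Q \<in> \<D>" and fin: "norm0 (\<lambda>x. ennreal \<bar>r x\<bar> * indicator Q x) < top" for r Q
  proof -
    note [measurable] = cube_sets[OF Q]
    have [measurable]: "(\<lambda>x. of_real (r x) * indicator Q x :: 'k) \<in> borel_measurable M" by measurable
    have "enorm N p0 (\<lambda>x. ennreal (norm (of_real (r x) * indicator Q x :: 'k))) = norm0 (\<lambda>x. ennreal (norm (of_real (r x) * indicator Q x :: 'k)))"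
      by (rule N(2)) measurable
    also have "\<dots> = norm0 (\<lambda>x. ennreal \<bar>r x\<bar> * indicator Q x)"
      by (rule enorm_cong) (auto simp: indicator_def)
    finally show ?thesis using fin params(3) by (simp add: Lp_space_iff meas)
  qed
  have bound_avg: "\<exists>R. \<forall>f\<in>F. \<forall>g\<in>G. norm (avg M Q f * avg M Q g) \<le> R" if Q: "Q \<in> S" for Q
  proof -
    have QD: "Q \<in> \<D>" using Q S_cubes by auto
    note m = cube_sets[OF QD] cube_pos[OF QD] cube_finite[OF QD]
    obtain K1 where K1: "0 \<le> K1" "\<And>f. f \<in> borel_measurable M \<Longrightarrow> eavg M f Q \<le> ennreal K1 * norm1 f"
      using eavg_bound[OF ap1 QD] by blast
    obtain K3 where K3: "0 \<le> K3" "\<And>f. f \<in> borel_measurable M \<Longrightarrow> eavg M f Q \<le> ennreal K3 * norm3 f"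
      using eavg_bound[OF ap3 QD] by blast
    have "norm (avg M Q f * avg M Q g) \<le> (K1 * CF) * (K3 * CG)" if fg: "f \<in> F" "g \<in> G" for f g
    proof -
      have "ennreal (norm (avg M Q f)) \<le> ennreal K1 * ennreal CF"
        by (rule order_trans[OF norm_avg_le_eavg[OF m] order_trans[OF K1(2)[OF nrm_m[OF F(1)[OF fg(1)]]]]]) (intro mult_left_mono F fg, simp)
      then have 1: "norm (avg M Q f) \<le> K1 * CF" using K1(1) F(3) by (simp flip: ennreal_mult)
      have "ennreal (norm (avg M Q g)) \<le> ennreal K3 * ennreal CG"
        by (rule order_trans[OF norm_avg_le_eavg[OF m] order_trans[OF K3(2)[OF nrm_m[OF G(1)[OF fg(2)]]]]]) (intro mult_left_mono G fg, simp)
      then have 2: "norm (avg M Q g) \<le> K3 * CG" using K3(1) G(3) by (simp flip: ennreal_mult)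
      show ?thesis unfolding norm_mult using 1 2 K1(1) F(3) by (intro mult_mono) auto
    qed
    then show ?thesis by blast
  qed
  have bound_adj: "\<exists>R. \<forall>f\<in>F. \<forall>g\<in>G. norm (of_real (avg M Q (\<lambda>y. norm ((b y - avg M Q b) * f y))) * avg M Q g) \<le> R" if Q: "Q \<in> S" for Q
  proof -
    have QD: "Q \<in> \<D>" using Q S_cubes by auto
    note m = cube_sets[OF QD] cube_pos[OF QD] cube_finite[OF QD]
    obtain K1 where K1: "0 \<le> K1" "\<And>f. f \<in> borel_measurable M \<Longrightarrow> eavg M (\<lambda>y. ennreal (norm (b y - avg M Q b)) * f y) Q \<le> ennreal K1 * norm1 f"
      using adj_eavg_bound[OF Q] by blast
    obtain K3 where K3: "0 \<le> K3" "\<And>f. f \<in> borel_measurable M \<Longrightarrow> eavg M f Q \<le> ennreal K3 * norm3 f"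
      using eavg_bound[OF ap3 QD] by blast
    have "norm (of_real (avg M Q (\<lambda>y. norm ((b y - avg M Q b) * f y))) * avg M Q g) \<le> (K1 * CF) * (K3 * CG)" if fg: "f \<in> F" "g \<in> G" for f g
    proof -
      let ?a = "avg M Q (\<lambda>y. norm ((b y - avg M Q b) * f y))"
      have "ennreal (norm ?a) \<le> eavg M (\<lambda>y. ennreal (norm (norm ((b y - avg M Q b) * f y)))) Q"
        by (rule norm_avg_le_eavg[OF m])
      also have "\<dots> = eavg M (\<lambda>y. ennreal (norm (b y - avg M Q b)) * nrm f y) Q"
        by (simp add: norm_mult ennreal_mult)
      also have "\<dots> \<le> ennreal K1 * norm1 (nrm f)" by (rule K1(2)[OF nrm_m[OF F(1)[OF fg(1)]]])
      also have "\<dots> \<le> ennreal K1 * ennreal CF" by (intro mult_left_mono F fg) simp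
      finally have 1: "norm ?a \<le> K1 * CF" using K1(1) F(3) by (simp flip: ennreal_mult)
      have "ennreal (norm (avg M Q g)) \<le> ennreal K3 * ennreal CG"
        by (rule order_trans[OF norm_avg_le_eavg[OF m] order_trans[OF K3(2)[OF nrm_m[OF G(1)[OF fg(2)]]]]]) (intro mult_left_mono G fg, simp)
      then have 2: "norm (avg M Q g) \<le> K3 * CG" using K3(1) G(3) by (simp flip: ennreal_mult)
      show ?thesis unfolding norm_mult[of "of_real _"] norm_of_real using 1 2 K1(1) F(3) by (intro mult_mono) auto
    qed
    then show ?thesis by blast
  qed
  have sumle: "enorm N p0 (\<lambda>x. \<integral>\<^sup>+Q. ennreal (norm (t Q x :: 'k)) \<partial>count_space (S - S0)) \<le> norm0 u"
    if t: "\<And>Q. Q \<in> S \<Longrightarrow> t Q \<in> borel_measurable M" and le: "\<And>x. (\<integral>\<^sup>+Q. ennreal (norm (t Q x)) \<partial>count_space (S - S0)) \<le> u x" for t u S0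
  proof -
    have "(\<lambda>x. \<integral>\<^sup>+Q. ennreal (norm (t Q x)) \<partial>count_space (S - S0)) \<in> borel_measurable M"
      using t S_countable by (intro borel_measurable_countable_sum) (auto intro!: measurable_compose[OF borel_measurable_norm] borel_measurable_norm)
    from N(2)[OF this] show ?thesis
      using params(3) le by (auto intro!: enorm_mono mult_right_mono)
  qed
  have "Lp_relatively_compact N p0 ((\<lambda>c x. \<Sum>\<^sub>\<infinity>Q\<in>S. c Q * (of_real (norm (b x - avg M Q b)) * indicator Q x)) `
      {(\<lambda>Q. avg M Q f * avg M Q g) | f g. f \<in> F \<and> g \<in> G})"
  proof (rule countable_series_relatively_compact[OF params(3) S_countable])
    fix Q assume Q: "Q \<in> S"
    then have QD: "Q \<in> \<D>" using S_cubes by auto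
    show "(\<lambda>x. of_real (norm (b x - avg M Q b)) * indicator Q x :: 'k) \<in> Lp_space N p0"
      using norm0_oscillation_finite[OF Q] by (intro Lp QD) auto
    show "\<exists>R. \<forall>c\<in>{(\<lambda>Q. avg M Q f * avg M Q g) | f g. f \<in> F \<and> g \<in> G}. norm (c Q) \<le> R"
      using bound_avg[OF Q] by auto
  next
    fix \<epsilon> :: real assume "0 < \<epsilon>"
    from tail[OF this] obtain S0 where S0: "finite S0" "S0 \<subseteq> S"
      "\<And>f g. f \<in> F \<Longrightarrow> g \<in> G \<Longrightarrow> norm0 (bilin (S - S0) (nrm f) (nrm g)) \<le> ennreal \<epsilon>" by blast
    have "enorm N p0 (\<lambda>x. \<integral>\<^sup>+Q. ennreal (norm (avg M Q f * avg M Q g * (of_real (norm (b x - avg M Q b)) * indicator Q x))) \<partial>count_space (S - S0)) \<le> ennreal \<epsilon>"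
      if fg: "f \<in> F" "g \<in> G" for f g
    proof (rule order_trans[OF sumle S0(3)[OF fg]])
      fix Q assume "Q \<in> S"
      then have [measurable]: "Q \<in> sets M" using S_cubes by auto
      show "(\<lambda>x. avg M Q f * avg M Q g * (of_real (norm (b x - avg M Q b)) * indicator Q x)) \<in> borel_measurable M" by measurable
    next
      fix x
      have eq: "avg M Q f * avg M Q g * (of_real (norm (b x - avg M Q b)) * indicator Q x) = bloom_term M b f g Q x" for Q
        by (simp add: bloom_term_def mult_ac)
      show "(\<integral>\<^sup>+Q. ennreal (norm (avg M Q f * avg M Q g * (of_real (norm (b x - avg M Q b)) * indicator Q x))) \<partial>count_space (S - S0))
          \<le> bilin (S - S0) (nrm f) (nrm g) x"
        unfolding eq bilin_def by (intro nn_integral_mono bloom_term_norm_le) auto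
    qed
    then show "\<exists>S0. finite S0 \<and> S0 \<subseteq> S \<and> (\<forall>c\<in>{(\<lambda>Q. avg M Q f * avg M Q g) | f g. f \<in> F \<and> g \<in> G}.
        enorm N p0 (\<lambda>x. \<integral>\<^sup>+Q. ennreal (norm (c Q * (of_real (norm (b x - avg M Q b)) * indicator Q x))) \<partial>count_space (S - S0)) \<le> ennreal \<epsilon>)"
      using S0(1,2) by blast
  qed
  moreover have "(\<lambda>c x. \<Sum>\<^sub>\<infinity>Q\<in>S. c Q * (of_real (norm (b x - avg M Q b)) * indicator Q x)) `
      {(\<lambda>Q. avg M Q f * avg M Q g) | f g. f \<in> F \<and> g \<in> G} = {bloom_sparse M S b f g | f g. f \<in> F \<and> g \<in> G}"
  proof -
    have eq: "(\<lambda>x. \<Sum>\<^sub>\<infinity>Q\<in>S. avg M Q f * avg M Q g * (of_real (norm (b x - avg M Q b)) * indicator Q x)) = bloom_sparse M S b f g" for f g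
      unfolding bloom_sparse_def[abs_def] bloom_term_def by (intro ext infsum_cong) (simp add: mult_ac)
    show ?thesis by (auto simp: image_iff eq) (metis eq)+
  qed
  ultimately show "Lp_relatively_compact N p0 {bloom_sparse M S b f g | f g. f \<in> F \<and> g \<in> G}" by simp
  have "Lp_relatively_compact N p0 ((\<lambda>c x. \<Sum>\<^sub>\<infinity>Q\<in>S. c Q * indicator Q x) `
      {(\<lambda>Q. of_real (avg M Q (\<lambda>y. norm ((b y - avg M Q b) * f y))) * avg M Q g) | f g. f \<in> F \<and> g \<in> G})"
  proof (rule countable_series_relatively_compact[OF params(3) S_countable])
    fix Q assume Q: "Q \<in> S"
    then have QD: "Q \<in> \<D>" using S_cubes by auto
    show "(\<lambda>x. indicator Q x :: 'k) \<in> Lp_space N p0"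
      using Lp[of "\<lambda>_. 1" Q] norm0_indicator_finite[OF QD] QD by simp
    show "\<exists>R. \<forall>c\<in>{(\<lambda>Q. of_real (avg M Q (\<lambda>y. norm ((b y - avg M Q b) * f y))) * avg M Q g) | f g. f \<in> F \<and> g \<in> G}. norm (c Q) \<le> R"
      using bound_adj[OF Q] by auto
  next
    fix \<epsilon> :: real assume "0 < \<epsilon>"
    from tail[OF this] obtain S0 where S0: "finite S0" "S0 \<subseteq> S"
      "\<And>f g. f \<in> F \<Longrightarrow> g \<in> G \<Longrightarrow> norm0 (bilin_adj (S - S0) (nrm f) (nrm g)) \<le> ennreal \<epsilon>" by blast
    have "enorm N p0 (\<lambda>x. \<integral>\<^sup>+Q. ennreal (norm (of_real (avg M Q (\<lambda>y. norm ((b y - avg M Q b) * f y))) * avg M Q g * indicator Q x)) \<partial>count_space (S - S0)) \<le> ennreal \<epsilon>"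
      if fg: "f \<in> F" "g \<in> G" for f g
    proof (rule order_trans[OF sumle S0(3)[OF fg]])
      fix Q assume "Q \<in> S"
      then have [measurable]: "Q \<in> sets M" using S_cubes by auto
      show "(\<lambda>x. of_real (avg M Q (\<lambda>y. norm ((b y - avg M Q b) * f y))) * avg M Q g * indicator Q x) \<in> borel_measurable M" by measurable
    next
      fix x
      have eq: "of_real (avg M Q (\<lambda>y. norm ((b y - avg M Q b) * f y))) * avg M Q g * indicator Q x = bloom_adj_term M b f g Q x" for Q
        by (simp only: bloom_adj_term_def)
      show "(\<integral>\<^sup>+Q. ennreal (norm (of_real (avg M Q (\<lambda>y. norm ((b y - avg M Q b) * f y))) * avg M Q g * indicator Q x)) \<partial>count_space (S - S0))
          \<le> bilin_adj (S - S0) (nrm f) (nrm g) x"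
        unfolding eq bilin_adj_def by (intro nn_integral_mono bloom_adj_term_norm_le) auto
    qed
    then show "\<exists>S0. finite S0 \<and> S0 \<subseteq> S \<and> (\<forall>c\<in>{(\<lambda>Q. of_real (avg M Q (\<lambda>y. norm ((b y - avg M Q b) * f y))) * avg M Q g) | f g. f \<in> F \<and> g \<in> G}.
        enorm N p0 (\<lambda>x. \<integral>\<^sup>+Q. ennreal (norm (c Q * indicator Q x)) \<partial>count_space (S - S0)) \<le> ennreal \<epsilon>)"
      using S0(1,2) by blast
  qed
  moreover have "(\<lambda>c x. \<Sum>\<^sub>\<infinity>Q\<in>S. c Q * indicator Q x) `
      {(\<lambda>Q. of_real (avg M Q (\<lambda>y. norm ((b y - avg M Q b) * f y))) * avg M Q g) | f g. f \<in> F \<and> g \<in> G} =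
      {bloom_sparse_adj M S b f g | f g. f \<in> F \<and> g \<in> G}"
  proof -
    have eq: "(\<lambda>x. \<Sum>\<^sub>\<infinity>Q\<in>S. of_real (avg M Q (\<lambda>y. norm ((b y - avg M Q b) * f y))) * avg M Q g * indicator Q x) = bloom_sparse_adj M S b f g" for f g
      unfolding bloom_sparse_adj_def[abs_def] bloom_adj_term_def ..
    show ?thesis by (auto simp: image_iff eq) (metis eq)+
  qed
  ultimately show "Lp_relatively_compact N p0 {bloom_sparse_adj M S b f g | f g. f \<in> F \<and> g \<in> G}" by simp
qed

end

lemma homogeneous_dyadicI:
  assumes "homogeneous_type M d" "dyadic_system M d \<delta> c1 C1 Dk"
  obtains cen where "homogeneous_dyadic M d \<delta> c1 C1 Dk cen"
proof -
  obtain cen where cen: "\<forall>k. \<forall>Q\<in>Dk k. cen k Q \<in> Q \<and>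
      qball M d (cen k Q) (c1 * \<delta> powi k) \<subseteq> Q \<and> Q \<subseteq> qball M d (cen k Q) (C1 * \<delta> powi k)"
    using assms(2) unfolding dyadic_system_def by (elim conjE exE) 
  have "homogeneous_dyadic M d \<delta> c1 C1 Dk cen"
  proof unfold_locales
    fix k l Q assume "l \<le> k" "Q \<in> Dk k"
    then show "\<exists>!R. R \<in> Dk l \<and> Q \<subseteq> R" using assms(2) unfolding dyadic_system_def by (elim conjE) simp
  next
    fix k l Q R assume "k \<le> l" "Q \<in> Dk k" "R \<in> Dk l"
    then show "R \<subseteq> Q \<or> R \<inter> Q = {}" using assms(2) unfolding dyadic_system_def by (elim conjE) simp
  qed (use assms cen in \<open>simp_all add: dyadic_system_def\<close>)
  then show ?thesis by (rule that)
qed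

lemma Lp_space_weighted:
  fixes f :: "'a \<Rightarrow> 'k::euclidean_space"
  assumes m: "lam \<in> borel_measurable M" "\<omega> \<in> borel_measurable M"
    and eq: "AE x in M. lam x = \<omega> x powr p" and pos: "\<And>x. x \<in> space M \<Longrightarrow> 0 < \<omega> x" and p: "0 < p"
    and f: "f \<in> Lp_space (weighted M lam) p"
  shows "f \<in> borel_measurable M"
    and "enorm M p (\<lambda>x. ennreal (norm (f x)) * ennreal (\<omega> x)) = ennreal (Lp_norm (weighted M lam) p f)"
proof -
  show [measurable]: "f \<in> borel_measurable M" using f by (simp add: Lp_space_def weighted_def)
  have "enorm (weighted M lam) p (\<lambda>x. ennreal (norm (f x))) = enorm M p (\<lambda>x. ennreal (norm (f x)) * ennreal (\<omega> x))"
    by (rule enorm_weighted[OF m _ eq pos p]) measurable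
  then show "enorm M p (\<lambda>x. ennreal (norm (f x)) * ennreal (\<omega> x)) = ennreal (Lp_norm (weighted M lam) p f)"
    using Lp_norm_eq[OF p f] by simp
qed

theorem theorem1p2:
  fixes M :: "'a measure" and d :: "'a \<Rightarrow> 'a \<Rightarrow> real" and x0 :: 'a
    and p p1 p2 \<eta> :: real
    and lam1 lam2 w \<nu> w_hat :: "'a \<Rightarrow> real"
    and b :: "'a \<Rightarrow> 'k::{real_normed_field, euclidean_space}"
    and S :: "'a set set"
  assumes "homogeneous_type M d"
    and "emeasure M (space M) = \<infinity>"
    and "\<And>x. x \<in> space M \<Longrightarrow> emeasure M {x} = 0"
    and "x0 \<in> space M"
    and "1 < p1" and "1 < p2"
    and "1 / p = 1 / p1 + 1 / p2"
    and "muckenhoupt M d p1 lam1" and "muckenhoupt M d p1 lam2" and "muckenhoupt M d p2 w"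
    and "\<nu> = (\<lambda>x. lam1 x powr (1 / p1) * lam2 x powr (- 1 / p1))"
    and "w_hat = (\<lambda>x. lam2 x powr (p / p1) * w x powr (p / p2))"
    and "b \<in> VMO M d x0 \<nu>"
    and "0 < \<eta>" and "\<eta> < 1"
    and "sparse_family M d \<eta> S"
  shows "(\<forall>f\<in>Lp_space (weighted M lam1) p1. \<forall>g\<in>Lp_space (weighted M w) p2.
            bloom_well_defined M S b f g) \<and>
         compact_Lp_operator (weighted M lam1) p1 (weighted M w) p2 (weighted M w_hat) p
           (bloom_sparse M S b) \<and>
         compact_Lp_operator (weighted M lam1) p1 (weighted M w) p2 (weighted M w_hat) p
           (bloom_sparse_adj M S b)"
proof -
  note ht = assms(1) and x0 = assms(4) and p1 = assms(5) and p2 = assms(6) and exps = assms(7)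
    and mu = assms(8-10) and \<nu>_def = assms(11) and w_hat_def = assms(12) and vmo = assms(13)
    and \<eta> = assms(14) and sparse = assms(16)
  define q1 where "q1 = p1 / (p1 - 1)"
  define q2 where "q2 = p2 / (p2 - 1)"
  have pq1: "1 / p1 + 1 / q1 = 1" and pq2: "1 / p2 + 1 / q2 = 1"
    using p1 p2 by (auto simp: q1_def q2_def field_simps)
  have "1 / p1 > 0" "1 / p2 > 0" using p1 p2 by auto
  then have "1 / p > 0" using exps by linarith
  then have p0: "0 < p" by (simp add: zero_less_divide_iff)
  interpret homogeneous M d by unfold_locales (rule ht)
  have lam_m[measurable]: "lam1 \<in> borel_measurable M" "lam2 \<in> borel_measurable M" "w \<in> borel_measurable M"
    using mu by (auto simp: muckenhoupt_def weight_def intro: loc_integrable_measurable)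
  obtain \<omega>1 K1 where w1: "\<omega>1 \<in> borel_measurable M" "\<And>x. x \<in> space M \<Longrightarrow> 0 < \<omega>1 x"
    "AE x in M. 0 < lam1 x \<and> \<omega>1 x = lam1 x powr (1 / p1)" "1 \<le> K1"
    "\<And>x r. x \<in> space M \<Longrightarrow> 0 < r \<Longrightarrow>
       wcube M p1 \<omega>1 (qball M d x r) *
       dcube M q1 \<omega>1 (qball M d x r) \<le> ennreal K1 * emeasure M (qball M d x r)"
    by (rule muckenhoupt_root[OF mu(1) p1 pq1]) (rule that; assumption)
  obtain \<omega>2 K2 where w2: "\<omega>2 \<in> borel_measurable M" "\<And>x. x \<in> space M \<Longrightarrow> 0 < \<omega>2 x"
    "AE x in M. 0 < lam2 x \<and> \<omega>2 x = lam2 x powr (1 / p1)" "1 \<le> K2"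
    "\<And>x r. x \<in> space M \<Longrightarrow> 0 < r \<Longrightarrow>
       wcube M p1 \<omega>2 (qball M d x r) *
       dcube M q1 \<omega>2 (qball M d x r) \<le> ennreal K2 * emeasure M (qball M d x r)"
    by (rule muckenhoupt_root[OF mu(2) p1 pq1]) (rule that; assumption)
  obtain \<omega>3 K3 where w3: "\<omega>3 \<in> borel_measurable M" "\<And>x. x \<in> space M \<Longrightarrow> 0 < \<omega>3 x"
    "AE x in M. 0 < w x \<and> \<omega>3 x = w x powr (1 / p2)" "1 \<le> K3"
    "\<And>x r. x \<in> space M \<Longrightarrow> 0 < r \<Longrightarrow>
       wcube M p2 \<omega>3 (qball M d x r) *
       dcube M q2 \<omega>3 (qball M d x r) \<le> ennreal K3 * emeasure M (qball M d x r)"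
    by (rule muckenhoupt_root[OF mu(3) p2 pq2]) (rule that; assumption)
  note [measurable] = w1(1) w2(1) w3(1)
  obtain \<delta> c1 C1 Dk where dyad: "dyadic_system M d \<delta> c1 C1 Dk" and SD: "S \<subseteq> (\<Union>k. Dk k)"
    using sparse unfolding sparse_family_def by (elim exE conjE) 
  obtain cen where "homogeneous_dyadic M d \<delta> c1 C1 Dk cen" using homogeneous_dyadicI[OF ht dyad] .
  then interpret homogeneous_dyadic M d \<delta> c1 C1 Dk cen .
  have ap1: "Ap p1 q1 \<omega>1" using w1(4) by (intro Ap_from_balls[OF p1 pq1 w1(1,2) _ w1(5)]) auto
  have ap2: "Ap p1 q1 \<omega>2" using w2(4) by (intro Ap_from_balls[OF p1 pq1 w2(1,2) _ w2(5)]) auto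
  have ap3: "Ap p2 q2 \<omega>3" using w3(4) by (intro Ap_from_balls[OF p2 pq2 w3(1,2) _ w3(5)]) auto
  have \<nu>_m: "\<nu> \<in> borel_measurable M" unfolding \<nu>_def by measurable
  have \<nu>_ae: "AE x in M. \<nu> x = \<omega>1 x / \<omega>2 x"
    using w1(3) w2(3) by eventually_elim (simp add: \<nu>_def powr_minus_divide)
  obtain D A B where vo: "vanishing_oscillation M DD D b (\<lambda>x. \<omega>1 x / \<omega>2 x) A B"
    using vmo_vanishing_oscillation[OF p1 pq1 w1(1) w2(1) w1(2) w2(2) w1(4,5) w2(4,5) \<nu>_m \<nu>_ae x0 vmo] .
  have sp: "nested_cubes.sparse M DD S"
    using SD \<eta> sparse unfolding sparse_def sparse_family_def by blast
  interpret bloom_setting M DD D b "\<lambda>x. \<omega>1 x / \<omega>2 x" A B p1 q1 p2 q2 p \<omega>1 \<omega>2 \<omega>3 S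
    using vo ap1 ap2 ap3 exps sp sigma_finite
    by (intro bloom_setting.intro bloom_setting_axioms.intro) auto
  have e1: "AE x in M. lam1 x = \<omega>1 x powr p1"
    using w1(3) by eventually_elim (use p1 in \<open>simp add: powr_powr\<close>)
  have e3: "AE x in M. w x = \<omega>3 x powr p2"
    using w3(3) by eventually_elim (use p2 in \<open>simp add: powr_powr\<close>)
  have e0: "AE x in M. w_hat x = (\<omega>2 x * \<omega>3 x) powr p"
    using w2(3) w3(3) by eventually_elim (simp add: w_hat_def powr_mult powr_powr)
  have w_hat_m: "w_hat \<in> borel_measurable M" unfolding w_hat_def by measurable
  have L1: "f \<in> borel_measurable M" "norm1 (nrm f) = ennreal (Lp_norm (weighted M lam1) p1 f)"
    if "f \<in> Lp_space (weighted M lam1) p1" for f :: "'a \<Rightarrow> 'k"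
    using Lp_space_weighted[OF lam_m(1) w1(1) e1 _ _ that] w1(2) p1 by auto
  have L3: "g \<in> borel_measurable M" "norm3 (nrm g) = ennreal (Lp_norm (weighted M w) p2 g)"
    if "g \<in> Lp_space (weighted M w) p2" for g :: "'a \<Rightarrow> 'k"
    using Lp_space_weighted[OF lam_m(3) w3(1) e3 _ _ that] w3(2) p2 by auto
  have "bloom_well_defined M S b f g"
    if f: "f \<in> Lp_space (weighted M lam1) p1" and g: "g \<in> Lp_space (weighted M w) p2" for f g
    using f g by (intro bloom_operators_well_defined) (simp_all add: L1 L3)
  moreover have "Lp_relatively_compact (weighted M w_hat) p {bloom_sparse M S b f g | f g. f \<in> F \<and> g \<in> G} \<and>
      Lp_relatively_compact (weighted M w_hat) p {bloom_sparse_adj M S b f g | f g. f \<in> F \<and> g \<in> G}"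
    if F: "Lp_bounded (weighted M lam1) p1 F" and G: "Lp_bounded (weighted M w) p2 G" for F G
  proof -
    obtain CF where CF: "\<And>f. f \<in> F \<Longrightarrow> f \<in> Lp_space (weighted M lam1) p1" "\<And>f. f \<in> F \<Longrightarrow> Lp_norm (weighted M lam1) p1 f \<le> CF"
      using F unfolding Lp_bounded_def by blast
    obtain CG where CG: "\<And>g. g \<in> G \<Longrightarrow> g \<in> Lp_space (weighted M w) p2" "\<And>g. g \<in> G \<Longrightarrow> Lp_norm (weighted M w) p2 g \<le> CG"
      using G unfolding Lp_bounded_def by blast
    have N: "sets (weighted M w_hat) = sets M" by (simp add: weighted_def)
    have N0: "enorm (weighted M w_hat) p u = enorm M p (\<lambda>x. u x * ennreal (\<omega>2 x * \<omega>3 x))" if "u \<in> borel_measurable M" for u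
      using w2(2) w3(2) by (intro enorm_weighted w_hat_m that e0 p0) auto
    have F1: "f \<in> borel_measurable M" "norm1 (nrm f) \<le> ennreal (max CF 0)" if "f \<in> F" for f
      using L1[OF CF(1)[OF that]] CF(2)[OF that] by (auto intro: ennreal_leI)
    have G1: "g \<in> borel_measurable M" "norm3 (nrm g) \<le> ennreal (max CG 0)" if "g \<in> G" for g
      using L3[OF CG(1)[OF that]] CG(2)[OF that] by (auto intro: ennreal_leI)
    show ?thesis
      using bloom_compact[OF N N0 F1 _ G1, of F G] by auto
  qed
  ultimately show ?thesis by (simp add: compact_Lp_operator_def)
qed

end
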